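(* Let $\Phi$ be a field of characteristic $3$, $\mathcal{C}$ an associative composition algebra over $\Phi$, $r\ge 3$ and $s\ge 1$ (with $s$ even if $\mathcal{C}$ is one-dimensional), $J\in M_s(\mathcal{C})$ an invertible matrix with $J^*=-J$, and $G$ an invertible diagonal $r\times r$ matrix with entries in $\Phi$ (not $\mathcal{C}$). Let $L$ be the Lie algebra described in the context, associated to the $J$-ternary algebra $M=M_{r\times s}(\mathcal{C})$, and semisimplify it with respect to the matrix with $I_r$ in the upper right block and zeros elsewhere. The Lie superalgebra one obtains is: (i) of type $A(r-1,s-1)$ if $\mathcal{C}$ is two-dimensional; (ii) $\mathfrak{osp}(r,s)$, which is of type $B$ or $D$ depending on whether $r$ is odd or even, if $\mathcal{C}$ is one-dimensional; (iii) $\mathfrak{osp}(4s,4r)$, i.e. of type $D(2s,2r)$, if $\mathcal{C}$ is four-dimensional.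
   Context: For a matrix $a$ over $\mathcal{C}$, $a^*=\bar a^{T}$ is the conjugate transpose. Writing elements of $M_{2r+s}(\mathcal{C})$ as block matrices with blocks of sizes $r,s,r$, let $$L=\left\{a\in M_{2r+s}(\mathcal{C}) : ah+ha^*=0\right\},\qquad h=\begin{pmatrix} 0 & 0 & -G^{-1} \\ 0 & J & 0 \\ G^{-1} & 0 & 0 \end{pmatrix}.$$ If $2r+s+1$ is divisible by $3$ and $\mathcal{C}$ is two-dimensional, one takes $[L,L]$ instead of $L$, to obtain the Lie algebra generated by the $J$-ternary algebra. The copies $M_1$ and $M_{-1}$ of $M=M_{r\times s}(\mathcal{C})$ in $L$ are formed by the elements $$x_1=\begin{pmatrix} 0 & x & 0 \\ 0 & 0 & Jx^*G \\ 0 & 0 & 0 \end{pmatrix},\qquad y_{-1}=\begin{pmatrix} 0 & 0 & 0 \\ -Jy^*G & 0 & 0 \\ 0 & y & 0 \end{pmatrix}\qquad (x,y\in M_{r\times s}(\mathcal{C})),$$ and the triple product $xyz$ on $M$ is given by $[[x_1,y_{-1}],z_1]=(xyz)_1$; with it $M$ is a $J$-ternary algebra. $J$-ternary algebra: a module $M$ with a trilinear product $(x,y,z)\mapsto xyz$ such that $xy(uvw)-uv(xyw)=(xyu)vw+u(yxv)w$ and $xyz-zyx=zxy-xzy$. Put $L_{x,y}z=xyz$ and $\langle x,y\rangle z=yzx-xzy$. The linear span $\mathcal{J}$ of the endomorphisms $\langle x,y\rangle$ is a Jordan subalgebra of $\operatorname{End}(M)$ under $a\cdot b=(ab+ba)/2$,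 assumed unital with unit $1$. $\operatorname{InStr}(M)$ is the linear span of all $L_{x,y}$ in $\operatorname{End}(M)$, a Lie algebra acting on $\mathcal{J}$ by $t\cdot\langle a,b\rangle=\langle t a,b\rangle+\langle a,t b\rangle$, and $\operatorname{InDer}_{\mathcal{J}}(M)=\{d\in\operatorname{InStr}(M): d\cdot 1=0\}$. Semisimplification: the inner derivation $f$ given by the chosen matrix satisfies $f^3=0$, which makes the Lie algebra a Lie algebra in the category of representations of the group functor $\alpha_3(K)=\{x\in K: x^3=0\}$ (with addition). The semisimplification of this category (the quotient by negligible morphisms) is the braided tensor category of super vector spaces. The image of the Lie algebra of a $J$-ternary algebra is the Lie superalgebra $\operatorname{InDer}_{\mathcal{J}}(M)\oplus M$ (even part $\operatorname{InDer}_{\mathcal{J}}(M)$, odd part $M$) with $$[(c,m),(d,n)]=([c,d]+L_{m,n}+L_{n,m},\;c(n)-d(m)).$$ $\mathfrak{osp}(a,b)$ is the orthosymplectic Lie superalgebra with orthogonal part of dimension $a$ and symplectic part of dimension $b$; $B(m,n)=\mathfrak{osp}(2m+1,2n)$ and $D(m,n)=\mathfrak{osp}(2m,2n)$. $A(m,n)$ denotes $\mathfrak{sl}(m+1,n+1)$, replaced by $\mathfrak{psl}(m+1,n+1)$ when the characteristic divides $m-n$.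
   Formalization: In (iii) the formal theorem has osp(2s,2r), i.e. type D(s,r), in place of osp(4s,4r), i.e. D(2s,2r): the odd part M has dimension 4rs, while that of osp(4s,4r) has dimension 16rs, so the printed sizes are impossible. *)

theory Defs
  imports
    "Jordan_Normal_Form.VS_Connect"
    "HOL-Algebra.Algebraic_Closure_Type"
begin

hide_const (open) Multiset.mult Polynomial.smult Modules.module_hom

section \<open>Composition algebras\<close>

definition polar :: "('c::ab_group_add \<Rightarrow> 'k::field) \<Rightarrow> 'c \<Rightarrow> 'c \<Rightarrow> 'k" where
  "polar n x y = n (x + y) - n x - n y"

text \<open>Associativity and the existence of a unit are part of the class \<^class>\<open>ring_1\<close>.\<close>

locale assoc_composition_algebra = vector_space scale
  for scale :: "'k::field \<Rightarrow> 'c::ring_1 \<Rightarrow> 'c" +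
  fixes n :: "'c \<Rightarrow> 'k"
  assumes scale_mult_left: "scale a x * y = scale a (x * y)"
    and scale_mult_right: "x * scale a y = scale a (x * y)"
    and norm_scale: "n (scale a x) = a\<^sup>2 * n x"
    and polar_add_left: "polar n (x + y) z = polar n x z + polar n y z"
    and polar_scale_left: "polar n (scale a x) y = a * polar n x y"
    and norm_mult: "n (x * y) = n x * n y"
    and polar_nondegenerate: "(\<And>y. polar n x y = 0) \<Longrightarrow> x = 0"

definition conjugation :: "('k::field \<Rightarrow> 'c::ring_1 \<Rightarrow> 'c) \<Rightarrow> ('c \<Rightarrow> 'k) \<Rightarrow> 'c \<Rightarrow> 'c" where
  "conjugation scale n x = scale (polar n x 1) 1 - x"

definition star :: "('k::field \<Rightarrow> 'c::ring_1 \<Rightarrow> 'c) \<Rightarrow> ('c \<Rightarrow> 'k) \<Rightarrow> 'c mat \<Rightarrow> 'c mat" where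
  "star scale n a = map_mat (conjugation scale n) (transpose_mat a)"


section \<open>\<open>J\<close>-ternary algebras and the Lie superalgebra attached to them\<close>

text \<open>In all the vector spaces below that carry no ring structure the fields \<^const>\<open>one\<close> (and
  \<^const>\<open>mult\<close>, unless stated otherwise) of the record \<^typ>\<open>('k, 'v) module\<close> are irrelevant.\<close>

record ('k, 'm) ternary = "('k, 'm) module" +
  triple :: "'m \<Rightarrow> 'm \<Rightarrow> 'm \<Rightarrow> 'm"

text \<open>Maps between carriers are extensional (\<^const>\<open>undefined\<close> off the carrier), so that equality
  of maps is equality on the carrier.\<close>

definition End_alg :: "('k::field, 'm, 'z) module_scheme \<Rightarrow> ('k, 'm \<Rightarrow> 'm) module" where
  "End_alg T = \<lparr> carrier = module_hom class_ring T T \<inter> extensional (carrier T),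
     mult = compose (carrier T),
     one = (\<lambda>z\<in>carrier T. z),
     zero = (\<lambda>z\<in>carrier T. \<zero>\<^bsub>T\<^esub>),
     add = (\<lambda>f g. \<lambda>z\<in>carrier T. f z \<oplus>\<^bsub>T\<^esub> g z),
     smult = (\<lambda>c f. \<lambda>z\<in>carrier T. c \<odot>\<^bsub>T\<^esub> f z) \<rparr>"

definition L_op :: "('k::field, 'm, 'z) ternary_scheme \<Rightarrow> 'm \<Rightarrow> 'm \<Rightarrow> 'm \<Rightarrow> 'm" where
  "L_op T x y = (\<lambda>z\<in>carrier T. triple T x y z)"

definition angle :: "('k::field, 'm, 'z) ternary_scheme \<Rightarrow> 'm \<Rightarrow> 'm \<Rightarrow> 'm \<Rightarrow> 'm" where
  "angle T x y = (\<lambda>z\<in>carrier T. triple T y z x \<ominus>\<^bsub>T\<^esub> triple T x z y)"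

definition jordan_space :: "('k::field, 'm, 'z) ternary_scheme \<Rightarrow> ('m \<Rightarrow> 'm) set" where
  "jordan_space T = LinearCombinations.module.span class_ring (End_alg T)
     {angle T x y | x y. x \<in> carrier T \<and> y \<in> carrier T}"

definition jordan_mult :: "('k::field, 'm, 'z) ternary_scheme \<Rightarrow> ('m \<Rightarrow> 'm) \<Rightarrow> ('m \<Rightarrow> 'm) \<Rightarrow> 'm \<Rightarrow> 'm" where
  "jordan_mult T a b = (1/2) \<odot>\<^bsub>End_alg T\<^esub> (a \<otimes>\<^bsub>End_alg T\<^esub> b \<oplus>\<^bsub>End_alg T\<^esub> b \<otimes>\<^bsub>End_alg T\<^esub> a)"

definition jordan_unit :: "('k::field, 'm, 'z) ternary_scheme \<Rightarrow> ('m \<Rightarrow> 'm) \<Rightarrow> bool" where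
  "jordan_unit T u \<longleftrightarrow> u \<in> jordan_space T \<and> (\<forall>a\<in>jordan_space T. jordan_mult T u a = a)"

definition InStr :: "('k::field, 'm, 'z) ternary_scheme \<Rightarrow> ('m \<Rightarrow> 'm) set" where
  "InStr T = LinearCombinations.module.span class_ring (End_alg T)
     {L_op T x y | x y. x \<in> carrier T \<and> y \<in> carrier T}"

text \<open>The linear map \<open>a \<mapsto> t \<cdot> a\<close> on the span of the \<open>\<langle>a, b\<rangle>\<close>, determined by its values there.\<close>

definition jordan_action :: "('k::field, 'm, 'z) ternary_scheme \<Rightarrow> ('m \<Rightarrow> 'm) \<Rightarrow> ('m \<Rightarrow> 'm) \<Rightarrow> ('m \<Rightarrow> 'm)" where
  "jordan_action T t =
     (let \<J> = (End_alg T)\<lparr>carrier := jordan_space T\<rparr> in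
      THE D. D \<in> module_hom class_ring \<J> \<J> \<inter> extensional (carrier \<J>) \<and>
        (\<forall>a\<in>carrier T. \<forall>b\<in>carrier T. D (angle T a b) = angle T (t a) b \<oplus>\<^bsub>End_alg T\<^esub> angle T a (t b)))"

definition InDer :: "('k::field, 'm, 'z) ternary_scheme \<Rightarrow> ('m \<Rightarrow> 'm) \<Rightarrow> ('m \<Rightarrow> 'm) set" where
  "InDer T u = {d \<in> InStr T. jordan_action T d u = \<zero>\<^bsub>End_alg T\<^esub>}"

text \<open>The product \<^const>\<open>mult\<close> of a superalgebra is the superbracket.\<close>

record ('k, 'v) superalgebra = "('k, 'v) module" +
  even_part :: "'v set"
  odd_part :: "'v set"

text \<open>The image, under the semisimplification of the category of representations of \<open>\<alpha>\<^sub>3\<close>, of the Lie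
  algebra of a \<open>J\<close>-ternary algebra \<open>T\<close> on which \<open>\<alpha>\<^sub>3\<close> acts through the inner derivation given by the
  element \<open>u\<close>, the unit of the Jordan algebra of \<open>T\<close>: the even part consists of the \<open>d\<close> in \<^const>\<open>InStr\<close>
  with \<open>d \<cdot> u = 0\<close>, the odd part is \<open>T\<close>.\<close>

definition semisimplification ::
    "('k::field, 'm, 'z) ternary_scheme \<Rightarrow> ('m \<Rightarrow> 'm) \<Rightarrow> ('k, ('m \<Rightarrow> 'm) \<times> 'm) superalgebra" where
  "semisimplification T u =
     (let E = End_alg T in
      \<lparr> carrier = InDer T u \<times> carrier T,
        mult = (\<lambda>(c, m) (d, n).
          ((c \<otimes>\<^bsub>E\<^esub> d \<ominus>\<^bsub>E\<^esub> d \<otimes>\<^bsub>E\<^esub> c) \<oplus>\<^bsub>E\<^esub> L_op T m n \<oplus>\<^bsub>E\<^esub> L_op T n m, c n \<ominus>\<^bsub>T\<^esub> d m)),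
        one = undefined,
        zero = (\<zero>\<^bsub>E\<^esub>, \<zero>\<^bsub>T\<^esub>),
        add = (\<lambda>(c, m) (d, n). (c \<oplus>\<^bsub>E\<^esub> d, m \<oplus>\<^bsub>T\<^esub> n)),
        smult = (\<lambda>k (c, m). (k \<odot>\<^bsub>E\<^esub> c, k \<odot>\<^bsub>T\<^esub> m)),
        even_part = InDer T u \<times> {\<zero>\<^bsub>T\<^esub>},
        odd_part = {\<zero>\<^bsub>E\<^esub>} \<times> carrier T \<rparr>)"


section \<open>The \<open>J\<close>-ternary algebra of \<open>r \<times> s\<close> matrices\<close>

definition hcat :: "'a::zero mat \<Rightarrow> 'a mat \<Rightarrow> 'a mat" (infixr \<open>@\<^sub>c\<close> 66) where
  "A @\<^sub>c B = four_block_mat A B (0\<^sub>m 0 (dim_col A)) (0\<^sub>m 0 (dim_col B))"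

definition block3 :: "'a::zero mat \<Rightarrow> 'a mat \<Rightarrow> 'a mat \<Rightarrow> 'a mat \<Rightarrow> 'a mat \<Rightarrow> 'a mat \<Rightarrow> 'a mat \<Rightarrow> 'a mat \<Rightarrow> 'a mat \<Rightarrow> 'a mat" where
  "block3 A11 A12 A13 A21 A22 A23 A31 A32 A33 =
     (A11 @\<^sub>c A12 @\<^sub>c A13) @\<^sub>r (A21 @\<^sub>c A22 @\<^sub>c A23) @\<^sub>r (A31 @\<^sub>c A32 @\<^sub>c A33)"

definition commutator :: "'a::ring mat \<Rightarrow> 'a mat \<Rightarrow> 'a mat" where
  "commutator a b = a * b - b * a"

locale matrix_data =
  fixes scale :: "'k::field \<Rightarrow> 'c::ring_1 \<Rightarrow> 'c" and n :: "'c \<Rightarrow> 'k"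
    and r s :: nat and J :: "'c mat" and G :: "'k mat"
begin

definition GC :: "'c mat" where
  "GC = map_mat (\<lambda>a. scale a 1) G"

definition M_up :: "'c mat \<Rightarrow> 'c mat" where
  "M_up x = block3 (0\<^sub>m r r) x (0\<^sub>m r r)
                   (0\<^sub>m s r) (0\<^sub>m s s) (J * star scale n x * GC)
                   (0\<^sub>m r r) (0\<^sub>m r s) (0\<^sub>m r r)"

definition M_down :: "'c mat \<Rightarrow> 'c mat" where
  "M_down y = block3 (0\<^sub>m r r) (0\<^sub>m r s) (0\<^sub>m r r)
                     (- (J * star scale n y * GC)) (0\<^sub>m s s) (0\<^sub>m s r)
                     (0\<^sub>m r r) y (0\<^sub>m r r)"

definition ternary_alg :: "('k, 'c mat) ternary" where
  "ternary_alg = \<lparr> carrier = carrier_mat r s,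
     mult = undefined,
     one = undefined,
     zero = 0\<^sub>m r s,
     add = (+),
     smult = (\<lambda>a. map_mat (scale a)),
     triple = (\<lambda>x y z. THE w. w \<in> carrier_mat r s \<and>
       commutator (commutator (M_up x) (M_down y)) (M_up z) = M_up w) \<rparr>"

definition e_matrix :: "'c mat" where
  "e_matrix = block3 (0\<^sub>m r r) (0\<^sub>m r s) (1\<^sub>m r)
                     (0\<^sub>m s r) (0\<^sub>m s s) (0\<^sub>m s r)
                     (0\<^sub>m r r) (0\<^sub>m r s) (0\<^sub>m r r)"

text \<open>The commutator with a matrix \<open>e\<close> concentrated in the upper right block maps the copy \<open>M\<^sub>-\<^sub>1\<close> of \<open>M\<close> to the
  copy \<open>M\<^sub>1\<close>; this is the resulting endomorphism of \<open>M\<close>.\<close>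

definition induced_op :: "'c mat \<Rightarrow> 'c mat \<Rightarrow> 'c mat" where
  "induced_op e = (\<lambda>y\<in>carrier_mat r s. THE w. w \<in> carrier_mat r s \<and> commutator e (M_down y) = M_up w)"

definition semisimplified :: "('k, ('c mat \<Rightarrow> 'c mat) \<times> 'c mat) superalgebra" where
  "semisimplified = semisimplification ternary_alg (induced_op e_matrix)"

end


section \<open>The matrix \<open>e\<close> is the unit of the Jordan algebra\<close>

context assoc_composition_algebra
begin

abbreviation "cj \<equiv> conjugation scale n"

lemma polar_commute: "polar n x y = polar n y x"
  by (simp add: polar_def add.commute)

lemma polar_add_right: "polar n x (y + z) = polar n x y + polar n x z"
  using polar_add_left[of y z x] by (simp add: polar_commute)

lemma polar_scale_right: "polar n x (scale a y) = a * polar n x y"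
  using polar_scale_left[of a y x] by (simp add: polar_commute)

lemma polar_minus_left: "polar n (- x) y = - polar n x y"
  using polar_scale_left[of "-1" x y] by simp

lemma polar_minus_right: "polar n y (- x) = - polar n y x"
  using polar_minus_left[of x y] by (simp add: polar_commute)

lemma polar_diff_left: "polar n (x - z) y = polar n x y - polar n z y"
  using polar_add_left[of x "-z" y] by (simp add: polar_minus_left)

lemma polar_diff_right: "polar n y (x - z) = polar n y x - polar n y z"
  using polar_diff_left[of x z y] by (simp add: polar_commute)

lemmas polar_linear = polar_add_left polar_add_right polar_scale_left polar_scale_right
  polar_minus_left polar_minus_right polar_diff_left polar_diff_right

lemma norm_add: "n (x + y) = n x + n y + polar n x y"
  by (simp add: polar_def)

lemma polar_mult_same_left: "polar n (x * y) (x * z) = n x * polar n y z"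
  by (simp add: polar_def norm_mult algebra_simps flip: distrib_left)

lemma polar_mult_same_right: "polar n (y * x) (z * x) = polar n y z * n x"
  by (simp add: polar_def norm_mult algebra_simps flip: distrib_right)

lemma polar_exchange:
  "polar n (x * z) (y * w) + polar n (y * z) (x * w) = polar n x y * polar n z w"
proof -
  have "polar n ((x + y) * z) ((x + y) * w) = n (x + y) * polar n z w"
    by (rule polar_mult_same_left)
  then show ?thesis
    by (simp add: distrib_right polar_linear polar_mult_same_left norm_add)
       (simp add: algebra_simps)
qed

lemma polar_cj_left: "polar n (x * z) w = polar n z (cj x * w)"
  using polar_exchange[of x z 1 w]
  by (simp add: conjugation_def left_diff_distrib polar_linear scale_mult_left algebra_simps)

lemma polar_cj_right: "polar n (z * x) w = polar n z (w * cj x)"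
proof -
  have "polar n (z * x) (w * 1) + polar n (w * x) (z * 1) = polar n z w * polar n x 1"
    by (rule polar_exchange)
  then have "polar n (z * x) w = polar n z w * polar n x 1 - polar n z (w * x)"
    by (simp add: polar_commute[of "w * x" z] eq_diff_eq)
  then show ?thesis
    by (simp add: conjugation_def right_diff_distrib polar_diff_right polar_scale_right scale_mult_right mult.commute)
qed

lemma norm_one: "n 1 = 1"
proof -
  have "n 1 * n 1 = n 1" using norm_mult[of 1 1] by simp
  moreover have "n 1 \<noteq> 0"
  proof
    assume "n 1 = 0"
    then have 0: "n x = 0" for x using norm_mult[of 1 x] by simp
    have "(1::'c) = 0" by (rule polar_nondegenerate) (simp add: polar_def 0)
    then show False by simp
  qed
  ultimately show ?thesis by simp
qed

lemma polar_one_one: "polar n 1 1 = 2"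
proof -
  have "n (1 + 1) = n (scale 2 1)"
    by (metis one_add_one scale_left_distrib scale_one)
  then show ?thesis by (simp add: polar_def norm_scale norm_one)
qed

lemma cj_add: "cj (x + y) = cj x + cj y"
  by (simp add: conjugation_def polar_linear scale_left_distrib)

lemma cj_scale: "cj (scale a x) = scale a (cj x)"
  by (simp add: conjugation_def polar_linear scale_right_diff_distrib)

lemma cj_minus: "cj (- x) = - cj x"
  by (simp add: conjugation_def polar_linear)

lemma cj_diff: "cj (x - y) = cj x - cj y"
  using cj_add[of x "- y"] by (simp add: cj_minus)

lemma cj_zero: "cj 0 = 0"
  using cj_scale[of 0 0] by simp

lemma cj_sum: "cj (sum f A) = (\<Sum>a\<in>A. cj (f a))"
  by (induction A rule: infinite_finite_induct) (simp_all add: cj_zero cj_add)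

lemma cj_one: "cj 1 = 1"
  by (simp add: conjugation_def polar_one_one) (metis add_diff_cancel_right' one_add_one scale_left_distrib scale_one)

lemma cj_cj: "cj (cj x) = x"
proof -
  have "polar n (cj x) 1 = polar n x 1"
    by (simp add: conjugation_def polar_linear polar_one_one)
  then show ?thesis by (simp add: conjugation_def)
qed

lemma cj_mult: "cj (x * y) = cj y * cj x"
proof -
  have "polar n (cj (x * y)) w = polar n (cj y * cj x) w" for w
  proof -
    have "polar n (cj (x * y)) w = polar n 1 (x * y * w)"
      using polar_cj_right[of 1 "cj (x*y)" w] polar_cj_left[of "cj (x * y)" 1 w]
      by (simp add: cj_cj)
    also have "\<dots> = polar n (cj y * cj x) w"
      using polar_cj_left[of "cj y" "cj x" w] polar_cj_left[of "cj x" 1 "y * w"]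
      by (simp add: cj_cj mult.assoc)
    finally show ?thesis .
  qed
  then have "cj (x * y) - cj y * cj x = 0"
    by (intro polar_nondegenerate) (simp add: polar_linear)
  then show ?thesis by simp
qed


abbreviation "st \<equiv> star scale n"

lemma star_dim [simp]: "dim_row (st A) = dim_col A" "dim_col (st A) = dim_row A"
  by (simp_all add: star_def)

lemma star_carrier [simp]: "A \<in> carrier_mat a b \<Longrightarrow> st A \<in> carrier_mat b a"
  by (simp add: star_def)

lemma star_index [simp]: "i < dim_col A \<Longrightarrow> j < dim_row A \<Longrightarrow> st A $$ (i, j) = cj (A $$ (j, i))"
  by (simp add: star_def)

lemma star_star [simp]: "st (st A) = A"
  by (rule eq_matI) (simp_all add: cj_cj)

lemma star_uminus: "st (- A) = - st A"
  by (rule eq_matI) (simp_all add: cj_minus)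

lemma star_add: "A \<in> carrier_mat a b \<Longrightarrow> B \<in> carrier_mat a b \<Longrightarrow> st (A + B) = st A + st B"
  by (rule eq_matI) (auto simp add: cj_add)

lemma star_mult: "A \<in> carrier_mat a b \<Longrightarrow> B \<in> carrier_mat b c \<Longrightarrow> st (A * B) = st B * st A"
  by (rule eq_matI) (auto simp add: scalar_prod_def cj_sum cj_mult)

lemma star_minus: "A \<in> carrier_mat a b \<Longrightarrow> B \<in> carrier_mat a b \<Longrightarrow> st (A - B) = st A - st B"
  by (rule eq_matI) (auto simp add: cj_diff)

lemma star_zero [simp]: "st (0\<^sub>m a b) = 0\<^sub>m b a"
  by (rule eq_matI) (simp_all add: cj_zero)

lemma star_one [simp]: "st (1\<^sub>m a) = 1\<^sub>m a"
  by (rule eq_matI) (simp_all add: cj_zero cj_one)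

end

lemma block3_eq:
  assumes "A11 \<in> carrier_mat r r" "A12 \<in> carrier_mat r s" "A13 \<in> carrier_mat r r"
    "A21 \<in> carrier_mat s r" "A22 \<in> carrier_mat s s" "A23 \<in> carrier_mat s r"
    "A31 \<in> carrier_mat r r" "A32 \<in> carrier_mat r s" "A33 \<in> carrier_mat r r"
  shows "block3 A11 A12 A13 A21 A22 A23 A31 A32 A33 =
    mat (2 * r + s) (2 * r + s) (\<lambda>(i, j).
      if i < r then (if j < r then A11 $$ (i, j) else if j < r + s then A12 $$ (i, j - r) else A13 $$ (i, j - r - s))
      else if i < r + s then
        (if j < r then A21 $$ (i - r, j) else if j < r + s then A22 $$ (i - r, j - r) else A23 $$ (i - r, j - r - s))
      else (if j < r then A31 $$ (i - r - s, j) else if j < r + s then A32 $$ (i - r - s, j - r)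
        else A33 $$ (i - r - s, j - r - s)))"
  using assms by (intro eq_matI) (auto simp: block3_def hcat_def append_rows_def)

lemma sum_split3:
  fixes f :: "nat \<Rightarrow> 'a::comm_monoid_add"
  shows "sum f {0..<2 * r + s} = (\<Sum>i=0..<r. f i) + (\<Sum>i=0..<s. f (r + i)) + (\<Sum>i=0..<r. f (r + s + i))"
proof -
  have "sum f {0..<2 * r + s} = sum f {0..<r} + sum f {r..<r+s} + sum f {r+s..<r+s+r}"
    by (simp add: sum.atLeastLessThan_concat add.commute mult_2 add.left_commute)
  also have "sum f {r..<r+s} = (\<Sum>i=0..<s. f (r + i))"
    using sum.shift_bounds_nat_ivl[of f 0 r s] by (simp add: add.commute)
  also have "sum f {r+s..<r+s+r} = (\<Sum>i=0..<r. f (r + s + i))"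
    using sum.shift_bounds_nat_ivl[of f 0 "r+s" r] by (simp add: add.commute)
  finally show ?thesis .
qed

lemma block3_mult:
  fixes A11 :: "'a::semiring_0 mat"
  assumes A: "A11 \<in> carrier_mat r r" "A12 \<in> carrier_mat r s" "A13 \<in> carrier_mat r r"
    "A21 \<in> carrier_mat s r" "A22 \<in> carrier_mat s s" "A23 \<in> carrier_mat s r"
    "A31 \<in> carrier_mat r r" "A32 \<in> carrier_mat r s" "A33 \<in> carrier_mat r r"
  and B: "B11 \<in> carrier_mat r r" "B12 \<in> carrier_mat r s" "B13 \<in> carrier_mat r r"
    "B21 \<in> carrier_mat s r" "B22 \<in> carrier_mat s s" "B23 \<in> carrier_mat s r"
    "B31 \<in> carrier_mat r r" "B32 \<in> carrier_mat r s" "B33 \<in> carrier_mat r r"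
  shows "block3 A11 A12 A13 A21 A22 A23 A31 A32 A33 * block3 B11 B12 B13 B21 B22 B23 B31 B32 B33 =
    block3 (A11 * B11 + A12 * B21 + A13 * B31) (A11 * B12 + A12 * B22 + A13 * B32) (A11 * B13 + A12 * B23 + A13 * B33)
      (A21 * B11 + A22 * B21 + A23 * B31) (A21 * B12 + A22 * B22 + A23 * B32) (A21 * B13 + A22 * B23 + A23 * B33)
      (A31 * B11 + A32 * B21 + A33 * B31) (A31 * B12 + A32 * B22 + A33 * B32) (A31 * B13 + A32 * B23 + A33 * B33)"
proof -
  note AB = A B
  have c: "A * B + C * D + E * F \<in> carrier_mat k m" 
    if "A \<in> carrier_mat k p" "B \<in> carrier_mat p m" "C \<in> carrier_mat k q" "D \<in> carrier_mat q m"
      "E \<in> carrier_mat k t" "F \<in> carrier_mat t m" for k m p q t and A B C D E F :: "'a mat"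
    using that by auto
  show ?thesis
    unfolding block3_eq[OF A] block3_eq[OF B]
    apply (subst block3_eq[of _ r _ s]; (meson AB add_carrier_mat mult_carrier_mat)?)
    apply (rule eq_matI)
    using AB by (auto simp: scalar_prod_def sum_split3)
qed

lemma block3_carrier:
  assumes "A11 \<in> carrier_mat r r" "A12 \<in> carrier_mat r s" "A13 \<in> carrier_mat r r"
    "A21 \<in> carrier_mat s r" "A22 \<in> carrier_mat s s" "A23 \<in> carrier_mat s r"
    "A31 \<in> carrier_mat r r" "A32 \<in> carrier_mat r s" "A33 \<in> carrier_mat r r"
  shows "block3 A11 A12 A13 A21 A22 A23 A31 A32 A33 \<in> carrier_mat (2 * r + s) (2 * r + s)"
  unfolding block3_eq[OF assms] by simp

lemma block3_minus:
  assumes "A11 \<in> carrier_mat r r" "A12 \<in> carrier_mat r s" "A13 \<in> carrier_mat r r"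
    "A21 \<in> carrier_mat s r" "A22 \<in> carrier_mat s s" "A23 \<in> carrier_mat s r"
    "A31 \<in> carrier_mat r r" "A32 \<in> carrier_mat r s" "A33 \<in> carrier_mat r r"
  and "B11 \<in> carrier_mat r r" "B12 \<in> carrier_mat r s" "B13 \<in> carrier_mat r r"
    "B21 \<in> carrier_mat s r" "B22 \<in> carrier_mat s s" "B23 \<in> carrier_mat s r"
    "B31 \<in> carrier_mat r r" "B32 \<in> carrier_mat r s" "B33 \<in> carrier_mat r r"
  shows "block3 A11 A12 A13 A21 A22 A23 A31 A32 A33 - block3 B11 B12 B13 B21 B22 B23 B31 B32 B33 =
    block3 (A11 - B11) (A12 - B12) (A13 - B13) (A21 - B21) (A22 - B22) (A23 - B23)
      (A31 - B31) (A32 - B32) (A33 - B33)"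
proof -
  note A = assms(1-9) and B = assms(10-18)
  show ?thesis
    unfolding block3_eq[OF A] block3_eq[OF B]
    by (subst block3_eq[of _ r _ s]; (intro minus_carrier_mat B)?; rule eq_matI; simp)
       (use A B in auto)
qed

lemma block3_inject:
  assumes "A11 \<in> carrier_mat r r" "A12 \<in> carrier_mat r s" "A13 \<in> carrier_mat r r"
    "A21 \<in> carrier_mat s r" "A22 \<in> carrier_mat s s" "A23 \<in> carrier_mat s r"
    "A31 \<in> carrier_mat r r" "A32 \<in> carrier_mat r s" "A33 \<in> carrier_mat r r"
  and "B11 \<in> carrier_mat r r" "B12 \<in> carrier_mat r s" "B13 \<in> carrier_mat r r"
    "B21 \<in> carrier_mat s r" "B22 \<in> carrier_mat s s" "B23 \<in> carrier_mat s r"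
    "B31 \<in> carrier_mat r r" "B32 \<in> carrier_mat r s" "B33 \<in> carrier_mat r r"
  and eq: "block3 A11 A12 A13 A21 A22 A23 A31 A32 A33 = block3 B11 B12 B13 B21 B22 B23 B31 B32 B33"
  shows "A12 = B12"
proof (rule eq_matI)
  fix i j assume ij: "i < dim_row B12" "j < dim_col B12"
  then have "i < r" "j < s" using assms by auto
  moreover have "block3 A11 A12 A13 A21 A22 A23 A31 A32 A33 $$ (i, r + j) = block3 B11 B12 B13 B21 B22 B23 B31 B32 B33 $$ (i, r + j)"
    using eq by simp
  ultimately show "A12 $$ (i, j) = B12 $$ (i, j)"
    unfolding block3_eq[OF assms(1-9)] block3_eq[OF assms(10-18)] by simp
qed (use assms in auto)

lemma zero_minus_zero [simp]: "0\<^sub>m a b - 0\<^sub>m a b = (0\<^sub>m a b :: 'a::group_add mat)"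
  by (intro eq_matI) auto

lemma commutator_up_down:
  fixes x :: "'a::ring_1 mat"
  assumes c: "x \<in> carrier_mat r s" "y \<in> carrier_mat r s" "A \<in> carrier_mat s r" "B \<in> carrier_mat s r"
  shows "commutator (block3 (0\<^sub>m r r) x (0\<^sub>m r r) (0\<^sub>m s r) (0\<^sub>m s s) A (0\<^sub>m r r) (0\<^sub>m r s) (0\<^sub>m r r))
      (block3 (0\<^sub>m r r) (0\<^sub>m r s) (0\<^sub>m r r) (- B) (0\<^sub>m s s) (0\<^sub>m s r) (0\<^sub>m r r) y (0\<^sub>m r r))
    = block3 (- (x * B)) (0\<^sub>m r s) (0\<^sub>m r r) (0\<^sub>m s r) (A * y + B * x) (0\<^sub>m s r) (0\<^sub>m r r) (0\<^sub>m r s) (- (y * A))"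
proof -
  note [simp] = c mult_carrier_mat[of _ r s _ r] mult_carrier_mat[of _ s r _ s]
  have [simp]: "A * y - - (B * x) = A * y + B * x"
    using c by (intro eq_matI) auto
  have mB: "- B \<in> carrier_mat s r" using c by simp
  note [simp] = left_mult_zero_mat[OF c(1)] left_mult_zero_mat[OF c(2)] left_mult_zero_mat[OF c(3)]
    left_mult_zero_mat[OF c(4)] left_mult_zero_mat[OF mB] right_mult_zero_mat[OF c(1)] right_mult_zero_mat[OF c(2)]
    right_mult_zero_mat[OF c(3)] right_mult_zero_mat[OF c(4)] right_mult_zero_mat[OF mB]
  have [simp]: "x * - B = - (x * B)" "- B * x = - (B * x)"
    using uminus_mult_right_mat[of x B] uminus_mult_left_mat[of B x] carrier_matD[OF c(1)] carrier_matD[OF c(4)] by auto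
  have [simp]: "0\<^sub>m r r - y * A = - (y * A)" "- (x * B) - 0\<^sub>m r r = - (x * B)"
    using carrier_matD[OF c(1)] carrier_matD[OF c(2)] carrier_matD[OF c(3)] carrier_matD[OF c(4)]
    by (auto intro!: eq_matI simp del: c)
  show ?thesis
    unfolding commutator_def
    by (subst block3_mult[of _ r _ s], simp_all, subst block3_mult[of _ r _ s], simp_all)
       (subst block3_minus[of _ r _ s], simp_all)
qed

lemma commutator_diag_up:
  fixes z :: "'a::ring_1 mat"
  assumes c: "z \<in> carrier_mat r s" "Z \<in> carrier_mat s r"
    "D1 \<in> carrier_mat r r" "D2 \<in> carrier_mat s s" "D3 \<in> carrier_mat r r"
  shows "commutator (block3 D1 (0\<^sub>m r s) (0\<^sub>m r r) (0\<^sub>m s r) D2 (0\<^sub>m s r) (0\<^sub>m r r) (0\<^sub>m r s) D3)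
      (block3 (0\<^sub>m r r) z (0\<^sub>m r r) (0\<^sub>m s r) (0\<^sub>m s s) Z (0\<^sub>m r r) (0\<^sub>m r s) (0\<^sub>m r r))
    = block3 (0\<^sub>m r r) (D1 * z - z * D2) (0\<^sub>m r r) (0\<^sub>m s r) (0\<^sub>m s s) (D2 * Z - Z * D3) (0\<^sub>m r r) (0\<^sub>m r s) (0\<^sub>m r r)"
proof -
  note [simp] = c mult_carrier_mat[of _ r s _ s] mult_carrier_mat[of _ s r _ r] mult_carrier_mat[of _ r r _ s]
    mult_carrier_mat[of _ s s _ r]
  note [simp] = c[THEN left_mult_zero_mat] c[THEN right_mult_zero_mat]
  show ?thesis
    unfolding commutator_def
    by (subst block3_mult[of _ r _ s], simp_all, subst block3_mult[of _ r _ s], simp_all)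
       (subst block3_minus[of _ r _ s], simp_all)
qed

lemma commutator_corner_down:
  fixes y :: "'a::ring_1 mat"
  assumes c: "y \<in> carrier_mat r s" "B \<in> carrier_mat s r"
  shows "commutator (block3 (0\<^sub>m r r) (0\<^sub>m r s) (1\<^sub>m r) (0\<^sub>m s r) (0\<^sub>m s s) (0\<^sub>m s r) (0\<^sub>m r r) (0\<^sub>m r s) (0\<^sub>m r r))
      (block3 (0\<^sub>m r r) (0\<^sub>m r s) (0\<^sub>m r r) (- B) (0\<^sub>m s s) (0\<^sub>m s r) (0\<^sub>m r r) y (0\<^sub>m r r))
    = block3 (0\<^sub>m r r) y (0\<^sub>m r r) (0\<^sub>m s r) (0\<^sub>m s s) B (0\<^sub>m r r) (0\<^sub>m r s) (0\<^sub>m r r)"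
proof -
  have mB: "- B \<in> carrier_mat s r" using c by simp
  have [simp]: "y - 0\<^sub>m r s = y" "0\<^sub>m s r - - B = B"
    using carrier_matD[OF c(1)] carrier_matD[OF c(2)] by (auto intro!: eq_matI)
  have [simp]: "- B * 1\<^sub>m r = - B" using mB by (rule right_mult_one_mat)
  have [simp]: "1\<^sub>m r * y = y" using c(1) by (rule left_mult_one_mat)
  note [simp] = c c[THEN left_mult_zero_mat] c[THEN right_mult_zero_mat] mB[THEN left_mult_zero_mat]
    mB[THEN right_mult_zero_mat]
  show ?thesis
    unfolding commutator_def
    by (subst block3_mult[of _ r _ s], simp_all, subst block3_mult[of _ r _ s], simp_all)
       (subst block3_minus[of _ r _ s], simp_all)
qed

lemma mult_assoc': "dim_col A = dim_row B \<Longrightarrow> dim_col B = dim_row C \<Longrightarrow> A * B * C = A * (B * C)"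
  for A B C :: "'a::semiring_0 mat"
  by (rule assoc_mult_mat) auto

lemma mult_add': "dim_col A = dim_row B \<Longrightarrow> dim_row C = dim_row B \<Longrightarrow> dim_col C = dim_col B \<Longrightarrow> A * (B + C) = A * B + A * C"
  for A B C :: "'a::semiring_0 mat"
  by (rule mult_add_distrib_mat) auto

lemma add_mult': "dim_col A = dim_row C \<Longrightarrow> dim_row A = dim_row B \<Longrightarrow> dim_col A = dim_col B \<Longrightarrow> (A + B) * C = A * C + B * C"
  for A B C :: "'a::semiring_0 mat"
  by (rule add_mult_distrib_mat) auto

context assoc_composition_algebra
begin

lemma star_mult': "dim_col A = dim_row B \<Longrightarrow> st (A * B) = st B * st A"
  by (rule star_mult) auto

lemma star_add': "dim_row A = dim_row B \<Longrightarrow> dim_col A = dim_col B \<Longrightarrow> st (A + B) = st A + st B"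
  by (rule star_add) auto

lemma star_minus': "dim_row A = dim_row B \<Longrightarrow> dim_col A = dim_col B \<Longrightarrow> st (A - B) = st A - st B"
  by (rule star_minus) auto

end

locale ternary_matrix_data = assoc_composition_algebra scale n + matrix_data scale n r s J G
  for scale :: "'k::field \<Rightarrow> 'c::ring_1 \<Rightarrow> 'c" and n r s J G +
  assumes J: "J \<in> carrier_mat s s" "star scale n J = - J"
    and G: "G \<in> carrier_mat r r" "diagonal_mat G"
begin

lemma GC_carrier [simp]: "GC \<in> carrier_mat r r"
  using G by (simp add: GC_def)

lemma star_GC [simp]: "st GC = GC"
proof (rule eq_matI)
  have d: "dim_row G = r" "dim_col G = r" using G by auto
  fix i j assume ij: "i < dim_row GC" "j < dim_col GC"
  then have "cj (scale (G $$ (j, i)) 1) = scale (G $$ (i, j)) 1"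
    using G d by (cases "i = j") (auto simp: cj_scale cj_one cj_zero diagonal_mat_def GC_def)
  with ij d show "st GC $$ (i, j) = GC $$ (i, j)" by (simp add: GC_def)
qed (use G in \<open>auto simp: GC_def\<close>)

lemma J_carrier [simp]: "J \<in> carrier_mat s s" by (rule J)

definition R :: "'c mat \<Rightarrow> 'c mat" where
  "R x = J * st x * GC"

lemma R_carrier [simp]: "x \<in> carrier_mat r s \<Longrightarrow> R x \<in> carrier_mat s r"
  by (rule carrier_matI) (simp_all add: R_def carrier_matD[OF J_carrier] carrier_matD[OF GC_carrier])

lemma dims [simp]: "dim_row J = s" "dim_col J = s" "dim_row GC = r" "dim_col GC = r"
  "dim_row (R x) = s" "dim_col (R x) = r"
  using carrier_matD[OF J_carrier] carrier_matD[OF GC_carrier] by (simp_all add: R_def)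

lemma star_R: assumes x: "x \<in> carrier_mat r s" shows "st (R x) = - (GC * x * J)"
proof -
  note [simp] = carrier_matD[OF x]
  have "st (R x) = GC * (x * - J)"
    unfolding R_def using J(2) by (simp add: star_mult')
  also have "\<dots> = - (GC * x * J)"
    by (simp add: mult_assoc')
  finally show ?thesis .
qed

lemma triple_eq:
  assumes c: "x \<in> carrier_mat r s" "y \<in> carrier_mat r s" "z \<in> carrier_mat r s"
  shows "triple ternary_alg x y z = - (x * R y) * z - z * (R x * y + R y * x)"
proof -
  let ?w = "- (x * R y) * z - z * (R x * y + R y * x)"
  let ?D2 = "R x * y + R y * x" and ?D3 = "- (y * R x)"
  note dim = carrier_matD[OF c(1)] carrier_matD[OF c(2)] carrier_matD[OF c(3)]
  have D: "- (x * R y) \<in> carrier_mat r r" "?D2 \<in> carrier_mat s s" "?D3 \<in> carrier_mat r r"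
    and w: "?w \<in> carrier_mat r s"
    by (intro carrier_matI; simp only: dim dims index_mult_mat index_add_mat index_minus_mat index_uminus_mat)+
  have cc: "commutator (commutator (M_up x) (M_down y)) (M_up z) =
      block3 (0\<^sub>m r r) ?w (0\<^sub>m r r) (0\<^sub>m s r) (0\<^sub>m s s) (?D2 * R z - R z * ?D3) (0\<^sub>m r r) (0\<^sub>m r s) (0\<^sub>m r r)"
    unfolding M_up_def M_down_def R_def[symmetric]
      commutator_up_down[OF c(1,2) R_carrier[OF c(1)] R_carrier[OF c(2)]]
    by (rule commutator_diag_up[OF c(3) R_carrier[OF c(3)] D])
  have 1: "st (- (x * R y) * z) = st z * (GC * y * J * st x)"
    using c by (simp add: dim star_mult' star_R star_uminus)
  have 2: "st (z * ?D2) = - (st y * (GC * x * J) + st x * (GC * y * J)) * st z"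
  proof -
    have "st (z * ?D2) = (- (st y * (GC * x * J)) + - (st x * (GC * y * J))) * st z"
      using c by (simp add: dim star_mult' star_add' star_R)
    also have "- (st y * (GC * x * J)) + - (st x * (GC * y * J)) = - (st y * (GC * x * J) + st x * (GC * y * J))"
      by (rule eq_matI) (simp_all add: dim)
    finally show ?thesis .
  qed
  have "st ?w = st z * (GC * y * J * st x) - st (z * ?D2)"
    using 1 by (simp add: dim star_minus')
  also have "\<dots> = st z * (GC * y * J * st x) + (st y * (GC * x * J) + st x * (GC * y * J)) * st z"
    unfolding 2 by (rule eq_matI) (simp_all add: dim)
  finally have "R ?w = J * (st z * (GC * y * J * st x) + (st y * (GC * x * J) + st x * (GC * y * J)) * st z) * GC"
    by (simp add: R_def)
  also have "\<dots> = R z * (y * R x) + (R y * x * R z + R x * y * R z)"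
    by (simp add: R_def dim mult_assoc' mult_add' add_mult')
  also have "\<dots> = ?D2 * R z - R z * ?D3"
    by (rule eq_matI) (simp_all add: dim add_mult' mult_assoc' del: index_mult_mat(1))
  finally have "R ?w = ?D2 * R z - R z * ?D3" .
  then have "commutator (commutator (M_up x) (M_down y)) (M_up z) = M_up ?w"
    unfolding cc by (simp add: M_up_def R_def)
  moreover have "w' = ?w" if "w' \<in> carrier_mat r s" "M_up ?w = M_up w'" for w'
    by (rule block3_inject[OF _ _ _ _ _ _ _ _ _ _ _ _ _ _ _ _ _ _ that(2)[unfolded M_up_def R_def[symmetric]], of r s, symmetric])
       (use that(1) w in simp_all)
  ultimately show ?thesis
    unfolding ternary_alg_def using w by (auto intro!: the_equality)
qed


lemma induced_op_e_matrix: "induced_op e_matrix = (\<lambda>y\<in>carrier_mat r s. y)"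
  unfolding induced_op_def
proof (rule restrict_ext)
  fix y :: "'c mat" assume y: "y \<in> carrier_mat r s"
  have e: "commutator e_matrix (M_down y) = M_up y"
    unfolding e_matrix_def M_down_def M_up_def R_def[symmetric] using y
    by (simp add: commutator_corner_down)
  have "w = y" if "w \<in> carrier_mat r s" "M_up y = M_up w" for w
    using block3_inject[OF _ _ _ _ _ _ _ _ _ _ _ _ _ _ _ _ _ _ that(2)[unfolded M_up_def R_def[symmetric]], of r s] that(1) y
    by simp
  then show "(THE w. w \<in> carrier_mat r s \<and> commutator e_matrix (M_down y) = M_up w) = y"
    unfolding e using y by (auto intro!: the_equality)
qed

end

lemma End_alg_closed:
  assumes "Module.module class_ring T"
  shows "f \<in> carrier (End_alg T) \<Longrightarrow> z \<in> carrier T \<Longrightarrow> f z \<in> carrier T"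
  by (auto simp: End_alg_def LinearCombinations.module_hom_def)

lemma module_End_alg:
  fixes T :: "('k::field, 'm, 'z) module_scheme"
  assumes T: "Module.module class_ring T"
  shows "Module.module class_ring (End_alg T)"
proof -
  interpret T: Module.module "class_ring :: 'k ring" T by (rule T)
  let ?E = "End_alg T"
  note defs = End_alg_def LinearCombinations.module_hom_def
  have ext: "f = g" if "f \<in> carrier ?E" "g \<in> carrier ?E" "\<And>z. z \<in> carrier T \<Longrightarrow> f z = g z" for f g
    using that by (intro extensionalityI[of f "carrier T" g]) (auto simp: defs)
  have add_cl: "f \<oplus>\<^bsub>?E\<^esub> g \<in> carrier ?E" if "f \<in> carrier ?E" "g \<in> carrier ?E" for f g
    using that by (auto simp: defs T.a_ac T.smult_r_distr Pi_iff)
  have smult_cl: "c \<odot>\<^bsub>?E\<^esub> f \<in> carrier ?E" if "f \<in> carrier ?E" for c f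
    using that by (auto simp: defs T.smult_r_distr T.smult_assoc1[symmetric] Pi_iff mult.commute)
  have zero_cl: "\<zero>\<^bsub>?E\<^esub> \<in> carrier ?E"
    by (auto simp: defs)
  have val [simp]: "(f \<oplus>\<^bsub>?E\<^esub> g) z = f z \<oplus>\<^bsub>T\<^esub> g z" "(c \<odot>\<^bsub>?E\<^esub> f) z = c \<odot>\<^bsub>T\<^esub> f z" "\<zero>\<^bsub>?E\<^esub> z = \<zero>\<^bsub>T\<^esub>"
    if "z \<in> carrier T" for f g c z using that by (simp_all add: End_alg_def)
  note cl [simp] = End_alg_closed[OF T] 
  show ?thesis
  proof (rule moduleI)
    show "cring (class_ring :: 'k ring)" using T unfolding Module.module_def by blast
    show "abelian_group ?E"
    proof (rule abelian_groupI)
      fix f assume f: "f \<in> carrier ?E"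
      show "\<exists>g\<in>carrier ?E. g \<oplus>\<^bsub>?E\<^esub> f = \<zero>\<^bsub>?E\<^esub>"
      proof (intro bexI[of _ "(-1) \<odot>\<^bsub>?E\<^esub> f"] ext add_cl smult_cl f zero_cl)
        fix z assume z: "z \<in> carrier T"
        have "(-1) \<odot>\<^bsub>T\<^esub> f z \<oplus>\<^bsub>T\<^esub> 1 \<odot>\<^bsub>T\<^esub> f z = (0::'k) \<odot>\<^bsub>T\<^esub> f z"
          using T.smult_l_distr[of "-1" 1 "f z"] f z by simp
        then show "((-1) \<odot>\<^bsub>?E\<^esub> f \<oplus>\<^bsub>?E\<^esub> f) z = \<zero>\<^bsub>?E\<^esub> z"
          using f z T.smult_one[of "f z"] T.smult_l_null[of "f z"] by simp
      qed
    qed (auto intro!: ext add_cl zero_cl simp: T.a_ac)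
  qed (auto intro!: ext add_cl smult_cl simp: T.smult_r_distr T.smult_l_distr[simplified] T.smult_assoc1[simplified] T.smult_one[simplified])
qed

context ternary_matrix_data
begin

lemma ternary_alg_simps [simp]:
  "carrier ternary_alg = carrier_mat r s" "zero ternary_alg = 0\<^sub>m r s" "add ternary_alg = (+)"
  "smult ternary_alg = (\<lambda>a. map_mat (scale a))"
  by (simp_all add: ternary_alg_def)

lemma module_ternary_alg: "Module.module class_ring ternary_alg"
proof (rule moduleI)
  show "cring (class_ring :: 'k ring)"
    by (rule class_cring.is_cring)
  show "abelian_group ternary_alg"
  proof (rule abelian_groupI)
    fix x :: "'c mat" assume "x \<in> carrier ternary_alg"
    then show "\<exists>y\<in>carrier ternary_alg. y \<oplus>\<^bsub>ternary_alg\<^esub> x = \<zero>\<^bsub>ternary_alg\<^esub>"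
      by (intro bexI[of _ "- x"]) auto
  qed (auto intro: comm_add_mat)
qed (auto intro!: eq_matI simp: scale_left_distrib scale_right_distrib)

lemma minus_ternary_alg:
  assumes "x \<in> carrier_mat r s" "y \<in> carrier_mat r s"
  shows "x \<ominus>\<^bsub>ternary_alg\<^esub> y = x - y"
proof -
  interpret T: Module.module "class_ring :: 'k ring" ternary_alg by (rule module_ternary_alg)
  have "\<ominus>\<^bsub>ternary_alg\<^esub> y = - y"
    using assms by (intro T.minus_equality) auto
  then show ?thesis using assms by (simp add: a_minus_def) (auto intro!: eq_matI)
qed

lemma angle_eq:
  assumes c: "x \<in> carrier_mat r s" "y \<in> carrier_mat r s" "z \<in> carrier_mat r s"
  shows "angle ternary_alg x y z = (y * R x - x * R y) * z"
proof -
  note dim = carrier_matD[OF c(1)] carrier_matD[OF c(2)] carrier_matD[OF c(3)]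
  have cl: "triple ternary_alg y z x \<in> carrier_mat r s" "triple ternary_alg x z y \<in> carrier_mat r s"
    unfolding triple_eq[OF c(2,3,1)] triple_eq[OF c(1,3,2)]
    by (intro carrier_matI; simp only: dim dims index_mult_mat index_add_mat index_minus_mat index_uminus_mat)+
  have "angle ternary_alg x y z = triple ternary_alg y z x - triple ternary_alg x z y"
    using c cl by (simp add: angle_def minus_ternary_alg)
  also have "\<dots> = (- (y * R z) * x - x * (R y * z + R z * y)) - (- (x * R z) * y - y * (R x * z + R z * x))"
    by (simp only: triple_eq[OF c(2,3,1)] triple_eq[OF c(1,3,2)])
  also have "\<dots> = y * R x * z - x * R y * z"
    by (rule eq_matI) (simp_all add: dim mult_assoc' mult_add' add_mult' del: index_mult_mat(1))
  also have "\<dots> = (y * R x - x * R y) * z"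
    by (rule minus_mult_distrib_mat[of _ r r _ _ s, symmetric]) (use c in \<open>auto intro!: carrier_matI simp: dim\<close>)
  finally show ?thesis .
qed

lemma angle_End: 
  assumes c: "x \<in> carrier_mat r s" "y \<in> carrier_mat r s"
  shows "angle ternary_alg x y \<in> carrier (End_alg ternary_alg)"
proof -
  note dim = carrier_matD[OF c(1)] carrier_matD[OF c(2)]
  let ?A = "y * R x - x * R y"
  have A: "?A \<in> carrier_mat r r" by (intro carrier_matI) (simp_all add: dim)
  have "map_mat (scale a) (?A * m) = ?A * map_mat (scale a) m" if "m \<in> carrier_mat r s" for a m
    using A that by (intro eq_matI) (auto simp: scalar_prod_def scale_sum_right scale_mult_right)
  moreover have "?A * (m1 + m2) = ?A * m1 + ?A * m2" if "m1 \<in> carrier_mat r s" "m2 \<in> carrier_mat r s" for m1 m2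
    using A that by (intro mult_add_distrib_mat)
  moreover have "?A * m \<in> carrier_mat r s" if "m \<in> carrier_mat r s" for m
    using A that by (rule mult_carrier_mat)
  ultimately show ?thesis
    using c by (auto simp: End_alg_def LinearCombinations.module_hom_def angle_eq) (auto simp: angle_def)
qed

lemma unit_End: "(\<lambda>z\<in>carrier_mat r s. z) \<in> carrier (End_alg ternary_alg)"
  by (auto simp: End_alg_def LinearCombinations.module_hom_def)

lemma jordan_mult_unit:
  assumes a: "a \<in> carrier (End_alg ternary_alg)" and two: "(2 :: 'k) \<noteq> 0"
  shows "jordan_mult ternary_alg (\<lambda>z\<in>carrier_mat r s. z) a = a"
proof (rule extensionalityI[of _ "carrier_mat r s"])
  fix z :: "'c mat" assume z: "z \<in> carrier_mat r s"
  have az: "a z \<in> carrier_mat r s" using End_alg_closed[OF module_ternary_alg a] z by simp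
  have "scale (1/2) (t + t) = t" for t
  proof -
    have "scale (1/2) (t + t) = scale (1/2) (scale 2 t)"
      by (metis one_add_one scale_left_distrib scale_one)
    with two show ?thesis by simp
  qed
  then show "jordan_mult ternary_alg (\<lambda>z\<in>carrier_mat r s. z) a z = a z"
    using az z by (auto simp: jordan_mult_def End_alg_def compose_def intro!: eq_matI)
qed (use a in \<open>auto simp: End_alg_def jordan_mult_def\<close>)

end

context ternary_matrix_data
begin

theorem jordan_unit_e_matrix:
  assumes two: "(2 :: 'k) \<noteq> 0" and s: "s \<ge> 1" and "invertible_mat J" "invertible_mat G"
  shows "jordan_unit ternary_alg (induced_op e_matrix)"
proof -
  let ?T = ternary_alg and ?id = "\<lambda>z\<in>carrier_mat r s. z :: 'c mat"
  interpret T: Module.module "class_ring :: 'k ring" ?T by (rule module_ternary_alg)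
  interpret E: Module.module "class_ring :: 'k ring" "End_alg ?T" by (rule module_End_alg[OF module_ternary_alg])
  let ?S = "{angle ?T x y | x y. x \<in> carrier ?T \<and> y \<in> carrier ?T}"
  have S: "?S \<subseteq> carrier (End_alg ?T)" by (auto intro: angle_End)
  have sub: "submodule class_ring (jordan_space ?T) (End_alg ?T)"
    unfolding jordan_space_def by (rule E.span_is_submodule[OF S])
  obtain Ji where Ji: "Ji \<in> carrier_mat s s" "J * Ji = 1\<^sub>m s"
  proof -
    from assms(3) obtain B where B: "J * B = 1\<^sub>m (dim_row J)" "B * J = 1\<^sub>m (dim_row B)"
      by (auto simp: invertible_mat_def inverts_mat_def)
    have "dim_row B = s" "dim_col B = s"
      using arg_cong[OF B(1), of dim_col] arg_cong[OF B(2), of dim_col] by auto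
    with B that[of B] show ?thesis by (auto intro: carrier_matI)
  qed
  have G_nz: "G $$ (i, i) \<noteq> 0" if i: "i < r" for i
  proof
    assume 0: "G $$ (i, i) = 0"
    from assms(4) obtain B where B: "G * B = 1\<^sub>m (dim_row G)" "B * G = 1\<^sub>m (dim_row B)"
      by (auto simp: invertible_mat_def inverts_mat_def)
    have d: "dim_row G = r" "dim_col G = r" using G by auto
    have "dim_row B = r" "dim_col B = r"
      using arg_cong[OF B(1), of dim_col] arg_cong[OF B(2), of dim_col] d by auto
    moreover have "G $$ (i, j) = 0" if "j < r" for j
      using 0 G(2) i that d by (cases "i = j") (auto simp: diagonal_mat_def)
    ultimately have "(G * B) $$ (i, i) = 0" using i d by (simp add: scalar_prod_def)
    with B(1) i d show False by simp
  qed
  define P where "P k = (\<lambda>z\<in>carrier_mat r s. mat r s (\<lambda>(i, j). if i < k then z $$ (i, j) else 0) :: 'c mat)" for k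
  have step: "\<exists>x y. x \<in> carrier_mat r s \<and> y \<in> carrier_mat r s \<and>
     y * R x - x * R y = mat r r (\<lambda>(i, j). if i = k \<and> j = k then 1 else 0)" if k: "k < r" for k
  proof -
    define c :: 'k where "c = inverse (2 * G $$ (k, k))"
    define K :: "'c mat" where "K = mat s r (\<lambda>(i, j). if i = 0 \<and> j = k then scale c 1 else 0)"
    define x where "x = st (Ji * K)"
    define y :: "'c mat" where "y = mat r s (\<lambda>(i, j). if i = k \<and> j = 0 then 1 else 0)"
    define U :: "'c mat" where "U = mat r r (\<lambda>(i, j). if i = k \<and> j = k then scale c 1 else 0)"
    have dims': "dim_row Ji = s" "dim_col Ji = s" "dim_row K = s" "dim_col K = r" "dim_row x = r" "dim_col x = s"
      "dim_row y = r" "dim_col y = s" "dim_row U = r" "dim_col U = r"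
      using Ji by (auto simp: K_def x_def y_def U_def)
    have "J * st x = J * Ji * K"
      unfolding x_def star_star by (rule assoc_mult_mat[symmetric]) (auto intro: carrier_matI simp: dims')
    then have Jx: "J * st x = K" using Ji by (simp add: carrier_matI dims')
    have yK: "y * K = U"
    proof (rule eq_matI)
      fix i j assume "i < dim_row U" "j < dim_col U"
      then have ij: "i < r" "j < r" by (simp_all add: dims')
      have "(y * K) $$ (i, j) = (\<Sum>l = 0..<s. y $$ (i, l) * K $$ (l, j))"
        using ij by (simp add: scalar_prod_def dims')
      also have "\<dots> = (\<Sum>l = 0..<s. if l = 0 then y $$ (i, 0) * K $$ (0, j) else 0)"
        using ij by (intro sum.cong) (auto simp: y_def)
      also have "\<dots> = y $$ (i, 0) * K $$ (0, j)" using s by (simp add: sum.delta)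
      also have "\<dots> = U $$ (i, j)" using ij s by (simp add: y_def K_def U_def)
      finally show "(y * K) $$ (i, j) = U $$ (i, j)" .
    qed (simp_all add: dims')
    have yRx: "y * R x = U * GC"
      unfolding R_def Jx by (subst yK[symmetric], rule assoc_mult_mat[symmetric]) (auto intro!: carrier_matI simp: dims')
    have stU: "st U = U"
      by (rule eq_matI) (auto simp: U_def cj_scale cj_one cj_zero)
    have "x * (J * st y) = - st (y * K)"
    proof -
      have "st (y * K) = st (J * st x) * st y" unfolding Jx by (simp add: star_mult' dims')
      also have "st (J * st x) = x * - J" using J(2) by (simp add: star_mult' dims')
      finally have "st (y * K) = - (x * J) * st y" by (simp add: dims')
      then show ?thesis by (simp add: dims' mult_assoc')
    qed
    then have "x * R y = - U * GC"
      unfolding R_def yK stU by (simp add: dims' flip: mult_assoc')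
    then have "y * R x - x * R y = U * GC - - U * GC" by (simp only: yRx)
    also have "\<dots> = mat r r (\<lambda>(i, j). if i = k \<and> j = k then 1 else 0)"
    proof (rule eq_matI)
      fix i j assume "i < dim_row (mat r r (\<lambda>(i, j). if i = k \<and> j = k then 1 else 0 :: 'c))"
         "j < dim_col (mat r r (\<lambda>(i, j). if i = k \<and> j = k then 1 else 0 :: 'c))"
      then have ij: "i < r" "j < r" by simp_all
      have "(U * GC) $$ (i, j) = (\<Sum>l = 0..<r. U $$ (i, l) * GC $$ (l, j))"
        using ij by (simp add: scalar_prod_def dims')
      also have "\<dots> = (\<Sum>l = 0..<r. if l = k then U $$ (i, k) * GC $$ (k, j) else 0)"
        using ij by (intro sum.cong) (auto simp: U_def)
      also have "\<dots> = U $$ (i, k) * GC $$ (k, j)" using k by (simp add: sum.delta)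
      also have "\<dots> = (if i = k \<and> j = k then scale (1/2) 1 else 0)"
        using ij k G G_nz[OF k] by (auto simp: U_def GC_def scale_mult_left c_def diagonal_mat_def field_simps)
      finally have UG: "(U * GC) $$ (i, j) = (if i = k \<and> j = k then scale (1/2) 1 else 0)" .
      have h: "scale (1/2) 1 + scale (1/2) 1 = (1 :: 'c)"
        using two by (simp flip: scale_left_distrib)
      show "(U * GC - - U * GC) $$ (i, j) = mat r r (\<lambda>(i, j). if i = k \<and> j = k then 1 else 0) $$ (i, j)"
        using ij UG h by (simp add: dims' del: index_mult_mat(1))
    qed (simp_all add: dims')
    finally show ?thesis by (intro exI[of _ x] exI[of _ y]) (auto intro!: carrier_matI simp: dims')
  qed
  have P: "P k \<in> jordan_space ?T" if "k \<le> r" for k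
    using that
  proof (induction k)
    case 0
    have "P 0 = \<zero>\<^bsub>End_alg ?T\<^esub>"
      by (auto simp: P_def End_alg_def fun_eq_iff restrict_def intro!: eq_matI)
    then show ?case using sub by (simp only: submodule_def)
  next
    case (Suc k)
    then obtain x y where xy: "x \<in> carrier_mat r s" "y \<in> carrier_mat r s"
      "y * R x - x * R y = mat r r (\<lambda>(i, j). if i = k \<and> j = k then 1 else 0)" using step[of k] by auto
    have "P (Suc k) = P k \<oplus>\<^bsub>End_alg ?T\<^esub> angle ?T x y"
    proof (rule extensionalityI[of _ "carrier_mat r s"])
      fix z :: "'c mat" assume z: "z \<in> carrier_mat r s"
      have "mat r r (\<lambda>(i, j). if i = k \<and> j = k then 1 else 0) * z = mat r s (\<lambda>(i, j). if i = k then z $$ (i, j) else 0)"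
        using z by (intro eq_matI) (auto simp: scalar_prod_def if_distrib[of "\<lambda>u. u * _"] sum.delta cong: if_cong)
      then show "P (Suc k) z = (P k \<oplus>\<^bsub>End_alg ?T\<^esub> angle ?T x y) z"
        using z by (auto simp: P_def End_alg_def angle_eq[OF xy(1,2)] xy(3) intro!: eq_matI)
    qed (auto simp: P_def End_alg_def)
    moreover have "angle ?T x y \<in> jordan_space ?T"
      unfolding jordan_space_def using E.in_own_span[OF S] xy(1,2) by auto
    ultimately show ?case using Suc sub by (auto simp: submodule_def)
  qed
  have "P r = ?id"
    by (auto simp: P_def fun_eq_iff restrict_def intro!: eq_matI)
  with P[of r] have "?id \<in> jordan_space ?T" by simp
  moreover have "jordan_space ?T \<subseteq> carrier (End_alg ?T)"
    using sub by (simp add: submodule_def)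
  ultimately show ?thesis
    unfolding jordan_unit_def induced_op_e_matrix using jordan_mult_unit[OF _ two] by auto
qed

end


section \<open>Classical Lie superalgebras\<close>

text \<open>Square matrices of size \<open>a + b\<close> are graded by their four blocks.\<close>

definition even_proj :: "nat \<Rightarrow> 'a::zero mat \<Rightarrow> 'a mat" where
  "even_proj a Q = mat (dim_row Q) (dim_col Q) (\<lambda>(i, j). if (i < a) = (j < a) then Q $$ (i, j) else 0)"

definition odd_proj :: "nat \<Rightarrow> 'a::zero mat \<Rightarrow> 'a mat" where
  "odd_proj a Q = mat (dim_row Q) (dim_col Q) (\<lambda>(i, j). if (i < a) = (j < a) then 0 else Q $$ (i, j))"

text \<open>The bilinear extension of \<open>[Q, Y] = XY - (-1)^(|Q||Y|) YX\<close>.\<close>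

definition superbracket :: "nat \<Rightarrow> 'a::field mat \<Rightarrow> 'a mat \<Rightarrow> 'a mat" where
  "superbracket a Q Y = Q * Y - even_proj a Y * Q - odd_proj a Y * (even_proj a Q - odd_proj a Q)"

definition gl_even :: "nat \<Rightarrow> nat \<Rightarrow> 'a::field mat set" where
  "gl_even a b = {Q \<in> carrier_mat (a + b) (a + b). even_proj a Q = Q}"

definition gl_odd :: "nat \<Rightarrow> nat \<Rightarrow> 'a::field mat set" where
  "gl_odd a b = {Q \<in> carrier_mat (a + b) (a + b). odd_proj a Q = Q}"

definition matrix_superalgebra :: "nat \<Rightarrow> nat \<Rightarrow> 'a::field mat set \<Rightarrow> 'a mat set \<Rightarrow> ('a, 'a mat) superalgebra" where
  "matrix_superalgebra a b V0 V1 =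
     \<lparr> carrier = {Q + R | Q R. Q \<in> V0 \<and> R \<in> V1},
       mult = superbracket a,
       one = undefined,
       zero = 0\<^sub>m (a + b) (a + b),
       add = (+),
       smult = (\<cdot>\<^sub>m),
       even_part = V0,
       odd_part = V1 \<rparr>"

definition supertrace :: "nat \<Rightarrow> 'a::field mat \<Rightarrow> 'a" where
  "supertrace a Q = (\<Sum>i<a. Q $$ (i, i)) - (\<Sum>i=a..<dim_row Q. Q $$ (i, i))"

definition sl :: "nat \<Rightarrow> nat \<Rightarrow> ('a::field, 'a mat) superalgebra" where
  "sl a b = matrix_superalgebra a b {Q \<in> gl_even a b. supertrace a Q = 0} (gl_odd a b)"

definition quotient_superalgebra :: "('k, 'v) superalgebra \<Rightarrow> 'v set \<Rightarrow> ('k, 'v set) superalgebra" where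
  "quotient_superalgebra g I =
     \<lparr> carrier = a_rcosets\<^bsub>g\<^esub> I,
       mult = rcoset_mult g I,
       one = undefined,
       zero = I,
       add = set_add g,
       smult = (\<lambda>c Q. \<Union>x\<in>Q. I +>\<^bsub>g\<^esub> (c \<odot>\<^bsub>g\<^esub> x)),
       even_part = (\<lambda>x. I +>\<^bsub>g\<^esub> x) ` even_part g,
       odd_part = (\<lambda>x. I +>\<^bsub>g\<^esub> x) ` odd_part g \<rparr>"

text \<open>Only used when \<open>a = b\<close> in the field, so that the scalar matrices lie in \<^const>\<open>sl\<close>.\<close>

definition psl :: "nat \<Rightarrow> nat \<Rightarrow> ('a::field, 'a mat set) superalgebra" where
  "psl a b = quotient_superalgebra (sl a b) {c \<cdot>\<^sub>m 1\<^sub>m (a + b) | c. True}"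

text \<open>For \<open>S\<close> symmetric and \<open>A\<close> alternating, \<open>B = diag(S, A)\<close> is the Gram matrix of a supersymmetric
  form.  A homogeneous \<open>Q\<close> belongs to the orthosymplectic superalgebra if
  \<open>B(Xv, w) + (-1)^(|Q||v|) B(v, Xw) = 0\<close>; the sign is accounted for by \<open>diag(1, -1)\<close>.\<close>

definition osp_form :: "nat \<Rightarrow> nat \<Rightarrow> 'a::field mat \<Rightarrow> 'a mat \<Rightarrow> ('a, 'a mat) superalgebra" where
  "osp_form a b S A =
     (let B = four_block_mat S (0\<^sub>m a b) (0\<^sub>m b a) A;
          P = four_block_mat (1\<^sub>m a) (0\<^sub>m a b) (0\<^sub>m b a) (- 1\<^sub>m b);
          Z = 0\<^sub>m (a + b) (a + b)
      in matrix_superalgebra a b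
           {Q \<in> gl_even a b. transpose_mat Q * B + B * Q = Z}
           {Q \<in> gl_odd a b. transpose_mat Q * B + P * B * Q = Z})"

definition symmetric_form :: "nat \<Rightarrow> 'a::field mat \<Rightarrow> bool" where
  "symmetric_form a S \<longleftrightarrow> S \<in> carrier_mat a a \<and> invertible_mat S \<and> transpose_mat S = S"

definition symplectic_form :: "nat \<Rightarrow> 'a::field mat \<Rightarrow> bool" where
  "symplectic_form b A \<longleftrightarrow> A \<in> carrier_mat b b \<and> invertible_mat A \<and> transpose_mat A = - A \<and>
     (\<forall>i<b. A $$ (i, i) = 0)"

text \<open>The standard forms; over an algebraically closed field of characteristic not 2 there is no
  other choice up to isomorphism.\<close>

definition osp :: "nat \<Rightarrow> nat \<Rightarrow> ('a::field, 'a mat) superalgebra" where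
  "osp a b = (let k = b div 2 in
     osp_form a b (1\<^sub>m a) (four_block_mat (0\<^sub>m k k) (1\<^sub>m k) (- 1\<^sub>m k) (0\<^sub>m k k)))"

definition superalgebra_hom ::
    "('k \<Rightarrow> 'l) \<Rightarrow> ('k, 'v) superalgebra \<Rightarrow> ('l, 'w) superalgebra \<Rightarrow> ('v \<Rightarrow> 'w) \<Rightarrow> bool" where
  "superalgebra_hom \<sigma> g k f \<longleftrightarrow>
     f \<in> carrier g \<rightarrow> carrier k \<and>
     f ` even_part g \<subseteq> even_part k \<and>
     f ` odd_part g \<subseteq> odd_part k \<and>
     (\<forall>x\<in>carrier g. \<forall>y\<in>carrier g. f (x \<oplus>\<^bsub>g\<^esub> y) = f x \<oplus>\<^bsub>k\<^esub> f y) \<and>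
     (\<forall>c. \<forall>x\<in>carrier g. f (c \<odot>\<^bsub>g\<^esub> x) = \<sigma> c \<odot>\<^bsub>k\<^esub> f x) \<and>
     (\<forall>x\<in>carrier g. \<forall>y\<in>carrier g. f (x \<otimes>\<^bsub>g\<^esub> y) = f x \<otimes>\<^bsub>k\<^esub> f y)"

definition superalgebra_iso :: "('k, 'v) superalgebra \<Rightarrow> ('k, 'w) superalgebra \<Rightarrow> bool" where
  "superalgebra_iso g k \<longleftrightarrow> (\<exists>f. superalgebra_hom id g k f \<and> bij_betw f (carrier g) (carrier k))"

text \<open>\<open>k\<close> is the scalar extension of \<open>g\<close> to the algebraic closure: an embedding of \<open>g\<close> into \<open>k\<close>
  over the inclusion of the fields carries some basis of \<open>g\<close> to a basis of \<open>k\<close>.\<close>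

definition form_of :: "('k::field, 'v) superalgebra \<Rightarrow> ('k alg_closure, 'w) superalgebra \<Rightarrow> bool" where
  "form_of g k \<longleftrightarrow> (\<exists>f B. superalgebra_hom to_ac g k f \<and>
     vectorspace.basis class_ring g B \<and> inj_on f B \<and> vectorspace.basis class_ring k (f ` B))"

definition type_A :: "('k::field, 'v) superalgebra \<Rightarrow> nat \<Rightarrow> nat \<Rightarrow> bool" where
  "type_A g m n \<longleftrightarrow>
     (if int CHAR('k) dvd int m - int n then form_of g (psl (m + 1) (n + 1))
      else form_of g (sl (m + 1) (n + 1)))"

definition type_B :: "('k::field, 'v) superalgebra \<Rightarrow> nat \<Rightarrow> nat \<Rightarrow> bool" where
  "type_B g m n \<longleftrightarrow> form_of g (osp (2 * m + 1) (2 * n))"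

text \<open>For four-dimensional \<open>C\<close> the odd part \<open>M\<close> of the superalgebra has dimension \<open>4rs = 2s \<cdot> 2r\<close>, and the
  odd part of \<open>osp(a, b)\<close> has dimension \<open>ab\<close>; so the type there is \<open>osp(2s, 2r)\<close>, not \<open>osp(4s, 4r)\<close>.\<close>

definition type_D :: "('k::field, 'v) superalgebra \<Rightarrow> nat \<Rightarrow> nat \<Rightarrow> bool" where
  "type_D g m n \<longleftrightarrow> form_of g (osp (2 * m) (2 * n))"

end

theory Submission
  imports Defs
begin

text \<open>
  Put \<open>R x = J x\<^sup>* G\<close>. The operator \<open>L\<^bsub>x,y\<^esub>\<close> of \<open>M\<close> is \<open>z \<mapsto> - x (R y) z - z (R x y + R y x)\<close>. In
  characteristic 3, where \<open>-2 = 1\<close>, the operator \<open>L\<^bsub>x,y\<^esub> + L\<^bsub>y,x\<^esub>\<close> is therefore \<open>z \<mapsto> P z - z D\<close> with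
  \<open>P = - (x R y + y R x)\<close> and \<open>D = - (R x y + R y x)\<close>. These are the diagonal blocks of the superbracket of
  the odd block matrices with upper right blocks \<open>x, y\<close> and lower left blocks \<open>- R x, - R y\<close>. So the triple
  product \<open>[[x, y], z]\<close> of odd elements of the semisimplification is that of odd matrices in
  \<open>gl(r|s)\<close> over \<open>C\<close>.

  The odd part generates the even part, that is, the operators \<open>L\<^bsub>x,y\<^esub> + L\<^bsub>y,x\<^esub>\<close> span the inner derivations.
  Indeed \<open>InStr(M)\<close> is spanned by these operators and by left multiplications by matrices \<open>H\<close> that are
  selfadjoint for \<open>G\<close>. An operator \<open>z \<mapsto> A z + z B\<close> in \<open>InStr(M)\<close> sends the unit of the Jordan algebra to
  the left multiplication by \<open>A + A'\<close>, where \<open>A'\<close> is the adjoint. That is 0 for the former operators and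
  \<open>2 H = - H\<close> for the latter (\<open>InDer_eq\<close>).

  Hence the semisimplification is determined by \<open>M\<close> with the triple product \<open>[[x, y], z]\<close>. Let
  \<open>g = g\<^sub>0 + g\<^sub>1\<close> be a Lie superalgebra of matrices over an extension field, with \<open>g\<^sub>0\<close> spanned by
  \<open>[g\<^sub>1, g\<^sub>1]\<close>, and let \<open>M \<rightarrow> g\<^sub>1\<close> be semilinear, compatible with the triple products, and with an image that
  spans \<open>g\<^sub>1\<close>. Every inner derivation of \<open>M\<close> is induced by an element of \<open>g\<^sub>0\<close>, unique up to the annihilator of
  \<open>g\<^sub>1\<close>, so the map extends to a homomorphism to the quotient of \<open>g\<close> by this annihilator, and the image spans.
  It maps bases to bases if the scalar extension of \<open>M \<rightarrow> g\<^sub>1\<close> is injective. This is expressed by functionals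
  that take values in the small field on \<open>M\<close>; applied to values of derivations, they give the same property
  for the even part (\<open>super_map_hom\<close>, \<open>super_map_semilinear\<close>, \<open>super_map_generates\<close>).

  It remains to find the embeddings. Over the algebraic closure \<open>K\<close> the algebra \<open>C\<close> becomes \<open>K\<close>,
  \<open>K \<times> K\<close> or \<open>M\<^sub>2(K)\<close>.

  \<^item> If \<open>C\<close> is one-dimensional, the star is the transpose, and the pairs of blocks \<open>x\<close>, \<open>- R x\<close> are the odd part
    of the orthosymplectic superalgebra of the symmetric matrix \<open>G\<close> and the alternating matrix
    \<open>- J\<^sup>-\<^sup>1\<close>. This embedding is defined over the field itself.
  \<^item> If \<open>C\<close> is two-dimensional, let \<open>\<phi>\<close> be one of the projections of \<open>K \<times> K\<close>. The other one is \<open>\<phi>\<close> after the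
    conjugation, so \<open>\<phi>(x)\<close> and \<open>\<phi>(R x)\<close> are independent blocks and span the whole odd part of \<open>sl(r|s)\<close>.
    The annihilator consists of the scalars in \<open>sl(r|s)\<close>, which explains the quotient \<open>psl\<close>.
  \<^item> If \<open>C\<close> is four-dimensional, \<open>x\<close> becomes a \<open>2r \<times> 2s\<close> matrix. The conjugation of \<open>M\<^sub>2(K)\<close> is the symplectic
    involution, so the hermitian \<open>G\<close> yields an alternating matrix of size \<open>2r\<close>, and the skew-hermitian \<open>J\<close>
    a symmetric matrix of size \<open>2s\<close>. After a transposition this is the odd part of \<open>osp(2s, 2r)\<close>.

  Over \<open>K\<close> all nondegenerate symmetric matrices of a given size are congruent, and so are the alternating
  ones, so that the forms can be replaced by the standard ones.
\<close>

section \<open>Forms of superalgebras\<close>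

text \<open>Zorn's lemma: a linear dependence involves finitely many vectors, so the union of a chain of independent
  sets is independent, and a maximal independent set generates.\<close>

lemma (in vectorspace) basis_exists: "\<exists>B. basis B"
proof -
  let ?P = "\<lambda>S. S \<subseteq> carrier V \<and> lin_indpt S"
  have chain: "\<Union>C \<in> {S. ?P S}" if C: "subset.chain {S. ?P S} C" for C
  proof -
    have "lin_indpt (\<Union>C)"
    proof
      assume "lin_dep (\<Union>C)"
      then obtain A a v where A: "finite A" "A \<subseteq> \<Union>C" "a \<in> A \<rightarrow> carrier K" "lincomb a A = \<zero>\<^bsub>V\<^esub>"
        "v \<in> A" "a v \<noteq> \<zero>\<^bsub>K\<^esub>" unfolding lin_dep_def by blast
      then have "C \<noteq> {}" by auto
      then obtain B where "B \<in> C" "A \<subseteq> B"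
        using finite_subset_Union_chain[OF A(1,2) _ C] by blast
      then have "lin_dep B" using A unfolding lin_dep_def by blast
      with \<open>B \<in> C\<close> C show False by (auto simp: subset.chain_def)
    qed
    with C show ?thesis by (auto simp: subset.chain_def)
  qed
  have "\<exists>M\<in>{S. ?P S}. \<forall>S\<in>{S. ?P S}. M \<subseteq> S \<longrightarrow> S = M"
    by (rule subset_Zorn') (rule chain)
  then obtain M where "M \<in> {S. ?P S}" and max': "\<forall>S\<in>{S. ?P S}. M \<subseteq> S \<longrightarrow> S = M"
    by (elim bexE)
  then have M: "M \<subseteq> carrier V" "lin_indpt M"
    and max: "\<And>S. S \<subseteq> carrier V \<Longrightarrow> lin_indpt S \<Longrightarrow> M \<subseteq> S \<Longrightarrow> S = M" by simp_all
  have "maximal M ?P" unfolding maximal_def using M max by simp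
  from max_li_is_gen[OF this] M have "basis M" unfolding basis_def by simp
  then show ?thesis by (rule exI)
qed

text \<open>Contracts a linear relation over the large field to one over the small field in which a chosen coefficient
  survives.\<close>

lemma field_functional_exists:
  fixes \<sigma> :: "'k::field \<Rightarrow> 'l::field"
  assumes "field_hom \<sigma>" and "c \<noteq> 0"
  obtains \<psi> :: "'l \<Rightarrow> 'k" where "\<And>x y. \<psi> (x + y) = \<psi> x + \<psi> y" "\<And>a x. \<psi> (\<sigma> a * x) = a * \<psi> x" "\<psi> c = 1"
proof -
  interpret \<sigma>: field_hom \<sigma> by fact
  interpret L: vector_space "\<lambda>a x. \<sigma> a * x"
    by unfold_locales (simp_all add: distrib_left distrib_right hom_distribs mult.assoc)
  interpret K: vector_space "(*) :: 'k \<Rightarrow> _"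
    by unfold_locales (simp_all add: distrib_left distrib_right mult.assoc)
  interpret LK: vector_space_pair "\<lambda>a x. \<sigma> a * x" "(*) :: 'k \<Rightarrow> _" ..
  have "L.independent {c}" using assms(2) by simp
  then obtain \<psi> where "Vector_Spaces.linear (\<lambda>a x. \<sigma> a * x) (*) \<psi>" "\<forall>x\<in>{c}. \<psi> x = 1"
    using LK.linear_independent_extend[of "{c}" "\<lambda>_. 1"] by blast
  then show thesis by (intro that[of \<psi>]) (auto simp: Vector_Spaces.linear_iff)
qed

definition functional :: "('l::field, 'w, 'z) module_scheme \<Rightarrow> ('w \<Rightarrow> 'l) \<Rightarrow> bool" where
  "functional W \<tau> \<longleftrightarrow> (\<forall>x\<in>carrier W. \<forall>y\<in>carrier W. \<tau> (x \<oplus>\<^bsub>W\<^esub> y) = \<tau> x + \<tau> y) \<and>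
     (\<forall>c. \<forall>x\<in>carrier W. \<tau> (c \<odot>\<^bsub>W\<^esub> x) = c * \<tau> x)"

lemma functional_lincomb:
  assumes W: "vectorspace class_ring W" and \<tau>: "functional W \<tau>" and "finite A" "A \<subseteq> carrier W"
  shows "\<tau> (LinearCombinations.module.lincomb W a A) = (\<Sum>v\<in>A. a v * \<tau> v)"
proof -
  interpret W: vectorspace class_ring W by fact
  have z: "\<tau> \<zero>\<^bsub>W\<^esub> = 0"
    using \<tau> W.smult_l_null[of "\<zero>\<^bsub>W\<^esub>"] unfolding functional_def
    by (metis W.M.zero_closed class_ring_simps(5) mult_zero_left)
  show ?thesis
    using assms(3,4)
  proof (induction A rule: finite_induct)
    case empty
    then show ?case using z by (simp add: W.lincomb_def)
  next
    case (insert v A)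
    then have "W.lincomb a (insert v A) = a v \<odot>\<^bsub>W\<^esub> v \<oplus>\<^bsub>W\<^esub> W.lincomb a A"
      unfolding W.lincomb_def by (subst W.M.finsum_insert) auto
    moreover have "W.lincomb a A \<in> carrier W" "a v \<odot>\<^bsub>W\<^esub> v \<in> carrier W"
      using insert by auto
    ultimately show ?case using insert \<tau> by (simp add: functional_def)
  qed
qed

text \<open>The assumption \<open>separate\<close> expresses without tensor products that the extension of \<open>f\<close> to the large field is
  injective: the functionals of \<open>W\<close> that take values in the small field on the image of \<open>g\<close> separate the
  points of \<open>g\<close>.\<close>

locale semilinear =
  fixes g :: "('k::field, 'v, 'y) module_scheme" and W :: "('l::field, 'w, 'z) module_scheme"
    and \<sigma> :: "'k \<Rightarrow> 'l" and f :: "'v \<Rightarrow> 'w"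
  assumes g: "vectorspace class_ring g" and W: "vectorspace class_ring W" and \<sigma>: "field_hom \<sigma>"
    and f_carrier: "x \<in> carrier g \<Longrightarrow> f x \<in> carrier W"
    and f_add: "x \<in> carrier g \<Longrightarrow> y \<in> carrier g \<Longrightarrow> f (x \<oplus>\<^bsub>g\<^esub> y) = f x \<oplus>\<^bsub>W\<^esub> f y"
    and f_smult: "x \<in> carrier g \<Longrightarrow> f (c \<odot>\<^bsub>g\<^esub> x) = \<sigma> c \<odot>\<^bsub>W\<^esub> f x"
    and separate: "x \<in> carrier g \<Longrightarrow>
      (\<And>\<tau>. functional W \<tau> \<Longrightarrow> (\<And>y. y \<in> carrier g \<Longrightarrow> \<tau> (f y) \<in> range \<sigma>) \<Longrightarrow> \<tau> (f x) = 0) \<Longrightarrow> x = \<zero>\<^bsub>g\<^esub>"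
begin

sublocale g: vectorspace "class_ring :: 'k ring" g by (rule g)
sublocale W: vectorspace "class_ring :: 'l ring" W by (rule W)
sublocale \<sigma>: field_hom \<sigma> by (rule \<sigma>)

lemma injective: "inj_on f (carrier g)"
proof (rule inj_onI)
  fix x y assume x: "x \<in> carrier g" and y: "y \<in> carrier g" and eq: "f x = f y"
  let ?z = "x \<oplus>\<^bsub>g\<^esub> (- 1) \<odot>\<^bsub>g\<^esub> y"
  have y': "(- 1) \<odot>\<^bsub>g\<^esub> y = \<ominus>\<^bsub>g\<^esub> y"
    using g.smult_l_minus[of 1 y] g.smult_one[of y] y by (simp add: class_ring_simps)
  have "?z = \<zero>\<^bsub>g\<^esub>"
  proof (rule separate)
    fix \<tau> assume \<tau>: "functional W \<tau>"
    have "f ?z = f y \<oplus>\<^bsub>W\<^esub> (- 1) \<odot>\<^bsub>W\<^esub> f y"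
      using x y eq by (simp add: f_add f_smult hom_distribs)
    then show "\<tau> (f ?z) = 0" using \<tau> f_carrier[OF y] W.smult_closed[of "-1" "f y"]
      by (simp add: functional_def)
  qed (use x y in simp)
  then have "x = \<ominus>\<^bsub>g\<^esub> (\<ominus>\<^bsub>g\<^esub> y)" unfolding y' using x y by (simp add: g.M.minus_equality)
  then show "x = y" using y by simp
qed

text \<open>Let \<open>\<Sum>b. a(b) f(b) = 0\<close>, and choose a functional \<open>\<psi>\<close> from the large to the small field that
  is 1 on some coefficient. If \<open>\<tau>\<close> takes values in the small field on the image of \<open>f\<close>, apply \<open>\<tau>\<close> and then \<open>\<psi>\<close> to the relation:
  this gives \<open>\<tau> (f (\<Sum>b. \<psi>(a(b)) b)) = 0\<close>. By separation the vector \<open>\<Sum>b. \<psi>(a(b)) b\<close> is 0, which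
  is a dependence in \<open>g\<close>.\<close>

lemma lin_indpt_image:
  assumes B: "B \<subseteq> carrier g" "g.lin_indpt B"
  shows "W.lin_indpt (f ` B)"
proof
  assume "W.lin_dep (f ` B)"
  then obtain A a v where A: "finite A" "A \<subseteq> f ` B" "W.lincomb a A = \<zero>\<^bsub>W\<^esub>" "v \<in> A" "a v \<noteq> 0"
    unfolding W.lin_dep_def by auto
  obtain C where C: "C \<subseteq> B" "inj_on f C" "A = f ` C" using A(2) subset_image_inj by metis
  have finC: "finite C" using A(1) C finite_image_iff by metis
  have Cg: "C \<subseteq> carrier g" using B C by auto
  obtain \<psi> where \<psi>: "\<And>x y. \<psi> (x + y) = \<psi> x + \<psi> y" "\<And>c x. \<psi> (\<sigma> c * x) = c * \<psi> x" "\<psi> (a v) = 1"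
    by (rule field_functional_exists[OF \<sigma> A(5)]) (rule that)
  have \<psi>0: "\<psi> 0 = 0" using \<psi>(2)[of 0 0] by simp
  have \<psi>_sum: "\<psi> (sum h S) = (\<Sum>x\<in>S. \<psi> (h x))" for h and S :: "'v set"
    by (induction S rule: infinite_finite_induct) (simp_all add: \<psi> \<psi>0)
  \<comment> \<open>The relation contracted by \<open>\<psi>\<close>; its coefficient at the preimage of \<open>v\<close> is 1.\<close>
  let ?x = "g.lincomb (\<lambda>b. \<psi> (a (f b))) C"
  have "?x = \<zero>\<^bsub>g\<^esub>"
  proof (rule separate)
    show "?x \<in> carrier g" using Cg finC by auto
    fix \<tau> assume \<tau>: "functional W \<tau>" and rat: "\<And>y. y \<in> carrier g \<Longrightarrow> \<tau> (f y) \<in> range \<sigma>"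
    define t where "t y = inv_into UNIV \<sigma> (\<tau> (f y))" for y
    have t: "\<tau> (f y) = \<sigma> (t y)" if "y \<in> carrier g" for y
      unfolding t_def using rat[OF that] by (simp add: f_inv_into_f)
    have \<tau>0: "\<tau> \<zero>\<^bsub>W\<^esub> = 0"
      using functional_lincomb[OF W \<tau>, of "{}"] by (simp add: W.lincomb_def)
    have tg: "functional g t"
      unfolding functional_def
    proof (intro conjI ballI allI)
      fix x y c assume x: "x \<in> carrier g" and y: "y \<in> carrier g"
      have "\<sigma> (t (x \<oplus>\<^bsub>g\<^esub> y)) = \<tau> (f x) + \<tau> (f y)"
        unfolding t[OF g.M.add.m_closed[OF x y], symmetric] f_add[OF x y]
        using \<tau> f_carrier[OF x] f_carrier[OF y] unfolding functional_def by blast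
      also have "\<dots> = \<sigma> (t x + t y)" by (simp only: t x y \<sigma>.hom_add)
      finally have "\<sigma> (t (x \<oplus>\<^bsub>g\<^esub> y)) = \<sigma> (t x + t y)" .
      then show "t (x \<oplus>\<^bsub>g\<^esub> y) = t x + t y" by simp
    next
      fix x c assume x: "x \<in> carrier g"
      have cx: "c \<odot>\<^bsub>g\<^esub> x \<in> carrier g" using x by simp
      have "\<sigma> (t (c \<odot>\<^bsub>g\<^esub> x)) = \<sigma> c * \<tau> (f x)"
        unfolding t[OF cx, symmetric] f_smult[OF x]
        using \<tau> f_carrier[OF x] unfolding functional_def by blast
      also have "\<dots> = \<sigma> (c * t x)" by (simp only: t x \<sigma>.hom_mult)
      finally have "\<sigma> (t (c \<odot>\<^bsub>g\<^esub> x)) = \<sigma> (c * t x)" .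
      then show "t (c \<odot>\<^bsub>g\<^esub> x) = c * t x" by simp
    qed
    have "0 = (\<Sum>w\<in>A. a w * \<tau> w)"
    proof -
      have "A \<subseteq> carrier W" using Cg C(3) f_carrier by auto
      from functional_lincomb[OF W \<tau> A(1) this, of a] show ?thesis unfolding A(3) \<tau>0 .
    qed
    also have "\<dots> = (\<Sum>b\<in>C. a (f b) * \<tau> (f b))"
      unfolding C(3) by (simp add: sum.reindex[OF C(2)])
    also have "\<dots> = (\<Sum>b\<in>C. \<sigma> (t b) * a (f b))"
      using Cg t by (intro sum.cong) (auto simp: mult.commute)
    finally have "0 = (\<Sum>b\<in>C. \<sigma> (t b) * a (f b))" .
    from arg_cong[OF this, of \<psi>] have "\<psi> 0 = (\<Sum>b\<in>C. t b * \<psi> (a (f b)))"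
      by (simp only: \<psi>_sum \<psi>(2))
    then have "t ?x = 0"
      using functional_lincomb[OF g tg finC Cg, of "\<lambda>b. \<psi> (a (f b))"] \<psi>0 by (simp add: mult.commute)
    moreover have "?x \<in> carrier g" using Cg finC by auto
    ultimately show "\<tau> (f ?x) = 0" by (simp add: t)
  qed
  moreover obtain b where "b \<in> C" "v = f b" using A C by auto
  ultimately have "g.lin_dep B"
    unfolding g.lin_dep_def using finC C(1) \<psi>(3)
    by (intro exI[of _ C] exI[of _ "\<lambda>b. \<psi> (a (f b))"] exI[of _ b]) auto
  with B show False by simp
qed

lemma basis_image:
  assumes B: "g.basis B" and gen: "carrier W \<subseteq> W.span (f ` carrier g)"
  shows "W.basis (f ` B)"
proof -
  have Bg: "B \<subseteq> carrier g" "g.lin_indpt B" and Bgen: "g.span B = carrier g" using B unfolding g.basis_def by auto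
  have fB: "f ` B \<subseteq> carrier W" using Bg f_carrier by auto
  have sub: "submodule class_ring (W.span (f ` B)) W" by (rule W.span_is_submodule[OF fB])
  let ?N = "{x \<in> carrier g. f x \<in> W.span (f ` B)}"
  have f0: "f \<zero>\<^bsub>g\<^esub> = \<zero>\<^bsub>W\<^esub>"
    using f_smult[of "\<zero>\<^bsub>g\<^esub>" 0] f_carrier[of "\<zero>\<^bsub>g\<^esub>"] g.smult_l_null[of "\<zero>\<^bsub>g\<^esub>"] W.smult_l_null[of "f \<zero>\<^bsub>g\<^esub>"]
    by (simp add: class_ring_simps)
  have "submodule class_ring ?N g"
    using g.module_axioms sub f0 unfolding submodule_def
    by (auto simp: f_add f_smult)
  then have "g.span B \<subseteq> ?N"
    using W.in_own_span[OF fB] Bg by (intro g.span_is_subset) auto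
  then have "f ` carrier g \<subseteq> W.span (f ` B)" using Bgen by auto
  then have "W.span (f ` carrier g) \<subseteq> W.span (f ` B)" by (rule W.span_is_subset[OF _ sub])
  with gen W.span_is_subset2[OF fB] have "W.gen_set (f ` B)" by auto
  with lin_indpt_image[OF Bg] fB show ?thesis unfolding W.basis_def by auto
qed

end

lemma form_ofI:
  assumes hom: "superalgebra_hom to_ac g h f" and f: "semilinear g h to_ac f"
    and gen: "carrier h \<subseteq> LinearCombinations.module.span class_ring h (f ` carrier g)"
  shows "form_of g h"
proof -
  interpret semilinear g h to_ac f by fact
  obtain B where B: "g.basis B" using g.basis_exists by blast
  then have "inj_on f B" using inj_on_subset[OF injective] unfolding g.basis_def by blast
  then show ?thesis unfolding form_of_def using hom B basis_image[OF B gen] by blast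
qed

lemma superalgebra_isoI:
  fixes g :: "('k::field, 'v) superalgebra"
  assumes hom: "superalgebra_hom id g h f" and f: "semilinear g h id f"
    and gen: "carrier h \<subseteq> LinearCombinations.module.span class_ring h (f ` carrier g)"
  shows "superalgebra_iso g h"
proof -
  interpret semilinear g h id f by fact
  have "submodule class_ring (f ` carrier g) h"
  proof -
    have "\<zero>\<^bsub>h\<^esub> = f \<zero>\<^bsub>g\<^esub>"
      using f_smult[of "\<zero>\<^bsub>g\<^esub>" 0] f_carrier[of "\<zero>\<^bsub>g\<^esub>"] g.smult_l_null[of "\<zero>\<^bsub>g\<^esub>"] W.smult_l_null[of "f \<zero>\<^bsub>g\<^esub>"]
      by (simp add: class_ring_simps)
    moreover have "f x \<oplus>\<^bsub>h\<^esub> f y \<in> f ` carrier g" "c \<odot>\<^bsub>h\<^esub> f x \<in> f ` carrier g" if "x \<in> carrier g" "y \<in> carrier g" for x y c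
      using that f_add[of x y, symmetric] f_smult[of x c, symmetric] by auto
    ultimately show ?thesis
      using f_carrier W.module_axioms g.M.zero_closed unfolding submodule_def by auto
  qed
  then have "carrier h \<subseteq> f ` carrier g"
    using gen W.span_is_subset[OF subset_refl] by blast
  then have "bij_betw f (carrier g) (carrier h)"
    using injective f_carrier unfolding bij_betw_def by auto
  then show ?thesis unfolding superalgebra_iso_def using hom by blast
qed

section \<open>Operators on the ternary algebra\<close>

lemma mult_minus': "dim_col A = dim_row B \<Longrightarrow> dim_row C = dim_row B \<Longrightarrow> dim_col C = dim_col B \<Longrightarrow> A * (B - C) = A * B - A * C"
  for A B C :: "'a::ring mat"
  by (rule mult_minus_distrib_mat) auto

lemma minus_mult': "dim_col A = dim_row C \<Longrightarrow> dim_row A = dim_row B \<Longrightarrow> dim_col A = dim_col B \<Longrightarrow> (A - B) * C = A * C - B * C"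
  for A B C :: "'a::ring mat"
  by (rule minus_mult_distrib_mat) auto

lemmas mat_ring = mult_assoc' mult_add' add_mult' mult_minus' minus_mult'

lemma vectorspaceI:
  fixes V :: "('k::field, 'v, 'z) module_scheme"
  shows "Module.module class_ring V \<Longrightarrow> vectorspace class_ring V"
  by (rule vectorspace.intro[OF _ class_field.field_axioms])

locale char3_matrix_data = ternary_matrix_data scale n r s J G
  for scale :: "'k::field \<Rightarrow> 'c::ring_1 \<Rightarrow> 'c" and n r s J G +
  assumes char3: "CHAR('k) = 3" and s: "s \<ge> 1"
    and invertible_J: "invertible_mat J" and invertible_G: "invertible_mat G"
begin

lemma three_scalar: "(3::'k) = 0"
  using of_nat_CHAR[where ?'a='k] char3 by simp

lemma two_scalar: "(2::'k) \<noteq> 0"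
proof
  assume "(2::'k) = 0"
  then have "(3::'k) - 2 = 0" using three_scalar by simp
  then show False by simp
qed

lemma double: "c + c = - (c::'c)"
proof -
  have "scale 3 c = c + c + c"
    using scale_left_distrib[of 1 1 c] scale_left_distrib[of 2 1 c] by simp
  then have "c + c + c = 0" by (simp add: three_scalar)
  then show ?thesis by (simp add: eq_neg_iff_add_eq_0)
qed

lemma inverse_mat_obtain:
  assumes "A \<in> carrier_mat m m" "invertible_mat A"
  obtains B where "B \<in> carrier_mat m m" "A * B = 1\<^sub>m m" "B * A = 1\<^sub>m m"
proof -
  obtain B where B: "A * B = 1\<^sub>m (dim_row A)" "B * A = 1\<^sub>m (dim_row B)"
    using assms(2) by (auto simp: invertible_mat_def inverts_mat_def)
  have "dim_row B = m" "dim_col B = m"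
    using arg_cong[OF B(1), of dim_col] arg_cong[OF B(2), of dim_col] assms(1) by auto
  with B assms(1) that[of B] show ?thesis by (auto intro: carrier_matI)
qed

definition GI :: "'c mat" where
  "GI = map_mat (\<lambda>a. scale (inverse a) 1) G"

lemma G_diag_nonzero: assumes i: "i < r" shows "G $$ (i, i) \<noteq> 0"
proof
  assume 0: "G $$ (i, i) = 0"
  obtain B where B: "B \<in> carrier_mat r r" "G * B = 1\<^sub>m r"
    using inverse_mat_obtain[OF G(1) invertible_G] by metis
  have "G $$ (i, j) = 0" if "j < r" for j
    using 0 G i that by (cases "i = j") (auto simp: diagonal_mat_def)
  moreover have "dim_row B = r" "dim_col B = r" "dim_row G = r" "dim_col G = r" using B(1) G(1) by auto
  ultimately have "(G * B) $$ (i, i) = 0" using i by (simp add: scalar_prod_def)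
  with B(2) i show False by simp
qed

lemma GI_carrier [simp]: "GI \<in> carrier_mat r r"
  using G by (simp add: GI_def)

lemma GI_dims [simp]: "dim_row GI = r" "dim_col GI = r"
  using carrier_matD[OF GI_carrier] by auto

lemma G_off_diag: "i < r \<Longrightarrow> j < r \<Longrightarrow> i \<noteq> j \<Longrightarrow> G $$ (i, j) = 0"
  using G by (auto simp: diagonal_mat_def)

lemma GC_GI: "GC * GI = 1\<^sub>m r" and GI_GC: "GI * GC = 1\<^sub>m r"
proof -
  have d: "dim_row G = r" "dim_col G = r" using G by auto
  have *: "GC $$ (i, j) = (if i = j then scale (G $$ (i, i)) 1 else 0)"
    "GI $$ (i, j) = (if i = j then scale (inverse (G $$ (i, i))) 1 else 0)" if "i < r" "j < r" for i j
    using that d G_off_diag[OF that] by (auto simp: GC_def GI_def)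
  show "GC * GI = 1\<^sub>m r" "GI * GC = 1\<^sub>m r"
    by (auto intro!: eq_matI simp: scalar_prod_def * G_diag_nonzero scale_mult_left
        if_distrib[of "\<lambda>u. u * _"] if_distrib[of "\<lambda>u. _ * u"] sum.delta cong: if_cong)
qed

text \<open>The adjoint with respect to the hermitian form with matrix \<open>G\<close>.\<close>

definition adj :: "'c mat \<Rightarrow> 'c mat" where "adj A = GI * st A * GC"

lemma adj_carrier [simp]: "A \<in> carrier_mat r r \<Longrightarrow> adj A \<in> carrier_mat r r"
  by (rule carrier_matI) (simp_all add: adj_def)

lemma adj_add: "A \<in> carrier_mat r r \<Longrightarrow> B \<in> carrier_mat r r \<Longrightarrow> adj (A + B) = adj A + adj B"
  by (auto simp: adj_def star_add' mat_ring)

lemma star_scale: "st (map_mat (scale c) A) = map_mat (scale c) (st A)"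
  by (rule eq_matI) (simp_all add: cj_scale)

lemma mult_scale: "dim_col A = dim_row B \<Longrightarrow> A * map_mat (scale c) B = map_mat (scale c) (A * B)"
  "dim_col A = dim_row B \<Longrightarrow> map_mat (scale c) A * B = map_mat (scale c) (A * B)"
  by (rule eq_matI; simp add: scalar_prod_def scale_mult_left scale_mult_right scale_sum_right)+

lemma add_scale: "dim_row A = dim_row B \<Longrightarrow> dim_col A = dim_col B \<Longrightarrow>
    map_mat (scale c) (A + B) = map_mat (scale c) A + map_mat (scale c) B"
  by (rule eq_matI) (simp_all add: scale_right_distrib)

lemma R_add: "x \<in> carrier_mat r s \<Longrightarrow> y \<in> carrier_mat r s \<Longrightarrow> R (x + y) = R x + R y"
  by (auto simp: R_def star_add' mat_ring)

lemma R_scale: "x \<in> carrier_mat r s \<Longrightarrow> R (map_mat (scale c) x) = map_mat (scale c) (R x)"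
  by (auto simp: R_def star_scale mult_scale)

lemma R_mult_left:
  assumes "A \<in> carrier_mat r r" "x \<in> carrier_mat r s"
  shows "R (A * x) = R x * adj A"
proof -
  have [simp]: "dim_row A = r" "dim_col A = r" "dim_row x = r" "dim_col x = s" using assms by auto
  have "R x * adj A = J * st x * (GC * GI) * (st A * GC)"
    unfolding R_def adj_def by (simp add: mat_ring)
  also have "J * st x * (GC * GI) = J * st x"
    unfolding GC_GI by (rule right_mult_one_mat) (rule carrier_matI, simp_all)
  finally show ?thesis unfolding R_def by (simp add: star_mult' mat_ring)
qed

lemma R_mult_right:
  assumes "B \<in> carrier_mat s s" "x \<in> carrier_mat r s" "J * st B = - (B * J)"
  shows "R (x * B) = - (B * R x)"
proof -
  have [simp]: "dim_row B = s" "dim_col B = s" "dim_row x = r" "dim_col x = s" using assms by auto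
  have "R (x * B) = J * st B * (st x * GC)" unfolding R_def by (simp add: star_mult' mat_ring)
  then show ?thesis unfolding assms(3) by (simp add: R_def mat_ring)
qed

lemma adj_xR:
  assumes "x \<in> carrier_mat r s" "y \<in> carrier_mat r s"
  shows "adj (x * R y) = - (y * R x)"
proof -
  have [simp]: "dim_row x = r" "dim_col x = s" "dim_row y = r" "dim_col y = s" using assms by auto
  have "adj (x * R y) = - (GI * GC * (y * (J * (st x * GC))))"
    unfolding adj_def using assms by (simp add: star_mult' star_R mat_ring)
  also have "GI * GC * (y * (J * (st x * GC))) = y * R x"
    unfolding GI_GC R_def by (subst left_mult_one_mat[of _ r r]) (auto simp: mat_ring intro!: carrier_matI)
  finally show ?thesis .
qed

lemma star_Rx_y:
  assumes "x \<in> carrier_mat r s" "y \<in> carrier_mat r s"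
  shows "J * st (R x * y) = - (R y * x * J)"
proof -
  have [simp]: "dim_row x = r" "dim_col x = s" "dim_row y = r" "dim_col y = s" using assms by auto
  show ?thesis using assms by (simp add: star_mult' star_R R_def J(2) mat_ring)
qed

text \<open>The operators \<open>L\<^bsub>x,y\<^esub>\<close> and their linear combinations have this shape. The condition on \<open>B\<close> means that it is
  skew for the form of \<open>J\<close>; it gives \<open>R (x B) = - B (R x)\<close>, which makes \<open>B\<close> drop out of the action on the
  Jordan algebra.\<close>

definition represented :: "('c mat \<Rightarrow> 'c mat) \<Rightarrow> 'c mat \<Rightarrow> 'c mat \<Rightarrow> bool" where
  "represented t A B \<longleftrightarrow> A \<in> carrier_mat r r \<and> B \<in> carrier_mat s s \<and> J * st B = - (B * J) \<and>
     t = (\<lambda>z\<in>carrier_mat r s. A * z + z * B)"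

abbreviation "\<T> \<equiv> ternary_alg"
abbreviation "\<E> \<equiv> End_alg ternary_alg"

sublocale T: vectorspace "class_ring :: 'k ring" \<T>
  by (rule vectorspaceI[OF module_ternary_alg])

sublocale E: vectorspace "class_ring :: 'k ring" \<E>
  by (rule vectorspaceI[OF module_End_alg[OF module_ternary_alg]])

lemma End_simps:
  "f \<in> carrier \<E> \<longleftrightarrow> f \<in> extensional (carrier_mat r s) \<and> (\<forall>x\<in>carrier_mat r s. f x \<in> carrier_mat r s) \<and>
     (\<forall>x\<in>carrier_mat r s. \<forall>y\<in>carrier_mat r s. f (x + y) = f x + f y) \<and>
     (\<forall>c. \<forall>x\<in>carrier_mat r s. f (map_mat (scale c) x) = map_mat (scale c) (f x))"
  "(f \<oplus>\<^bsub>\<E>\<^esub> g) = (\<lambda>z\<in>carrier_mat r s. f z + g z)"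
  "(c \<odot>\<^bsub>\<E>\<^esub> f) = (\<lambda>z\<in>carrier_mat r s. map_mat (scale c) (f z))"
  "\<zero>\<^bsub>\<E>\<^esub> = (\<lambda>z\<in>carrier_mat r s. 0\<^sub>m r s)"
  by (auto simp: End_alg_def LinearCombinations.module_hom_def Pi_iff)

lemma End_minus: "f \<in> carrier \<E> \<Longrightarrow> g \<in> carrier \<E> \<Longrightarrow> f \<ominus>\<^bsub>\<E>\<^esub> g = (\<lambda>z\<in>carrier_mat r s. f z - g z)"
proof -
  assume f: "f \<in> carrier \<E>" and g: "g \<in> carrier \<E>"
  have "\<ominus>\<^bsub>\<E>\<^esub> g = (- 1) \<odot>\<^bsub>\<E>\<^esub> g"
    using E.smult_l_minus[of 1 g] E.smult_one[of g] g by (simp add: class_ring_simps)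
  then have "f \<ominus>\<^bsub>\<E>\<^esub> g = (\<lambda>z\<in>carrier_mat r s. f z + map_mat (scale (-1)) (g z))"
    by (simp add: a_minus_def End_simps(2,3) cong: restrict_cong)
  also have "\<dots> = (\<lambda>z\<in>carrier_mat r s. f z - g z)"
    using f g by (intro restrict_ext eq_matI) (auto simp: End_simps(1))
  finally show ?thesis .
qed

lemma represented_End: assumes "represented t A B" shows "t \<in> carrier \<E>"
proof -
  have c: "A \<in> carrier_mat r r" "B \<in> carrier_mat s s" and t: "t = (\<lambda>z\<in>carrier_mat r s. A * z + z * B)"
    using assms by (auto simp: represented_def)
  have d [simp]: "dim_row A = r" "dim_col A = r" "dim_row B = s" "dim_col B = s" using c by auto
  have cl: "A * z + z * B \<in> carrier_mat r s" if "z \<in> carrier_mat r s" for z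
    using c that by auto
  have "A * (x + y) + (x + y) * B = A * x + x * B + (A * y + y * B)"
    if "x \<in> carrier_mat r s" "y \<in> carrier_mat r s" for x y
  proof -
    have [simp]: "dim_row x = r" "dim_col x = s" "dim_row y = r" "dim_col y = s" using that by auto
    show ?thesis by (rule eq_matI) (simp_all add: mat_ring algebra_simps del: index_mult_mat(1))
  qed
  moreover have "A * map_mat (scale c) x + map_mat (scale c) x * B = map_mat (scale c) (A * x + x * B)"
    if "x \<in> carrier_mat r s" for x c
  proof -
    have [simp]: "dim_row x = r" "dim_col x = s" using that by auto
    show ?thesis by (simp add: mult_scale add_scale)
  qed
  ultimately show ?thesis unfolding End_simps(1) t using cl by auto
qed

lemma represented_add:
  assumes "represented t A B" "represented t' A' B'"
  shows "represented (t \<oplus>\<^bsub>\<E>\<^esub> t') (A + A') (B + B')"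
proof -
  have c: "A \<in> carrier_mat r r" "B \<in> carrier_mat s s" "A' \<in> carrier_mat r r" "B' \<in> carrier_mat s s"
    and B: "J * st B = - (B * J)" "J * st B' = - (B' * J)"
    and t: "t = (\<lambda>z\<in>carrier_mat r s. A * z + z * B)" "t' = (\<lambda>z\<in>carrier_mat r s. A' * z + z * B')"
    using assms by (auto simp: represented_def)
  have d [simp]: "dim_row A = r" "dim_col A = r" "dim_row B = s" "dim_col B = s" 
    "dim_row A' = r" "dim_col A' = r" "dim_row B' = s" "dim_col B' = s" using c by auto
  have "J * st (B + B') = - ((B + B') * J)"
    by (rule eq_matI) (simp_all add: star_add' mat_ring B del: index_mult_mat(1))
  moreover have "A * z + z * B + (A' * z + z * B') = (A + A') * z + z * (B + B')" if "z \<in> carrier_mat r s" for z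
  proof -
    have [simp]: "dim_row z = r" "dim_col z = s" using that by auto
    show ?thesis by (rule eq_matI) (simp_all add: mat_ring algebra_simps del: index_mult_mat(1))
  qed
  then have "t \<oplus>\<^bsub>\<E>\<^esub> t' = (\<lambda>z\<in>carrier_mat r s. (A + A') * z + z * (B + B'))"
    unfolding t End_simps(2) by (intro restrict_ext) simp
  ultimately show ?thesis unfolding represented_def using c by simp
qed

lemma represented_smult:
  assumes "represented t A B"
  shows "represented (c \<odot>\<^bsub>\<E>\<^esub> t) (map_mat (scale c) A) (map_mat (scale c) B)"
proof -
  have c: "A \<in> carrier_mat r r" "B \<in> carrier_mat s s"
    and B: "J * st B = - (B * J)"
    and t: "t = (\<lambda>z\<in>carrier_mat r s. A * z + z * B)"
    using assms by (auto simp: represented_def)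
  have d [simp]: "dim_row A = r" "dim_col A = r" "dim_row B = s" "dim_col B = s" using c by auto
  have "J * st (map_mat (scale c) B) = - (map_mat (scale c) B * J)"
    by (rule eq_matI) (simp_all add: star_scale mult_scale B del: index_mult_mat(1))
  moreover have "map_mat (scale c) (A * z + z * B) = map_mat (scale c) A * z + z * map_mat (scale c) B"
    if "z \<in> carrier_mat r s" for z
  proof -
    have [simp]: "dim_row z = r" "dim_col z = s" using that by auto
    show ?thesis by (simp add: mult_scale add_scale)
  qed
  then have "c \<odot>\<^bsub>\<E>\<^esub> t = (\<lambda>z\<in>carrier_mat r s. map_mat (scale c) A * z + z * map_mat (scale c) B)"
    unfolding t End_simps(3) by (intro restrict_ext) simp
  ultimately show ?thesis unfolding represented_def using c by simp
qed

lemma represented_zero: "represented \<zero>\<^bsub>\<E>\<^esub> (0\<^sub>m r r) (0\<^sub>m s s)"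
  by (auto simp: represented_def End_simps(4) intro!: eq_matI restrict_ext)

lemma represented_L_op:
  assumes c: "x \<in> carrier_mat r s" "y \<in> carrier_mat r s"
  shows "represented (L_op \<T> x y) (- (x * R y)) (- (R x * y + R y * x))"
proof -
  have d [simp]: "dim_row x = r" "dim_col x = s" "dim_row y = r" "dim_col y = s" using c by auto
  have "J * st (- (R x * y + R y * x)) = R y * x * J + R x * y * J"
    using star_Rx_y[OF c] star_Rx_y[OF c(2,1)]
    by (auto intro!: eq_matI simp: star_uminus star_add' mat_ring simp del: index_mult_mat(1))
  then have "J * st (- (R x * y + R y * x)) = - (- (R x * y + R y * x) * J)"
    by (simp add: mat_ring) (auto intro!: eq_matI simp: algebra_simps simp del: index_mult_mat(1))
  moreover have "- (x * R y) * z - z * (R x * y + R y * x) = - (x * R y) * z + z * - (R x * y + R y * x)"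
    if "z \<in> carrier_mat r s" for z
  proof -
    have [simp]: "dim_row z = r" "dim_col z = s" using that by auto
    show ?thesis by (rule eq_matI) (simp_all add: mat_ring del: index_mult_mat(1))
  qed
  ultimately show ?thesis
    unfolding represented_def L_op_def using triple_eq[OF c] by (auto intro!: carrier_matI)
qed

end

section \<open>Inner derivations\<close>

context char3_matrix_data
begin

lemma End_closed: "f \<in> carrier \<E> \<Longrightarrow> z \<in> carrier_mat r s \<Longrightarrow> f z \<in> carrier_mat r s"
  by (simp add: End_simps(1))

definition left_op :: "'c mat \<Rightarrow> 'c mat \<Rightarrow> 'c mat" where
  "left_op N = (\<lambda>z\<in>carrier_mat r s. N * z)"

text \<open>The superbracket of the odd elements \<open>x\<close> and \<open>y\<close> in the semisimplification.\<close>

definition der :: "'c mat \<Rightarrow> 'c mat \<Rightarrow> 'c mat \<Rightarrow> 'c mat" where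
  "der x y = L_op \<T> x y \<oplus>\<^bsub>\<E>\<^esub> L_op \<T> y x"

abbreviation "ders \<equiv> {der x y | x y. x \<in> carrier_mat r s \<and> y \<in> carrier_mat r s}"

definition Der :: "('c mat \<Rightarrow> 'c mat) set" where
  "Der = E.span ders"

text \<open>Two copies of the right factor of \<open>L\<^bsub>x,y\<^esub>\<close> add up; because of \<open>-2 = 1\<close> the result has the same shape as the
  left factor, up to sign, which is what makes it a superbracket of odd matrices.\<close>

lemma der_represented:
  assumes c: "x \<in> carrier_mat r s" "y \<in> carrier_mat r s"
  shows "represented (der x y) (- (x * R y + y * R x)) (R x * y + R y * x)"
proof -
  have d [simp]: "dim_row x = r" "dim_col x = s" "dim_row y = r" "dim_col y = s" using c by auto
  have 1: "- (x * R y) + - (y * R x) = - (x * R y + y * R x)"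
    by (rule eq_matI) (simp_all del: index_mult_mat(1))
  have 2: "- (R x * y + R y * x) + - (R y * x + R x * y) = R x * y + R y * x"
  proof (rule eq_matI)
    fix i j assume ij: "i < dim_row (R x * y + R y * x)" "j < dim_col (R x * y + R y * x)"
    let ?c = "(R x * y) $$ (i, j) + (R y * x) $$ (i, j)"
    have "- ?c + - ?c = - (?c + ?c)" by simp
    also have "\<dots> = ?c" unfolding double by simp
    finally show "(- (R x * y + R y * x) + - (R y * x + R x * y)) $$ (i, j) = (R x * y + R y * x) $$ (i, j)"
      using ij by (simp add: add.commute del: index_mult_mat(1))
  qed simp_all
  show ?thesis
    unfolding der_def using represented_add[OF represented_L_op[OF c] represented_L_op[OF c(2,1)]]
    by (simp only: 1 2)
qed

lemma der_End: "x \<in> carrier_mat r s \<Longrightarrow> y \<in> carrier_mat r s \<Longrightarrow> der x y \<in> carrier \<E>"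
  by (rule represented_End[OF der_represented])

lemma ders_End: "ders \<subseteq> carrier \<E>"
  using der_End by auto

lemma L_ops_End: "{L_op \<T> x y | x y. x \<in> carrier \<T> \<and> y \<in> carrier \<T>} \<subseteq> carrier \<E>"
  using represented_End[OF represented_L_op] by auto

lemma submodule_InStr: "submodule class_ring (InStr \<T>) \<E>"
  unfolding InStr_def by (rule E.span_is_submodule[OF L_ops_End])

lemma submodule_Der: "submodule class_ring Der \<E>"
  unfolding Der_def by (rule E.span_is_submodule[OF ders_End])

lemma Der_induct [consumes 1, case_names zero der add smult]:
  assumes "d \<in> Der"
    and "P \<zero>\<^bsub>\<E>\<^esub>" "\<And>x y. x \<in> carrier_mat r s \<Longrightarrow> y \<in> carrier_mat r s \<Longrightarrow> P (der x y)"
    and "\<And>d e. d \<in> Der \<Longrightarrow> e \<in> Der \<Longrightarrow> P d \<Longrightarrow> P e \<Longrightarrow> P (d \<oplus>\<^bsub>\<E>\<^esub> e)"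
    and "\<And>c d. d \<in> Der \<Longrightarrow> P d \<Longrightarrow> P (c \<odot>\<^bsub>\<E>\<^esub> d)"
  shows "P d"
proof -
  have "submodule class_ring {d \<in> Der. P d} \<E>"
    using submodule_Der assms(2,4,5) unfolding submodule_def by auto
  moreover have "ders \<subseteq> {d \<in> Der. P d}"
  proof clarify
    fix x y :: "'c mat" assume c: "x \<in> carrier_mat r s" "y \<in> carrier_mat r s"
    then have "der x y \<in> ders" by blast
    then show "der x y \<in> Der \<and> P (der x y)"
      using E.in_own_span[OF ders_End] assms(3)[OF c] unfolding Der_def by blast
  qed
  ultimately have "Der \<subseteq> {d \<in> Der. P d}" unfolding Der_def by (intro E.span_is_subset)
  with assms(1) show ?thesis by auto
qed

lemma angles_End: "{angle \<T> x y | x y. x \<in> carrier \<T> \<and> y \<in> carrier \<T>} \<subseteq> carrier \<E>"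
  using angle_End by auto

lemma submodule_jordan_space: "submodule class_ring (jordan_space \<T>) \<E>"
  unfolding jordan_space_def by (rule E.span_is_submodule[OF angles_End])

lemma angle_in_jordan_space:
  "x \<in> carrier_mat r s \<Longrightarrow> y \<in> carrier_mat r s \<Longrightarrow> angle \<T> x y \<in> jordan_space \<T>"
  unfolding jordan_space_def using E.in_own_span[OF angles_End] by auto

text \<open>The contributions of \<open>B\<close> to the two terms cancel because \<open>R (x B) = - B (R x)\<close>. Those of \<open>A\<close> combine
  through \<open>R (A x) = (R x) A'\<close> for the adjoint \<open>A'\<close> of \<open>A\<close>.\<close>

lemma represented_angle:
  assumes rep: "represented t A B" and c: "a \<in> carrier_mat r s" "b \<in> carrier_mat r s"
  shows "(\<lambda>z\<in>carrier_mat r s. A * angle \<T> a b z + angle \<T> a b (adj A * z)) =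
    angle \<T> (t a) b \<oplus>\<^bsub>\<E>\<^esub> angle \<T> a (t b)"
proof -
  have AB: "A \<in> carrier_mat r r" "B \<in> carrier_mat s s" and B: "J * st B = - (B * J)"
    and t: "t = (\<lambda>z\<in>carrier_mat r s. A * z + z * B)"
    using rep by (auto simp: represented_def)
  have ta: "t a \<in> carrier_mat r s" "t b \<in> carrier_mat r s"
    using represented_End[OF rep] c by (simp_all add: End_simps(1))
  have d [simp]: "dim_row A = r" "dim_col A = r" "dim_row B = s" "dim_col B = s"
    "dim_row a = r" "dim_col a = s" "dim_row b = r" "dim_col b = s" using AB c by auto
  have d' [simp]: "dim_row (adj A) = r" "dim_col (adj A) = r" using carrier_matD[OF adj_carrier[OF AB(1)]] by auto
  have tv: "t a = A * a + a * B" "t b = A * b + b * B" using c by (simp_all add: t)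
  have Rt: "R (t a) = R a * adj A - B * R a" "R (t b) = R b * adj A - B * R b"
    unfolding tv using AB c
    by (auto simp: R_add[of "A * _"] R_mult_left R_mult_right[OF _ _ B] mult_carrier_mat[of _ r r] mult_carrier_mat[of _ r s] intro!: eq_matI
        simp del: index_mult_mat(1))
  show ?thesis
    unfolding End_simps(2)
  proof (rule restrict_ext)
    fix z :: "'c mat" assume z: "z \<in> carrier_mat r s"
    have [simp]: "dim_row z = r" "dim_col z = s" using z by auto
    have az: "adj A * z \<in> carrier_mat r s" using AB z by (intro mult_carrier_mat[of _ r r] adj_carrier)
    show "A * angle \<T> a b z + angle \<T> a b (adj A * z) = angle \<T> (t a) b z + angle \<T> a (t b) z"
      unfolding angle_eq[OF c z] angle_eq[OF c az] angle_eq[OF ta(1) c(2) z] angle_eq[OF c(1) ta(2) z] Rt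
      unfolding tv
      by (rule eq_matI) (simp_all add: mat_ring algebra_simps del: index_mult_mat(1))
  qed
qed

text \<open>The map \<open>a \<mapsto> (z \<mapsto> A a(z) + a(A' z))\<close> is linear and has the prescribed values on the spanning set of the
  Jordan algebra, hence it is the map singled out by \<^const>\<open>jordan_action\<close>; evaluate it at the identity.\<close>

lemma jordan_action_unit:
  assumes rep: "represented t A B"
  shows "jordan_action \<T> t (\<lambda>z\<in>carrier_mat r s. z) = left_op (A + adj A)"
proof -
  let ?JS = "\<E>\<lparr>carrier := jordan_space \<T>\<rparr>"
  let ?D = "\<lambda>a\<in>jordan_space \<T>. \<lambda>z\<in>carrier_mat r s. A * a z + a (adj A * z)"
  have A: "A \<in> carrier_mat r r" using rep by (auto simp: represented_def)
  have d [simp]: "dim_row A = r" "dim_col A = r" using A by auto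
  have adA: "adj A * z \<in> carrier_mat r s" if "z \<in> carrier_mat r s" for z
    using A that by (intro mult_carrier_mat[of _ r r] adj_carrier)
  have JSE: "jordan_space \<T> \<subseteq> carrier \<E>" using submodule_jordan_space by (simp add: submodule_def)
  have D_add: "?D (a \<oplus>\<^bsub>\<E>\<^esub> b) = ?D a \<oplus>\<^bsub>\<E>\<^esub> ?D b" if ab: "a \<in> jordan_space \<T>" "b \<in> jordan_space \<T>" for a b
  proof -
    have s: "a \<oplus>\<^bsub>\<E>\<^esub> b \<in> jordan_space \<T>" using submodule_jordan_space ab by (simp add: submodule_def)
    show ?thesis unfolding restrict_apply'[OF s] restrict_apply'[OF ab(1)] restrict_apply'[OF ab(2)] unfolding End_simps(2)
    proof (rule restrict_ext)
      fix z :: "'c mat" assume z: "z \<in> carrier_mat r s"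
      have "a z \<in> carrier_mat r s" "b z \<in> carrier_mat r s" "a (adj A * z) \<in> carrier_mat r s" "b (adj A * z) \<in> carrier_mat r s"
        using End_closed[OF subsetD[OF JSE]] ab z adA[OF z] by blast+
      then have [simp]: "dim_row (a z) = r" "dim_col (a z) = s" "dim_row (b z) = r" "dim_col (b z) = s"
        "dim_row (a (adj A * z)) = r" "dim_col (a (adj A * z)) = s" "dim_row (b (adj A * z)) = r" "dim_col (b (adj A * z)) = s"
        by auto
      show "A * (\<lambda>z\<in>carrier_mat r s. a z + b z) z + (\<lambda>z\<in>carrier_mat r s. a z + b z) (adj A * z) =
         (\<lambda>z\<in>carrier_mat r s. A * a z + a (adj A * z)) z + (\<lambda>z\<in>carrier_mat r s. A * b z + b (adj A * z)) z"
        unfolding restrict_apply'[OF z] restrict_apply'[OF adA[OF z]]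
        by (rule eq_matI) (simp_all add: mat_ring algebra_simps del: index_mult_mat(1))
    qed
  qed
  have D_smult: "?D (c \<odot>\<^bsub>\<E>\<^esub> a) = c \<odot>\<^bsub>\<E>\<^esub> ?D a" if a: "a \<in> jordan_space \<T>" for a c
  proof -
    have s: "c \<odot>\<^bsub>\<E>\<^esub> a \<in> jordan_space \<T>" using submodule_jordan_space a by (simp add: submodule_def)
    show ?thesis unfolding restrict_apply'[OF s] restrict_apply'[OF a] unfolding End_simps(3)
    proof (rule restrict_ext)
      fix z :: "'c mat" assume z: "z \<in> carrier_mat r s"
      have "a z \<in> carrier_mat r s" "a (adj A * z) \<in> carrier_mat r s"
        using End_closed[OF subsetD[OF JSE]] a z adA[OF z] by blast+
      then have [simp]: "dim_row (a z) = r" "dim_col (a z) = s" 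
        "dim_row (a (adj A * z)) = r" "dim_col (a (adj A * z)) = s" 
        by auto
      show "A * (\<lambda>z\<in>carrier_mat r s. map_mat (scale c) (a z)) z + (\<lambda>z\<in>carrier_mat r s. map_mat (scale c) (a z)) (adj A * z) =
         map_mat (scale c) ((\<lambda>z\<in>carrier_mat r s. A * a z + a (adj A * z)) z)"
        unfolding restrict_apply'[OF z] restrict_apply'[OF adA[OF z]]
        by (simp add: mult_scale add_scale)
    qed
  qed
  have D_gen: "?D (angle \<T> a b) = angle \<T> (t a) b \<oplus>\<^bsub>\<E>\<^esub> angle \<T> a (t b)"
    and D_gen_in: "?D (angle \<T> a b) \<in> jordan_space \<T>"
    if c: "a \<in> carrier_mat r s" "b \<in> carrier_mat r s" for a b
  proof -
    show *: "?D (angle \<T> a b) = angle \<T> (t a) b \<oplus>\<^bsub>\<E>\<^esub> angle \<T> a (t b)"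
      unfolding restrict_apply'[OF angle_in_jordan_space[OF c]] by (rule represented_angle[OF rep c])
    have "t a \<in> carrier_mat r s" "t b \<in> carrier_mat r s"
      using represented_End[OF rep] c by (simp_all add: End_simps(1))
    then have "angle \<T> (t a) b \<in> jordan_space \<T>" "angle \<T> a (t b) \<in> jordan_space \<T>"
      using angle_in_jordan_space c by auto
    then show "?D (angle \<T> a b) \<in> jordan_space \<T>"
      unfolding * using submodule_jordan_space by (simp add: submodule_def)
  qed
  have D_closed: "?D a \<in> jordan_space \<T>" if "a \<in> jordan_space \<T>" for a
  proof -
    let ?N = "{a \<in> jordan_space \<T>. ?D a \<in> jordan_space \<T>}"
    have z: "\<zero>\<^bsub>\<E>\<^esub> \<in> jordan_space \<T>" using submodule_jordan_space by (simp add: submodule_def)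
    have D0: "?D \<zero>\<^bsub>\<E>\<^esub> = \<zero>\<^bsub>\<E>\<^esub>"
      unfolding restrict_apply'[OF z] unfolding End_simps(4)
    proof (rule restrict_ext)
      fix z :: "'c mat" assume z: "z \<in> carrier_mat r s"
      show "A * (\<lambda>z\<in>carrier_mat r s. 0\<^sub>m r s) z + (\<lambda>z\<in>carrier_mat r s. 0\<^sub>m r s) (adj A * z) = 0\<^sub>m r s"
        unfolding restrict_apply'[OF z] restrict_apply'[OF adA[OF z]]
        using A by simp
    qed
    have "submodule class_ring ?N \<E>"
      using submodule_jordan_space D0 D_add D_smult unfolding submodule_def
      by (intro conjI) (auto simp del: restrict_apply restrict_apply')
    moreover have "{angle \<T> x y | x y. x \<in> carrier \<T> \<and> y \<in> carrier \<T>} \<subseteq> ?N"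
      using D_gen_in angle_in_jordan_space
      by (auto simp del: restrict_apply restrict_apply')
    ultimately have "jordan_space \<T> \<subseteq> ?N"
      using E.span_is_subset unfolding jordan_space_def[of \<T>] by blast
    with that show ?thesis by blast
  qed
  have act: "jordan_action \<T> t = ?D"
    unfolding jordan_action_def Let_def
  proof (rule the_equality)
    show "?D \<in> LinearCombinations.module_hom class_ring ?JS ?JS \<inter> extensional (carrier ?JS) \<and>
      (\<forall>a\<in>carrier \<T>. \<forall>b\<in>carrier \<T>. ?D (angle \<T> a b) = angle \<T> (t a) b \<oplus>\<^bsub>\<E>\<^esub> angle \<T> a (t b))"
      unfolding LinearCombinations.module_hom_def using D_closed D_add D_smult D_gen
      by (auto simp del: restrict_apply restrict_apply')
  next
    fix D assume D: "D \<in> LinearCombinations.module_hom class_ring ?JS ?JS \<inter> extensional (carrier ?JS) \<and>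
      (\<forall>a\<in>carrier \<T>. \<forall>b\<in>carrier \<T>. D (angle \<T> a b) = angle \<T> (t a) b \<oplus>\<^bsub>\<E>\<^esub> angle \<T> a (t b))"
    let ?N = "{a \<in> jordan_space \<T>. D a = ?D a}"
    have z: "\<zero>\<^bsub>\<E>\<^esub> \<in> jordan_space \<T>" using submodule_jordan_space by (simp add: submodule_def)
    have Dl: "D (a \<oplus>\<^bsub>\<E>\<^esub> b) = D a \<oplus>\<^bsub>\<E>\<^esub> D b" "D (c \<odot>\<^bsub>\<E>\<^esub> a) = c \<odot>\<^bsub>\<E>\<^esub> D a" "D a \<in> jordan_space \<T>"
      if "a \<in> jordan_space \<T>" "b \<in> jordan_space \<T>" for a b c
      using D that by (auto simp: LinearCombinations.module_hom_def)
    have null: "0 \<odot>\<^bsub>\<E>\<^esub> a = \<zero>\<^bsub>\<E>\<^esub>" if "a \<in> jordan_space \<T>" for a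
      using E.smult_l_null[of a] that JSE by (auto simp: class_ring_simps)
    have "D \<zero>\<^bsub>\<E>\<^esub> = \<zero>\<^bsub>\<E>\<^esub>"
      using Dl(2)[OF z z, of 0] unfolding null[OF z] null[OF Dl(3)[OF z z]] .
    moreover have "?D \<zero>\<^bsub>\<E>\<^esub> = \<zero>\<^bsub>\<E>\<^esub>"
      using D_smult[OF z, of 0] unfolding null[OF z] null[OF D_closed[OF z]] .
    ultimately have "D \<zero>\<^bsub>\<E>\<^esub> = ?D \<zero>\<^bsub>\<E>\<^esub>" by (rule trans[OF _ sym])
    then have "submodule class_ring ?N \<E>"
      using submodule_jordan_space D_add D_smult Dl unfolding submodule_def
      by (intro conjI) (auto simp del: restrict_apply restrict_apply')
    moreover have "{angle \<T> x y | x y. x \<in> carrier \<T> \<and> y \<in> carrier \<T>} \<subseteq> ?N"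
      using D D_gen angle_in_jordan_space
      by (auto simp del: restrict_apply restrict_apply')
    ultimately have "jordan_space \<T> \<subseteq> ?N"
      using E.span_is_subset unfolding jordan_space_def[of \<T>] by blast
    then show "D = ?D"
      using D by (intro extensionalityI[of _ "jordan_space \<T>"]) (auto simp del: restrict_apply')
  qed
  have u: "(\<lambda>z\<in>carrier_mat r s. z) \<in> jordan_space \<T>"
    using jordan_unit_e_matrix[OF two_scalar s invertible_J invertible_G]
    by (simp add: jordan_unit_def induced_op_e_matrix)
  show ?thesis
    unfolding act restrict_apply'[OF u] left_op_def
  proof (rule restrict_ext)
    fix z :: "'c mat" assume z: "z \<in> carrier_mat r s"
    then show "A * (\<lambda>z\<in>carrier_mat r s. z) z + (\<lambda>z\<in>carrier_mat r s. z) (adj A * z) = (A + adj A) * z"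
      unfolding restrict_apply'[OF z] restrict_apply'[OF adA[OF z]]
      using A by (intro add_mult_distrib_mat[symmetric]) auto
  qed
qed

lemma left_op_eq_zero:
  assumes N: "N \<in> carrier_mat r r" and 0: "left_op N = \<zero>\<^bsub>\<E>\<^esub>"
  shows "N = 0\<^sub>m r r"
proof (rule eq_matI)
  fix i j assume ij: "i < dim_row (0\<^sub>m r r :: 'c mat)" "j < dim_col (0\<^sub>m r r :: 'c mat)"
  let ?z = "mat r s (\<lambda>(k, l). if k = j \<and> l = 0 then 1 else 0) :: 'c mat"
  have "left_op N ?z = 0\<^sub>m r s" unfolding 0 by (simp add: End_simps(4))
  then have "(N * ?z) $$ (i, 0) = 0" using ij s by (simp add: left_op_def)
  moreover have "(N * ?z) $$ (i, 0) = N $$ (i, j)"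
    using ij N s by (auto simp: scalar_prod_def if_distrib[of "\<lambda>u. _ * u"] sum.delta cong: if_cong)
  ultimately show "N $$ (i, j) = 0\<^sub>m r r $$ (i, j)" using ij by simp
qed (use N in auto)

lemma Der_represented:
  assumes "d \<in> Der"
  shows "\<exists>A B. represented d A B \<and> adj A = - A"
  using assms
proof (induction rule: Der_induct)
  case zero
  show ?case using represented_zero by (intro exI conjI) (auto simp: adj_def intro!: eq_matI)
next
  case (der x y)
  have [simp]: "dim_row x = r" "dim_col x = s" "dim_row y = r" "dim_col y = s" using der by auto
  have "adj (- (x * R y + y * R x)) = x * R y + y * R x"
  proof -
    have "adj (- (x * R y + y * R x)) = - (adj (x * R y + y * R x))"
      by (simp add: adj_def star_uminus)
    also have "\<dots> = - (- (y * R x) + - (x * R y))"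
      using der by (simp add: adj_add mult_carrier_mat[of _ r s] adj_xR)
    also have "\<dots> = x * R y + y * R x"
      by (rule eq_matI) (simp_all del: index_mult_mat(1))
    finally show ?thesis .
  qed
  then show ?case using der_represented[OF der] by (intro exI conjI) auto
next
  case (add d e)
  then obtain A B A' B' where r: "represented d A B" "adj A = - A" "represented e A' B'" "adj A' = - A'" by blast
  then have c: "A \<in> carrier_mat r r" "A' \<in> carrier_mat r r" by (auto simp: represented_def)
  then have "adj (A + A') = - (A + A')" using r by (auto simp: adj_add intro!: eq_matI)
  then show ?case using represented_add[OF r(1,3)] by blast
next
  case (smult c d)
  then obtain A B where r: "represented d A B" "adj A = - A" by blast
  then have [simp]: "dim_row A = r" "dim_col A = r" by (auto simp: represented_def)
  have "adj (map_mat (scale c) A) = map_mat (scale c) (adj A)"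
    by (simp add: adj_def star_scale mult_scale)
  also have "\<dots> = - map_mat (scale c) A" unfolding r(2) by (auto intro!: eq_matI)
  finally show ?case using represented_smult[OF r(1)] by blast
qed

lemma represented_left_op: "H \<in> carrier_mat r r \<Longrightarrow> represented (left_op H) H (0\<^sub>m s s)"
  unfolding represented_def left_op_def by (auto intro!: restrict_ext eq_matI)

text \<open>The right factors of \<open>L\<^bsub>x,y\<^esub>\<close> and \<open>- (L\<^bsub>x,y\<^esub> + L\<^bsub>y,x\<^esub>)\<close> agree, and the difference of the left factors is
  \<open>x R y - y R x\<close> in characteristic 3. This matrix is selfadjoint since the adjoint of \<open>x R y\<close> is \<open>- y R x\<close>.\<close>

lemma L_op_decomposition:
  assumes c: "x \<in> carrier_mat r s" "y \<in> carrier_mat r s"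
  shows "L_op \<T> x y = (- 1) \<odot>\<^bsub>\<E>\<^esub> der x y \<oplus>\<^bsub>\<E>\<^esub> left_op (x * R y - y * R x)"
proof -
  have d [simp]: "dim_row x = r" "dim_col x = s" "dim_row y = r" "dim_col y = s" using c by auto
  show ?thesis
  proof (rule extensionalityI[of _ "carrier_mat r s"])
    fix z :: "'c mat" assume z: "z \<in> carrier_mat r s"
    have [simp]: "dim_row z = r" "dim_col z = s" using z by auto
    have dz: "der x y z = - (x * R y + y * R x) * z + z * (R x * y + R y * x)"
      using der_represented[OF c] z by (simp add: represented_def)
    have "- (x * R y) * z - z * (R x * y + R y * x) =
      map_mat (scale (- 1)) (- (x * R y + y * R x) * z + z * (R x * y + R y * x)) + (x * R y - y * R x) * z"
    proof (rule eq_matI)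
      fix i j assume ij: "i < dim_row (map_mat (scale (- 1)) (- (x * R y + y * R x) * z + z * (R x * y + R y * x)) + (x * R y - y * R x) * z)"
        "j < dim_col (map_mat (scale (- 1)) (- (x * R y + y * R x) * z + z * (R x * y + R y * x)) + (x * R y - y * R x) * z)"
      show "(- (x * R y) * z - z * (R x * y + R y * x)) $$ (i, j) =
        (map_mat (scale (- 1)) (- (x * R y + y * R x) * z + z * (R x * y + R y * x)) + (x * R y - y * R x) * z) $$ (i, j)"
        using ij double[of "(x * (R y * z)) $$ (i, j)"]
        by (simp add: mat_ring del: index_mult_mat(1))
    qed simp_all
    then show "L_op \<T> x y z = ((- 1) \<odot>\<^bsub>\<E>\<^esub> der x y \<oplus>\<^bsub>\<E>\<^esub> left_op (x * R y - y * R x)) z"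
      using z triple_eq[OF c z] by (simp add: L_op_def left_op_def End_simps dz)
  qed (auto simp: L_op_def End_simps)
qed

lemma InStr_decomposition:
  assumes "t \<in> InStr \<T>"
  shows "\<exists>d\<in>Der. \<exists>H\<in>carrier_mat r r. adj H = H \<and> t = d \<oplus>\<^bsub>\<E>\<^esub> left_op H"
proof -
  let ?P = "\<lambda>t. \<exists>d\<in>Der. \<exists>H\<in>carrier_mat r r. adj H = H \<and> t = d \<oplus>\<^bsub>\<E>\<^esub> left_op H"
  have DerE: "d \<in> carrier \<E>" if "d \<in> Der" for d using submodule_Der that by (auto simp: submodule_def)
  have LE: "left_op H \<in> carrier \<E>" if "H \<in> carrier_mat r r" for H
    by (rule represented_End[OF represented_left_op[OF that]])
  have "submodule class_ring {t \<in> carrier \<E>. ?P t} \<E>"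
    unfolding submodule_def
  proof (intro conjI ballI allI impI)
    show "Module.module (class_ring :: 'k ring) \<E>" by (rule E.module_axioms)
    have "?P \<zero>\<^bsub>\<E>\<^esub>"
    proof (intro bexI conjI)
      show "\<zero>\<^bsub>\<E>\<^esub> \<in> Der" using submodule_Der by (auto simp: submodule_def)
      show "adj (0\<^sub>m r r) = 0\<^sub>m r r" by (auto simp: adj_def intro!: eq_matI)
      have "left_op (0\<^sub>m r r) = \<zero>\<^bsub>\<E>\<^esub>"
        unfolding left_op_def End_simps(4) by (intro restrict_ext) (auto intro!: eq_matI)
      then show "\<zero>\<^bsub>\<E>\<^esub> = \<zero>\<^bsub>\<E>\<^esub> \<oplus>\<^bsub>\<E>\<^esub> left_op (0\<^sub>m r r)" by simp
    qed auto
    then show "\<zero>\<^bsub>\<E>\<^esub> \<in> {t \<in> carrier \<E>. ?P t}" by simp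
  next
    fix t t' assume a: "t \<in> {t \<in> carrier \<E>. ?P t}" "t' \<in> {t \<in> carrier \<E>. ?P t}"
    then obtain d H d' H' where dh: "d \<in> Der" "H \<in> carrier_mat r r" "adj H = H" "t = d \<oplus>\<^bsub>\<E>\<^esub> left_op H"
      "d' \<in> Der" "H' \<in> carrier_mat r r" "adj H' = H'" "t' = d' \<oplus>\<^bsub>\<E>\<^esub> left_op H'" by blast
    have "?P (t \<oplus>\<^bsub>\<E>\<^esub> t')"
    proof -
      have 1: "d \<oplus>\<^bsub>\<E>\<^esub> d' \<in> Der" using submodule_Der dh by (auto simp: submodule_def)
      have 2: "adj (H + H') = H + H'" "H + H' \<in> carrier_mat r r" using dh by (auto simp add: adj_add)
      have "left_op (H + H') = left_op H \<oplus>\<^bsub>\<E>\<^esub> left_op H'"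
        unfolding left_op_def End_simps(2) using dh
        by (intro restrict_ext) (auto intro!: add_mult_distrib_mat)
      then have "t \<oplus>\<^bsub>\<E>\<^esub> t' = d \<oplus>\<^bsub>\<E>\<^esub> d' \<oplus>\<^bsub>\<E>\<^esub> left_op (H + H')"
        using dh DerE LE by (simp add: E.M.a_ac)
      with 1 2 show ?thesis by blast
    qed
    with a show "t \<oplus>\<^bsub>\<E>\<^esub> t' \<in> {t \<in> carrier \<E>. ?P t}" by simp
  next
    fix c t assume a: "c \<in> carrier (class_ring :: 'k ring)" "t \<in> {t \<in> carrier \<E>. ?P t}"
    then obtain d H where dh: "d \<in> Der" "H \<in> carrier_mat r r" "adj H = H" "t = d \<oplus>\<^bsub>\<E>\<^esub> left_op H" by blast
    then have [simp]: "dim_row H = r" "dim_col H = r" by auto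
    have "?P (c \<odot>\<^bsub>\<E>\<^esub> t)"
    proof -
      have 1: "c \<odot>\<^bsub>\<E>\<^esub> d \<in> Der" using submodule_Der dh by (auto simp: submodule_def)
      have 2: "adj (map_mat (scale c) H) = map_mat (scale c) H"
      proof -
        have "adj (map_mat (scale c) H) = map_mat (scale c) (adj H)"
          by (simp add: adj_def star_scale mult_scale)
        then show ?thesis using dh by simp
      qed
      have "left_op (map_mat (scale c) H) = c \<odot>\<^bsub>\<E>\<^esub> left_op H"
        unfolding left_op_def End_simps(3)
        by (intro restrict_ext) (auto simp: mult_scale)
      then have "c \<odot>\<^bsub>\<E>\<^esub> t = c \<odot>\<^bsub>\<E>\<^esub> d \<oplus>\<^bsub>\<E>\<^esub> left_op (map_mat (scale c) H)"
        using dh DerE LE by (simp add: E.smult_r_distr)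
      moreover have "map_mat (scale c) H \<in> carrier_mat r r" using dh by simp
      ultimately show ?thesis using 1 2 by blast
    qed
    with a show "c \<odot>\<^bsub>\<E>\<^esub> t \<in> {t \<in> carrier \<E>. ?P t}" by simp
  qed auto
  moreover have "{L_op \<T> x y | x y. x \<in> carrier \<T> \<and> y \<in> carrier \<T>} \<subseteq> {t \<in> carrier \<E>. ?P t}"
  proof clarify
    fix x y assume c: "x \<in> carrier \<T>" "y \<in> carrier \<T>"
    then have c: "x \<in> carrier_mat r s" "y \<in> carrier_mat r s" by simp_all
    have [simp]: "dim_row x = r" "dim_col x = s" "dim_row y = r" "dim_col y = s" using c by auto
    have "?P (L_op \<T> x y)"
    proof (intro bexI conjI)
      have "der x y \<in> Der" using E.in_own_span[OF ders_End] c unfolding Der_def by auto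
      then show "(- 1) \<odot>\<^bsub>\<E>\<^esub> der x y \<in> Der" using submodule_Der by (auto simp: submodule_def)
      have "x * R y - y * R x = x * R y + - (y * R x)"
        by (rule eq_matI) (simp_all del: index_mult_mat(1))
      then have "adj (x * R y - y * R x) = adj (x * R y) + adj (- (y * R x))"
        using adj_add[of "x * R y" "- (y * R x)"] c by (simp add: mult_carrier_mat[of _ r s])
      also have "adj (- (y * R x)) = - adj (y * R x)" by (simp add: adj_def star_uminus)
      also have "adj (x * R y) + - adj (y * R x) = x * R y - y * R x"
        using c by (simp add: adj_xR) (auto intro!: eq_matI simp del: index_mult_mat(1))
      finally show "adj (x * R y - y * R x) = x * R y - y * R x" .
      show "x * R y - y * R x \<in> carrier_mat r r" by (rule carrier_matI) simp_all
    qed (rule L_op_decomposition[OF c])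
    then show "L_op \<T> x y \<in> carrier \<E> \<and> ?P (L_op \<T> x y)"
      using represented_End[OF represented_L_op[OF c]] by blast
  qed
  ultimately have "InStr \<T> \<subseteq> {t \<in> carrier \<E>. ?P t}"
    unfolding InStr_def by (intro E.span_is_subset)
  with assms show ?thesis by blast
qed

text \<open>Write an inner structural operator as an element of \<^const>\<open>Der\<close> plus the left multiplication by a selfadjoint
  \<open>H\<close>. The left factor of the former is skew, so the unit is sent to the left multiplication by
  \<open>2 H = - H\<close>.\<close>

theorem InDer_eq: "InDer \<T> (induced_op e_matrix) = Der"
proof (intro equalityI subsetI)
  fix d assume d: "d \<in> Der"
  obtain A B where r: "represented d A B" "adj A = - A" using Der_represented[OF d] by blast
  have A: "A \<in> carrier_mat r r" using r by (auto simp: represented_def)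
  have "Der \<subseteq> InStr \<T>"
    unfolding Der_def
  proof (rule E.span_is_subset)
    have L: "L_op \<T> x y \<in> InStr \<T>" if "x \<in> carrier_mat r s" "y \<in> carrier_mat r s" for x y
      using E.in_own_span[OF L_ops_End] that unfolding InStr_def by auto
    show "ders \<subseteq> InStr \<T>"
    proof clarify
      fix x y :: "'c mat" assume c: "x \<in> carrier_mat r s" "y \<in> carrier_mat r s"
      show "der x y \<in> InStr \<T>"
        unfolding der_def using submodule_InStr L[OF c] L[OF c(2,1)] unfolding submodule_def by blast
    qed
  qed (rule submodule_InStr)
  moreover have "left_op (A + adj A) = \<zero>\<^bsub>\<E>\<^esub>"
    unfolding r(2) left_op_def End_simps(4) using A by (intro restrict_ext) (auto intro!: eq_matI simp: scalar_prod_def)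
  ultimately show "d \<in> InDer \<T> (induced_op e_matrix)"
    unfolding InDer_def induced_op_e_matrix using d jordan_action_unit[OF r(1)] by auto
next
  fix t assume "t \<in> InDer \<T> (induced_op e_matrix)"
  then have t: "t \<in> InStr \<T>" and 0: "jordan_action \<T> t (\<lambda>z\<in>carrier_mat r s. z) = \<zero>\<^bsub>\<E>\<^esub>"
    unfolding InDer_def induced_op_e_matrix by auto
  from InStr_decomposition[OF t] obtain d H where d: "d \<in> Der" and H: "H \<in> carrier_mat r r" "adj H = H"
    and tdh: "t = d \<oplus>\<^bsub>\<E>\<^esub> left_op H" by blast
  obtain A B where r: "represented d A B" "adj A = - A" using Der_represented[OF d] by blast
  have A: "A \<in> carrier_mat r r" using r by (auto simp: represented_def)
  have "represented t (A + H) (B + 0\<^sub>m s s)"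
    unfolding tdh by (rule represented_add[OF r(1) represented_left_op[OF H(1)]])
  from jordan_action_unit[OF this] have "left_op (A + H + adj (A + H)) = \<zero>\<^bsub>\<E>\<^esub>" using 0 by simp
  also have "A + H + adj (A + H) = - H"
    using A H r(2) double by (auto simp: adj_add intro!: eq_matI)
  finally have "- H = 0\<^sub>m r r" using H by (intro left_op_eq_zero) auto
  then have "H = - 0\<^sub>m r r" by (metis uminus_uminus_mat)
  also have "\<dots> = 0\<^sub>m r r" by (rule eq_matI) simp_all
  finally have "H = 0\<^sub>m r r" .
  then have "left_op H = \<zero>\<^bsub>\<E>\<^esub>"
    unfolding left_op_def End_simps(4) by (intro restrict_ext) (auto intro!: eq_matI)
  with d show "t \<in> Der" unfolding tdh using submodule_Der by (auto simp: submodule_def)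
qed

end

section \<open>Lie superalgebras of matrices\<close>

definition mat_subspace :: "nat \<Rightarrow> 'a::field mat set \<Rightarrow> bool" where
  "mat_subspace N V \<longleftrightarrow> V \<subseteq> carrier_mat N N \<and> 0\<^sub>m N N \<in> V \<and> (\<forall>x\<in>V. \<forall>y\<in>V. x + y \<in> V) \<and>
     (\<forall>c. \<forall>x\<in>V. c \<cdot>\<^sub>m x \<in> V)"

text \<open>Stated with subspaces as upper bounds, so that a spanning property is applied by exhibiting a subspace.\<close>

definition spanned_by :: "nat \<Rightarrow> 'a::field mat set \<Rightarrow> 'a mat set \<Rightarrow> bool" where
  "spanned_by N V S \<longleftrightarrow> (\<forall>W. mat_subspace N W \<longrightarrow> S \<subseteq> W \<longrightarrow> V \<subseteq> W)"

definition anticommutator :: "'a::ring mat \<Rightarrow> 'a mat \<Rightarrow> 'a mat" where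
  "anticommutator x y = x * y + y * x"

lemma gl_evenD: "Q \<in> gl_even a b \<Longrightarrow> Q \<in> carrier_mat (a + b) (a + b)"
  and gl_oddD: "Q \<in> gl_odd a b \<Longrightarrow> Q \<in> carrier_mat (a + b) (a + b)"
  by (auto simp: gl_even_def gl_odd_def)

lemma gl_even_index:
  assumes "Q \<in> gl_even a b" "i < a + b" "j < a + b" "(i < a) \<noteq> (j < a)"
  shows "Q $$ (i, j) = 0"
proof -
  have "Q = even_proj a Q" using assms by (simp add: gl_even_def)
  then have "Q $$ (i, j) = even_proj a Q $$ (i, j)" by simp
  also have "\<dots> = 0" using assms gl_evenD[OF assms(1)] by (auto simp: even_proj_def)
  finally show ?thesis .
qed

lemma gl_odd_index:
  assumes "Q \<in> gl_odd a b" "i < a + b" "j < a + b" "(i < a) = (j < a)"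
  shows "Q $$ (i, j) = 0"
proof -
  have "Q = odd_proj a Q" using assms by (simp add: gl_odd_def)
  then have "Q $$ (i, j) = odd_proj a Q $$ (i, j)" by simp
  also have "\<dots> = 0" using assms gl_oddD[OF assms(1)] by (auto simp: odd_proj_def)
  finally show ?thesis .
qed

lemma even_proj_add:
  assumes q: "q \<in> gl_even a b" and x: "x \<in> gl_odd a b"
  shows "even_proj a (q + x) = q" "odd_proj a (q + x) = x"
proof -
  have [simp]: "dim_row q = a + b" "dim_col q = a + b" "dim_row x = a + b" "dim_col x = a + b"
    using gl_evenD[OF q] gl_oddD[OF x] by auto
  show "even_proj a (q + x) = q"
    by (rule eq_matI) (use gl_odd_index[OF x] gl_even_index[OF q] in \<open>auto simp: even_proj_def\<close>)
  show "odd_proj a (q + x) = x"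
    by (rule eq_matI) (use gl_odd_index[OF x] gl_even_index[OF q] in \<open>auto simp: odd_proj_def\<close>)
qed

lemma superbracket_eq:
  assumes p: "p \<in> gl_even a b" and x: "x \<in> gl_odd a b" and q: "q \<in> gl_even a b" and y: "y \<in> gl_odd a b"
  shows "superbracket a (p + x) (q + y) = (commutator p q + anticommutator x y) + (commutator p y - commutator q x)"
proof -
  have [simp]: "dim_row q = a + b" "dim_col q = a + b" "dim_row x = a + b" "dim_col x = a + b"
    "dim_row p = a + b" "dim_col p = a + b" "dim_row y = a + b" "dim_col y = a + b"
    using gl_evenD[OF q] gl_oddD[OF x] gl_evenD[OF p] gl_oddD[OF y] by auto
  show ?thesis
    unfolding superbracket_def even_proj_add[OF p x] even_proj_add[OF q y] commutator_def anticommutator_def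
    by (rule eq_matI) (simp_all add: mat_ring algebra_simps del: index_mult_mat(1))
qed

lemma mat_subspaceD:
  assumes "mat_subspace N V"
  shows "x \<in> V \<Longrightarrow> x \<in> carrier_mat N N" "0\<^sub>m N N \<in> V" "x \<in> V \<Longrightarrow> y \<in> V \<Longrightarrow> x + y \<in> V" "x \<in> V \<Longrightarrow> c \<cdot>\<^sub>m x \<in> V"
  using assms by (auto simp: mat_subspace_def)

lemma mat_subspace_minus:
  assumes V: "mat_subspace N V" and "x \<in> V" "y \<in> V"
  shows "x - y \<in> V"
proof -
  have "x + (- 1) \<cdot>\<^sub>m y \<in> V" using mat_subspaceD[OF V] assms by blast
  also have "x + (- 1) \<cdot>\<^sub>m y = x - y"
    using mat_subspaceD(1)[OF V] assms by (auto intro!: eq_matI)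
  finally show ?thesis .
qed

lemma commutator_linear:
  fixes p q x :: "'a::field mat"
  assumes "p \<in> carrier_mat N N" "q \<in> carrier_mat N N" "x \<in> carrier_mat N N"
  shows "commutator (p + q) x = commutator p x + commutator q x"
    "commutator (p - q) x = commutator p x - commutator q x"
    "commutator x (p + q) = commutator x p + commutator x q"
    "anticommutator (p + q) x = anticommutator p x + anticommutator q x"
    "anticommutator x (p + q) = anticommutator x p + anticommutator x q"
    "commutator (commutator p q) x = commutator p (commutator q x) - commutator q (commutator p x)"
proof -
  have [simp]: "dim_row q = N" "dim_col q = N" "dim_row x = N" "dim_col x = N"
    "dim_row p = N" "dim_col p = N" using assms by auto
  show "commutator (p + q) x = commutator p x + commutator q x"
    "commutator (p - q) x = commutator p x - commutator q x"
    "commutator x (p + q) = commutator x p + commutator x q"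
    "anticommutator (p + q) x = anticommutator p x + anticommutator q x"
    "anticommutator x (p + q) = anticommutator x p + anticommutator x q"
    "commutator (commutator p q) x = commutator p (commutator q x) - commutator q (commutator p x)"
    unfolding commutator_def anticommutator_def
    by (rule eq_matI; simp add: mat_ring algebra_simps del: index_mult_mat(1))+
qed

lemma commutator_smult:
  fixes p x :: "'a::field mat"
  assumes "p \<in> carrier_mat N N" "x \<in> carrier_mat N N"
  shows "commutator (c \<cdot>\<^sub>m p) x = c \<cdot>\<^sub>m commutator p x"
    "commutator x (c \<cdot>\<^sub>m p) = c \<cdot>\<^sub>m commutator x p"
    "anticommutator (c \<cdot>\<^sub>m p) x = c \<cdot>\<^sub>m anticommutator p x"
    "anticommutator x (c \<cdot>\<^sub>m p) = c \<cdot>\<^sub>m anticommutator x p"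
    "commutator p x \<in> carrier_mat N N" "anticommutator p x \<in> carrier_mat N N"
proof -
  have [simp]: "dim_row x = N" "dim_col x = N" "dim_row p = N" "dim_col p = N" using assms by auto
  have [simp]: "(c \<cdot>\<^sub>m p) * x = c \<cdot>\<^sub>m (p * x)" "x * (c \<cdot>\<^sub>m p) = c \<cdot>\<^sub>m (x * p)"
    by (rule mult_smult_assoc_mat[OF assms], rule mult_smult_distrib[OF assms(2,1)])
  show "commutator (c \<cdot>\<^sub>m p) x = c \<cdot>\<^sub>m commutator p x"
    "commutator x (c \<cdot>\<^sub>m p) = c \<cdot>\<^sub>m commutator x p"
    "anticommutator (c \<cdot>\<^sub>m p) x = c \<cdot>\<^sub>m anticommutator p x"
    "anticommutator x (c \<cdot>\<^sub>m p) = c \<cdot>\<^sub>m anticommutator x p"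
    unfolding commutator_def anticommutator_def
    by (rule eq_matI; simp add: algebra_simps del: index_mult_mat(1))+
  show "commutator p x \<in> carrier_mat N N" "anticommutator p x \<in> carrier_mat N N"
    by (rule carrier_matI; simp add: commutator_def anticommutator_def)+
qed

lemma commutator_zero:
  fixes x :: "'a::field mat"
  assumes "x \<in> carrier_mat N N"
  shows "commutator (0\<^sub>m N N) x = 0\<^sub>m N N" "commutator x (0\<^sub>m N N) = 0\<^sub>m N N"
    "anticommutator (0\<^sub>m N N) x = 0\<^sub>m N N" "anticommutator x (0\<^sub>m N N) = 0\<^sub>m N N"
  using assms by (simp_all add: commutator_def anticommutator_def)

text \<open>Subalgebras of \<open>gl(a|b)\<close> with an even part that is spanned by the brackets of odd elements.\<close>

locale matrix_lie_superalgebra =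
  fixes a b :: nat and V0 V1 :: "'l::field mat set"
  assumes V0: "mat_subspace (a + b) V0" "V0 \<subseteq> gl_even a b"
    and V1: "mat_subspace (a + b) V1" "V1 \<subseteq> gl_odd a b"
    and closed_00: "p \<in> V0 \<Longrightarrow> q \<in> V0 \<Longrightarrow> commutator p q \<in> V0"
    and closed_01: "p \<in> V0 \<Longrightarrow> x \<in> V1 \<Longrightarrow> commutator p x \<in> V1"
    and closed_11: "x \<in> V1 \<Longrightarrow> y \<in> V1 \<Longrightarrow> anticommutator x y \<in> V0"
    and generated: "spanned_by (a + b) V0 {anticommutator x y | x y. x \<in> V1 \<and> y \<in> V1}"
begin

abbreviation "\<G> \<equiv> matrix_superalgebra a b V0 V1"

lemma sub0: "x \<in> V0 \<Longrightarrow> x \<in> carrier_mat (a + b) (a + b)" "0\<^sub>m (a + b) (a + b) \<in> V0"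
  "x \<in> V0 \<Longrightarrow> y \<in> V0 \<Longrightarrow> x + y \<in> V0" "x \<in> V0 \<Longrightarrow> c \<cdot>\<^sub>m x \<in> V0" "x \<in> V0 \<Longrightarrow> y \<in> V0 \<Longrightarrow> x - y \<in> V0"
  using mat_subspaceD[OF V0(1)] mat_subspace_minus[OF V0(1)] by auto

lemma sub1: "x \<in> V1 \<Longrightarrow> x \<in> carrier_mat (a + b) (a + b)" "0\<^sub>m (a + b) (a + b) \<in> V1"
  "x \<in> V1 \<Longrightarrow> y \<in> V1 \<Longrightarrow> x + y \<in> V1" "x \<in> V1 \<Longrightarrow> c \<cdot>\<^sub>m x \<in> V1" "x \<in> V1 \<Longrightarrow> y \<in> V1 \<Longrightarrow> x - y \<in> V1"
  using mat_subspaceD[OF V1(1)] mat_subspace_minus[OF V1(1)] by auto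

lemma projections:
  assumes "q \<in> V0" "x \<in> V1"
  shows "even_proj a (q + x) = q" "odd_proj a (q + x) = x"
  using even_proj_add assms V0(2) V1(2) by blast+

lemma mult_eq:
  assumes "p \<in> V0" "x \<in> V1" "q \<in> V0" "y \<in> V1"
  shows "superbracket a (p + x) (q + y) = (commutator p q + anticommutator x y) + (commutator p y - commutator q x)"
  by (rule superbracket_eq) (use assms V0(2) V1(2) in blast)+

lemma carrier_iff: "Q \<in> carrier \<G> \<longleftrightarrow> (\<exists>q\<in>V0. \<exists>x\<in>V1. Q = q + x)"
  by (auto simp: matrix_superalgebra_def)

lemma sum_add:
  assumes "p \<in> V0" "x \<in> V1" "q \<in> V0" "y \<in> V1"
  shows "(p + x) + (q + y) = (p + q) + (x + y)"
  using sub0(1)[OF assms(1)] sub0(1)[OF assms(3)] sub1(1)[OF assms(2)] sub1(1)[OF assms(4)]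
  by (intro eq_matI) auto

lemma sum_smult: 
  assumes "p \<in> V0" "x \<in> V1"
  shows "c \<cdot>\<^sub>m (p + x) = c \<cdot>\<^sub>m p + c \<cdot>\<^sub>m x"
  using sub0(1)[OF assms(1)] sub1(1)[OF assms(2)]
  by (intro eq_matI) (auto simp: distrib_left)

lemma add_closed: "P \<in> carrier \<G> \<Longrightarrow> Q \<in> carrier \<G> \<Longrightarrow> P + Q \<in> carrier \<G>"
  unfolding carrier_iff by (metis sum_add sub0(3) sub1(3))

lemma smult_closed: "P \<in> carrier \<G> \<Longrightarrow> c \<cdot>\<^sub>m P \<in> carrier \<G>"
  unfolding carrier_iff by (metis sum_smult sub0(4) sub1(4))

lemma carrier_mat: "P \<in> carrier \<G> \<Longrightarrow> P \<in> carrier_mat (a + b) (a + b)"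
  unfolding carrier_iff using sub0(1) sub1(1) by (auto intro: add_carrier_mat)

lemma even_in: "q \<in> V0 \<Longrightarrow> q \<in> carrier \<G>" and odd_in: "x \<in> V1 \<Longrightarrow> x \<in> carrier \<G>"
  unfolding carrier_iff using sub0 sub1 by (metis right_add_zero_mat, metis left_add_zero_mat)

lemma simps: "add \<G> = (+)" "module.smult \<G> = (\<cdot>\<^sub>m)" "zero \<G> = 0\<^sub>m (a + b) (a + b)" "mult \<G> = superbracket a"
  "even_part \<G> = V0" "odd_part \<G> = V1"
  by (simp_all add: matrix_superalgebra_def)

lemma vectorspace_matrix_superalgebra: "vectorspace class_ring \<G>"
proof (rule vectorspaceI, rule moduleI)
  show "cring (class_ring :: 'l ring)" by (rule class_cring.is_cring)
  show "abelian_group \<G>"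
  proof (rule abelian_groupI)
    fix x assume x: "x \<in> carrier \<G>"
    show "\<exists>y\<in>carrier \<G>. y \<oplus>\<^bsub>\<G>\<^esub> x = \<zero>\<^bsub>\<G>\<^esub>"
      using carrier_mat[OF x] by (intro bexI[of _ "(-1) \<cdot>\<^sub>m x"] smult_closed x) (auto simp: simps intro!: eq_matI)
  qed (use carrier_mat even_in sub0(2) in \<open>auto simp: simps add_closed intro: comm_add_mat assoc_add_mat\<close>)
qed (use carrier_mat in \<open>auto simp: simps smult_closed distrib_right add_smult_distrib_left_mat[OF carrier_mat carrier_mat]
      intro!: eq_matI\<close>)

end

context char3_matrix_data
begin

lemma semisimplified_simps:
  "carrier semisimplified = Der \<times> carrier_mat r s"
  "mult semisimplified = (\<lambda>(c, m) (d, n). ((c \<otimes>\<^bsub>\<E>\<^esub> d \<ominus>\<^bsub>\<E>\<^esub> d \<otimes>\<^bsub>\<E>\<^esub> c) \<oplus>\<^bsub>\<E>\<^esub> L_op \<T> m n \<oplus>\<^bsub>\<E>\<^esub> L_op \<T> n m, c n \<ominus>\<^bsub>\<T>\<^esub> d m))"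
  "zero semisimplified = (\<zero>\<^bsub>\<E>\<^esub>, 0\<^sub>m r s)"
  "add semisimplified = (\<lambda>(c, m) (d, n). (c \<oplus>\<^bsub>\<E>\<^esub> d, m + n))"
  "module.smult semisimplified = (\<lambda>k (c, m). (k \<odot>\<^bsub>\<E>\<^esub> c, map_mat (scale k) m))"
  "even_part semisimplified = Der \<times> {0\<^sub>m r s}"
  "odd_part semisimplified = {\<zero>\<^bsub>\<E>\<^esub>} \<times> carrier_mat r s"
  by (simp_all add: semisimplified_def semisimplification_def InDer_eq Let_def)

lemma Der_End: "d \<in> Der \<Longrightarrow> d \<in> carrier \<E>"
  using submodule_Der by (auto simp: submodule_def)

lemma Der_closed: "\<zero>\<^bsub>\<E>\<^esub> \<in> Der" "d \<in> Der \<Longrightarrow> e \<in> Der \<Longrightarrow> d \<oplus>\<^bsub>\<E>\<^esub> e \<in> Der" "d \<in> Der \<Longrightarrow> c \<odot>\<^bsub>\<E>\<^esub> d \<in> Der"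
  using submodule_Der by (auto simp: submodule_def)

lemma der_Der: "x \<in> carrier_mat r s \<Longrightarrow> y \<in> carrier_mat r s \<Longrightarrow> der x y \<in> Der"
  unfolding Der_def using E.in_own_span[OF ders_End] by blast

lemma vectorspace_semisimplified: "vectorspace class_ring semisimplified"
proof (rule vectorspaceI, rule moduleI)
  show "cring (class_ring :: 'k ring)" by (rule class_cring.is_cring)
  show "abelian_group semisimplified"
  proof (rule abelian_groupI)
    fix x assume x: "x \<in> carrier semisimplified"
    then obtain d m where dm: "x = (d, m)" "d \<in> Der" "m \<in> carrier_mat r s" by (auto simp: semisimplified_simps)
    have "(- 1) \<odot>\<^bsub>\<E>\<^esub> d = \<ominus>\<^bsub>\<E>\<^esub> d"
      using E.smult_l_minus[of 1 d] E.smult_one[of d] Der_End[OF dm(2)] by (simp add: class_ring_simps)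
    then have "(- 1) \<odot>\<^bsub>\<E>\<^esub> d \<oplus>\<^bsub>\<E>\<^esub> d = \<zero>\<^bsub>\<E>\<^esub>"
      using Der_End[OF dm(2)] by (simp add: E.M.l_neg)
    then show "\<exists>y\<in>carrier semisimplified. y \<oplus>\<^bsub>semisimplified\<^esub> x = \<zero>\<^bsub>semisimplified\<^esub>"
      using dm Der_closed(3)[OF dm(2)]
      by (intro bexI[of _ "((- 1) \<odot>\<^bsub>\<E>\<^esub> d, - m)"]) (auto simp: semisimplified_simps)
  qed (auto simp: semisimplified_simps Der_closed E.M.a_ac Der_End intro: comm_add_mat assoc_add_mat)
qed (auto simp: semisimplified_simps Der_closed Der_End E.smult_l_distr[simplified] E.smult_r_distr E.smult_assoc1[simplified] E.smult_one[simplified]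
       scale_left_distrib scale_right_distrib intro!: eq_matI)

end

section \<open>Homomorphisms determined by the odd part\<close>

definition functional_on :: "'a::field mat set \<Rightarrow> ('a mat \<Rightarrow> 'a) \<Rightarrow> bool" where
  "functional_on V \<tau> \<longleftrightarrow> (\<forall>x\<in>V. \<forall>y\<in>V. \<tau> (x + y) = \<tau> x + \<tau> y) \<and> (\<forall>c. \<forall>x\<in>V. \<tau> (c \<cdot>\<^sub>m x) = c * \<tau> x)"

text \<open>The map \<open>inc\<close> is defined on \<open>M\<close> only. Since brackets of odd elements span both even parts, compatibility with
  the triple product \<open>[[x, y], z]\<close> suffices to extend it. The assumption \<open>inc_separated\<close> is the injectivity of
  the scalar extension of \<open>inc\<close>, in the form used for \<^locale>\<open>semilinear\<close>.\<close>

locale odd_embedding =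
  char3_matrix_data scale n r s J G + matrix_lie_superalgebra a b V0 V1
  for scale :: "'k::field \<Rightarrow> 'c::ring_1 \<Rightarrow> 'c" and n r s J G
    and a b :: nat and V0 V1 :: "'l::field mat set" +
  fixes \<sigma> :: "'k \<Rightarrow> 'l" and inc :: "'c mat \<Rightarrow> 'l mat"
  assumes \<sigma>: "field_hom \<sigma>"
    and inc_odd: "m \<in> carrier_mat r s \<Longrightarrow> inc m \<in> V1"
    and inc_add: "m \<in> carrier_mat r s \<Longrightarrow> m' \<in> carrier_mat r s \<Longrightarrow> inc (m + m') = inc m + inc m'"
    and inc_scale: "m \<in> carrier_mat r s \<Longrightarrow> inc (map_mat (scale c) m) = \<sigma> c \<cdot>\<^sub>m inc m"
    and inc_der: "x \<in> carrier_mat r s \<Longrightarrow> y \<in> carrier_mat r s \<Longrightarrow> z \<in> carrier_mat r s \<Longrightarrow>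
      inc (der x y z) = commutator (anticommutator (inc x) (inc y)) (inc z)"
    and inc_spans: "spanned_by (a + b) V1 (inc ` carrier_mat r s)"
    and inc_separated: "m \<in> carrier_mat r s \<Longrightarrow>
      (\<And>\<tau>. functional_on V1 \<tau> \<Longrightarrow> (\<And>m'. m' \<in> carrier_mat r s \<Longrightarrow> \<tau> (inc m') \<in> range \<sigma>) \<Longrightarrow> \<tau> (inc m) = 0) \<Longrightarrow>
      m = 0\<^sub>m r s"
begin

definition induces :: "'l mat \<Rightarrow> ('c mat \<Rightarrow> 'c mat) \<Rightarrow> bool" where
  "induces q d \<longleftrightarrow> q \<in> V0 \<and> (\<forall>z\<in>carrier_mat r s. inc (d z) = commutator q (inc z))"

lemma inc_carrier: "m \<in> carrier_mat r s \<Longrightarrow> inc m \<in> carrier_mat (a + b) (a + b)"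
  using sub1(1)[OF inc_odd] .

lemma inc_zero: "inc (0\<^sub>m r s) = 0\<^sub>m (a + b) (a + b)"
proof -
  interpret \<sigma>: field_hom \<sigma> by (rule \<sigma>)
  have "map_mat (scale 0) (0\<^sub>m r s) = (0\<^sub>m r s :: 'c mat)" by (rule eq_matI) auto
  then have "inc (0\<^sub>m r s) = 0 \<cdot>\<^sub>m inc (0\<^sub>m r s)" using inc_scale[of "0\<^sub>m r s" 0] by simp
  also have "\<dots> = 0\<^sub>m (a + b) (a + b)" using inc_carrier[of "0\<^sub>m r s"] by (auto intro!: eq_matI)
  finally show ?thesis .
qed

lemma inc_minus:
  assumes "m \<in> carrier_mat r s" "m' \<in> carrier_mat r s"
  shows "inc (m - m') = inc m - inc m'"
proof -
  interpret \<sigma>: field_hom \<sigma> by (rule \<sigma>)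
  have "m - m' = m + map_mat (scale (- 1)) m'" using assms by (auto intro!: eq_matI)
  then show ?thesis
    using inc_add[OF assms(1), of "map_mat (scale (- 1)) m'"] inc_scale[OF assms(2), of "- 1"] assms inc_carrier[OF assms(1)] inc_carrier[OF assms(2)]
    by (auto simp: hom_distribs intro!: eq_matI)
qed

lemma induces_zero: "induces (0\<^sub>m (a + b) (a + b)) \<zero>\<^bsub>\<E>\<^esub>"
  unfolding induces_def using sub0(2) inc_carrier by (auto simp: End_simps(4) inc_zero commutator_zero(1))

lemma induces_add:
  assumes "induces q d" "induces p e" "d \<in> carrier \<E>" "e \<in> carrier \<E>"
  shows "induces (q + p) (d \<oplus>\<^bsub>\<E>\<^esub> e)"
  using assms unfolding induces_def
  by (auto simp: End_simps(2) inc_add End_closed commutator_linear(1)[OF sub0(1) sub0(1) inc_carrier] intro: sub0(3))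

lemma induces_smult:
  assumes "induces q d" "d \<in> carrier \<E>"
  shows "induces (\<sigma> c \<cdot>\<^sub>m q) (c \<odot>\<^bsub>\<E>\<^esub> d)"
  using assms unfolding induces_def
  by (auto simp: End_simps(3) inc_scale End_closed commutator_smult(1)[OF sub0(1) inc_carrier] intro: sub0(4))

lemma induces_der:
  assumes "x \<in> carrier_mat r s" "y \<in> carrier_mat r s"
  shows "induces (anticommutator (inc x) (inc y)) (der x y)"
  using assms unfolding induces_def by (simp add: inc_der closed_11 inc_odd)

lemma End_mult: "c \<otimes>\<^bsub>\<E>\<^esub> d = (\<lambda>z\<in>carrier_mat r s. c (d z))"
  by (simp add: End_alg_def compose_def)

lemma End_mult_closed:
  assumes "c \<in> carrier \<E>" "d \<in> carrier \<E>" shows "c \<otimes>\<^bsub>\<E>\<^esub> d \<in> carrier \<E>"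
  unfolding End_mult using assms by (auto simp: End_simps(1))

lemma induces_commutator:
  assumes "induces p c" "induces q d" "c \<in> carrier \<E>" "d \<in> carrier \<E>"
  shows "induces (commutator p q) (c \<otimes>\<^bsub>\<E>\<^esub> d \<ominus>\<^bsub>\<E>\<^esub> d \<otimes>\<^bsub>\<E>\<^esub> c)"
  unfolding induces_def
proof (intro conjI ballI)
  have pq: "p \<in> V0" "q \<in> V0" using assms by (auto simp: induces_def)
  then show "commutator p q \<in> V0" by (rule closed_00)
  fix z :: "'c mat" assume z: "z \<in> carrier_mat r s"
  have cz: "c z \<in> carrier_mat r s" "d z \<in> carrier_mat r s" "c (d z) \<in> carrier_mat r s" "d (c z) \<in> carrier_mat r s"
    using assms z End_closed by auto
  have "(c \<otimes>\<^bsub>\<E>\<^esub> d \<ominus>\<^bsub>\<E>\<^esub> d \<otimes>\<^bsub>\<E>\<^esub> c) z = c (d z) - d (c z)"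
    using End_minus[OF End_mult_closed[OF assms(3,4)] End_mult_closed[OF assms(4,3)]] z
    by (simp add: End_mult)
  then have "inc ((c \<otimes>\<^bsub>\<E>\<^esub> d \<ominus>\<^bsub>\<E>\<^esub> d \<otimes>\<^bsub>\<E>\<^esub> c) z) = inc (c (d z)) - inc (d (c z))"
    using inc_minus[OF cz(3,4)] by simp
  also have "\<dots> = commutator p (commutator q (inc z)) - commutator q (commutator p (inc z))"
    using assms(1,2) z cz by (simp add: induces_def)
  also have "\<dots> = commutator (commutator p q) (inc z)"
    using commutator_linear(6)[OF sub0(1)[OF pq(1)] sub0(1)[OF pq(2)] inc_carrier[OF z]] by simp
  finally show "inc ((c \<otimes>\<^bsub>\<E>\<^esub> d \<ominus>\<^bsub>\<E>\<^esub> d \<otimes>\<^bsub>\<E>\<^esub> c) z) = commutator (commutator p q) (inc z)" .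
qed

lemma induces_exists: "d \<in> Der \<Longrightarrow> \<exists>q. induces q d"
proof (induction rule: Der_induct)
  case zero
  then show ?case using induces_zero by blast
next
  case (der x y)
  then show ?case using induces_der by blast
next
  case (add d e)
  then show ?case using induces_add Der_End by blast
next
  case (smult c d)
  then show ?case using induces_smult Der_End by blast
qed

text \<open>The difference of the two elements kills the image of \<open>M\<close>, which spans \<open>V1\<close>.\<close>

lemma induces_unique:
  assumes "induces q d" "induces q' d" and x: "x \<in> V1"
  shows "commutator (q - q') x = 0\<^sub>m (a + b) (a + b)"
proof -
  have q: "q \<in> V0" "q' \<in> V0" and q': "q - q' \<in> V0" using assms sub0(5) by (auto simp: induces_def)
  let ?W = "{x \<in> V1. commutator (q - q') x = 0\<^sub>m (a + b) (a + b)}"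
  have "mat_subspace (a + b) ?W"
    using V1(1) q' unfolding mat_subspace_def
    by (auto simp: commutator_linear(3)[of _ "a + b"] commutator_smult(2)[of _ "a + b"] commutator_zero(2) sub0(1) sub1(1))
  moreover have "inc ` carrier_mat r s \<subseteq> ?W"
  proof clarify
    fix z :: "'c mat" assume z: "z \<in> carrier_mat r s"
    have "commutator (q - q') (inc z) = commutator q (inc z) - commutator q' (inc z)"
      by (rule commutator_linear(2)[OF sub0(1)[OF q(1)] sub0(1)[OF q(2)] inc_carrier[OF z]])
    also have "\<dots> = inc (d z) - inc (d z)" using assms z by (simp add: induces_def)
    also have "\<dots> = 0\<^sub>m (a + b) (a + b)"
    proof -
      have "inc (d z) \<in> carrier_mat (a + b) (a + b)"
        using assms z commutator_smult(5)[OF sub0(1)[OF q(1)] inc_carrier[OF z]]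
        by (simp add: induces_def)
      then show ?thesis by (auto intro!: eq_matI)
    qed
    finally show "inc z \<in> V1 \<and> commutator (q - q') (inc z) = 0\<^sub>m (a + b) (a + b)" using inc_odd[OF z] by simp
  qed
  ultimately have "V1 \<subseteq> ?W" using inc_spans unfolding spanned_by_def by blast
  with x show ?thesis by blast
qed

text \<open>The elements of \<open>V0\<close> that induce a derivation are determined up to the annihilator of \<open>V1\<close>, so the target
  is the quotient by the annihilator; \<open>\<pi>\<close> is the quotient map.\<close>

context
  fixes h :: "('l, 'w) superalgebra" and \<pi> :: "'l mat \<Rightarrow> 'w"
  assumes h: "vectorspace class_ring h"
    and \<pi>_hom: "superalgebra_hom id \<G> h \<pi>" and \<pi>_surj: "\<pi> ` carrier \<G> = carrier h"
    and \<pi>_ker: "\<And>Q. Q \<in> carrier \<G> \<Longrightarrow> \<pi> Q = \<zero>\<^bsub>h\<^esub> \<longleftrightarrow>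
      Q \<in> V0 \<and> (\<forall>x\<in>V1. commutator Q x = 0\<^sub>m (a + b) (a + b))"
begin

interpretation h: vectorspace "class_ring :: 'l ring" h by (rule h)
interpretation \<sigma>: field_hom \<sigma> by (rule \<sigma>)

definition super_map :: "('c mat \<Rightarrow> 'c mat) \<times> 'c mat \<Rightarrow> 'w" where
  "super_map = (\<lambda>(d, m). \<pi> ((SOME q. induces q d) + inc m))"

lemma \<pi>_add: "P \<in> carrier \<G> \<Longrightarrow> Q \<in> carrier \<G> \<Longrightarrow> \<pi> (P + Q) = \<pi> P \<oplus>\<^bsub>h\<^esub> \<pi> Q"
  and \<pi>_smult: "P \<in> carrier \<G> \<Longrightarrow> \<pi> (c \<cdot>\<^sub>m P) = c \<odot>\<^bsub>h\<^esub> \<pi> P"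
  and \<pi>_mult: "P \<in> carrier \<G> \<Longrightarrow> Q \<in> carrier \<G> \<Longrightarrow> \<pi> (superbracket a P Q) = \<pi> P \<otimes>\<^bsub>h\<^esub> \<pi> Q"
  and \<pi>_carrier: "P \<in> carrier \<G> \<Longrightarrow> \<pi> P \<in> carrier h"
  and \<pi>_even: "q \<in> V0 \<Longrightarrow> \<pi> q \<in> even_part h" and \<pi>_odd: "x \<in> V1 \<Longrightarrow> \<pi> x \<in> odd_part h"
  using \<pi>_hom by (auto simp: superalgebra_hom_def simps)

lemma \<pi>_minus: assumes P: "P \<in> carrier \<G>" and Q: "Q \<in> carrier \<G>" shows "\<pi> P = \<pi> Q \<longleftrightarrow> \<pi> (P - Q) = \<zero>\<^bsub>h\<^esub>"
proof -
  have e: "P - Q = P + (- 1) \<cdot>\<^sub>m Q"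
    using carrier_mat[OF P] carrier_mat[OF Q] by (auto intro!: eq_matI)
  have "\<pi> (P - Q) = \<pi> P \<oplus>\<^bsub>h\<^esub> (- 1) \<odot>\<^bsub>h\<^esub> \<pi> Q"
    unfolding e \<pi>_add[OF P smult_closed[OF Q]] \<pi>_smult[OF Q] ..
  also have "(- 1) \<odot>\<^bsub>h\<^esub> \<pi> Q = \<ominus>\<^bsub>h\<^esub> \<pi> Q"
    using h.smult_l_minus[of 1 "\<pi> Q"] h.smult_one[of "\<pi> Q"] \<pi>_carrier[OF Q] by (simp add: class_ring_simps)
  finally have *: "\<pi> (P - Q) = \<pi> P \<oplus>\<^bsub>h\<^esub> \<ominus>\<^bsub>h\<^esub> \<pi> Q" .
  show ?thesis
  proof
    assume "\<pi> P = \<pi> Q" then show "\<pi> (P - Q) = \<zero>\<^bsub>h\<^esub>"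
      unfolding * using \<pi>_carrier[OF Q] by (simp add: h.M.r_neg)
  next
    assume "\<pi> (P - Q) = \<zero>\<^bsub>h\<^esub>"
    then have "\<ominus>\<^bsub>h\<^esub> (\<ominus>\<^bsub>h\<^esub> \<pi> Q) = \<pi> P"
      unfolding * using \<pi>_carrier[OF Q] \<pi>_carrier[OF P] by (intro h.M.minus_equality) auto
    then show "\<pi> P = \<pi> Q" using \<pi>_carrier[OF Q] by simp
  qed
qed

lemma super_map_eq:
  assumes q: "induces q d" and m: "m \<in> carrier_mat r s"
  shows "super_map (d, m) = \<pi> (q + inc m)"
proof -
  let ?q = "SOME q. induces q d"
  have q': "induces ?q d" using q by (rule someI)
  have V: "?q \<in> V0" "q \<in> V0" using q q' by (auto simp: induces_def)
  have c: "?q + inc m \<in> carrier \<G>" "q + inc m \<in> carrier \<G>" 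
    using V inc_odd[OF m] unfolding carrier_iff by blast+
  have "?q + inc m - (q + inc m) = ?q - q"
    using sub0(1)[OF V(1)] sub0(1)[OF V(2)] inc_carrier[OF m] by (auto intro!: eq_matI)
  then have "\<pi> (?q + inc m - (q + inc m)) = \<zero>\<^bsub>h\<^esub>"
    using \<pi>_ker[OF even_in[OF sub0(5)[OF V]]] sub0(5)[OF V] induces_unique[OF q' q] by simp
  then have "\<pi> (?q + inc m) = \<pi> (q + inc m)" using \<pi>_minus[OF c] by simp
  then show ?thesis by (simp add: super_map_def)
qed

lemma semisimplifiedE:
  assumes "x \<in> carrier semisimplified"
  obtains d m q where "x = (d, m)" "d \<in> Der" "m \<in> carrier_mat r s" "induces q d" "q \<in> V0" "inc m \<in> V1"
    "q + inc m \<in> carrier \<G>" "super_map x = \<pi> (q + inc m)"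
proof -
  obtain d m where dm: "x = (d, m)" "d \<in> Der" "m \<in> carrier_mat r s"
    using assms by (auto simp: semisimplified_simps)
  obtain q where q: "induces q d" using induces_exists[OF dm(2)] by blast
  then have "q \<in> V0" by (simp add: induces_def)
  then show thesis using that[OF dm q] inc_odd[OF dm(3)] super_map_eq[OF q dm(3)] dm(1)
    unfolding carrier_iff by blast
qed

lemma super_map_hom: "superalgebra_hom \<sigma> semisimplified h super_map"
  unfolding superalgebra_hom_def
proof (intro conjI ballI allI)
  show "super_map \<in> carrier semisimplified \<rightarrow> carrier h"
    using \<pi>_carrier by (auto elim!: semisimplifiedE)
  show "super_map ` even_part semisimplified \<subseteq> even_part h"
  proof clarify
    fix d m assume "(d, m) \<in> even_part semisimplified"
    then have dm: "d \<in> Der" "m = 0\<^sub>m r s" by (auto simp: semisimplified_simps)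
    obtain q where q: "induces q d" using induces_exists[OF dm(1)] by blast
    then have V: "q \<in> V0" by (simp add: induces_def)
    have "super_map (d, m) = \<pi> q"
      using super_map_eq[OF q, of m] dm(2) sub0(1)[OF V] by (simp add: inc_zero)
    then show "super_map (d, m) \<in> even_part h" using \<pi>_even[OF V] by simp
  qed
  show "super_map ` odd_part semisimplified \<subseteq> odd_part h"
  proof clarify
    fix d m assume "(d, m) \<in> odd_part semisimplified"
    then have dm: "d = \<zero>\<^bsub>\<E>\<^esub>" "m \<in> carrier_mat r s" by (auto simp: semisimplified_simps)
    have "super_map (d, m) = \<pi> (inc m)"
      using super_map_eq[OF induces_zero dm(2)] dm inc_carrier[OF dm(2)] by simp
    then show "super_map (d, m) \<in> odd_part h" using \<pi>_odd[OF inc_odd[OF dm(2)]] by simp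
  qed
next
  fix x y assume "x \<in> carrier semisimplified" "y \<in> carrier semisimplified"
  from this(1) obtain d m q where x: "x = (d, m)" "d \<in> Der" "m \<in> carrier_mat r s" "induces q d" "q \<in> V0" "inc m \<in> V1"
    "q + inc m \<in> carrier \<G>" "super_map x = \<pi> (q + inc m)" by (rule semisimplifiedE)
  from \<open>y \<in> carrier semisimplified\<close> obtain e k p where y: "y = (e, k)" "e \<in> Der" "k \<in> carrier_mat r s" "induces p e" "p \<in> V0" "inc k \<in> V1"
    "p + inc k \<in> carrier \<G>" "super_map y = \<pi> (p + inc k)" by (rule semisimplifiedE)
  have "super_map (x \<oplus>\<^bsub>semisimplified\<^esub> y) = super_map (d \<oplus>\<^bsub>\<E>\<^esub> e, m + k)"
    using x y by (simp add: semisimplified_simps)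
  also have "\<dots> = \<pi> (q + p + inc (m + k))"
    by (rule super_map_eq[OF induces_add[OF x(4) y(4)]]) (use x y Der_End in auto)
  also have "q + p + inc (m + k) = q + inc m + (p + inc k)"
    unfolding inc_add[OF x(3) y(3)] by (rule sum_add[symmetric]) (use x y in auto)
  finally show "super_map (x \<oplus>\<^bsub>semisimplified\<^esub> y) = super_map x \<oplus>\<^bsub>h\<^esub> super_map y"
    using x y by (simp add: \<pi>_add)
next
  fix c x assume "x \<in> carrier semisimplified"
  then obtain d m q where x: "x = (d, m)" "d \<in> Der" "m \<in> carrier_mat r s" "induces q d" "q \<in> V0" "inc m \<in> V1"
    "q + inc m \<in> carrier \<G>" "super_map x = \<pi> (q + inc m)" by (rule semisimplifiedE)
  have "super_map (c \<odot>\<^bsub>semisimplified\<^esub> x) = super_map (c \<odot>\<^bsub>\<E>\<^esub> d, map_mat (scale c) m)"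
    using x by (simp add: semisimplified_simps)
  also have "\<dots> = \<pi> (\<sigma> c \<cdot>\<^sub>m q + inc (map_mat (scale c) m))"
    by (rule super_map_eq[OF induces_smult[OF x(4)]]) (use x Der_End in auto)
  also have "\<sigma> c \<cdot>\<^sub>m q + inc (map_mat (scale c) m) = \<sigma> c \<cdot>\<^sub>m (q + inc m)"
    unfolding inc_scale[OF x(3)] by (rule sum_smult[symmetric]) (use x in auto)
  finally show "super_map (c \<odot>\<^bsub>semisimplified\<^esub> x) = \<sigma> c \<odot>\<^bsub>h\<^esub> super_map x"
    using x by (simp add: \<pi>_smult)
next
  fix x y assume "x \<in> carrier semisimplified" "y \<in> carrier semisimplified"
  from this(1) obtain d m q where x: "x = (d, m)" "d \<in> Der" "m \<in> carrier_mat r s" "induces q d" "q \<in> V0" "inc m \<in> V1"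
    "q + inc m \<in> carrier \<G>" "super_map x = \<pi> (q + inc m)" by (rule semisimplifiedE)
  from \<open>y \<in> carrier semisimplified\<close> obtain e k p where y: "y = (e, k)" "e \<in> Der" "k \<in> carrier_mat r s" "induces p e" "p \<in> V0" "inc k \<in> V1"
    "p + inc k \<in> carrier \<G>" "super_map y = \<pi> (p + inc k)" by (rule semisimplifiedE)
  note de = Der_End[OF x(2)] Der_End[OF y(2)]
  have cl: "d k \<in> carrier_mat r s" "e m \<in> carrier_mat r s" using de x y End_closed by auto
  let ?br = "d \<otimes>\<^bsub>\<E>\<^esub> e \<ominus>\<^bsub>\<E>\<^esub> e \<otimes>\<^bsub>\<E>\<^esub> d"
  have br: "?br \<in> carrier \<E>" using End_mult_closed de by simp
  have L: "L_op \<T> m k \<in> carrier \<E>" "L_op \<T> k m \<in> carrier \<E>"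
    using represented_End[OF represented_L_op] x y by auto
  have "x \<otimes>\<^bsub>semisimplified\<^esub> y = (?br \<oplus>\<^bsub>\<E>\<^esub> L_op \<T> m k \<oplus>\<^bsub>\<E>\<^esub> L_op \<T> k m, d k - e m)"
    using x y cl by (simp add: semisimplified_simps minus_ternary_alg)
  also have "?br \<oplus>\<^bsub>\<E>\<^esub> L_op \<T> m k \<oplus>\<^bsub>\<E>\<^esub> L_op \<T> k m = ?br \<oplus>\<^bsub>\<E>\<^esub> der m k"
    unfolding der_def using br L by (simp add: E.M.a_assoc)
  finally have "super_map (x \<otimes>\<^bsub>semisimplified\<^esub> y) = super_map (?br \<oplus>\<^bsub>\<E>\<^esub> der m k, d k - e m)" by simp
  also have "\<dots> = \<pi> (commutator q p + anticommutator (inc m) (inc k) + inc (d k - e m))"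
    by (rule super_map_eq[OF induces_add[OF induces_commutator[OF x(4) y(4) de] induces_der[OF x(3) y(3)] br der_End[OF x(3) y(3)]]])
       (use cl in auto)
  also have "inc (d k - e m) = commutator q (inc k) - commutator p (inc m)"
    unfolding inc_minus[OF cl] using x y by (simp add: induces_def)
  also have "commutator q p + anticommutator (inc m) (inc k) + (commutator q (inc k) - commutator p (inc m)) =
      superbracket a (q + inc m) (p + inc k)"
    by (rule mult_eq[symmetric]) (use x y in auto)
  finally show "super_map (x \<otimes>\<^bsub>semisimplified\<^esub> y) = super_map x \<otimes>\<^bsub>h\<^esub> super_map y"
    using x y by (simp add: \<pi>_mult)
qed

lemma functional_descends:
  assumes add: "\<And>P Q. P \<in> carrier \<G> \<Longrightarrow> Q \<in> carrier \<G> \<Longrightarrow> \<tau> (P + Q) = \<tau> P + \<tau> Q"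
    and smult: "\<And>c P. P \<in> carrier \<G> \<Longrightarrow> \<tau> (c \<cdot>\<^sub>m P) = c * \<tau> P"
    and ker: "\<And>Q. Q \<in> V0 \<Longrightarrow> (\<And>x. x \<in> V1 \<Longrightarrow> commutator Q x = 0\<^sub>m (a + b) (a + b)) \<Longrightarrow> \<tau> Q = 0"
  obtains \<tau>' where "functional h \<tau>'" "\<And>P. P \<in> carrier \<G> \<Longrightarrow> \<tau>' (\<pi> P) = \<tau> P"
proof
  define \<tau>' where "\<tau>' w = \<tau> (SOME P. P \<in> carrier \<G> \<and> \<pi> P = w)" for w
  show *: "\<tau>' (\<pi> P) = \<tau> P" if P: "P \<in> carrier \<G>" for P
  proof -
    define Q where "Q = (SOME Q. Q \<in> carrier \<G> \<and> \<pi> Q = \<pi> P)"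
    have Q: "Q \<in> carrier \<G>" "\<pi> Q = \<pi> P"
      unfolding Q_def using someI[of "\<lambda>Q. Q \<in> carrier \<G> \<and> \<pi> Q = \<pi> P" P] P by auto
    have e: "Q - P = Q + (- 1) \<cdot>\<^sub>m P"
      using carrier_mat[OF P] carrier_mat[OF Q(1)] by (auto intro!: eq_matI)
    have QP: "Q - P \<in> carrier \<G>" unfolding e by (intro add_closed smult_closed P Q)
    have "\<pi> (Q - P) = \<zero>\<^bsub>h\<^esub>" using \<pi>_minus[OF Q(1) P] Q(2) by simp
    then have "\<tau> (Q - P) = 0" using \<pi>_ker[OF QP] ker by blast
    then have "\<tau> Q + (- 1) * \<tau> P = 0"
      unfolding e using add[OF Q(1) smult_closed[OF P]] smult[OF P] by metis
    then show ?thesis unfolding \<tau>'_def Q_def[symmetric] by simp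
  qed
  show "functional h \<tau>'"
    unfolding functional_def
  proof (intro conjI ballI allI)
    fix v w assume "v \<in> carrier h" "w \<in> carrier h"
    then obtain P Q where PQ: "P \<in> carrier \<G>" "Q \<in> carrier \<G>" "v = \<pi> P" "w = \<pi> Q"
      using \<pi>_surj by blast
    show "\<tau>' (v \<oplus>\<^bsub>h\<^esub> w) = \<tau>' v + \<tau>' w"
      unfolding PQ \<pi>_add[OF PQ(1,2), symmetric] using PQ by (simp add: * add add_closed)
  next
    fix c v assume "v \<in> carrier h"
    then obtain P where P: "P \<in> carrier \<G>" "v = \<pi> P" using \<pi>_surj by blast
    show "\<tau>' (c \<odot>\<^bsub>h\<^esub> v) = c * \<tau>' v"
      unfolding P(2) \<pi>_smult[OF P(1), symmetric] using P by (simp add: * smult smult_closed)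
  qed
qed

text \<open>Functionals of \<open>V1\<close> yield functionals of the target in two ways: they can be applied to the odd component,
  or to the bracket of the even component with a fixed \<open>inc z\<close>. Both vanish on the annihilator of \<open>V1\<close>. The
  first kind shows that the odd component of an element vanishes; for an even component that induces \<open>d\<close>, the second
  kind shows \<open>d z = 0\<close> for all \<open>z\<close>.\<close>

lemma super_map_semilinear: "semilinear semisimplified h \<sigma> super_map"
proof (rule semilinear.intro)
  show "vectorspace class_ring semisimplified" by (rule vectorspace_semisimplified)
  show "vectorspace class_ring h" by (rule h)
  note hom = super_map_hom[unfolded superalgebra_hom_def]
  show "super_map x \<in> carrier h" if "x \<in> carrier semisimplified" for x using hom that by blast
  show "super_map (x \<oplus>\<^bsub>semisimplified\<^esub> y) = super_map x \<oplus>\<^bsub>h\<^esub> super_map y"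
    if "x \<in> carrier semisimplified" "y \<in> carrier semisimplified" for x y using hom that by blast
  show "super_map (c \<odot>\<^bsub>semisimplified\<^esub> x) = \<sigma> c \<odot>\<^bsub>h\<^esub> super_map x"
    if "x \<in> carrier semisimplified" for x c using hom that by blast
next
  fix x assume x: "x \<in> carrier semisimplified"
    and sep: "\<And>\<tau>. functional h \<tau> \<Longrightarrow> (\<And>y. y \<in> carrier semisimplified \<Longrightarrow> \<tau> (super_map y) \<in> range \<sigma>) \<Longrightarrow> \<tau> (super_map x) = 0"
  from x obtain d m q where x: "x = (d, m)" "d \<in> Der" "m \<in> carrier_mat r s" "induces q d" "q \<in> V0" "inc m \<in> V1"
    "q + inc m \<in> carrier \<G>" "super_map x = \<pi> (q + inc m)" by (rule semisimplifiedE)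
  have zero: "\<tau> (0\<^sub>m (a + b) (a + b)) = 0" if "functional_on V1 \<tau>" for \<tau>
  proof -
    have "\<tau> (0 \<cdot>\<^sub>m 0\<^sub>m (a + b) (a + b)) = 0 * \<tau> (0\<^sub>m (a + b) (a + b))"
      using that sub1(2) unfolding functional_on_def by blast
    then show ?thesis by simp
  qed
  have "m = 0\<^sub>m r s"
  proof (rule inc_separated[OF x(3)])
    fix \<tau> assume \<tau>: "functional_on V1 \<tau>" and rat: "\<And>m'. m' \<in> carrier_mat r s \<Longrightarrow> \<tau> (inc m') \<in> range \<sigma>"
    let ?t = "\<lambda>P. \<tau> (odd_proj a P)"
    have t: "?t (p + y) = \<tau> y" if "p \<in> V0" "y \<in> V1" for p y using projections[OF that] by simp
    obtain \<tau>' where \<tau>': "functional h \<tau>'" "\<And>P. P \<in> carrier \<G> \<Longrightarrow> \<tau>' (\<pi> P) = ?t P"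
    proof (rule functional_descends)
      fix P Q assume "P \<in> carrier \<G>" "Q \<in> carrier \<G>"
      then obtain p y p' y' where P: "P = p + y" "p \<in> V0" "y \<in> V1" "Q = p' + y'" "p' \<in> V0" "y' \<in> V1"
        unfolding carrier_iff by blast
      show "?t (P + Q) = ?t P + ?t Q"
        unfolding P(1,4) sum_add[OF P(2,3,5,6)] t[OF sub0(3)[OF P(2,5)] sub1(3)[OF P(3,6)]] t[OF P(2,3)] t[OF P(5,6)]
        using \<tau> P unfolding functional_on_def by blast
    next
      fix c P assume "P \<in> carrier \<G>"
      then obtain p y where P: "P = p + y" "p \<in> V0" "y \<in> V1" unfolding carrier_iff by blast
      show "?t (c \<cdot>\<^sub>m P) = c * ?t P"
        unfolding P(1) sum_smult[OF P(2,3)] t[OF sub0(4)[OF P(2)] sub1(4)[OF P(3)]] t[OF P(2,3)]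
        using \<tau> P unfolding functional_on_def by blast
    next
      fix Q assume Q: "Q \<in> V0"
      have "Q + 0\<^sub>m (a + b) (a + b) = Q" using sub0(1)[OF Q] by simp
      then show "?t Q = 0" using t[OF Q sub1(2)] zero[OF \<tau>] by simp
    qed (rule that)
    have "\<tau>' (super_map x) = 0"
    proof (rule sep[OF \<tau>'(1)])
      fix y assume "y \<in> carrier semisimplified"
      then obtain e k p where y: "y = (e, k)" "e \<in> Der" "k \<in> carrier_mat r s" "induces p e" "p \<in> V0" "inc k \<in> V1"
        "p + inc k \<in> carrier \<G>" "super_map y = \<pi> (p + inc k)" by (rule semisimplifiedE)
      show "\<tau>' (super_map y) \<in> range \<sigma>"
        unfolding y(8) \<tau>'(2)[OF y(7)] t[OF y(5,6)] by (rule rat[OF y(3)])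
    qed
    then show "\<tau> (inc m) = 0" unfolding x(8) \<tau>'(2)[OF x(7)] t[OF x(5,6)] .
  qed
  moreover have "d z = 0\<^sub>m r s" if z: "z \<in> carrier_mat r s" for z
  proof (rule inc_separated)
    show "d z \<in> carrier_mat r s" using Der_End[OF x(2)] z End_closed by blast
    fix \<tau> assume \<tau>: "functional_on V1 \<tau>" and rat: "\<And>m'. m' \<in> carrier_mat r s \<Longrightarrow> \<tau> (inc m') \<in> range \<sigma>"
    let ?t = "\<lambda>P. \<tau> (commutator (even_proj a P) (inc z))"
    note iz = inc_odd[OF z] inc_carrier[OF z]
    have t: "?t (p + y) = \<tau> (commutator p (inc z))" if "p \<in> V0" "y \<in> V1" for p y using projections[OF that] by simp
    obtain \<tau>' where \<tau>': "functional h \<tau>'" "\<And>P. P \<in> carrier \<G> \<Longrightarrow> \<tau>' (\<pi> P) = ?t P"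
    proof (rule functional_descends)
      fix P Q assume "P \<in> carrier \<G>" "Q \<in> carrier \<G>"
      then obtain p y p' y' where P: "P = p + y" "p \<in> V0" "y \<in> V1" "Q = p' + y'" "p' \<in> V0" "y' \<in> V1"
        unfolding carrier_iff by blast
      show "?t (P + Q) = ?t P + ?t Q"
        unfolding P(1,4) sum_add[OF P(2,3,5,6)] t[OF sub0(3)[OF P(2,5)] sub1(3)[OF P(3,6)]] t[OF P(2,3)] t[OF P(5,6)]
          commutator_linear(1)[OF sub0(1)[OF P(2)] sub0(1)[OF P(5)] iz(2)]
        using \<tau> closed_01[OF P(2) iz(1)] closed_01[OF P(5) iz(1)] unfolding functional_on_def by blast
    next
      fix c P assume "P \<in> carrier \<G>"
      then obtain p y where P: "P = p + y" "p \<in> V0" "y \<in> V1" unfolding carrier_iff by blast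
      show "?t (c \<cdot>\<^sub>m P) = c * ?t P"
        unfolding P(1) sum_smult[OF P(2,3)] t[OF sub0(4)[OF P(2)] sub1(4)[OF P(3)]] t[OF P(2,3)]
          commutator_smult(1)[OF sub0(1)[OF P(2)] iz(2)]
        using \<tau> closed_01[OF P(2) iz(1)] unfolding functional_on_def by blast
    next
      fix Q assume Q: "Q \<in> V0" and k: "\<And>x. x \<in> V1 \<Longrightarrow> commutator Q x = 0\<^sub>m (a + b) (a + b)"
      have "Q + 0\<^sub>m (a + b) (a + b) = Q" using sub0(1)[OF Q] by simp
      then show "?t Q = 0" using t[OF Q sub1(2)] k[OF iz(1)] zero[OF \<tau>] by simp
    qed (rule that)
    have "\<tau>' (super_map x) = 0"
    proof (rule sep[OF \<tau>'(1)])
      fix y assume "y \<in> carrier semisimplified"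
      then obtain e k p where y: "y = (e, k)" "e \<in> Der" "k \<in> carrier_mat r s" "induces p e" "p \<in> V0" "inc k \<in> V1"
        "p + inc k \<in> carrier \<G>" "super_map y = \<pi> (p + inc k)" by (rule semisimplifiedE)
      have "commutator p (inc z) = inc (e z)" using y(4) z by (simp add: induces_def)
      moreover have "e z \<in> carrier_mat r s" using Der_End[OF y(2)] z End_closed by blast
      ultimately show "\<tau>' (super_map y) \<in> range \<sigma>"
        unfolding y(8) \<tau>'(2)[OF y(7)] t[OF y(5,6)] using rat by simp
    qed
    then show "\<tau> (inc (d z)) = 0" unfolding x(8) \<tau>'(2)[OF x(7)] t[OF x(5,6)]
      using x(4) z by (simp add: induces_def)
  qed
  then have "d = \<zero>\<^bsub>\<E>\<^esub>"
    using Der_End[OF x(2)] unfolding End_simps(4)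
    by (intro extensionalityI[of d "carrier_mat r s"]) (auto simp: End_simps(1))
  ultimately show "x = \<zero>\<^bsub>semisimplified\<^esub>" using x(1) by (simp add: semisimplified_simps)
qed (rule \<sigma>)

text \<open>The image of \<open>M\<close> spans \<open>V1\<close>, the brackets of odd elements span \<open>V0\<close>, and these brackets are bilinear.\<close>

lemma super_map_generates: "carrier h \<subseteq> h.span (super_map ` carrier semisimplified)" (is "_ \<subseteq> ?S")
proof -
  have im: "super_map ` carrier semisimplified \<subseteq> carrier h"
    using super_map_hom unfolding superalgebra_hom_def by blast
  have sub: "submodule class_ring ?S h" by (rule h.span_is_submodule[OF im])
  have own: "super_map x \<in> ?S" if "x \<in> carrier semisimplified" for x
    using h.in_own_span[OF im] that by blast
  have S: "\<zero>\<^bsub>h\<^esub> \<in> ?S" "v \<in> ?S \<Longrightarrow> w \<in> ?S \<Longrightarrow> v \<oplus>\<^bsub>h\<^esub> w \<in> ?S" "v \<in> ?S \<Longrightarrow> c \<odot>\<^bsub>h\<^esub> v \<in> ?S" for v w c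
    using sub by (auto simp: submodule_def)
  let ?N = "a + b"
  have \<pi>0: "\<pi> (0\<^sub>m ?N ?N) = \<zero>\<^bsub>h\<^esub>"
    using \<pi>_ker[OF even_in[OF sub0(2)]] sub0(2) by (simp add: commutator_zero(1) sub1(1))
  have odd: "V1 \<subseteq> {x \<in> V1. \<pi> x \<in> ?S}"
  proof -
    have "mat_subspace ?N {x \<in> V1. \<pi> x \<in> ?S}"
      using V1(1) S unfolding mat_subspace_def
      by (auto simp: \<pi>_add[OF odd_in odd_in] \<pi>_smult[OF odd_in] \<pi>0)
    moreover have "inc ` carrier_mat r s \<subseteq> {x \<in> V1. \<pi> x \<in> ?S}"
    proof clarify
      fix m :: "'c mat" assume m: "m \<in> carrier_mat r s"
      have "super_map (\<zero>\<^bsub>\<E>\<^esub>, m) = \<pi> (inc m)"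
        using super_map_eq[OF induces_zero m] inc_carrier[OF m] by simp
      moreover have "(\<zero>\<^bsub>\<E>\<^esub>, m) \<in> carrier semisimplified" using m Der_closed(1) by (simp add: semisimplified_simps)
      ultimately show "inc m \<in> V1 \<and> \<pi> (inc m) \<in> ?S" using own inc_odd[OF m] by metis
    qed
    ultimately show ?thesis using inc_spans unfolding spanned_by_def by blast
  qed
  have anti: "\<pi> (anticommutator x y) \<in> ?S" if x: "x \<in> V1" and y: "y \<in> V1" for x y
  proof -
    have 1: "V1 \<subseteq> {x \<in> V1. \<pi> (anticommutator x (inc k)) \<in> ?S}" if k: "k \<in> carrier_mat r s" for k
    proof -
      note ki = inc_odd[OF k] inc_carrier[OF k]
      have "mat_subspace ?N {x \<in> V1. \<pi> (anticommutator x (inc k)) \<in> ?S}"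
        using V1(1) S ki unfolding mat_subspace_def
        by (auto simp: commutator_linear(4)[of _ ?N] commutator_smult(3)[of _ ?N] commutator_zero(3) sub1(1) \<pi>_add[OF even_in even_in] \<pi>_smult[OF even_in] closed_11 \<pi>0)
      moreover have "inc ` carrier_mat r s \<subseteq> {x \<in> V1. \<pi> (anticommutator x (inc k)) \<in> ?S}"
      proof clarify
        fix m :: "'c mat" assume m: "m \<in> carrier_mat r s"
        have A: "anticommutator (inc m) (inc k) \<in> V0" by (intro closed_11 inc_odd m k)
        have "super_map (der m k, 0\<^sub>m r s) = \<pi> (anticommutator (inc m) (inc k))"
          using super_map_eq[OF induces_der[OF m k], of "0\<^sub>m r s"] sub0(1)[OF A] by (simp add: inc_zero)
        moreover have "(der m k, 0\<^sub>m r s) \<in> carrier semisimplified" using der_Der[OF m k] by (simp add: semisimplified_simps)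
        ultimately show "inc m \<in> V1 \<and> \<pi> (anticommutator (inc m) (inc k)) \<in> ?S" using own inc_odd[OF m] by metis
      qed
      ultimately show ?thesis using inc_spans unfolding spanned_by_def by blast
    qed
    have "mat_subspace ?N {y \<in> V1. \<pi> (anticommutator x y) \<in> ?S}"
      using V1(1) S x sub1(1)[OF x] unfolding mat_subspace_def
      by (auto simp: commutator_linear(5)[of _ ?N] commutator_smult(4)[of _ ?N] commutator_zero(4) sub1(1) \<pi>_add[OF even_in even_in] \<pi>_smult[OF even_in] closed_11 \<pi>0)
    moreover have "inc ` carrier_mat r s \<subseteq> {y \<in> V1. \<pi> (anticommutator x y) \<in> ?S}"
      using 1 x inc_odd by blast
    ultimately have "V1 \<subseteq> {y \<in> V1. \<pi> (anticommutator x y) \<in> ?S}" using inc_spans unfolding spanned_by_def by blast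
    with y show ?thesis by blast
  qed
  have even: "V0 \<subseteq> {x \<in> V0. \<pi> x \<in> ?S}"
  proof -
    have "mat_subspace ?N {x \<in> V0. \<pi> x \<in> ?S}"
      using V0(1) S unfolding mat_subspace_def
      by (auto simp: \<pi>_add[OF even_in even_in] \<pi>_smult[OF even_in] \<pi>0)
    moreover have "{anticommutator x y | x y. x \<in> V1 \<and> y \<in> V1} \<subseteq> {x \<in> V0. \<pi> x \<in> ?S}"
      using anti closed_11 by blast
    ultimately show ?thesis using generated unfolding spanned_by_def by blast
  qed
  show ?thesis
  proof
    fix w assume "w \<in> carrier h"
    then obtain P where P: "P \<in> carrier \<G>" "w = \<pi> P" using \<pi>_surj by blast
    then obtain q x where q: "P = q + x" "q \<in> V0" "x \<in> V1" unfolding carrier_iff by blast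
    have "w = \<pi> q \<oplus>\<^bsub>h\<^esub> \<pi> x" using P q \<pi>_add[OF even_in odd_in] by simp
    then show "w \<in> ?S" using S(2) even odd q by blast
  qed
qed

end

end

section \<open>Block matrices\<close>

definition block_diag :: "'a::zero mat \<Rightarrow> 'a mat \<Rightarrow> 'a mat" where
  "block_diag P D = four_block_mat P (0\<^sub>m (dim_row P) (dim_col D)) (0\<^sub>m (dim_row D) (dim_col P)) D"

definition block_off :: "'a::zero mat \<Rightarrow> 'a mat \<Rightarrow> 'a mat" where
  "block_off W Y = four_block_mat (0\<^sub>m (dim_row W) (dim_col Y)) W Y (0\<^sub>m (dim_row Y) (dim_col W))"

lemma block_carrier [simp]:
  "P \<in> carrier_mat a a \<Longrightarrow> D \<in> carrier_mat b b \<Longrightarrow> block_diag P D \<in> carrier_mat (a + b) (a + b)"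
  "W \<in> carrier_mat a b \<Longrightarrow> Y \<in> carrier_mat b a \<Longrightarrow> block_off W Y \<in> carrier_mat (a + b) (a + b)"
  by (auto simp: block_diag_def block_off_def)

lemma block_dims [simp]:
  "dim_row (block_diag P D) = dim_row P + dim_row D" "dim_col (block_diag P D) = dim_col P + dim_col D"
  "dim_row (block_off W Y) = dim_row W + dim_row Y" "dim_col (block_off W Y) = dim_col Y + dim_col W"
  by (auto simp: block_diag_def block_off_def)

lemma block_diag_inject:
  assumes "P \<in> carrier_mat a a" "D \<in> carrier_mat b b" "P' \<in> carrier_mat a a" "D' \<in> carrier_mat b b"
  shows "block_diag P D = block_diag P' D' \<longleftrightarrow> P = P' \<and> D = D'"
proof
  assume eq: "block_diag P D = block_diag P' D'"
  have [simp]: "dim_row P = a" "dim_col P = a" "dim_row D = b" "dim_col D = b"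
    "dim_row P' = a" "dim_col P' = a" "dim_row D' = b" "dim_col D' = b" using assms by auto
  have "P $$ (i, j) = P' $$ (i, j)" if "i < a" "j < a" for i j
    using arg_cong[OF eq, of "\<lambda>Q. Q $$ (i, j)"] that by (simp add: block_diag_def)
  moreover have "D $$ (i, j) = D' $$ (i, j)" if "i < b" "j < b" for i j
    using arg_cong[OF eq, of "\<lambda>Q. Q $$ (a + i, a + j)"] that by (simp add: block_diag_def)
  ultimately show "P = P' \<and> D = D'" by (auto intro!: eq_matI)
qed auto

lemma block_off_inject:
  assumes "W \<in> carrier_mat a b" "Y \<in> carrier_mat b a" "W' \<in> carrier_mat a b" "Y' \<in> carrier_mat b a"
  shows "block_off W Y = block_off W' Y' \<longleftrightarrow> W = W' \<and> Y = Y'"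
proof
  assume eq: "block_off W Y = block_off W' Y'"
  have [simp]: "dim_row W = a" "dim_col W = b" "dim_row Y = b" "dim_col Y = a"
    "dim_row W' = a" "dim_col W' = b" "dim_row Y' = b" "dim_col Y' = a" using assms by auto
  have "W $$ (i, j) = W' $$ (i, j)" if "i < a" "j < b" for i j
    using arg_cong[OF eq, of "\<lambda>Q. Q $$ (i, a + j)"] that by (simp add: block_off_def)
  moreover have "Y $$ (i, j) = Y' $$ (i, j)" if "i < b" "j < a" for i j
    using arg_cong[OF eq, of "\<lambda>Q. Q $$ (a + i, j)"] that by (simp add: block_off_def)
  ultimately show "W = W' \<and> Y = Y'" by (auto intro!: eq_matI)
qed auto

lemma block_mult:
  fixes P P' :: "'a::ring mat"
  assumes "P \<in> carrier_mat a a" "D \<in> carrier_mat b b" "P' \<in> carrier_mat a a" "D' \<in> carrier_mat b b"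
    "W \<in> carrier_mat a b" "Y \<in> carrier_mat b a" "W' \<in> carrier_mat a b" "Y' \<in> carrier_mat b a"
  shows "block_diag P D * block_diag P' D' = block_diag (P * P') (D * D')"
    "block_diag P D * block_off W Y = block_off (P * W) (D * Y)"
    "block_off W Y * block_diag P D = block_off (W * D) (Y * P)"
    "block_off W Y * block_off W' Y' = block_diag (W * Y') (Y * W')"
proof -
  note c = assms mult_carrier_mat[OF assms(1,3)] mult_carrier_mat[OF assms(2,4)] mult_carrier_mat[OF assms(1,5)]
    mult_carrier_mat[OF assms(2,6)] mult_carrier_mat[OF assms(5,2)] mult_carrier_mat[OF assms(6,1)]
    mult_carrier_mat[OF assms(5,8)] mult_carrier_mat[OF assms(6,7)]
  note d = c[THEN carrier_matD(1)] c[THEN carrier_matD(2)]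
  note z = c[THEN left_mult_zero_mat] c[THEN right_mult_zero_mat] c[THEN left_add_zero_mat] c[THEN right_add_zero_mat]
  show "block_diag P D * block_diag P' D' = block_diag (P * P') (D * D')"
    "block_diag P D * block_off W Y = block_off (P * W) (D * Y)"
    "block_off W Y * block_diag P D = block_off (W * D) (Y * P)"
    "block_off W Y * block_off W' Y' = block_diag (W * Y') (Y * W')"
    unfolding block_diag_def block_off_def d
    by (subst mult_four_block_mat[of _ a a _ b _ b], auto simp: c z)+
qed

lemma block_transpose:
  assumes "P \<in> carrier_mat a a" "D \<in> carrier_mat b b" "W \<in> carrier_mat a b" "Y \<in> carrier_mat b a"
  shows "transpose_mat (block_diag P D) = block_diag (transpose_mat P) (transpose_mat D)"
    "transpose_mat (block_off W Y) = block_off (transpose_mat Y) (transpose_mat W)"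
  using assms by (auto simp: block_diag_def block_off_def intro!: eq_matI)

lemma block_linear:
  fixes P P' :: "'a::ring_1 mat"
  assumes "P \<in> carrier_mat a a" "D \<in> carrier_mat b b" "P' \<in> carrier_mat a a" "D' \<in> carrier_mat b b"
    "W \<in> carrier_mat a b" "Y \<in> carrier_mat b a" "W' \<in> carrier_mat a b" "Y' \<in> carrier_mat b a"
  shows "block_diag P D + block_diag P' D' = block_diag (P + P') (D + D')"
    "block_diag P D - block_diag P' D' = block_diag (P - P') (D - D')"
    "c \<cdot>\<^sub>m block_diag P D = block_diag (c \<cdot>\<^sub>m P) (c \<cdot>\<^sub>m D)"
    "block_off W Y + block_off W' Y' = block_off (W + W') (Y + Y')"
    "block_off W Y - block_off W' Y' = block_off (W - W') (Y - Y')"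
    "c \<cdot>\<^sub>m block_off W Y = block_off (c \<cdot>\<^sub>m W) (c \<cdot>\<^sub>m Y)"
  using assms by (auto simp: block_diag_def block_off_def intro!: eq_matI)

lemma block_zero: "block_diag (0\<^sub>m a a) (0\<^sub>m b b) = 0\<^sub>m (a + b) (a + b)" "block_off (0\<^sub>m a b) (0\<^sub>m b a) = 0\<^sub>m (a + b) (a + b)"
  by (auto simp: block_diag_def block_off_def intro!: eq_matI)

lemma block_diag_gl_even: "P \<in> carrier_mat a a \<Longrightarrow> D \<in> carrier_mat b b \<Longrightarrow> block_diag P D \<in> gl_even a b"
  by (auto simp: gl_even_def even_proj_def block_diag_def intro!: eq_matI)

lemma block_off_gl_odd: "W \<in> carrier_mat a b \<Longrightarrow> Y \<in> carrier_mat b a \<Longrightarrow> block_off W Y \<in> gl_odd a b"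
  by (auto simp: gl_odd_def odd_proj_def block_off_def intro!: eq_matI)

lemma gl_evenE:
  assumes Q: "Q \<in> gl_even a b"
  obtains P D where "P \<in> carrier_mat a a" "D \<in> carrier_mat b b" "Q = block_diag P D"
proof
  let ?P = "mat a a (\<lambda>(i, j). Q $$ (i, j))" and ?D = "mat b b (\<lambda>(i, j). Q $$ (a + i, a + j))"
  show "Q = block_diag ?P ?D"
    using gl_evenD[OF Q] gl_even_index[OF Q] by (intro eq_matI) (auto simp: block_diag_def)
qed auto

lemma gl_oddE:
  assumes Q: "Q \<in> gl_odd a b"
  obtains W Y where "W \<in> carrier_mat a b" "Y \<in> carrier_mat b a" "Q = block_off W Y"
proof
  let ?W = "mat a b (\<lambda>(i, j). Q $$ (i, a + j))" and ?Y = "mat b a (\<lambda>(i, j). Q $$ (a + i, j))"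
  show "Q = block_off ?W ?Y"
    using gl_oddD[OF Q] gl_odd_index[OF Q] by (intro eq_matI) (auto simp: block_off_def)
qed auto

lemma block_brackets:
  fixes P P' :: "'a::ring_1 mat"
  assumes "P \<in> carrier_mat a a" "D \<in> carrier_mat b b" "P' \<in> carrier_mat a a" "D' \<in> carrier_mat b b"
    "W \<in> carrier_mat a b" "Y \<in> carrier_mat b a" "W' \<in> carrier_mat a b" "Y' \<in> carrier_mat b a"
  shows "commutator (block_diag P D) (block_diag P' D') = block_diag (commutator P P') (commutator D D')"
    "commutator (block_diag P D) (block_off W Y) = block_off (P * W - W * D) (D * Y - Y * P)"
    "anticommutator (block_off W Y) (block_off W' Y') = block_diag (W * Y' + W' * Y) (Y * W' + Y' * W)"
proof -
  note m = block_mult[OF assms] block_mult[OF assms(3,4,1,2,7,8,5,6)]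
  show "commutator (block_diag P D) (block_diag P' D') = block_diag (commutator P P') (commutator D D')"
    unfolding commutator_def m by (rule block_linear(2)[where a=a and b=b]) (use assms in \<open>auto intro: mult_carrier_mat\<close>)
  show "commutator (block_diag P D) (block_off W Y) = block_off (P * W - W * D) (D * Y - Y * P)"
    unfolding commutator_def m by (rule block_linear(5)[where a=a and b=b]) (use assms in \<open>auto intro: mult_carrier_mat\<close>)
  show "anticommutator (block_off W Y) (block_off W' Y') = block_diag (W * Y' + W' * Y) (Y * W' + Y' * W)"
    unfolding anticommutator_def m by (rule block_linear(1)[where a=a and b=b]) (use assms in \<open>auto intro: mult_carrier_mat\<close>)
qed

definition unit_mat :: "nat \<Rightarrow> nat \<Rightarrow> nat \<Rightarrow> nat \<Rightarrow> 'a::{zero,one} mat" where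
  "unit_mat p q k l = mat p q (\<lambda>(i, j). if i = k \<and> j = l then 1 else 0)"

lemma unit_mat_carrier [simp]: "unit_mat p q k l \<in> carrier_mat p q"
  "dim_row (unit_mat p q k l) = p" "dim_col (unit_mat p q k l) = q"
  by (simp_all add: unit_mat_def)

lemma mat_induct_units [consumes 1, case_names zero add smult unit]:
  fixes M :: "'a::field mat"
  assumes M: "M \<in> carrier_mat p q" and zero: "Pr (0\<^sub>m p q)"
    and add: "\<And>A B. A \<in> carrier_mat p q \<Longrightarrow> B \<in> carrier_mat p q \<Longrightarrow> Pr A \<Longrightarrow> Pr B \<Longrightarrow> Pr (A + B)"
    and smult: "\<And>c A. A \<in> carrier_mat p q \<Longrightarrow> Pr A \<Longrightarrow> Pr (c \<cdot>\<^sub>m A)"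
    and unit: "\<And>i j. i < p \<Longrightarrow> j < q \<Longrightarrow> Pr (unit_mat p q i j)"
  shows "Pr M"
proof (cases "q = 0")
  case True
  then have "M = 0\<^sub>m p q" using M by (auto intro!: eq_matI)
  then show ?thesis using zero by simp
next
  case False
  \<comment> \<open>The entries of \<open>M\<close> are added one by one in row-major order.\<close>
  define tr where "tr t = mat p q (\<lambda>(i, j). if i * q + j < t then M $$ (i, j) else 0)" for t
  have "Pr (tr t)" if "t \<le> p * q" for t
    using that
  proof (induction t)
    case 0
    have "tr 0 = 0\<^sub>m p q" by (auto simp: tr_def intro!: eq_matI)
    then show ?case using zero by simp
  next
    case (Suc t)
    let ?i = "t div q" and ?j = "t mod q"
    have j: "?j < q" using False by simp
    have i: "?i < p" using Suc.prems False by (simp add: less_mult_imp_div_less)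
    have inj: "i * q + j' = t \<longleftrightarrow> i = ?i \<and> j' = ?j" if "j' < q" for i j'
      using that by auto
    have "tr (Suc t) = tr t + M $$ (?i, ?j) \<cdot>\<^sub>m unit_mat p q ?i ?j"
      by (rule eq_matI) (auto simp: tr_def unit_mat_def less_Suc_eq inj simp del: div_mult_mod_eq)
    moreover have "tr t \<in> carrier_mat p q" by (simp add: tr_def)
    ultimately show ?case using Suc add smult unit[OF i j] by simp
  qed
  moreover have "tr (p * q) = M"
  proof (rule eq_matI)
    fix i j assume "i < dim_row M" "j < dim_col M"
    then have ij: "i < p" "j < q" using M by auto
    then have "i * q + j < Suc i * q" by simp
    also have "\<dots> \<le> p * q" using ij(1) by (intro mult_le_mono1) simp
    finally show "tr (p * q) $$ (i, j) = M $$ (i, j)" using ij by (simp add: tr_def)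
  qed (use M in \<open>auto simp: tr_def\<close>)
  ultimately show ?thesis by force
qed

lemma unit_mat_mult:
  "i < p \<Longrightarrow> j < q \<Longrightarrow> k < q \<Longrightarrow> l < t \<Longrightarrow>
    unit_mat p q i j * unit_mat q t k l = (if j = k then unit_mat p t i l else 0\<^sub>m p t :: 'a::ring_1 mat)"
  by (rule eq_matI) (auto simp: unit_mat_def scalar_prod_def if_distrib[of "\<lambda>u. u * _"] sum.delta cong: if_cong)

lemma unit_mat_transpose: "transpose_mat (unit_mat p q i j) = unit_mat q p j i"
  by (rule eq_matI) (auto simp: unit_mat_def)

lemma index_mult_unit_right:
  "M \<in> carrier_mat p p \<Longrightarrow> i < p \<Longrightarrow> k < q \<Longrightarrow> j < p \<Longrightarrow> l < q \<Longrightarrow>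
    (M * unit_mat p q i k) $$ (j, l) = (if l = k then M $$ (j, i) else (0::'a::ring_1))"
  by (auto simp: unit_mat_def scalar_prod_def if_distrib[of "\<lambda>u. _ * u"] sum.delta cong: if_cong)

lemma index_mult_unit_left:
  "M \<in> carrier_mat q q \<Longrightarrow> i < p \<Longrightarrow> k < q \<Longrightarrow> j < p \<Longrightarrow> l < q \<Longrightarrow>
    (unit_mat p q i k * M) $$ (j, l) = (if j = i then M $$ (k, l) else (0::'a::ring_1))"
  by (auto simp: unit_mat_def scalar_prod_def if_distrib[of "\<lambda>u. u * _"] sum.delta cong: if_cong)

text \<open>A form of Schur's lemma: inserting matrix units for \<open>W\<close> shows that off-diagonal entries of \<open>P\<close> and \<open>D\<close> vanish and
  that all diagonal entries coincide.\<close>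

lemma intertwiner_scalar:
  fixes P D :: "'a::field mat"
  assumes P: "P \<in> carrier_mat a a" and D: "D \<in> carrier_mat b b" and ab: "a \<ge> 1" "b \<ge> 1"
    and comm: "\<And>W. W \<in> carrier_mat a b \<Longrightarrow> P * W = W * D"
  obtains c where "P = c \<cdot>\<^sub>m 1\<^sub>m a" "D = c \<cdot>\<^sub>m 1\<^sub>m b"
proof
  have e: "(if l = k then P $$ (j, i) else 0) = (if j = i then D $$ (k, l) else 0)"
    if "i < a" "k < b" "j < a" "l < b" for i j k l
    using index_mult_unit_right[OF P that] index_mult_unit_left[OF D that] comm[OF unit_mat_carrier(1), of i k] by simp
  show "P = P $$ (0, 0) \<cdot>\<^sub>m 1\<^sub>m a"
  proof (rule eq_matI)
    fix j i assume "j < dim_row (P $$ (0, 0) \<cdot>\<^sub>m 1\<^sub>m a)" "i < dim_col (P $$ (0, 0) \<cdot>\<^sub>m 1\<^sub>m a)"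
    then show "P $$ (j, i) = (P $$ (0, 0) \<cdot>\<^sub>m 1\<^sub>m a) $$ (j, i)"
      using e[of i 0 j 0] e[of 0 0 0 0] ab by auto
  qed (use P in auto)
  show "D = P $$ (0, 0) \<cdot>\<^sub>m 1\<^sub>m b"
  proof (rule eq_matI)
    fix k l assume "k < dim_row (P $$ (0, 0) \<cdot>\<^sub>m 1\<^sub>m b)" "l < dim_col (P $$ (0, 0) \<cdot>\<^sub>m 1\<^sub>m b)"
    then show "D $$ (k, l) = (P $$ (0, 0) \<cdot>\<^sub>m 1\<^sub>m b) $$ (k, l)"
      using e[of 0 k 0 l] ab by auto
  qed (use D in auto)
qed

section \<open>Orthosymplectic superalgebras of pairs of forms\<close>

lemma transpose_uminus: "transpose_mat (- A) = - transpose_mat A"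
  by (rule eq_matI) auto

lemma transpose_mult': "dim_col A = dim_row B \<Longrightarrow> transpose_mat (A * B) = transpose_mat B * transpose_mat (A :: 'a::comm_ring_1 mat)"
  by (rule transpose_mult[of _ "dim_row A" "dim_col A" _ "dim_col B"]) auto

lemma transpose_add': "dim_row A = dim_row B \<Longrightarrow> dim_col A = dim_col B \<Longrightarrow> transpose_mat (A + B) = transpose_mat A + transpose_mat B"
  by (rule eq_matI) auto

lemma transpose_minus': "dim_row A = dim_row B \<Longrightarrow> dim_col A = dim_col B \<Longrightarrow> transpose_mat (A - B) = transpose_mat A - transpose_mat B"
  by (rule eq_matI) auto

lemma mat_eq_uminus: "A = - B \<longleftrightarrow> A + B = 0\<^sub>m p q" if "A \<in> carrier_mat p q" "B \<in> carrier_mat p q" for A B :: "'a::group_add mat"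
proof
  assume eq: "A + B = 0\<^sub>m p q"
  show "A = - B"
  proof (rule eq_matI)
    fix i j assume ij: "i < dim_row (- B)" "j < dim_col (- B)"
    then have "(A + B) $$ (i, j) = 0" using eq that by simp
    then show "A $$ (i, j) = (- B) $$ (i, j)" using ij by (simp add: eq_neg_iff_add_eq_0)
  qed (use that in auto)
qed (use that in \<open>auto intro!: eq_matI\<close>)

text \<open>The inverses of the forms \<open>S\<close> and \<open>A\<close> are parameters, the second one as \<open>K = - A\<^sup>-\<^sup>1\<close>. With this sign
  the lower left block of an odd element is \<open>- K W\<^sup>T S\<close> when the upper right block is \<open>W\<close>, in accordance with
  the blocks \<open>x\<close> and \<open>- J x\<^sup>* G\<close> for \<open>M\<close>.\<close>

locale osp_data =
  fixes a b :: nat and S SI A K :: "'l::field mat"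
  assumes two: "(2::'l) \<noteq> 0" and ab: "a \<ge> 1" "b \<ge> 1"
    and S: "S \<in> carrier_mat a a" "transpose_mat S = S" "SI \<in> carrier_mat a a" "S * SI = 1\<^sub>m a" "SI * S = 1\<^sub>m a"
    and A: "A \<in> carrier_mat b b" "transpose_mat A = - A"
    and K: "K \<in> carrier_mat b b" "A * K = - 1\<^sub>m b" "K * A = - 1\<^sub>m b"
begin

lemma dims [simp]: "dim_row S = a" "dim_col S = a" "dim_row SI = a" "dim_col SI = a"
  "dim_row A = b" "dim_col A = b" "dim_row K = b" "dim_col K = b"
  using S A K by auto

lemma cancel:
  "dim_row C = a \<Longrightarrow> S * (SI * C) = C" "dim_row C = a \<Longrightarrow> SI * (S * C) = C"
  "dim_row C = b \<Longrightarrow> A * (K * C) = - C" "dim_row C = b \<Longrightarrow> K * (A * C) = - C"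
proof -
  show "dim_row C = a \<Longrightarrow> S * (SI * C) = C" using mult_assoc'[of S SI C] S(4) by simp
  show "dim_row C = a \<Longrightarrow> SI * (S * C) = C" using mult_assoc'[of SI S C] S(5) by simp
  show "dim_row C = b \<Longrightarrow> A * (K * C) = - C" using mult_assoc'[of A K C] K(2) by simp
  show "dim_row C = b \<Longrightarrow> K * (A * C) = - C" using mult_assoc'[of K A C] K(3) by simp
qed

lemma SI_symmetric: "transpose_mat SI = SI"
proof -
  have "transpose_mat SI * S = transpose_mat (S * SI)" by (simp add: transpose_mult' S(2) del: S(4))
  then have "transpose_mat SI * S = 1\<^sub>m a" unfolding S(4) by simp
  then have "transpose_mat SI * S * SI = SI" by (simp add: left_mult_one_mat[OF S(3)])
  moreover have "transpose_mat SI * S * SI = transpose_mat SI * (S * SI)" by (rule mult_assoc') simp_all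
  ultimately show ?thesis unfolding S(4) by (simp add: right_mult_one_mat[of _ a a])
qed

lemma K_alternating: "transpose_mat K = - K"
proof -
  have "transpose_mat (A * K) * K = - K" unfolding K(2) by (simp add: transpose_uminus left_mult_one_mat[OF K(1)])
  moreover have "transpose_mat (A * K) * K = - transpose_mat K * (A * K)"
    by (simp add: transpose_mult' A(2) mat_ring)
  ultimately show ?thesis unfolding K(2) by (simp add: right_mult_one_mat[of _ b b])
qed

definition rho :: "'l mat \<Rightarrow> 'l mat" where "rho W = K * transpose_mat W * S"

lemma rho_carrier [simp]: "W \<in> carrier_mat a b \<Longrightarrow> rho W \<in> carrier_mat b a"
  by (rule carrier_matI) (simp_all add: rho_def)

lemma rho_dims [simp]: "dim_row (rho W) = b" "dim_col (rho W) = a"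
  by (simp_all add: rho_def)

definition V0 :: "'l mat set" where
  "V0 = {block_diag P D | P D. P \<in> carrier_mat a a \<and> D \<in> carrier_mat b b \<and>
     transpose_mat P * S = - (S * P) \<and> transpose_mat D * A = - (A * D)}"

definition V1 :: "'l mat set" where
  "V1 = {block_off W (- rho W) | W. W \<in> carrier_mat a b}"

lemma osp_form_eq: "osp_form a b S A = matrix_superalgebra a b V0 V1"
proof -
  let ?B = "four_block_mat S (0\<^sub>m a b) (0\<^sub>m b a) A" 
  let ?P = "four_block_mat (1\<^sub>m a) (0\<^sub>m a b) (0\<^sub>m b a) (- 1\<^sub>m b) :: 'l mat"
  let ?Z = "0\<^sub>m (a + b) (a + b) :: 'l mat"
  have B: "?B = block_diag S A" by (simp add: block_diag_def)
  have P: "?P = block_diag (1\<^sub>m a) (- 1\<^sub>m b)" by (simp add: block_diag_def)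
  have PB: "?P * ?B = block_diag S (- A)"
    unfolding B P
    by (subst block_mult(1)[of _ a _ b _ _ "0\<^sub>m a b" "0\<^sub>m b a" "0\<^sub>m a b" "0\<^sub>m b a"])
       (use S A in \<open>auto simp: left_mult_one_mat[OF S(1)] left_mult_one_mat[OF A(1)]\<close>)
  have even: "transpose_mat (block_diag P D) * ?B + ?B * block_diag P D = ?Z \<longleftrightarrow>
      transpose_mat P * S = - (S * P) \<and> transpose_mat D * A = - (A * D)"
    if c: "P \<in> carrier_mat a a" "D \<in> carrier_mat b b" for P D
  proof -
    have t: "transpose_mat P \<in> carrier_mat a a" "transpose_mat D \<in> carrier_mat b b" using c by auto
    note m = mult_carrier_mat[OF t(1) S(1)] mult_carrier_mat[OF t(2) A(1)] mult_carrier_mat[OF S(1) c(1)] mult_carrier_mat[OF A(1) c(2)]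
    have "transpose_mat (block_diag P D) * ?B + ?B * block_diag P D =
       block_diag (transpose_mat P * S + S * P) (transpose_mat D * A + A * D)"
      unfolding B block_transpose(1)[OF c zero_carrier_mat zero_carrier_mat]
        block_mult(1)[OF t S(1) A(1) zero_carrier_mat zero_carrier_mat zero_carrier_mat zero_carrier_mat]
        block_mult(1)[OF S(1) A(1) c zero_carrier_mat zero_carrier_mat zero_carrier_mat zero_carrier_mat]
      by (rule block_linear(1)[OF m zero_carrier_mat zero_carrier_mat zero_carrier_mat zero_carrier_mat])
    also have "\<dots> = ?Z \<longleftrightarrow> transpose_mat P * S + S * P = 0\<^sub>m a a \<and> transpose_mat D * A + A * D = 0\<^sub>m b b"
      unfolding block_zero(1)[symmetric]
      by (rule block_diag_inject[OF add_carrier_mat[OF m(3)] add_carrier_mat[OF m(4)] zero_carrier_mat zero_carrier_mat])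
    also have "\<dots> \<longleftrightarrow> transpose_mat P * S = - (S * P) \<and> transpose_mat D * A = - (A * D)"
      using mat_eq_uminus[OF m(1,3)] mat_eq_uminus[OF m(2,4)] by simp
    finally show ?thesis .
  qed
  have odd: "transpose_mat (block_off W Y) * ?B + ?P * ?B * block_off W Y = ?Z \<longleftrightarrow> Y = - rho W"
    if c: "W \<in> carrier_mat a b" "Y \<in> carrier_mat b a" for W Y
  proof -
    have [simp]: "dim_row W = a" "dim_col W = b" "dim_row Y = b" "dim_col Y = a" using c by auto
    have t: "transpose_mat W \<in> carrier_mat b a" "transpose_mat Y \<in> carrier_mat a b" using c by auto
    have A': "- A \<in> carrier_mat b b" using A by simp
    note m = mult_carrier_mat[OF t(2) A(1)] mult_carrier_mat[OF t(1) S(1)] mult_carrier_mat[OF S(1) c(1)] mult_carrier_mat[OF A' c(2)]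
    have "transpose_mat (block_off W Y) * ?B + ?P * ?B * block_off W Y =
       block_off (transpose_mat Y * A + S * W) (transpose_mat W * S + (- A) * Y)"
      unfolding PB unfolding B block_transpose(2)[OF zero_carrier_mat zero_carrier_mat c]
        block_mult(3)[OF S(1) A(1) zero_carrier_mat zero_carrier_mat t(2,1) zero_carrier_mat zero_carrier_mat]
        block_mult(2)[OF S(1) A' zero_carrier_mat zero_carrier_mat c zero_carrier_mat zero_carrier_mat]
      by (rule block_linear(4)[OF zero_carrier_mat zero_carrier_mat zero_carrier_mat zero_carrier_mat m])
    also have "\<dots> = ?Z \<longleftrightarrow> transpose_mat Y * A + S * W = 0\<^sub>m a b \<and> transpose_mat W * S + (- A) * Y = 0\<^sub>m b a"
      unfolding block_zero(2)[symmetric]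
      by (rule block_off_inject[OF add_carrier_mat[OF m(3)] add_carrier_mat[OF m(4)] zero_carrier_mat zero_carrier_mat])
    also have "\<dots> \<longleftrightarrow> transpose_mat Y * A = - (S * W) \<and> transpose_mat W * S = A * Y"
      using mat_eq_uminus[OF m(1,3)] mat_eq_uminus[OF m(2,4)] by simp
    also have "\<dots> \<longleftrightarrow> Y = - rho W"
    proof (intro iffI conjI)
      assume "transpose_mat Y * A = - (S * W) \<and> transpose_mat W * S = A * Y"
      then have "K * (transpose_mat W * S) = K * (A * Y)" by simp
      then have "K * (transpose_mat W * S) = - Y" by (simp add: cancel)
      then have "- (K * (transpose_mat W * S)) = - (- Y)" by (rule arg_cong)
      then show "Y = - rho W" by (simp add: rho_def mat_ring)
    next
      assume Y: "Y = - rho W"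
      show "transpose_mat W * S = A * Y" unfolding Y by (simp add: rho_def mat_ring cancel)
      have "transpose_mat Y * A = S * (W * (K * A))"
        unfolding Y by (simp add: rho_def mat_ring transpose_uminus transpose_mult' S(2) K_alternating)
      then show "transpose_mat Y * A = - (S * W)" by (simp add: K(3) right_mult_one_mat[OF c(1)])
    qed
    finally show ?thesis .
  qed
  have "{Q \<in> gl_even a b. transpose_mat Q * ?B + ?B * Q = ?Z} = V0"
  proof (intro equalityI subsetI)
    fix Q assume "Q \<in> {Q \<in> gl_even a b. transpose_mat Q * ?B + ?B * Q = ?Z}"
    then have Q: "Q \<in> gl_even a b" and e: "transpose_mat Q * ?B + ?B * Q = ?Z" by auto
    from Q obtain P D where c: "P \<in> carrier_mat a a" "D \<in> carrier_mat b b" and QPD: "Q = block_diag P D" by (rule gl_evenE)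
    show "Q \<in> V0" using even[OF c] e c unfolding QPD V0_def by blast
  next
    fix Q assume "Q \<in> V0"
    then obtain P D where c: "P \<in> carrier_mat a a" "D \<in> carrier_mat b b" and QPD: "Q = block_diag P D"
      and e: "transpose_mat P * S = - (S * P) \<and> transpose_mat D * A = - (A * D)" unfolding V0_def by blast
    show "Q \<in> {Q \<in> gl_even a b. transpose_mat Q * ?B + ?B * Q = ?Z}"
      using even[OF c] e block_diag_gl_even[OF c] unfolding QPD by blast
  qed
  moreover have "{Q \<in> gl_odd a b. transpose_mat Q * ?B + ?P * ?B * Q = ?Z} = V1"
  proof (intro equalityI subsetI)
    fix Q assume "Q \<in> {Q \<in> gl_odd a b. transpose_mat Q * ?B + ?P * ?B * Q = ?Z}"
    then have Q: "Q \<in> gl_odd a b" and e: "transpose_mat Q * ?B + ?P * ?B * Q = ?Z" by auto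
    from Q obtain W Y where c: "W \<in> carrier_mat a b" "Y \<in> carrier_mat b a" and QWY: "Q = block_off W Y" by (rule gl_oddE)
    show "Q \<in> V1" using odd[OF c] e c unfolding QWY V1_def by blast
  next
    fix Q assume "Q \<in> V1"
    then obtain W where c: "W \<in> carrier_mat a b" and Q: "Q = block_off W (- rho W)" unfolding V1_def by blast
    have c': "- rho W \<in> carrier_mat b a" using c by simp
    show "Q \<in> {Q \<in> gl_odd a b. transpose_mat Q * ?B + ?P * ?B * Q = ?Z}"
      using odd[OF c c'] block_off_gl_odd[OF c c'] unfolding Q by blast
  qed
  ultimately show ?thesis unfolding osp_form_def Let_def by simp
qed

lemma V0I: "P \<in> carrier_mat a a \<Longrightarrow> D \<in> carrier_mat b b \<Longrightarrow> transpose_mat P * S = - (S * P) \<Longrightarrow> 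
    transpose_mat D * A = - (A * D) \<Longrightarrow> block_diag P D \<in> V0"
  unfolding V0_def by blast

lemma V1I: "W \<in> carrier_mat a b \<Longrightarrow> block_off W (- rho W) \<in> V1"
  unfolding V1_def by blast

text \<open>The action of the even part on the odd part is determined by the upper right blocks.\<close>

lemma rho_commutator:
  assumes c: "P \<in> carrier_mat a a" "D \<in> carrier_mat b b" "W \<in> carrier_mat a b"
    and e: "transpose_mat P * S = - (S * P)" "transpose_mat D * A = - (A * D)"
  shows "D * (- rho W) - (- rho W) * P = - rho (P * W - W * D)"
proof -
  have d [simp]: "dim_row P = a" "dim_col P = a" "dim_row D = b" "dim_col D = b" "dim_row W = a" "dim_col W = b" using c by auto
  have "K * (transpose_mat D * A) * K = - (K * (A * D) * K)" unfolding e(2) by (simp add: mat_ring)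
  then have "- (K * transpose_mat D) = D * K"
    by (simp add: mat_ring K(2) cancel right_mult_one_mat[of _ b b])
  then have KD: "K * transpose_mat D = - (D * K)" by (metis uminus_uminus_mat)
  have "rho (P * W - W * D) = K * transpose_mat W * (transpose_mat P * S) - K * transpose_mat D * (transpose_mat W * S)"
    unfolding rho_def by (simp add: mat_ring transpose_mult' transpose_minus')
  also have "\<dots> = - (rho W * P) + D * rho W"
    unfolding e(1) KD rho_def by (rule eq_matI) (simp_all add: mat_ring del: index_mult_mat(1))
  finally show ?thesis
    by (intro eq_matI) (simp_all add: mat_ring del: index_mult_mat(1))
qed

lemma anticommutator_eq:
  assumes "W \<in> carrier_mat a b" "Y \<in> carrier_mat a b"
  shows "anticommutator (block_off W (- rho W)) (block_off Y (- rho Y)) =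
    block_diag (- (W * rho Y + Y * rho W)) (- (rho W * Y + rho Y * W))"
proof -
  have d [simp]: "dim_row W = a" "dim_col W = b" "dim_row Y = a" "dim_col Y = b" using assms by auto
  have c: "- rho W \<in> carrier_mat b a" "- rho Y \<in> carrier_mat b a" using assms by auto
  show ?thesis
    unfolding block_brackets(3)[OF zero_carrier_mat zero_carrier_mat zero_carrier_mat zero_carrier_mat assms(1) c(1) assms(2) c(2)]
    by (intro arg_cong2[of _ _ _ _ block_diag] eq_matI) (simp_all add: mat_ring del: index_mult_mat(1))
qed

lemma transpose_rho: "W \<in> carrier_mat a b \<Longrightarrow> transpose_mat (rho W) = - (S * W * K)"
  by (auto simp: rho_def transpose_mult' S(2) K_alternating mat_ring)

text \<open>For the spanning condition, take a column \<open>p\<close>, the first unit column \<open>e\<close>, \<open>W = e p\<^sup>T\<close> and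
  \<open>Y = S\<^sup>-\<^sup>1 W\<close>. Since \<open>p\<^sup>T K p = 0\<close>, the orthogonal component of the bracket of the corresponding odd elements
  vanishes, and the symplectic component is \<open>- 2 K p p\<^sup>T\<close>. By polarisation all \<open>K (N + N\<^sup>T)\<close> are
  obtained, and they fill the symplectic Lie algebra. Modulo the latter, \<open>W = e\<^sub>i e\<^sup>T\<close> and \<open>Y = e\<^sub>j (A e)\<^sup>T\<close>
  yield \<open>(E\<^sub>i\<^sub>j - E\<^sub>j\<^sub>i) S\<close>, and these matrices span the orthogonal Lie algebra.\<close>

sublocale matrix_lie_superalgebra a b V0 V1
proof
  show "V0 \<subseteq> gl_even a b" unfolding V0_def using block_diag_gl_even by blast
  show "V1 \<subseteq> gl_odd a b" unfolding V1_def by (clarify, rule block_off_gl_odd) simp_all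
  show "mat_subspace (a + b) V0"
    unfolding mat_subspace_def
  proof (intro conjI ballI allI)
    show "V0 \<subseteq> carrier_mat (a + b) (a + b)" unfolding V0_def using block_carrier(1) by blast
    have "block_diag (0\<^sub>m a a) (0\<^sub>m b b) \<in> V0" by (rule V0I) (use S A in \<open>auto intro!: eq_matI\<close>)
    then show "0\<^sub>m (a + b) (a + b) \<in> V0" by (simp add: block_zero)
    fix x assume "x \<in> V0"
    then obtain P D where x: "x = block_diag P D" and c: "P \<in> carrier_mat a a" "D \<in> carrier_mat b b"
      and e: "transpose_mat P * S = - (S * P)" "transpose_mat D * A = - (A * D)" unfolding V0_def by blast
    have [simp]: "dim_row P = a" "dim_col P = a" "dim_row D = b" "dim_col D = b" using c by auto
    show "k \<cdot>\<^sub>m x \<in> V0" for k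
    proof -
      have [simp]: "transpose_mat (k \<cdot>\<^sub>m P) = k \<cdot>\<^sub>m transpose_mat P" "transpose_mat (k \<cdot>\<^sub>m D) = k \<cdot>\<^sub>m transpose_mat D"
        by (auto intro!: eq_matI)
      have t: "transpose_mat P \<in> carrier_mat a a" "transpose_mat D \<in> carrier_mat b b" using c by auto
      show ?thesis
        unfolding x block_linear(3)[OF c c zero_carrier_mat zero_carrier_mat zero_carrier_mat zero_carrier_mat]
        by (rule V0I) (use c e in \<open>auto simp: mult_smult_assoc_mat[OF t(1) S(1)] mult_smult_assoc_mat[OF t(2) A(1)]
          mult_smult_distrib[OF S(1) c(1)] mult_smult_distrib[OF A(1) c(2)] intro!: eq_matI simp del: index_mult_mat(1)\<close>)
    qed
    fix y assume "y \<in> V0"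
    then obtain P' D' where y: "y = block_diag P' D'" and c': "P' \<in> carrier_mat a a" "D' \<in> carrier_mat b b"
      and e': "transpose_mat P' * S = - (S * P')" "transpose_mat D' * A = - (A * D')" unfolding V0_def by blast
    have [simp]: "dim_row P' = a" "dim_col P' = a" "dim_row D' = b" "dim_col D' = b" using c' by auto
    show "x + y \<in> V0"
      unfolding x y block_linear(1)[OF c c' zero_carrier_mat zero_carrier_mat zero_carrier_mat zero_carrier_mat]
      by (rule V0I) (use c c' e e' in \<open>auto simp: transpose_add' mat_ring intro!: eq_matI simp del: index_mult_mat(1)\<close>)
  qed
  show "mat_subspace (a + b) V1"
    unfolding mat_subspace_def
  proof (intro conjI ballI allI)
    show "V1 \<subseteq> carrier_mat (a + b) (a + b)" unfolding V1_def by (clarify, rule block_carrier(2)) simp_all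
    have r0: "- rho (0\<^sub>m a b) = 0\<^sub>m b a" by (rule eq_matI) (auto simp: rho_def scalar_prod_def)
    show "0\<^sub>m (a + b) (a + b) \<in> V1" using V1I[of "0\<^sub>m a b"] unfolding r0 block_zero by simp
    fix x assume "x \<in> V1"
    then obtain W where x: "x = block_off W (- rho W)" and c: "W \<in> carrier_mat a b" unfolding V1_def by blast
    have [simp]: "dim_row W = a" "dim_col W = b" using c by auto
    have r: "- rho W \<in> carrier_mat b a" using c by simp
    show "k \<cdot>\<^sub>m x \<in> V1" for k
    proof -
      have "transpose_mat (k \<cdot>\<^sub>m W) = k \<cdot>\<^sub>m transpose_mat W" by (auto intro!: eq_matI)
      then have "rho (k \<cdot>\<^sub>m W) = k \<cdot>\<^sub>m rho W"
        using c mult_smult_distrib[OF K(1), of "transpose_mat W" a k] mult_smult_assoc_mat[of "K * transpose_mat W" b a S a k] S(1) K(1)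
        by (simp add: rho_def)
      then have "k \<cdot>\<^sub>m (- rho W) = - rho (k \<cdot>\<^sub>m W)" by (auto intro!: eq_matI)
      then show ?thesis
        unfolding x block_linear(6)[OF zero_carrier_mat zero_carrier_mat zero_carrier_mat zero_carrier_mat c r c r]
        using V1I[of "k \<cdot>\<^sub>m W"] c by simp
    qed
    fix y assume "y \<in> V1"
    then obtain Y where y: "y = block_off Y (- rho Y)" and c': "Y \<in> carrier_mat a b" unfolding V1_def by blast
    have [simp]: "dim_row Y = a" "dim_col Y = b" using c' by auto
    have r': "- rho Y \<in> carrier_mat b a" using c' by simp
    have "- rho W + - rho Y = - rho (W + Y)"
      unfolding rho_def by (rule eq_matI) (simp_all add: mat_ring transpose_add' del: index_mult_mat(1))
    then show "x + y \<in> V1"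
      unfolding x y block_linear(4)[OF zero_carrier_mat zero_carrier_mat zero_carrier_mat zero_carrier_mat c r c' r']
      using V1I[of "W + Y"] c c' by simp
  qed
  show "commutator x y \<in> V0" if xy: "x \<in> V0" "y \<in> V0" for x y
  proof -
    from xy(1) obtain P D where x: "x = block_diag P D" and c: "P \<in> carrier_mat a a" "D \<in> carrier_mat b b"
      and e: "transpose_mat P * S = - (S * P)" "transpose_mat D * A = - (A * D)" unfolding V0_def by blast
    have [simp]: "dim_row P = a" "dim_col P = a" "dim_row D = b" "dim_col D = b" using c by auto
    from xy(2) obtain P' D' where y: "y = block_diag P' D'" and c': "P' \<in> carrier_mat a a" "D' \<in> carrier_mat b b"
      and e': "transpose_mat P' * S = - (S * P')" "transpose_mat D' * A = - (A * D')" unfolding V0_def by blast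
    have [simp]: "dim_row P' = a" "dim_col P' = a" "dim_row D' = b" "dim_col D' = b" using c' by auto
    have comm: "transpose_mat (commutator U U') * F = - (F * commutator U U')"
      if u: "U \<in> carrier_mat l l" "U' \<in> carrier_mat l l" "F \<in> carrier_mat l l"
        "transpose_mat U * F = - (F * U)" "transpose_mat U' * F = - (F * U')" for U U' F :: "'l mat" and l
    proof -
      have [simp]: "dim_row U = l" "dim_col U = l" "dim_row U' = l" "dim_col U' = l" "dim_row F = l" "dim_col F = l" using u by auto
      have "transpose_mat (commutator U U') * F = transpose_mat U' * (transpose_mat U * F) - transpose_mat U * (transpose_mat U' * F)"
        by (simp add: commutator_def transpose_minus' transpose_mult' mat_ring)
      also have "transpose_mat U' * (transpose_mat U * F) = F * (U' * U)"
        unfolding u(4) using arg_cong[OF u(5), of "\<lambda>Z. Z * U"] by (simp add: mat_ring)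
      also have "transpose_mat U * (transpose_mat U' * F) = F * (U * U')"
        unfolding u(5) using arg_cong[OF u(4), of "\<lambda>Z. Z * U'"] by (simp add: mat_ring)
      also have "F * (U' * U) - F * (U * U') = - (F * commutator U U')"
        unfolding commutator_def by (rule eq_matI) (simp_all add: mat_ring del: index_mult_mat(1))
      finally show ?thesis .
    qed
    show ?thesis
      unfolding x y block_brackets(1)[OF c c' zero_carrier_mat zero_carrier_mat zero_carrier_mat zero_carrier_mat]
      by (rule V0I[OF commutator_smult(5)[OF c(1) c'(1)] commutator_smult(5)[OF c(2) c'(2)]
        comm[OF c(1) c'(1) S(1) e(1) e'(1)] comm[OF c(2) c'(2) A(1) e(2) e'(2)]])
  qed
  show "commutator x y \<in> V1" if xy: "x \<in> V0" "y \<in> V1" for x y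
  proof -
    from xy(1) obtain P D where x: "x = block_diag P D" and c: "P \<in> carrier_mat a a" "D \<in> carrier_mat b b"
      and e: "transpose_mat P * S = - (S * P)" "transpose_mat D * A = - (A * D)" unfolding V0_def by blast
    have d [simp]: "dim_row P = a" "dim_col P = a" "dim_row D = b" "dim_col D = b" using c by auto
    from xy(2) obtain W where y: "y = block_off W (- rho W)" and W: "W \<in> carrier_mat a b" unfolding V1_def by blast
    have r: "- rho W \<in> carrier_mat b a" using W by simp
    show ?thesis
      unfolding x y block_brackets(2)[OF c c W r W r] rho_commutator[OF c W e]
      by (rule V1I[OF minus_carrier_mat[OF mult_carrier_mat[OF W c(2)]]])
  qed
  show anti: "anticommutator x y \<in> V0" if xy: "x \<in> V1" "y \<in> V1" for x y
  proof -
    from xy(1) obtain W where x: "x = block_off W (- rho W)" and W: "W \<in> carrier_mat a b" unfolding V1_def by blast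
    from xy(2) obtain Y where y: "y = block_off Y (- rho Y)" and Y: "Y \<in> carrier_mat a b" unfolding V1_def by blast
    have [simp]: "dim_row W = a" "dim_col W = b" "dim_row Y = a" "dim_col Y = b" using W Y by auto
    show ?thesis
      unfolding x y anticommutator_eq[OF W Y]
    proof (rule V0I)
      show "transpose_mat (- (W * rho Y + Y * rho W)) * S = - (S * - (W * rho Y + Y * rho W))"
        by (rule eq_matI) (simp_all add: transpose_uminus transpose_add' transpose_mult' transpose_rho[OF W] transpose_rho[OF Y]
          mat_ring del: index_mult_mat(1), simp_all add: rho_def mat_ring del: index_mult_mat(1))
      show "transpose_mat (- (rho W * Y + rho Y * W)) * A = - (A * - (rho W * Y + rho Y * W))"
        by (rule eq_matI) (simp_all add: transpose_uminus transpose_add' transpose_mult' transpose_rho[OF W] transpose_rho[OF Y]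
          mat_ring del: index_mult_mat(1), simp_all add: rho_def mat_ring K(3) cancel right_mult_one_mat[of _ _ b] del: index_mult_mat(1))
    qed (rule carrier_matI, simp, simp, rule carrier_matI, simp, simp)
  qed
  show "spanned_by (a + b) V0 {anticommutator x y | x y. x \<in> V1 \<and> y \<in> V1}"
    unfolding spanned_by_def
  proof (intro allI impI)
    fix U assume U: "mat_subspace (a + b) U" and sub: "{anticommutator x y | x y. x \<in> V1 \<and> y \<in> V1} \<subseteq> U"
    note Uc = mat_subspaceD[OF U] mat_subspace_minus[OF U]
    have gen: "block_diag (- (W * rho Y + Y * rho W)) (- (rho W * Y + rho Y * W)) \<in> U"
      if "W \<in> carrier_mat a b" "Y \<in> carrier_mat a b" for W Y
    proof -
      have "anticommutator (block_off W (- rho W)) (block_off Y (- rho Y)) \<in> U"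
        by (rule subsetD[OF sub]) (use V1I[OF that(1)] V1I[OF that(2)] in blast)
      then show ?thesis unfolding anticommutator_eq[OF that] .
    qed
    note bl = zero_carrier_mat[of a b] zero_carrier_mat[of b a] zero_carrier_mat[of a b] zero_carrier_mat[of b a]
    note z = zero_carrier_mat[of a a]
    have square: "block_diag (0\<^sub>m a a) (K * (p * transpose_mat p)) \<in> U" if p: "p \<in> carrier_mat b 1" for p
    proof -
      have [simp]: "dim_row p = b" "dim_col p = 1" using p by auto
      let ?u = "unit_mat a 1 0 0 :: 'l mat"
      let ?W = "?u * transpose_mat p" and ?Y = "SI * (?u * transpose_mat p)"
      have c: "?W \<in> carrier_mat a b" "?Y \<in> carrier_mat a b" by (auto intro!: carrier_matI)
      have pKp: "transpose_mat p * (K * p) = 0\<^sub>m 1 1"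
      proof (rule eq_matI)
        let ?x = "transpose_mat p * (K * p)"
        have "transpose_mat ?x = - ?x" by (simp add: transpose_mult' K_alternating mat_ring)
        then have "transpose_mat ?x $$ (0, 0) = - ?x $$ (0, 0)" by simp
        then have "2 * ?x $$ (0, 0) = 0" by (simp del: index_mult_mat(1))
        then show "?x $$ (i, j) = 0\<^sub>m 1 1 $$ (i, j)" if "i < dim_row (0\<^sub>m 1 1 :: 'l mat)" "j < dim_col (0\<^sub>m 1 1 :: 'l mat)" for i j
          using two that by (simp del: index_mult_mat(1))
      qed auto
      have uu: "transpose_mat ?u * ?u = 1\<^sub>m 1"
        unfolding unit_mat_transpose using ab by (subst unit_mat_mult) (auto simp: unit_mat_def intro!: eq_matI)
      have pKp': "transpose_mat p * (K * (p * B)) = 0\<^sub>m 1 (dim_col B)" if "dim_row B = 1" for B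
        using pKp mult_assoc'[of "transpose_mat p" "K * p" B] that by (simp add: mat_ring)
      have uu': "transpose_mat ?u * (?u * B) = B" if "dim_row B = 1" for B
        using uu mult_assoc'[of "transpose_mat ?u" "?u" B] that by simp
      have 1: "?W * rho ?Y + ?Y * rho ?W = 0\<^sub>m a a"
        unfolding rho_def by (rule eq_matI) (simp_all add: mat_ring transpose_mult' SI_symmetric pKp' cancel right_mult_zero_mat[of _ _ 1] del: index_mult_mat(1))
      have 2: "rho ?W * ?Y + rho ?Y * ?W = K * (p * transpose_mat p) + K * (p * transpose_mat p)"
        unfolding rho_def by (rule eq_matI) (simp_all add: mat_ring transpose_mult' SI_symmetric cancel uu' del: index_mult_mat(1) One_nat_def)
      have n: "- (K * (p * transpose_mat p) + K * (p * transpose_mat p)) \<in> carrier_mat b b" by (auto intro!: carrier_matI)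
      have "block_diag (- 0\<^sub>m a a) (- (K * (p * transpose_mat p) + K * (p * transpose_mat p))) \<in> U"
        using gen[OF c] unfolding 1 2 .
      from Uc(4)[OF this, of "- (1/2)"] have "block_diag (- (1/2) \<cdot>\<^sub>m (- 0\<^sub>m a a)) (- (1/2) \<cdot>\<^sub>m - (K * (p * transpose_mat p) + K * (p * transpose_mat p))) \<in> U"
        using block_linear(3)[OF uminus_carrier_mat[OF z] n uminus_carrier_mat[OF z] n bl] by simp
      moreover have "- (1/2) \<cdot>\<^sub>m (- 0\<^sub>m a a) = (0\<^sub>m a a :: 'l mat)" by (rule eq_matI) auto
      moreover have "- (1/2) \<cdot>\<^sub>m - (K * (p * transpose_mat p) + K * (p * transpose_mat p)) = K * (p * transpose_mat p)"
      proof (rule eq_matI)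
        fix i j assume ij: "i < dim_row (K * (p * transpose_mat p))" "j < dim_col (K * (p * transpose_mat p))"
        have "- (1/2) * - (x + x) = x" for x :: 'l using two by (simp add: field_simps)
        then show "(- (1/2) \<cdot>\<^sub>m - (K * (p * transpose_mat p) + K * (p * transpose_mat p))) $$ (i, j) = (K * (p * transpose_mat p)) $$ (i, j)"
          using ij by (simp del: index_mult_mat(1))
      qed auto
      ultimately show ?thesis by simp
    qed
    have sym: "block_diag (0\<^sub>m a a) (K * (M + transpose_mat M)) \<in> U" if M: "M \<in> carrier_mat b b" for M
      using M
    proof (induction rule: mat_induct_units)
      case zero
      have "K * (0\<^sub>m b b + transpose_mat (0\<^sub>m b b)) = 0\<^sub>m b b" using K(1) by (auto intro!: eq_matI)
      then show ?case using Uc(2) by (simp add: block_zero)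
    next
      case (add M N)
      have [simp]: "dim_row M = b" "dim_col M = b" "dim_row N = b" "dim_col N = b" using add by auto
      have c: "K * (M + transpose_mat M) \<in> carrier_mat b b" "K * (N + transpose_mat N) \<in> carrier_mat b b" by (auto intro!: carrier_matI)
      have "K * (M + transpose_mat M) + K * (N + transpose_mat N) = K * (M + N + transpose_mat (M + N))"
        by (rule eq_matI) (simp_all add: mat_ring transpose_add' del: index_mult_mat(1))
      then show ?case using Uc(3)[OF add(3,4)] block_linear(1)[OF z c(1) z c(2) bl] by simp
    next
      case (smult k M)
      have [simp]: "dim_row M = b" "dim_col M = b" using smult by auto
      have c: "K * (M + transpose_mat M) \<in> carrier_mat b b" by (auto intro!: carrier_matI)
      have "k \<cdot>\<^sub>m M + transpose_mat (k \<cdot>\<^sub>m M) = k \<cdot>\<^sub>m (M + transpose_mat M)"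
        by (rule eq_matI) (simp_all add: distrib_left)
      then have "k \<cdot>\<^sub>m (K * (M + transpose_mat M)) = K * (k \<cdot>\<^sub>m M + transpose_mat (k \<cdot>\<^sub>m M))"
        using mult_smult_distrib[OF K(1), of "M + transpose_mat M" b k] smult by simp
      moreover have "k \<cdot>\<^sub>m 0\<^sub>m a a = (0\<^sub>m a a :: 'l mat)" by (rule eq_matI) auto
      ultimately show ?case using Uc(4)[OF smult(2), of k] block_linear(3)[OF z c z c bl] by simp
    next
      case (unit k l)
      let ?k = "unit_mat b 1 k 0 :: 'l mat" and ?l = "unit_mat b 1 l 0 :: 'l mat"
      let ?q = "\<lambda>p. K * (p * transpose_mat p)"
      have c: "?q p \<in> carrier_mat b b" if "p \<in> carrier_mat b 1" for p using that by (auto intro!: carrier_matI)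
      have s: "?k + ?l \<in> carrier_mat b 1" by simp
      have "?q (?k + ?l) - ?q ?k - ?q ?l = K * (?k * transpose_mat ?l + ?l * transpose_mat ?k)"
        by (rule eq_matI) (simp_all add: mat_ring transpose_add' del: index_mult_mat(1))
      also have "?k * transpose_mat ?l = unit_mat b b k l" 
        unfolding unit_mat_transpose using unit by (subst unit_mat_mult) auto
      also have "?l * transpose_mat ?k = transpose_mat (unit_mat b b k l)"
        unfolding unit_mat_transpose using unit by (subst unit_mat_mult) auto
      finally have e: "?q (?k + ?l) - ?q ?k - ?q ?l = K * (unit_mat b b k l + transpose_mat (unit_mat b b k l))" .
      have "block_diag (0\<^sub>m a a) (?q (?k + ?l)) - block_diag (0\<^sub>m a a) (?q ?k) - block_diag (0\<^sub>m a a) (?q ?l) \<in> U"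
        by (intro Uc(5) square) simp_all
      also have "block_diag (0\<^sub>m a a) (?q (?k + ?l)) - block_diag (0\<^sub>m a a) (?q ?k) = block_diag (0\<^sub>m a a - 0\<^sub>m a a) (?q (?k + ?l) - ?q ?k)"
        by (rule block_linear(2)[OF z c[OF s] z c bl]) simp
      also have "\<dots> - block_diag (0\<^sub>m a a) (?q ?l) = block_diag (0\<^sub>m a a - 0\<^sub>m a a - 0\<^sub>m a a) (?q (?k + ?l) - ?q ?k - ?q ?l)"
        by (rule block_linear(2)[OF _ minus_carrier_mat[OF c] z c bl]) simp_all
      finally show ?case unfolding e by simp
    qed
    have sp: "block_diag (0\<^sub>m a a) D \<in> U" if D: "D \<in> carrier_mat b b" "transpose_mat D * A = - (A * D)" for D
    proof -
      have [simp]: "dim_row D = b" "dim_col D = b" using D by auto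
      let ?M = "- (1/2) \<cdot>\<^sub>m (A * D)"
      have "transpose_mat (A * D) = transpose_mat D * - A" using A by (simp add: transpose_mult')
      also have "\<dots> = A * D" using D(2) by simp
      finally have t: "transpose_mat (A * D) = A * D" .
      have "?M + transpose_mat ?M = - (A * D)"
      proof (rule eq_matI)
        fix i j assume ij: "i < dim_row (- (A * D))" "j < dim_col (- (A * D))"
        then have "transpose_mat (A * D) $$ (i, j) = (A * D) $$ (i, j)" using t by simp
        then have "(A * D) $$ (j, i) = (A * D) $$ (i, j)" using ij by simp
        moreover have "- (1/2) * x + - (1/2) * x = - x" for x :: 'l using two by (simp add: field_simps)
        ultimately show "(?M + transpose_mat ?M) $$ (i, j) = (- (A * D)) $$ (i, j)"
          using ij by (simp del: index_mult_mat(1))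
      qed auto
      then have "K * (?M + transpose_mat ?M) = D" by (simp add: cancel)
      moreover have "?M \<in> carrier_mat b b" by (auto intro!: carrier_matI)
      ultimately show ?thesis using sym[of ?M] by simp
    qed
    have skew: "block_diag ((M - transpose_mat M) * S) (0\<^sub>m b b) \<in> U" if M: "M \<in> carrier_mat a a" for M
      using M
    proof (induction rule: mat_induct_units)
      case zero
      have "(0\<^sub>m a a - transpose_mat (0\<^sub>m a a)) * S = 0\<^sub>m a a" using S(1) by (auto intro!: eq_matI)
      then show ?case using Uc(2) by (simp add: block_zero)
    next
      case (add M N)
      have [simp]: "dim_row M = a" "dim_col M = a" "dim_row N = a" "dim_col N = a" using add by auto
      have c: "(M - transpose_mat M) * S \<in> carrier_mat a a" "(N - transpose_mat N) * S \<in> carrier_mat a a" by (auto intro!: carrier_matI)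
      have "(M - transpose_mat M) * S + (N - transpose_mat N) * S = (M + N - transpose_mat (M + N)) * S"
        by (rule eq_matI) (simp_all add: mat_ring transpose_add' del: index_mult_mat(1))
      then show ?case using Uc(3)[OF add(3,4)] block_linear(1)[OF c(1) zero_carrier_mat c(2) zero_carrier_mat bl] by simp
    next
      case (smult k M)
      have [simp]: "dim_row M = a" "dim_col M = a" using smult by auto
      have c: "(M - transpose_mat M) * S \<in> carrier_mat a a" by (auto intro!: carrier_matI)
      have "k \<cdot>\<^sub>m M - transpose_mat (k \<cdot>\<^sub>m M) = k \<cdot>\<^sub>m (M - transpose_mat M)"
        by (rule eq_matI) (simp_all add: right_diff_distrib)
      then have "k \<cdot>\<^sub>m ((M - transpose_mat M) * S) = (k \<cdot>\<^sub>m M - transpose_mat (k \<cdot>\<^sub>m M)) * S"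
        using mult_smult_assoc_mat[of "M - transpose_mat M" a a S a k] S(1) carrier_matI[of "M - transpose_mat M" a a] by simp
      moreover have "k \<cdot>\<^sub>m 0\<^sub>m b b = (0\<^sub>m b b :: 'l mat)" by (rule eq_matI) auto
      ultimately show ?case using Uc(4)[OF smult(2), of k] block_linear(3)[OF c zero_carrier_mat c zero_carrier_mat bl] by simp
    next
      case (unit i j)
      let ?i = "unit_mat a 1 i 0 :: 'l mat" and ?j = "unit_mat a 1 j 0 :: 'l mat" and ?p = "unit_mat b 1 0 0 :: 'l mat"
      let ?W = "?i * transpose_mat ?p" and ?Y = "?j * transpose_mat (A * ?p)"
      have c: "?W \<in> carrier_mat a b" "?Y \<in> carrier_mat a b" by (auto intro!: carrier_matI)
      have pp: "transpose_mat ?p * ?p = 1\<^sub>m 1"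
        unfolding unit_mat_transpose using ab by (subst unit_mat_mult) (auto simp: unit_mat_def intro!: eq_matI)
      have pp': "transpose_mat ?p * (?p * B) = B" if "dim_row B = 1" for B
        using pp mult_assoc'[of "transpose_mat ?p" "?p" B] that by simp
      have ij: "?i * transpose_mat ?j = unit_mat a a i j" "?j * transpose_mat ?i = transpose_mat (unit_mat a a i j)"
        unfolding unit_mat_transpose using unit by (subst unit_mat_mult; auto)+
      have "- (?W * rho ?Y + ?Y * rho ?W) = (?i * transpose_mat ?j - ?j * transpose_mat ?i) * S"
        unfolding rho_def
        by (rule eq_matI) (simp_all add: mat_ring transpose_mult' transpose_uminus A(2) cancel pp' del: index_mult_mat(1) One_nat_def)
      then have e: "- (?W * rho ?Y + ?Y * rho ?W) = (unit_mat a a i j - transpose_mat (unit_mat a a i j)) * S"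
        unfolding ij .
      let ?D = "- (rho ?W * ?Y + rho ?Y * ?W)"
      have Dc: "?D \<in> carrier_mat b b" by (auto intro!: carrier_matI)
      have ec: "(unit_mat a a i j - transpose_mat (unit_mat a a i j)) * S \<in> carrier_mat a a" by (auto intro!: carrier_matI)
      have "block_diag (- (?W * rho ?Y + ?Y * rho ?W)) ?D \<in> V0"
        using anti[OF V1I[OF c(1)] V1I[OF c(2)]] unfolding anticommutator_eq[OF c] .
      then obtain P D' where "block_diag (- (?W * rho ?Y + ?Y * rho ?W)) ?D = block_diag P D'"
        "P \<in> carrier_mat a a" "D' \<in> carrier_mat b b" "transpose_mat D' * A = - (A * D')" unfolding V0_def by blast
      then have "transpose_mat ?D * A = - (A * ?D)"
        using block_diag_inject[OF _ Dc, of "- (?W * rho ?Y + ?Y * rho ?W)" a P D'] unfolding e using ec by simp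
      then have "block_diag (0\<^sub>m a a) ?D \<in> U" by (rule sp[OF Dc])
      then have "block_diag (- (?W * rho ?Y + ?Y * rho ?W)) ?D - block_diag (0\<^sub>m a a) ?D \<in> U"
        by (rule Uc(5)[OF gen[OF c]])
      also have "block_diag (- (?W * rho ?Y + ?Y * rho ?W)) ?D - block_diag (0\<^sub>m a a) ?D =
        block_diag ((unit_mat a a i j - transpose_mat (unit_mat a a i j)) * S - 0\<^sub>m a a) (?D - ?D)"
        unfolding e by (rule block_linear(2)[OF ec Dc z Dc bl])
      also have "?D - ?D = 0\<^sub>m b b" by (rule eq_matI) (simp_all del: index_mult_mat(1))
      also have "(unit_mat a a i j - transpose_mat (unit_mat a a i j)) * S - 0\<^sub>m a a = (unit_mat a a i j - transpose_mat (unit_mat a a i j)) * S"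
        by (rule eq_matI) (simp_all del: index_mult_mat(1))
      finally show ?case .
    qed
    have so: "block_diag P (0\<^sub>m b b) \<in> U" if P: "P \<in> carrier_mat a a" "transpose_mat P * S = - (S * P)" for P
    proof -
      have [simp]: "dim_row P = a" "dim_col P = a" using P by auto
      let ?N = "P * SI"
      let ?M = "(1/2) \<cdot>\<^sub>m ?N"
      have "transpose_mat ?N = SI * ((transpose_mat P * S) * SI)"
        by (simp add: transpose_mult' SI_symmetric mat_ring S(4) right_mult_one_mat[of _ a a])
      also have "\<dots> = - ?N" unfolding P(2) by (simp add: mat_ring cancel)
      finally have t: "transpose_mat ?N = - ?N" .
      have "?M - transpose_mat ?M = ?N"
      proof (rule eq_matI)
        fix i j assume ij: "i < dim_row ?N" "j < dim_col ?N"
        then have "transpose_mat ?N $$ (i, j) = (- ?N) $$ (i, j)" using t by simp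
        then have "?N $$ (j, i) = - (?N $$ (i, j))" using ij by simp
        moreover have "(1/2) * x - (1/2) * (- x) = x" for x :: 'l using two by (simp add: field_simps)
        ultimately show "(?M - transpose_mat ?M) $$ (i, j) = ?N $$ (i, j)"
          using ij by (simp del: index_mult_mat(1))
      qed auto
      then have "(?M - transpose_mat ?M) * S = P" by (simp add: mat_ring S(5) right_mult_one_mat[of _ a a])
      moreover have "?M \<in> carrier_mat a a" by (auto intro!: carrier_matI)
      ultimately show ?thesis using skew[of ?M] by simp
    qed
    show "V0 \<subseteq> U"
    proof
      fix x assume "x \<in> V0"
      then obtain P D where x: "x = block_diag P D" and c: "P \<in> carrier_mat a a" "D \<in> carrier_mat b b"
        and e: "transpose_mat P * S = - (S * P)" "transpose_mat D * A = - (A * D)" unfolding V0_def by blast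
      have "block_diag P (0\<^sub>m b b) + block_diag (0\<^sub>m a a) D \<in> U" by (intro Uc(3) so sp c e)
      also have "block_diag P (0\<^sub>m b b) + block_diag (0\<^sub>m a a) D = x"
        unfolding x using block_linear(1)[OF c(1) zero_carrier_mat z c(2) bl] c by simp
      finally show "x \<in> U" .
    qed
  qed
qed

text \<open>By Schur's lemma an annihilating element is a scalar matrix, and a scalar that is skew for \<open>S\<close> is 0.\<close>

lemma annihilator_trivial:
  assumes Q: "Q \<in> V0" and ann: "\<And>x. x \<in> V1 \<Longrightarrow> commutator Q x = 0\<^sub>m (a + b) (a + b)"
  shows "Q = 0\<^sub>m (a + b) (a + b)"
proof -
  from Q obtain P D where QPD: "Q = block_diag P D" and c: "P \<in> carrier_mat a a" "D \<in> carrier_mat b b"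
    and e: "transpose_mat P * S = - (S * P)" unfolding V0_def by blast
  have [simp]: "dim_row P = a" "dim_col P = a" "dim_row D = b" "dim_col D = b" using c by auto
  have "P * W = W * D" if W: "W \<in> carrier_mat a b" for W
  proof -
    have [simp]: "dim_row W = a" "dim_col W = b" using W by auto
    have r: "- rho W \<in> carrier_mat b a" using W by simp
    have pc: "P * W - W * D \<in> carrier_mat a b" "D * - rho W - - rho W * P \<in> carrier_mat b a" by (auto intro!: carrier_matI)
    have "block_off (P * W - W * D) (D * - rho W - - rho W * P) = block_off (0\<^sub>m a b) (0\<^sub>m b a)"
      using ann[OF V1I[OF W]] unfolding QPD block_brackets(2)[OF c c W r W r] block_zero .
    then have "P * W - W * D = 0\<^sub>m a b"
      using block_off_inject[OF pc zero_carrier_mat zero_carrier_mat] by blast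
    then have "(P * W - W * D) + W * D = 0\<^sub>m a b + W * D" by simp
    also have "(P * W - W * D) + W * D = P * W" by (rule eq_matI) (simp_all del: index_mult_mat(1))
    also have "0\<^sub>m a b + W * D = W * D" by (rule left_add_zero_mat) (rule carrier_matI, simp_all)
    finally show ?thesis .
  qed
  from intertwiner_scalar[OF c ab this] obtain k where k: "P = k \<cdot>\<^sub>m 1\<^sub>m a" "D = k \<cdot>\<^sub>m 1\<^sub>m b" by metis
  have "transpose_mat P = P" unfolding k(1) by (rule eq_matI) auto
  moreover have "P * S = k \<cdot>\<^sub>m S" "S * P = k \<cdot>\<^sub>m S"
    unfolding k(1) using mult_smult_assoc_mat[OF one_carrier_mat S(1)] mult_smult_distrib[OF S(1) one_carrier_mat] S(1) by auto
  ultimately have "k \<cdot>\<^sub>m S = - (k \<cdot>\<^sub>m S)" using e by simp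
  then have eq: "(k \<cdot>\<^sub>m S) $$ (i, j) = (- (k \<cdot>\<^sub>m S)) $$ (i, j)" for i j by simp
  have kS: "2 * (k * S $$ (i, j)) = 0" if "i < a" "j < a" for i j using eq[of i j] that by auto
  have "k = 0"
  proof (rule ccontr)
    assume "k \<noteq> 0"
    have S0: "S $$ (i, j) = 0" if ij: "i < a" "j < a" for i j
    proof -
      show ?thesis using kS[OF ij] two \<open>k \<noteq> 0\<close> by simp
    qed
    then have "(S * SI) $$ (0, 0) = 0" using ab by (simp add: scalar_prod_def)
    then show False unfolding S(4) using ab by simp
  qed
  then have "P = 0\<^sub>m a a" "D = 0\<^sub>m b b" unfolding k by (auto intro!: eq_matI)
  then show ?thesis unfolding QPD by (simp add: block_zero)
qed

end

section \<open>Special linear superalgebras and their quotients by scalars\<close>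

definition mtrace :: "'a::comm_ring_1 mat \<Rightarrow> 'a" where "mtrace P = (\<Sum>i<dim_row P. P $$ (i, i))"

lemma mtrace_linear:
  assumes "P \<in> carrier_mat p p" "Q \<in> carrier_mat p p"
  shows "mtrace (P + Q) = mtrace P + mtrace Q" "mtrace (P - Q) = mtrace P - mtrace Q" "mtrace (c \<cdot>\<^sub>m P) = c * mtrace P"
  using assms by (auto simp: mtrace_def sum.distrib sum_subtractf sum_distrib_left)

lemma mtrace_mult:
  assumes "P \<in> carrier_mat p q" "Q \<in> carrier_mat q p"
  shows "mtrace (P * Q) = mtrace (Q * P)"
proof -
  have "mtrace (P * Q) = (\<Sum>i<p. \<Sum>j<q. P $$ (i, j) * Q $$ (j, i))"
    using assms by (auto simp: mtrace_def scalar_prod_def atLeast0LessThan intro!: sum.cong)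
  also have "\<dots> = (\<Sum>j<q. \<Sum>i<p. Q $$ (j, i) * P $$ (i, j))"
    by (subst sum.swap) (simp add: mult.commute)
  also have "\<dots> = mtrace (Q * P)"
    using assms by (auto simp: mtrace_def scalar_prod_def atLeast0LessThan intro!: sum.cong)
  finally show ?thesis .
qed

lemma mtrace_unit: "i < p \<Longrightarrow> j < p \<Longrightarrow> mtrace (unit_mat p p i j) = (if i = j then 1 else 0)"
  by (auto simp: mtrace_def unit_mat_def sum.delta)

lemma mtrace_zero [simp]: "mtrace (0\<^sub>m p p) = 0"
  by (simp add: mtrace_def)

lemma supertrace_block_diag:
  assumes "P \<in> carrier_mat a a" "D \<in> carrier_mat b b"
  shows "supertrace a (block_diag P D) = mtrace P - mtrace D"
proof -
  have [simp]: "dim_row P = a" "dim_col P = a" "dim_row D = b" "dim_col D = b" using assms by auto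
  have "(\<Sum>i<a. block_diag P D $$ (i, i)) = mtrace P"
    by (simp add: mtrace_def block_diag_def)
  moreover have "(\<Sum>i=a..<a + b. block_diag P D $$ (i, i)) = mtrace D"
    using sum.shift_bounds_nat_ivl[of "\<lambda>i. block_diag P D $$ (i, i)" 0 a b]
    by (simp add: mtrace_def block_diag_def add.commute atLeast0LessThan)
  ultimately show ?thesis by (simp add: supertrace_def)
qed

locale sl_data =
  fixes a b :: nat and field_type :: "'l::field itself"
  assumes ab: "a \<ge> 1" "b \<ge> 1"
begin

definition V0 :: "'l mat set" where "V0 = {Q \<in> gl_even a b. supertrace a Q = 0}"
definition V1 :: "'l mat set" where "V1 = gl_odd a b"

lemma sl_eq: "sl a b = matrix_superalgebra a b V0 V1"
  by (simp add: sl_def V0_def V1_def)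

lemma V0_iff: "P \<in> carrier_mat a a \<Longrightarrow> D \<in> carrier_mat b b \<Longrightarrow> block_diag P D \<in> V0 \<longleftrightarrow> mtrace P = mtrace D"
  by (simp add: V0_def block_diag_gl_even supertrace_block_diag)

lemma V0E:
  assumes "Q \<in> V0"
  obtains P D where "P \<in> carrier_mat a a" "D \<in> carrier_mat b b" "Q = block_diag P D" "mtrace P = mtrace D"
proof -
  have "Q \<in> gl_even a b" using assms by (simp add: V0_def)
  then obtain P D where c: "P \<in> carrier_mat a a" "D \<in> carrier_mat b b" "Q = block_diag P D" by (rule gl_evenE)
  with assms V0_iff[OF c(1,2)] that show thesis by simp
qed

lemmas zeros = zero_carrier_mat[of a b] zero_carrier_mat[of b a] zero_carrier_mat[of a b] zero_carrier_mat[of b a]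
lemmas zeros' = zero_carrier_mat[of a a] zero_carrier_mat[of b b] zero_carrier_mat[of a a] zero_carrier_mat[of b b]

text \<open>The brackets of matrix units contain all \<open>E\<^sub>i\<^sub>j\<close> with \<open>i \<noteq> j\<close> in either block, and the pairs of \<open>E\<^sub>i\<^sub>i\<close> and
  \<open>E\<^sub>k\<^sub>k\<close>. So each matrix \<open>N\<close> in one block occurs together with the multiple \<open>tr(N) E\<^sub>0\<^sub>0\<close> in the other block. For a pair of
  matrices with the same trace, the sum of the two elements obtained in this way exceeds the pair by a multiple of the pair
  \<open>E\<^sub>0\<^sub>0\<close>, \<open>E\<^sub>0\<^sub>0\<close>.\<close>

sublocale matrix_lie_superalgebra a b V0 V1
proof
  show "V0 \<subseteq> gl_even a b" "V1 \<subseteq> gl_odd a b" by (auto simp: V0_def V1_def)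
  show "mat_subspace (a + b) V0"
    unfolding mat_subspace_def
  proof (intro conjI ballI allI)
    show "V0 \<subseteq> carrier_mat (a + b) (a + b)" by (auto simp: V0_def gl_even_def)
    show "0\<^sub>m (a + b) (a + b) \<in> V0"
      unfolding block_zero(1)[symmetric] by (subst V0_iff) simp_all
    fix x assume "x \<in> V0"
    then obtain P D where c: "P \<in> carrier_mat a a" "D \<in> carrier_mat b b" and x: "x = block_diag P D" and t: "mtrace P = mtrace D"
      by (rule V0E)
    show "k \<cdot>\<^sub>m x \<in> V0" for k
      unfolding x block_linear(3)[OF c c zeros] using c t by (simp add: V0_iff mtrace_linear(3)[OF c(1) c(1)] mtrace_linear(3)[OF c(2) c(2)])
    fix y assume "y \<in> V0"
    then obtain P' D' where c': "P' \<in> carrier_mat a a" "D' \<in> carrier_mat b b" and y: "y = block_diag P' D'" and t': "mtrace P' = mtrace D'"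
      by (rule V0E)
    show "x + y \<in> V0"
      unfolding x y block_linear(1)[OF c c' zeros] using c c' t t'
      by (simp add: V0_iff mtrace_linear(1)[OF c(1) c'(1)] mtrace_linear(1)[OF c(2) c'(2)])
  qed
  show "mat_subspace (a + b) V1"
    unfolding mat_subspace_def
  proof (intro conjI ballI allI)
    show "V1 \<subseteq> carrier_mat (a + b) (a + b)" by (auto simp: V1_def gl_odd_def)
    show "0\<^sub>m (a + b) (a + b) \<in> V1"
      unfolding block_zero(2)[symmetric] V1_def by (rule block_off_gl_odd) simp_all
    fix x assume "x \<in> V1"
    then obtain W Y where c: "W \<in> carrier_mat a b" "Y \<in> carrier_mat b a" and x: "x = block_off W Y"
      unfolding V1_def by (rule gl_oddE)
    show "k \<cdot>\<^sub>m x \<in> V1" for k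
      unfolding x block_linear(6)[OF zeros' c c] V1_def by (rule block_off_gl_odd) (use c in auto)
    fix y assume "y \<in> V1"
    then obtain W' Y' where c': "W' \<in> carrier_mat a b" "Y' \<in> carrier_mat b a" and y: "y = block_off W' Y'"
      unfolding V1_def by (rule gl_oddE)
    show "x + y \<in> V1"
      unfolding x y block_linear(4)[OF zeros' c c'] V1_def by (rule block_off_gl_odd) (use c c' in auto)
  qed
  show "commutator x y \<in> V0" if xy: "x \<in> V0" "y \<in> V0" for x y
  proof -
    from xy(1) obtain P D where c: "P \<in> carrier_mat a a" "D \<in> carrier_mat b b" and x: "x = block_diag P D" by (rule V0E)
    from xy(2) obtain P' D' where c': "P' \<in> carrier_mat a a" "D' \<in> carrier_mat b b" and y: "y = block_diag P' D'" by (rule V0E)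
    have tr: "mtrace (commutator U U') = 0" if u: "U \<in> carrier_mat l l" "U' \<in> carrier_mat l l" for U U' :: "'l mat" and l
      unfolding commutator_def mtrace_linear(2)[OF mult_carrier_mat[OF u] mult_carrier_mat[OF u(2,1)]] mtrace_mult[OF u] by simp
    show ?thesis
      unfolding x y block_brackets(1)[OF c c' zeros] V0_iff[OF commutator_smult(5)[OF c(1) c'(1)] commutator_smult(5)[OF c(2) c'(2)]]
      using tr[OF c(1) c'(1)] tr[OF c(2) c'(2)] by simp
  qed
  show "commutator x y \<in> V1" if xy: "x \<in> V0" "y \<in> V1" for x y
  proof -
    from xy(1) obtain P D where c: "P \<in> carrier_mat a a" "D \<in> carrier_mat b b" and x: "x = block_diag P D" by (rule V0E)
    from xy(2) obtain W Y where d: "W \<in> carrier_mat a b" "Y \<in> carrier_mat b a" and y: "y = block_off W Y"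
      unfolding V1_def by (rule gl_oddE)
    show ?thesis
      unfolding x y block_brackets(2)[OF c c d d] V1_def
      by (rule block_off_gl_odd[OF minus_carrier_mat[OF mult_carrier_mat[OF d(1) c(2)]] minus_carrier_mat[OF mult_carrier_mat[OF d(2) c(1)]]])
  qed
  show "anticommutator x y \<in> V0" if xy: "x \<in> V1" "y \<in> V1" for x y
  proof -
    from xy(1) obtain W Y where d: "W \<in> carrier_mat a b" "Y \<in> carrier_mat b a" and x: "x = block_off W Y"
      unfolding V1_def by (rule gl_oddE)
    from xy(2) obtain W' Y' where d': "W' \<in> carrier_mat a b" "Y' \<in> carrier_mat b a" and y: "y = block_off W' Y'"
      unfolding V1_def by (rule gl_oddE)
    note m = mult_carrier_mat[OF d(1) d'(2)] mult_carrier_mat[OF d'(1) d(2)] mult_carrier_mat[OF d(2) d'(1)] mult_carrier_mat[OF d'(2) d(1)]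
    show ?thesis
      unfolding x y block_brackets(3)[OF zeros' d d'] V0_iff[OF add_carrier_mat[OF m(2)] add_carrier_mat[OF m(4)]]
        mtrace_linear(1)[OF m(1,2)] mtrace_linear(1)[OF m(3,4)]
      using mtrace_mult[OF d(1) d'(2)] mtrace_mult[OF d'(1) d(2)] by simp
  qed
  show "spanned_by (a + b) V0 {anticommutator x y | x y. x \<in> V1 \<and> y \<in> V1}"
    unfolding spanned_by_def
  proof (intro allI impI)
    fix U assume U: "mat_subspace (a + b) U" and sub: "{anticommutator x y | x y. x \<in> V1 \<and> y \<in> V1} \<subseteq> U"
    note Uc = mat_subspaceD[OF U] mat_subspace_minus[OF U]
    have gen: "block_diag (W * Y) (Y * W) \<in> U" if c: "W \<in> carrier_mat a b" "Y \<in> carrier_mat b a" for W Y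
    proof -
      have "block_off W (0\<^sub>m b a) \<in> V1" "block_off (0\<^sub>m a b) Y \<in> V1"
        unfolding V1_def using c by (auto intro: block_off_gl_odd)
      then have "anticommutator (block_off W (0\<^sub>m b a)) (block_off (0\<^sub>m a b) Y) \<in> U"
        by (intro subsetD[OF sub]) blast
      also have "anticommutator (block_off W (0\<^sub>m b a)) (block_off (0\<^sub>m a b) Y) = block_diag (W * Y) (Y * W)"
        unfolding block_brackets(3)[OF zeros' c(1) zeros(2) zeros(1) c(2)]
        using c mult_carrier_mat[OF c] mult_carrier_mat[OF c(2,1)] by simp
      finally show ?thesis .
    qed
    have u: "block_diag (if k = l then unit_mat a a i j else 0\<^sub>m a a) (if i = j then unit_mat b b k l else 0\<^sub>m b b) \<in> U"
      if "i < a" "j < a" "k < b" "l < b" for i j k l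
    proof -
      have "unit_mat a b i l * unit_mat b a k j = (if l = k then unit_mat a a i j else (0\<^sub>m a a :: 'l mat))"
        "unit_mat b a k j * unit_mat a b i l = (if j = i then unit_mat b b k l else (0\<^sub>m b b :: 'l mat))"
        using that by (simp_all add: unit_mat_mult)
      then show ?thesis
        using gen[of "unit_mat a b i l" "unit_mat b a k j"] by (simp add: eq_commute[of l k] eq_commute[of j i] cong: if_cong)
    qed
    let ?a = "unit_mat a a 0 0 :: 'l mat" and ?b = "unit_mat b b 0 0 :: 'l mat"
    have P: "block_diag M (mtrace M \<cdot>\<^sub>m ?b) \<in> U" if M: "M \<in> carrier_mat a a" for M
      using M
    proof (induction rule: mat_induct_units)
      case zero
      have "0 \<cdot>\<^sub>m ?b = 0\<^sub>m b b" by (rule eq_matI) auto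
      then show ?case using Uc(2) by (simp add: block_zero)
    next
      case (add M N)
      have c: "mtrace M \<cdot>\<^sub>m ?b \<in> carrier_mat b b" "mtrace N \<cdot>\<^sub>m ?b \<in> carrier_mat b b" by auto
      have "mtrace M \<cdot>\<^sub>m ?b + mtrace N \<cdot>\<^sub>m ?b = mtrace (M + N) \<cdot>\<^sub>m ?b"
        unfolding mtrace_linear(1)[OF add(1,2)] by (rule eq_matI) (auto simp: distrib_right)
      then show ?case using Uc(3)[OF add(3,4)] block_linear(1)[OF add(1) c(1) add(2) c(2) zeros] by simp
    next
      case (smult k M)
      have c: "mtrace M \<cdot>\<^sub>m ?b \<in> carrier_mat b b" by auto
      have "k \<cdot>\<^sub>m (mtrace M \<cdot>\<^sub>m ?b) = mtrace (k \<cdot>\<^sub>m M) \<cdot>\<^sub>m ?b"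
        unfolding mtrace_linear(3)[OF smult(1,1)] by (rule eq_matI) auto
      then show ?case using Uc(4)[OF smult(2), of k] block_linear(3)[OF smult(1) c smult(1) c zeros] by simp
    next
      case (unit i j)
      have "(if i = j then 1 else 0) \<cdot>\<^sub>m ?b = (if i = j then ?b else 0\<^sub>m b b)"
        by (auto intro!: eq_matI)
      then show ?case using u[of i j 0 0] unit ab by (simp add: mtrace_unit)
    qed
    have D: "block_diag (mtrace M \<cdot>\<^sub>m ?a) M \<in> U" if M: "M \<in> carrier_mat b b" for M
      using M
    proof (induction rule: mat_induct_units)
      case zero
      have "0 \<cdot>\<^sub>m ?a = 0\<^sub>m a a" by (rule eq_matI) auto
      then show ?case using Uc(2) by (simp add: block_zero)
    next
      case (add M N)
      have c: "mtrace M \<cdot>\<^sub>m ?a \<in> carrier_mat a a" "mtrace N \<cdot>\<^sub>m ?a \<in> carrier_mat a a" by auto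
      have "mtrace M \<cdot>\<^sub>m ?a + mtrace N \<cdot>\<^sub>m ?a = mtrace (M + N) \<cdot>\<^sub>m ?a"
        unfolding mtrace_linear(1)[OF add(1,2)] by (rule eq_matI) (auto simp: distrib_right)
      then show ?case using Uc(3)[OF add(3,4)] block_linear(1)[OF c(1) add(1) c(2) add(2) zeros] by simp
    next
      case (smult k M)
      have c: "mtrace M \<cdot>\<^sub>m ?a \<in> carrier_mat a a" by auto
      have "k \<cdot>\<^sub>m (mtrace M \<cdot>\<^sub>m ?a) = mtrace (k \<cdot>\<^sub>m M) \<cdot>\<^sub>m ?a"
        unfolding mtrace_linear(3)[OF smult(1,1)] by (rule eq_matI) auto
      then show ?case using Uc(4)[OF smult(2), of k] block_linear(3)[OF c smult(1) c smult(1) zeros] by simp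
    next
      case (unit k l)
      have "(if k = l then 1 else 0) \<cdot>\<^sub>m ?a = (if k = l then ?a else 0\<^sub>m a a)"
        by (auto intro!: eq_matI)
      then show ?case using u[of 0 0 k l] unit ab by (simp add: mtrace_unit)
    qed
    show "V0 \<subseteq> U"
    proof
      fix x assume "x \<in> V0"
      then obtain M N where c: "M \<in> carrier_mat a a" "N \<in> carrier_mat b b" and x: "x = block_diag M N" and t: "mtrace M = mtrace N"
        by (rule V0E)
      let ?t = "mtrace N"
      have cu: "?t \<cdot>\<^sub>m ?a \<in> carrier_mat a a" "?t \<cdot>\<^sub>m ?b \<in> carrier_mat b b" "?a \<in> carrier_mat a a" "?b \<in> carrier_mat b b" by auto
      have "block_diag ?a ?b \<in> U" using u[of 0 0 0 0] ab by simp
      then have "?t \<cdot>\<^sub>m block_diag ?a ?b \<in> U" by (rule Uc(4))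
      then have "block_diag (?t \<cdot>\<^sub>m ?a) (?t \<cdot>\<^sub>m ?b) \<in> U"
        using block_linear(3)[OF cu(3,4,3,4) zeros] by simp
      from Uc(5)[OF Uc(3)[OF P[OF c(1)] D[OF c(2)]] this]
      have "block_diag M (?t \<cdot>\<^sub>m ?b) + block_diag (?t \<cdot>\<^sub>m ?a) N - block_diag (?t \<cdot>\<^sub>m ?a) (?t \<cdot>\<^sub>m ?b) \<in> U"
        unfolding t .
      also have "block_diag M (?t \<cdot>\<^sub>m ?b) + block_diag (?t \<cdot>\<^sub>m ?a) N - block_diag (?t \<cdot>\<^sub>m ?a) (?t \<cdot>\<^sub>m ?b) = x"
        unfolding x using c by (intro eq_matI) (auto simp: block_diag_def)
      finally show "x \<in> U" .
    qed
  qed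
qed

text \<open>The second condition is the vanishing of the supertrace of \<open>c \<cdot> 1\<close>.\<close>

lemma annihilator_scalar:
  assumes Q: "Q \<in> V0" and ann: "\<And>x. x \<in> V1 \<Longrightarrow> commutator Q x = 0\<^sub>m (a + b) (a + b)"
  shows "\<exists>c. Q = c \<cdot>\<^sub>m 1\<^sub>m (a + b) \<and> c * (of_nat a - of_nat b) = 0"
proof -
  from Q obtain P D where c: "P \<in> carrier_mat a a" "D \<in> carrier_mat b b" and QPD: "Q = block_diag P D" and t: "mtrace P = mtrace D"
    by (rule V0E)
  have [simp]: "dim_row P = a" "dim_col P = a" "dim_row D = b" "dim_col D = b" using c by auto
  have "P * W = W * D" if W: "W \<in> carrier_mat a b" for W
  proof -
    have pc: "P * W - W * D \<in> carrier_mat a b" "D * 0\<^sub>m b a - 0\<^sub>m b a * P \<in> carrier_mat b a" using W by (auto intro!: carrier_matI)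
    have "block_off W (0\<^sub>m b a) \<in> V1" unfolding V1_def using W by (auto intro: block_off_gl_odd)
    then have "block_off (P * W - W * D) (D * 0\<^sub>m b a - 0\<^sub>m b a * P) = block_off (0\<^sub>m a b) (0\<^sub>m b a)"
      using ann unfolding QPD block_brackets(2)[OF c c W zeros(2) W zeros(2)] block_zero(2)
        by (metis block_brackets(2)[OF c c W zeros(2) W zeros(2)])
    then have "P * W - W * D = 0\<^sub>m a b"
      using block_off_inject[OF pc zeros(1,2)] by blast
    then have "(P * W - W * D) + W * D = 0\<^sub>m a b + W * D" by simp
    also have "(P * W - W * D) + W * D = P * W" using W by (intro eq_matI) (simp_all del: index_mult_mat(1))
    also have "0\<^sub>m a b + W * D = W * D" by (rule left_add_zero_mat) (rule mult_carrier_mat[OF W c(2)])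
    finally show ?thesis .
  qed
  from intertwiner_scalar[OF c ab this] obtain k where k: "P = k \<cdot>\<^sub>m 1\<^sub>m a" "D = k \<cdot>\<^sub>m 1\<^sub>m b" by metis
  have "of_nat a * k = of_nat b * k" using t unfolding k by (simp add: mtrace_def)
  moreover have "Q = k \<cdot>\<^sub>m 1\<^sub>m (a + b)" unfolding QPD k by (rule eq_matI) (auto simp: block_diag_def)
  ultimately show ?thesis by (auto simp: algebra_simps)
qed

lemma scalar_annihilates:
  fixes x :: "'l mat"
  assumes "x \<in> carrier_mat (a + b) (a + b)"
  shows "commutator (c \<cdot>\<^sub>m 1\<^sub>m (a + b)) x = 0\<^sub>m (a + b) (a + b)"
proof -
  have "c \<cdot>\<^sub>m 1\<^sub>m (a + b) * x = c \<cdot>\<^sub>m x" "x * (c \<cdot>\<^sub>m 1\<^sub>m (a + b)) = c \<cdot>\<^sub>m x"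
    using assms mult_smult_assoc_mat[OF one_carrier_mat assms] mult_smult_distrib[OF assms one_carrier_mat] by auto
  then show ?thesis unfolding commutator_def using assms by (auto intro!: eq_matI)
qed

lemma scalar_in_V0:
  assumes "(of_nat a :: 'l) = of_nat b"
  shows "c \<cdot>\<^sub>m 1\<^sub>m (a + b) \<in> V0"
proof -
  have e: "c \<cdot>\<^sub>m 1\<^sub>m (a + b) = block_diag (c \<cdot>\<^sub>m 1\<^sub>m a) (c \<cdot>\<^sub>m 1\<^sub>m b)" by (rule eq_matI) (auto simp: block_diag_def)
  show ?thesis unfolding e using assms by (subst V0_iff) (auto simp: mtrace_def)
qed

end

lemma vectorspace_image:
  fixes g :: "('k::field, 'v, 'y) module_scheme" and h :: "('k, 'w, 'z) module_scheme"
  assumes g: "vectorspace class_ring g" and im: "\<pi> ` carrier g = carrier h"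
    and add: "\<And>x y. x \<in> carrier g \<Longrightarrow> y \<in> carrier g \<Longrightarrow> \<pi> (x \<oplus>\<^bsub>g\<^esub> y) = \<pi> x \<oplus>\<^bsub>h\<^esub> \<pi> y"
    and smult: "\<And>c x. x \<in> carrier g \<Longrightarrow> \<pi> (c \<odot>\<^bsub>g\<^esub> x) = c \<odot>\<^bsub>h\<^esub> \<pi> x"
    and zero: "\<pi> \<zero>\<^bsub>g\<^esub> = \<zero>\<^bsub>h\<^esub>"
  shows "vectorspace class_ring h"
proof -
  interpret g: vectorspace "class_ring :: 'k ring" g by (rule g)
  have lift: "\<exists>y\<in>carrier g. x = \<pi> y" if "x \<in> carrier h" for x using that im by blast
  have cl: "\<pi> y \<in> carrier h" if "y \<in> carrier g" for y using that im by blast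
  show ?thesis
  proof (rule vectorspaceI, rule moduleI)
    show "cring (class_ring :: 'k ring)" by (rule class_cring.is_cring)
    show "abelian_group h"
    proof (rule abelian_groupI)
      fix x assume "x \<in> carrier h"
      then obtain y where y: "y \<in> carrier g" "x = \<pi> y" using lift by blast
      have "\<pi> (\<ominus>\<^bsub>g\<^esub> y) \<oplus>\<^bsub>h\<^esub> x = \<zero>\<^bsub>h\<^esub>"
        using y add[of "\<ominus>\<^bsub>g\<^esub> y" y] zero by (simp add: g.M.l_neg)
      then show "\<exists>z\<in>carrier h. z \<oplus>\<^bsub>h\<^esub> x = \<zero>\<^bsub>h\<^esub>" using cl[of "\<ominus>\<^bsub>g\<^esub> y"] y by auto
    next
      fix x y assume "x \<in> carrier h" "y \<in> carrier h"
      then obtain x' y' where e: "x' \<in> carrier g" "x = \<pi> x'" "y' \<in> carrier g" "y = \<pi> y'" using lift by blast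
      show "x \<oplus>\<^bsub>h\<^esub> y \<in> carrier h" "x \<oplus>\<^bsub>h\<^esub> y = y \<oplus>\<^bsub>h\<^esub> x"
        unfolding e(2,4) add[OF e(1,3), symmetric] add[OF e(3,1), symmetric] using e cl by (auto simp: g.M.a_comm)
      fix z assume "z \<in> carrier h"
      then obtain z' where z: "z' \<in> carrier g" "z = \<pi> z'" using lift by blast
      show "x \<oplus>\<^bsub>h\<^esub> y \<oplus>\<^bsub>h\<^esub> z = x \<oplus>\<^bsub>h\<^esub> (y \<oplus>\<^bsub>h\<^esub> z)"
        using e z add[of x' y'] add[of y' z'] add[of "x' \<oplus>\<^bsub>g\<^esub> y'" z'] add[of x' "y' \<oplus>\<^bsub>g\<^esub> z'"] by (simp add: g.M.a_assoc)
    next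
      show "\<zero>\<^bsub>h\<^esub> \<in> carrier h" using zero cl[OF g.M.zero_closed] by simp
    next
      fix x assume "x \<in> carrier h"
      then obtain y where y: "y \<in> carrier g" "x = \<pi> y" using lift by blast
      show "\<zero>\<^bsub>h\<^esub> \<oplus>\<^bsub>h\<^esub> x = x"
        using y add[of "\<zero>\<^bsub>g\<^esub>" y] zero by simp
    qed
  next
    fix c :: 'k and x assume "x \<in> carrier h"
    then obtain x' where e: "x' \<in> carrier g" "x = \<pi> x'" using lift by blast
    note sm = smult[OF e(1), symmetric]
    show "c \<odot>\<^bsub>h\<^esub> x \<in> carrier h"
      unfolding e(2) sm using e cl by simp
    show "\<one>\<^bsub>class_ring\<^esub> \<odot>\<^bsub>h\<^esub> x = x"
      unfolding e(2) sm using e g.smult_one[of x'] by simp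
    fix d :: 'k
    show "(c \<oplus>\<^bsub>class_ring\<^esub> d) \<odot>\<^bsub>h\<^esub> x = c \<odot>\<^bsub>h\<^esub> x \<oplus>\<^bsub>h\<^esub> d \<odot>\<^bsub>h\<^esub> x"
      unfolding e(2) sm using e g.smult_l_distr[of c d x'] by (simp add: add)
    show "(c \<otimes>\<^bsub>class_ring\<^esub> d) \<odot>\<^bsub>h\<^esub> x = c \<odot>\<^bsub>h\<^esub> (d \<odot>\<^bsub>h\<^esub> x)"
      unfolding e(2) sm using e g.smult_assoc1[of c d x'] smult[of "d \<odot>\<^bsub>g\<^esub> x'" c] by simp
  next
    fix c :: 'k and x y assume "x \<in> carrier h" "y \<in> carrier h"
    then obtain x' y' where e: "x' \<in> carrier g" "x = \<pi> x'" "y' \<in> carrier g" "y = \<pi> y'" using lift by blast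
    show "c \<odot>\<^bsub>h\<^esub> (x \<oplus>\<^bsub>h\<^esub> y) = c \<odot>\<^bsub>h\<^esub> x \<oplus>\<^bsub>h\<^esub> c \<odot>\<^bsub>h\<^esub> y"
      unfolding e(2,4) add[OF e(1,3), symmetric] smult[OF e(1), symmetric] smult[OF e(3), symmetric]
      using e smult[of "x' \<oplus>\<^bsub>g\<^esub> y'" c] by (simp add: g.smult_r_distr add)
  qed
qed

context sl_data
begin

definition scalars :: "'l mat set" where "scalars = {c \<cdot>\<^sub>m 1\<^sub>m (a + b) | c. True}"

definition coset :: "'l mat \<Rightarrow> 'l mat set" where "coset Q = scalars +>\<^bsub>\<G>\<^esub> Q"

lemma coset_eq: "coset Q = {c \<cdot>\<^sub>m 1\<^sub>m (a + b) + Q | c. True}"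
  by (auto simp: coset_def a_r_coset_def' scalars_def simps)

lemma coset_self: "Q \<in> carrier \<G> \<Longrightarrow> Q \<in> coset Q"
proof -
  assume "Q \<in> carrier \<G>"
  from carrier_mat[OF this] have "0 \<cdot>\<^sub>m 1\<^sub>m (a + b) + Q = Q" by (intro eq_matI) auto
  from this[symmetric] show ?thesis unfolding coset_eq by blast
qed

lemma coset_shift: "Q \<in> carrier_mat (a + b) (a + b) \<Longrightarrow> coset (c \<cdot>\<^sub>m 1\<^sub>m (a + b) + Q) = coset Q"
proof (intro equalityI subsetI)
  assume Q: "Q \<in> carrier_mat (a + b) (a + b)"
  fix P assume "P \<in> coset (c \<cdot>\<^sub>m 1\<^sub>m (a + b) + Q)"
  then obtain d where P: "P = d \<cdot>\<^sub>m 1\<^sub>m (a + b) + (c \<cdot>\<^sub>m 1\<^sub>m (a + b) + Q)" unfolding coset_eq by blast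
  have "P = (d + c) \<cdot>\<^sub>m 1\<^sub>m (a + b) + Q" unfolding P using Q by (intro eq_matI) (auto simp: distrib_right)
  then show "P \<in> coset Q" unfolding coset_eq by blast
next
  assume Q: "Q \<in> carrier_mat (a + b) (a + b)"
  fix P assume "P \<in> coset Q"
  then obtain d where P: "P = d \<cdot>\<^sub>m 1\<^sub>m (a + b) + Q" unfolding coset_eq by blast
  have "P = (d - c) \<cdot>\<^sub>m 1\<^sub>m (a + b) + (c \<cdot>\<^sub>m 1\<^sub>m (a + b) + Q)"
    unfolding P using Q by (intro eq_matI) (auto simp: left_diff_distrib)
  then show "P \<in> coset (c \<cdot>\<^sub>m 1\<^sub>m (a + b) + Q)" unfolding coset_eq by blast
qed

lemma coset_set_add:
  assumes "P \<in> carrier \<G>" "Q \<in> carrier \<G>"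
  shows "set_add \<G> (coset P) (coset Q) = coset (P + Q)"
proof -
  note PQ = carrier_mat[OF assms(1)] carrier_mat[OF assms(2)]
  have e: "(c \<cdot>\<^sub>m 1\<^sub>m (a + b) + P) + (d \<cdot>\<^sub>m 1\<^sub>m (a + b) + Q) = (c + d) \<cdot>\<^sub>m 1\<^sub>m (a + b) + (P + Q)" for c d
    using PQ by (intro eq_matI) (auto simp: distrib_right)
  show ?thesis
  proof (intro equalityI subsetI)
    fix U assume "U \<in> set_add \<G> (coset P) (coset Q)"
    then obtain c d where "U = (c \<cdot>\<^sub>m 1\<^sub>m (a + b) + P) + (d \<cdot>\<^sub>m 1\<^sub>m (a + b) + Q)"
      unfolding set_add_def' coset_eq by (auto simp: simps)
    then show "U \<in> coset (P + Q)" unfolding e coset_eq by blast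
  next
    fix U assume "U \<in> coset (P + Q)"
    then obtain c where "U = c \<cdot>\<^sub>m 1\<^sub>m (a + b) + (P + Q)" unfolding coset_eq by blast
    then have "U = (c \<cdot>\<^sub>m 1\<^sub>m (a + b) + P) + (0 \<cdot>\<^sub>m 1\<^sub>m (a + b) + Q)" unfolding e by simp
    then show "U \<in> set_add \<G> (coset P) (coset Q)"
      unfolding set_add_def' coset_eq by (auto simp: simps)
  qed
qed

context
  assumes char_dvd: "(of_nat a :: 'l) = of_nat b"
begin

lemma superbracket_shift:
  assumes "P \<in> carrier \<G>" "Q \<in> carrier \<G>"
  shows "superbracket a (c \<cdot>\<^sub>m 1\<^sub>m (a + b) + P) (d \<cdot>\<^sub>m 1\<^sub>m (a + b) + Q) = superbracket a P Q"
proof -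
  obtain p x where P: "P = p + x" "p \<in> V0" "x \<in> V1" using assms(1) unfolding carrier_iff by blast
  obtain q y where Q: "Q = q + y" "q \<in> V0" "y \<in> V1" using assms(2) unfolding carrier_iff by blast
  let ?c = "c \<cdot>\<^sub>m 1\<^sub>m (a + b)" and ?d = "d \<cdot>\<^sub>m 1\<^sub>m (a + b)"
  note s = scalar_in_V0[OF char_dvd]
  note m = sub0(1)[OF P(2)] sub0(1)[OF Q(2)] sub1(1)[OF P(3)] sub1(1)[OF Q(3)]
  have one: "?c \<in> carrier_mat (a + b) (a + b)" "?d \<in> carrier_mat (a + b) (a + b)" by auto
  have anti: "commutator U V = - commutator V U" if "U \<in> carrier_mat (a + b) (a + b)" "V \<in> carrier_mat (a + b) (a + b)" for U V :: "'l mat"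
    using that unfolding commutator_def by (intro eq_matI) (auto simp del: index_mult_mat(1))
  have z: "commutator U ?d = 0\<^sub>m (a + b) (a + b)" if "U \<in> carrier_mat (a + b) (a + b)" for U
    unfolding anti[OF that one(2)] scalar_annihilates[OF that] by (rule eq_matI) auto
  have za: "0\<^sub>m (a + b) (a + b) + U = U" "U + 0\<^sub>m (a + b) (a + b) = U" if "U \<in> carrier_mat (a + b) (a + b)" for U :: "'l mat"
    using that by auto
  have 1: "commutator (?c + p) (?d + q) = commutator p q"
    using m one by (simp add: commutator_linear(1,3)[of _ "a + b"] scalar_annihilates z za commutator_smult(5)[of _ "a + b"])
  have 2: "commutator (?c + p) y = commutator p y" "commutator (?d + q) x = commutator q x"
    using m one by (simp_all add: commutator_linear(1)[of _ "a + b"] scalar_annihilates za commutator_smult(5)[of _ "a + b"])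
  have "?c + P = (?c + p) + x" "?d + Q = (?d + q) + y"
    unfolding P(1) Q(1) using m by (auto intro!: eq_matI)
  then have "superbracket a (?c + P) (?d + Q) = superbracket a ((?c + p) + x) ((?d + q) + y)" by simp
  also have "\<dots> = superbracket a (p + x) (q + y)"
    unfolding mult_eq[OF sub0(3)[OF s P(2)] P(3) sub0(3)[OF s Q(2)] Q(3)] mult_eq[OF P(2,3) Q(2,3)] 1 2 ..
  finally show ?thesis unfolding P(1) Q(1) .
qed

lemma psl_eq: "psl a b = quotient_superalgebra \<G> scalars"
  unfolding psl_def sl_eq scalars_def ..

lemma coset_psl:
  assumes "P \<in> carrier \<G>" "Q \<in> carrier \<G>"
  shows "coset (P + Q) = coset P \<oplus>\<^bsub>psl a b\<^esub> coset Q"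
    "coset (superbracket a P Q) = coset P \<otimes>\<^bsub>psl a b\<^esub> coset Q"
    "coset (k \<cdot>\<^sub>m P) = k \<odot>\<^bsub>psl a b\<^esub> coset P"
proof -
  note PQ = carrier_mat[OF assms(1)] carrier_mat[OF assms(2)]
  show "coset (P + Q) = coset P \<oplus>\<^bsub>psl a b\<^esub> coset Q"
    unfolding psl_eq using coset_set_add[OF assms] by (simp add: quotient_superalgebra_def)
  have "coset P \<otimes>\<^bsub>psl a b\<^esub> coset Q = (\<Union>U\<in>coset P. \<Union>V\<in>coset Q. coset (superbracket a U V))"
    unfolding psl_eq by (simp add: quotient_superalgebra_def rcoset_mult_def coset_def[symmetric] simps)
  also have "\<dots> = (\<Union>U\<in>coset P. \<Union>V\<in>coset Q. coset (superbracket a P Q))"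
    using superbracket_shift[OF assms] by (intro SUP_cong refl) (auto simp: coset_eq)
  also have "\<dots> = coset (superbracket a P Q)" using coset_self[OF assms(1)] coset_self[OF assms(2)] by blast
  finally show "coset (superbracket a P Q) = coset P \<otimes>\<^bsub>psl a b\<^esub> coset Q" ..
  have "k \<odot>\<^bsub>psl a b\<^esub> coset P = (\<Union>U\<in>coset P. coset (k \<cdot>\<^sub>m U))"
    unfolding psl_eq by (simp add: quotient_superalgebra_def coset_def[symmetric] simps)
  also have "\<dots> = (\<Union>U\<in>coset P. coset (k \<cdot>\<^sub>m P))"
  proof (intro SUP_cong refl)
    fix U assume "U \<in> coset P"
    then obtain c where U: "U = c \<cdot>\<^sub>m 1\<^sub>m (a + b) + P" unfolding coset_eq by blast
    have "k \<cdot>\<^sub>m U = (k * c) \<cdot>\<^sub>m 1\<^sub>m (a + b) + k \<cdot>\<^sub>m P" unfolding U using PQ by (intro eq_matI) (auto simp: distrib_left)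
    then show "coset (k \<cdot>\<^sub>m U) = coset (k \<cdot>\<^sub>m P)" using coset_shift[of "k \<cdot>\<^sub>m P"] PQ by simp
  qed
  also have "\<dots> = coset (k \<cdot>\<^sub>m P)" using coset_self[OF assms(1)] by blast
  finally show "coset (k \<cdot>\<^sub>m P) = k \<odot>\<^bsub>psl a b\<^esub> coset P" ..
qed

lemma psl_simps: "carrier (psl a b) = coset ` carrier \<G>" "\<zero>\<^bsub>psl a b\<^esub> = scalars"
    "even_part (psl a b) = coset ` V0" "odd_part (psl a b) = coset ` V1"
  unfolding psl_eq by (auto simp: quotient_superalgebra_def A_RCOSETS_def' coset_def simps)

lemma coset_hom: "superalgebra_hom id \<G> (psl a b) coset"
  unfolding superalgebra_hom_def using coset_psl by (auto simp: psl_simps simps)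

lemma coset_kernel:
  assumes "Q \<in> carrier \<G>"
  shows "coset Q = \<zero>\<^bsub>psl a b\<^esub> \<longleftrightarrow> Q \<in> V0 \<and> (\<forall>x\<in>V1. commutator Q x = 0\<^sub>m (a + b) (a + b))"
proof -
  have "coset Q = scalars \<longleftrightarrow> Q \<in> scalars"
  proof
    assume "coset Q = scalars" then show "Q \<in> scalars" using coset_self[OF assms] by simp
  next
    assume "Q \<in> scalars"
    then obtain c where Q: "Q = c \<cdot>\<^sub>m 1\<^sub>m (a + b) + 0\<^sub>m (a + b) (a + b)" unfolding scalars_def by auto
    have "coset Q = coset (0\<^sub>m (a + b) (a + b))" unfolding Q by (rule coset_shift) simp
    also have "\<dots> = scalars" unfolding coset_eq scalars_def by simp
    finally show "coset Q = scalars" .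
  qed
  also have "\<dots> \<longleftrightarrow> Q \<in> V0 \<and> (\<forall>x\<in>V1. commutator Q x = 0\<^sub>m (a + b) (a + b))"
    using annihilator_scalar[of Q] scalar_in_V0[OF char_dvd] scalar_annihilates sub1(1) unfolding scalars_def by blast
  finally show ?thesis by (simp add: psl_simps)
qed

lemma vectorspace_psl: "vectorspace class_ring (psl a b :: ('l, 'l mat set) superalgebra)"
proof (rule vectorspace_image[OF vectorspace_matrix_superalgebra])
  show "coset ` carrier \<G> = carrier (psl a b)" by (simp add: psl_simps)
  show "coset \<zero>\<^bsub>\<G>\<^esub> = \<zero>\<^bsub>psl a b\<^esub>"
    using coset_kernel[OF even_in[OF sub0(2)]] sub0(2) by (simp add: simps commutator_zero(1) sub1(1))
qed (use coset_psl in \<open>simp_all add: simps\<close>)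

end

end

section \<open>Normal forms of symmetric and alternating matrices\<close>

text \<open>If \<open>m < n\<close>, pad the factors by zeros to square matrices, which does not change the product. Then the reversed
  product is the identity as well, although its row \<open>m\<close> vanishes.\<close>

lemma product_one_dim_le:
  fixes P Q :: "'l::field mat"
  assumes P: "P \<in> carrier_mat n m" and Q: "Q \<in> carrier_mat m n" and PQ: "P * Q = 1\<^sub>m n"
  shows "n \<le> m"
proof (rule ccontr)
  assume "\<not> n \<le> m"
  then have mn: "m < n" by simp
  let ?P = "mat n n (\<lambda>(i, j). if j < m then P $$ (i, j) else 0)"
  let ?Q = "mat n n (\<lambda>(i, j). if i < m then Q $$ (i, j) else 0)"
  have "?P * ?Q = P * Q"
  proof (rule eq_matI)
    fix i j assume "i < dim_row (P * Q)" "j < dim_col (P * Q)"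
    then have ij: "i < n" "j < n" using P Q by auto
    have "(?P * ?Q) $$ (i, j) = (\<Sum>k = 0..<n. if k < m then P $$ (i, k) * Q $$ (k, j) else 0)"
      using ij by (auto simp: scalar_prod_def intro!: sum.cong)
    also have "\<dots> = (\<Sum>k\<in>{0..<m}. P $$ (i, k) * Q $$ (k, j))"
      using mn by (intro sum.mono_neutral_cong_right) auto
    also have "\<dots> = (P * Q) $$ (i, j)" using ij P Q by (simp add: scalar_prod_def)
    finally show "(?P * ?Q) $$ (i, j) = (P * Q) $$ (i, j)" .
  qed (use P Q in auto)
  then have "?Q * ?P = 1\<^sub>m n"
    using PQ by (intro mat_mult_left_right_inverse[of ?P n ?Q]) auto
  then have "(?Q * ?P) $$ (m, m) = 1" using mn by simp
  moreover have "(?Q * ?P) $$ (m, m) = 0" using mn by (simp add: scalar_prod_def)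
  ultimately show False by simp
qed

lemma spanning_family_card:
  fixes e :: "nat \<Rightarrow> nat \<Rightarrow> 'l::field"
  assumes "\<And>x k. k < n \<Longrightarrow> x k = (\<Sum>i<m. c x i * e i k)"
  shows "n \<le> m"
proof (rule product_one_dim_le)
  let ?u = "\<lambda>k j. if j = k then 1 else 0 :: 'l"
  show "mat n m (\<lambda>(k, i). e i k) * mat m n (\<lambda>(i, k). c (?u k) i) = 1\<^sub>m n"
  proof (rule eq_matI)
    fix i j assume "i < dim_row (1\<^sub>m n :: 'l mat)" "j < dim_col (1\<^sub>m n :: 'l mat)"
    then show "(mat n m (\<lambda>(k, i). e i k) * mat m n (\<lambda>(i, k). c (?u k) i)) $$ (i, j) = 1\<^sub>m n $$ (i, j)"
      using assms[of i "?u j"] by (simp add: scalar_prod_def atLeast0LessThan mult.commute)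
  qed auto
qed auto

text \<open>Vectors are functions on the natural numbers of which only the first \<open>n\<close> values matter.\<close>

locale bilinear_matrix_form =
  fixes n :: nat and S SI :: "'l::field mat"
  assumes S: "S \<in> carrier_mat n n" and SI: "SI \<in> carrier_mat n n" "S * SI = 1\<^sub>m n" and two: "(2::'l) \<noteq> 0"
begin

definition B :: "(nat \<Rightarrow> 'l) \<Rightarrow> (nat \<Rightarrow> 'l) \<Rightarrow> 'l" where
  "B x y = (\<Sum>k<n. \<Sum>l<n. x k * S $$ (k, l) * y l)"

lemma B_add: "B (\<lambda>k. x k + y k) z = B x z + B y z" "B z (\<lambda>k. x k + y k) = B z x + B z y"
  by (simp_all add: B_def algebra_simps sum.distrib)

lemma B_scale: "B (\<lambda>k. c * x k) z = c * B x z" "B z (\<lambda>k. c * x k) = c * B z x"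
  by (simp_all add: B_def algebra_simps sum_distrib_left)

lemma B_zero: "B (\<lambda>k. 0) z = 0" "B z (\<lambda>k. 0) = 0"
  by (simp_all add: B_def)

lemma B_diff: "B (\<lambda>k. x k - y k) z = B x z - B y z" "B z (\<lambda>k. x k - y k) = B z x - B z y"
  by (simp_all add: B_def algebra_simps sum_subtractf)

lemma B_sum: "B (\<lambda>k. \<Sum>i\<in>I. f i k) z = (\<Sum>i\<in>I. B (f i) z)" "B z (\<lambda>k. \<Sum>i\<in>I. f i k) = (\<Sum>i\<in>I. B z (f i))"
  by (induction I rule: infinite_finite_induct) (simp_all add: B_zero B_add)

lemma B_nondegenerate:
  assumes "\<And>y. B x y = 0" and k: "k < n" shows "x k = 0"
proof -
  let ?x = "mat 1 n (\<lambda>(i, k). x k)"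
  have "?x * S = 0\<^sub>m 1 n"
  proof (rule eq_matI)
    fix i j assume "i < dim_row (0\<^sub>m 1 n :: 'l mat)" "j < dim_col (0\<^sub>m 1 n :: 'l mat)"
    then have ij: "i = 0" "j < n" by auto
    have "B x (\<lambda>l. if l = j then 1 else 0) = (\<Sum>k<n. x k * S $$ (k, j))"
      using ij unfolding B_def by (simp add: if_distrib[of "\<lambda>u. _ * u"] sum.delta cong: if_cong)
    then show "(?x * S) $$ (i, j) = 0\<^sub>m 1 n $$ (i, j)"
      using ij S assms(1) by (simp add: scalar_prod_def atLeast0LessThan)
  qed (use S in auto)
  then have 0: "?x * S * SI = 0\<^sub>m 1 n" using SI(1) by simp
  have "?x * S * SI = ?x"
    using assoc_mult_mat[of ?x 1 n S n SI n] S SI right_mult_one_mat[of ?x 1 n] by simp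
  from trans[OF this[symmetric] 0] have "?x = 0\<^sub>m 1 n" .
  then have "?x $$ (0, k) = 0\<^sub>m 1 n $$ (0, k)" by (rule arg_cong)
  then show ?thesis using k by simp
qed

lemma form_matrix:
  assumes "\<And>i j. i < m \<Longrightarrow> j < m \<Longrightarrow> B (e i) (e j) = T $$ (i, j)" "T \<in> carrier_mat m m"
  shows "transpose_mat (mat n m (\<lambda>(k, i). e i k)) * S * mat n m (\<lambda>(k, i). e i k) = T"
proof (rule eq_matI)
  fix i j assume "i < dim_row T" "j < dim_col T"
  then have ij: "i < m" "j < m" using assms(2) by auto
  show "(transpose_mat (mat n m (\<lambda>(k, i). e i k)) * S * mat n m (\<lambda>(k, i). e i k)) $$ (i, j) = T $$ (i, j)"
    using ij S unfolding assms(1)[OF ij, symmetric] B_def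
    by (simp add: scalar_prod_def atLeast0LessThan sum_distrib_right) (rule sum.swap)
qed (use assms(2) S in auto)

text \<open>Gram-Schmidt. Suppose that all vectors orthogonal to the family constructed so far are isotropic. By polarisation
  the orthogonal complement is totally isotropic, hence 0 by nondegeneracy, and the family spans. So as long as
  \<open>m < n\<close>, some orthogonal vector is anisotropic, and it can be divided by a square root of its norm.\<close>

lemma orthonormal_family:
  assumes sym: "transpose_mat S = S" and closed: "\<And>c::'l. \<exists>d. d ^ 2 = c" and "m \<le> n"
  shows "\<exists>e. \<forall>i<m. \<forall>j<m. B (e i) (e j) = (if i = j then 1 else 0)"
  using \<open>m \<le> n\<close>
proof (induction m)
  case (Suc m)
  then obtain e where e: "\<And>i j. i < m \<Longrightarrow> j < m \<Longrightarrow> B (e i) (e j) = (if i = j then 1 else 0)" by auto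
  have Bsym: "B x y = B y x" for x y
  proof -
    have s: "S $$ (k, l) = S $$ (l, k)" if "k < n" "l < n" for k l
      using arg_cong[OF sym, of "\<lambda>Z. Z $$ (k, l)"] that S by simp
    have "B x y = (\<Sum>l<n. \<Sum>k<n. x k * S $$ (k, l) * y l)" unfolding B_def by (rule sum.swap)
    also have "\<dots> = B y x" unfolding B_def by (intro sum.cong refl) (simp add: s mult.commute mult.left_commute)
    finally show ?thesis .
  qed
  define pr where "pr x = (\<lambda>k. x k - (\<Sum>i<m. B (e i) x * e i k))" for x
  have pr: "B (e j) (pr x) = 0" if "j < m" for j x
  proof -
    have "B (e j) (pr x) = B (e j) x - (\<Sum>i<m. B (e i) x * B (e j) (e i))"
      unfolding pr_def by (simp add: B_diff B_sum B_scale)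
    also have "(\<Sum>i<m. B (e i) x * B (e j) (e i)) = (\<Sum>i<m. if i = j then B (e j) x else 0)"
      using that by (intro sum.cong) (auto simp: e)
    also have "\<dots> = B (e j) x" using that by (simp add: sum.delta)
    finally show ?thesis by simp
  qed
  have "\<exists>v. B v v \<noteq> 0 \<and> (\<forall>j<m. B (e j) v = 0)"
  proof (rule ccontr)
    assume no: "\<not> (\<exists>v. B v v \<noteq> 0 \<and> (\<forall>j<m. B (e j) v = 0))"
    have iso: "B v v = 0" if "\<And>j. j < m \<Longrightarrow> B (e j) v = 0" for v using no that by blast
    have "pr x k = 0" if "k < n" for x k
    proof (rule B_nondegenerate[OF _ that])
      fix y
      have 0: "B (pr x) (pr y) = 0"
      proof -
        have "B (\<lambda>k. pr x k + pr y k) (\<lambda>k. pr x k + pr y k) = 0" "B (pr x) (pr x) = 0" "B (pr y) (pr y) = 0"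
          by (rule iso; simp add: B_add pr)+
        then have "2 * B (pr x) (pr y) = 0" by (simp add: B_add Bsym[of "pr y" "pr x"])
        then show ?thesis using two by simp
      qed
      have "B (pr x) y = B (pr x) (\<lambda>k. pr y k + (\<Sum>i<m. B (e i) y * e i k))" by (simp add: pr_def)
      also have "\<dots> = B (pr x) (pr y) + (\<Sum>i<m. B (e i) y * B (pr x) (e i))" by (simp add: B_add B_sum B_scale)
      also have "(\<Sum>i<m. B (e i) y * B (pr x) (e i)) = 0"
        using pr by (intro sum.neutral) (simp add: Bsym[of "pr x" "e _"])
      also have "B (pr x) (pr y) + 0 = 0" by (simp add: 0)
      finally show "B (pr x) y = 0" .
    qed
    then have "x k = (\<Sum>i<m. B (e i) x * e i k)" if "k < n" for x k using that by (simp add: pr_def)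
    then have "n \<le> m" by (rule spanning_family_card)
    with Suc.prems show False by simp
  qed
  then obtain v where v: "B v v \<noteq> 0" "\<And>j. j < m \<Longrightarrow> B (e j) v = 0" by blast
  obtain d where d: "d ^ 2 = B v v" using closed by blast
  then have d0: "d \<noteq> 0" using v(1) by auto
  define w where "w = (\<lambda>k. (1 / d) * v k)"
  have w: "B w (e j) = 0" "B (e j) w = 0" if "j < m" for j
    unfolding w_def B_scale d[symmetric] using v(2)[OF that] Bsym[of v "e j"] by simp_all
  have ww: "B w w = 1"
    unfolding w_def B_scale d[symmetric] using d0 by (simp add: power2_eq_square)
  have "B ((e(m := w)) i) ((e(m := w)) j) = (if i = j then 1 else 0)" if "i < Suc m" "j < Suc m" for i j
    using that e w ww by (auto simp: less_Suc_eq)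
  then show ?case by (intro exI[of _ "e(m := w)"]) auto
qed auto

lemma B_alternating:
  assumes alt: "transpose_mat S = - S"
  shows "B x y = - B y x"
proof -
  have s: "S $$ (k, l) = - S $$ (l, k)" if "k < n" "l < n" for k l
    using arg_cong[OF alt, of "\<lambda>Z. Z $$ (l, k)"] that S by simp
  have "B x y = (\<Sum>l<n. \<Sum>k<n. x k * S $$ (k, l) * y l)" unfolding B_def by (rule sum.swap)
  also have "\<dots> = (\<Sum>l<n. \<Sum>k<n. - (y l * S $$ (l, k) * x k))"
    by (intro sum.cong refl, subst s) auto
  also have "\<dots> = - B y x" unfolding B_def by (simp add: sum_negf)
  finally show ?thesis .
qed

text \<open>As long as \<open>2 m < n\<close> the hyperbolic pairs constructed so far do not span, so some projection \<open>v\<close> to their orthogonal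
  complement is nonzero. By nondegeneracy \<open>v\<close> pairs nontrivially with a vector, whose projection completes \<open>v\<close> to
  a hyperbolic pair.\<close>

lemma symplectic_family:
  assumes alt: "transpose_mat S = - S" and "2 * m \<le> n"
  shows "\<exists>p q. \<forall>i<m. \<forall>j<m. B (p i) (p j) = 0 \<and> B (q i) (q j) = 0 \<and> B (p i) (q j) = (if i = j then 1 else 0)"
  using assms(2)
proof (induction m)
  case (Suc m)
  then obtain p q where "\<forall>i<m. \<forall>j<m. B (p i) (p j) = 0 \<and> B (q i) (q j) = 0 \<and> B (p i) (q j) = (if i = j then 1 else 0)"
    by auto
  then have pq: "\<And>i j. i < m \<Longrightarrow> j < m \<Longrightarrow> B (p i) (p j) = 0" "\<And>i j. i < m \<Longrightarrow> j < m \<Longrightarrow> B (q i) (q j) = 0"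
    "\<And>i j. i < m \<Longrightarrow> j < m \<Longrightarrow> B (p i) (q j) = (if i = j then 1 else 0)" by auto
  note Balt = B_alternating[OF alt]
  have Bself: "B x x = 0" for x
  proof -
    have "2 * B x x = 0" using Balt[of x x] by (simp add: eq_neg_iff_add_eq_0)
    then show ?thesis using two by simp
  qed
  have qp: "B (q i) (p j) = (if i = j then - 1 else 0)" if "i < m" "j < m" for i j
    using Balt[of "q i" "p j"] pq(3)[OF that(2,1)] by auto
  define pr where "pr x = (\<lambda>k. x k - (\<Sum>i<m. B x (q i) * p i k) + (\<Sum>i<m. B x (p i) * q i k))" for x
  have prB: "B (pr x) y = B x y - (\<Sum>i<m. B x (q i) * B (p i) y) + (\<Sum>i<m. B x (p i) * B (q i) y)" for x y
    unfolding pr_def by (simp add: B_diff B_add B_sum B_scale)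
  have pr: "B (pr x) (p j) = 0" "B (pr x) (q j) = 0" if "j < m" for j x
  proof -
    have "(\<Sum>i<m. B x (q i) * B (p i) (p j)) = 0" "(\<Sum>i<m. B x (p i) * B (q i) (q j)) = 0"
      using that by (auto simp: pq intro!: sum.neutral)
    moreover have "(\<Sum>i<m. B x (p i) * B (q i) (p j)) = (\<Sum>i<m. if i = j then - B x (p j) else 0)"
      "(\<Sum>i<m. B x (q i) * B (p i) (q j)) = (\<Sum>i<m. if i = j then B x (q j) else 0)"
      by (intro sum.cong refl; use that in \<open>simp add: pq qp\<close>)+
    ultimately show "B (pr x) (p j) = 0" "B (pr x) (q j) = 0"
      using that by (simp_all add: prB sum.delta)
  qed
  have "\<exists>v k. k < n \<and> pr v k \<noteq> 0"
  proof (rule ccontr)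
    assume no: "\<not> (\<exists>v k. k < n \<and> pr v k \<noteq> 0)"
    have expand: "x k = (\<Sum>i<m. B x (q i) * p i k) + (\<Sum>i<m. - B x (p i) * q i k)" if "k < n" for x k
    proof -
      have "pr x k = 0" using no that by blast
      moreover have "u = v - w" if "u - v + w = 0" for u v w :: 'l
      proof -
        have "u = (u - v + w) + v - w" by simp
        then show ?thesis unfolding that by simp
      qed
      ultimately have "x k = (\<Sum>i<m. B x (q i) * p i k) - (\<Sum>i<m. B x (p i) * q i k)"
        unfolding pr_def by blast
      then show ?thesis by (simp add: sum_negf)
    qed
    have "x k = (\<Sum>i<m + m. (if i < m then B x (q i) else - B x (p (i - m))) * (if i < m then p i k else q (i - m) k))"
      if "k < n" for x k
    proof -
      let ?f = "\<lambda>i. (if i < m then B x (q i) else - B x (p (i - m))) * (if i < m then p i k else q (i - m) k)"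
      have "(\<Sum>i<m + m. ?f i) = (\<Sum>i<m. ?f i) + (\<Sum>i=m..<m + m. ?f i)"
        using sum.atLeastLessThan_concat[of 0 m "m + m" ?f] by (simp add: atLeast0LessThan)
      also have "(\<Sum>i=m..<m + m. ?f i) = (\<Sum>i<m. ?f (i + m))"
        using sum.shift_bounds_nat_ivl[of ?f 0 m m] by (simp add: atLeast0LessThan)
      finally have "(\<Sum>i<m + m. ?f i) = (\<Sum>i<m. ?f i) + (\<Sum>i<m. ?f (i + m))" .
      then show ?thesis by (subst expand[OF that]) simp
    qed
    then have "n \<le> m + m" by (rule spanning_family_card)
    with Suc.prems show False by simp
  qed
  then obtain v k where v: "k < n" "pr v k \<noteq> 0" by blast
  then obtain y where y: "B (pr v) y \<noteq> 0" using B_nondegenerate by blast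
  let ?p = "pr v"
  have "B ?p (pr y) = - B (pr y) ?p" by (rule Balt)
  also have "B (pr y) ?p = B y ?p - (\<Sum>i<m. B y (q i) * B (p i) ?p) + (\<Sum>i<m. B y (p i) * B (q i) ?p)" by (rule prB)
  also have "\<dots> = B y ?p"
    using pr by (simp add: Balt[of _ "pr v"])
  finally have py: "B ?p (pr y) \<noteq> 0" using y Balt[of "pr v" y] by simp
  let ?c = "B ?p (pr y)"
  let ?q = "\<lambda>k. (1 / ?c) * pr y k"
  have new: "B ?p ?q = 1" using py by (simp only: B_scale) simp
  have q0: "B ?q (p j) = 0" "B ?q (q j) = 0" "B (p j) ?q = 0" "B (q j) ?q = 0" "B (p j) ?p = 0" "B (q j) ?p = 0" if "j < m" for j
    using pr[OF that] by (simp_all only: B_scale Balt[of "p j"] Balt[of "q j"]) simp_all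
  have "B ((p(m := ?p)) i) ((p(m := ?p)) j) = 0 \<and> B ((q(m := ?q)) i) ((q(m := ?q)) j) = 0 \<and>
      B ((p(m := ?p)) i) ((q(m := ?q)) j) = (if i = j then 1 else 0)" if "i < Suc m" "j < Suc m" for i j
    using that pq pr q0 new Bself by (auto simp: less_Suc_eq)
  then show ?case by blast
qed auto

end

lemma inverse_of_congruence:
  fixes P S T TI :: "'l::field mat"
  assumes "P \<in> carrier_mat n n" "S \<in> carrier_mat n n" "TI \<in> carrier_mat n n" "T \<in> carrier_mat n n"
    and PSP: "transpose_mat P * S * P = T" and TI: "TI * T = 1\<^sub>m n"
  obtains Q where "Q \<in> carrier_mat n n" "P * Q = 1\<^sub>m n" "Q * P = 1\<^sub>m n" "S = transpose_mat Q * T * Q"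
proof -
  have [simp]: "dim_row P = n" "dim_col P = n" "dim_row S = n" "dim_col S = n" "dim_row TI = n" "dim_col TI = n" using assms by auto
  define Q where "Q = TI * (transpose_mat P * S)"
  have Q: "Q \<in> carrier_mat n n" unfolding Q_def by (rule carrier_matI) auto
  have [simp]: "dim_row Q = n" "dim_col Q = n" using Q by auto
  have QP: "Q * P = 1\<^sub>m n" unfolding Q_def using PSP TI by (simp add: mat_ring)
  then have PQ: "P * Q = 1\<^sub>m n" using mat_mult_left_right_inverse[OF Q assms(1)] by blast
  have "transpose_mat Q * transpose_mat P = 1\<^sub>m n" using arg_cong[OF PQ, of transpose_mat] by (simp add: transpose_mult')
  then have 1: "transpose_mat Q * (transpose_mat P * Z) = Z" if "Z \<in> carrier_mat n n" for Z
    using that mult_assoc'[of "transpose_mat Q" "transpose_mat P" Z] by auto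
  have "transpose_mat Q * T * Q = transpose_mat Q * (transpose_mat P * (S * (P * Q)))"
    unfolding PSP[symmetric] by (simp add: mat_ring)
  also have "\<dots> = S" unfolding PQ using assms(2) by (simp add: 1)
  finally show thesis using that[OF Q PQ QP] by simp
qed

lemma symmetric_normal_form:
  fixes S :: "'l::alg_closed_field mat"
  assumes S: "S \<in> carrier_mat n n" "transpose_mat S = S" and SI: "SI \<in> carrier_mat n n" "S * SI = 1\<^sub>m n"
    and two: "(2::'l) \<noteq> 0"
  obtains P Q where "P \<in> carrier_mat n n" "Q \<in> carrier_mat n n" "P * Q = 1\<^sub>m n" "Q * P = 1\<^sub>m n" "S = transpose_mat Q * Q"
proof -
  interpret bilinear_matrix_form n S SI by unfold_locales fact+
  have "\<exists>d. d ^ 2 = c" for c :: 'l using nth_root_exists[of 2 c] by auto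
  from orthonormal_family[OF assms(2) this, of n] obtain e where "\<forall>i<n. \<forall>j<n. B (e i) (e j) = (if i = j then 1 else 0)" by auto
  then have "transpose_mat (mat n n (\<lambda>(k, i). e i k)) * S * mat n n (\<lambda>(k, i). e i k) = 1\<^sub>m n"
    by (intro form_matrix) auto
  from inverse_of_congruence[OF _ assms(1) _ _ this, of "1\<^sub>m n"] that show thesis
    by (metis left_mult_one_mat one_carrier_mat mat_carrier right_mult_one_mat transpose_carrier_mat)
qed

definition std_alternating :: "nat \<Rightarrow> 'a::ring_1 mat" where
  "std_alternating k = four_block_mat (0\<^sub>m k k) (1\<^sub>m k) (- 1\<^sub>m k) (0\<^sub>m k k)"

lemma std_alternating_carrier [simp]: "std_alternating k \<in> carrier_mat (2 * k) (2 * k)"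
  "dim_row (std_alternating k) = 2 * k" "dim_col (std_alternating k) = 2 * k"
  by (auto simp: std_alternating_def)

lemma std_alternating_square: "std_alternating k * std_alternating k = - 1\<^sub>m (2 * k)"
proof -
  have "std_alternating k * std_alternating k = four_block_mat (- 1\<^sub>m k) (0\<^sub>m k k) (0\<^sub>m k k) (- 1\<^sub>m k :: 'a mat)"
    unfolding std_alternating_def by (subst mult_four_block_mat[of _ k k _ k _ k]) auto
  also have "\<dots> = - 1\<^sub>m (2 * k)" by (rule eq_matI) auto
  finally show ?thesis .
qed

lemma std_alternating_transpose: "transpose_mat (std_alternating k) = - std_alternating k"
  by (rule eq_matI) (auto simp: std_alternating_def)

lemma alternating_normal_form:
  fixes S :: "'l::field mat"
  assumes S: "S \<in> carrier_mat (2 * k) (2 * k)" "transpose_mat S = - S" and SI: "SI \<in> carrier_mat (2 * k) (2 * k)" "S * SI = 1\<^sub>m (2 * k)"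
    and two: "(2::'l) \<noteq> 0"
  obtains P Q where "P \<in> carrier_mat (2 * k) (2 * k)" "Q \<in> carrier_mat (2 * k) (2 * k)"
    "P * Q = 1\<^sub>m (2 * k)" "Q * P = 1\<^sub>m (2 * k)" "S = transpose_mat Q * std_alternating k * Q"
proof -
  interpret bilinear_matrix_form "2 * k" S SI by unfold_locales fact+
  from symplectic_family[OF assms(2), of k] obtain p q where
    pq: "\<forall>i<k. \<forall>j<k. B (p i) (p j) = 0 \<and> B (q i) (q j) = 0 \<and> B (p i) (q j) = (if i = j then 1 else 0)" by auto
  note Balt = B_alternating[OF assms(2)]
  let ?e = "\<lambda>i. if i < k then p i else q (i - k)"
  have "B (?e i) (?e j) = std_alternating k $$ (i, j)" if "i < 2 * k" "j < 2 * k" for i j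
    using that pq Balt[of "q (i - k)" "p j"] by (auto simp: std_alternating_def)
  then have "transpose_mat (mat (2 * k) (2 * k) (\<lambda>(k, i). ?e i k)) * S * mat (2 * k) (2 * k) (\<lambda>(k, i). ?e i k) = std_alternating k"
    by (intro form_matrix) auto
  moreover have "(- std_alternating k) * std_alternating k = (1\<^sub>m (2 * k) :: 'l mat)"
    by (simp add: std_alternating_square)
  ultimately obtain Q where "Q \<in> carrier_mat (2 * k) (2 * k)" "mat (2 * k) (2 * k) (\<lambda>(k, i). ?e i k) * Q = 1\<^sub>m (2 * k)"
    "Q * mat (2 * k) (2 * k) (\<lambda>(k, i). ?e i k) = 1\<^sub>m (2 * k)" "S = transpose_mat Q * std_alternating k * Q"
    by (rule inverse_of_congruence[OF mat_carrier assms(1) uminus_carrier_mat[OF std_alternating_carrier(1)] std_alternating_carrier(1)])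
  then show thesis by (rule that[OF mat_carrier])
qed

section \<open>Orthogonal bases of composition algebras\<close>

context assoc_composition_algebra
begin

definition orthogonal_set :: "'c set \<Rightarrow> bool" where
  "orthogonal_set E \<longleftrightarrow> finite E \<and> (\<forall>e\<in>E. n e \<noteq> 0) \<and> (\<forall>e\<in>E. \<forall>f\<in>E. e \<noteq> f \<longrightarrow> polar n e f = 0)"

text \<open>The coordinate of \<open>x\<close> at a vector \<open>e\<close> of an orthogonal basis.\<close>

definition coord :: "'c \<Rightarrow> 'c \<Rightarrow> 'k" where "coord x e = polar n x e / (2 * n e)"

lemma polar_self: "polar n x x = 2 * n x"
  using polar_mult_same_right[of 1 x 1] by (simp add: polar_one_one)

lemma polar_sum_left: "polar n (\<Sum>e\<in>E. f e) y = (\<Sum>e\<in>E. polar n (f e) y)"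
proof (induction E rule: infinite_finite_induct)
  case empty
  show ?case using polar_scale_left[of 0 0 y] by simp
next
  case (infinite A)
  show ?case using polar_scale_left[of 0 0 y] infinite by simp
qed (simp add: polar_add_left)

lemma norm_cj: "x * cj x = scale (n x) 1"
proof -
  have "polar n (x * cj x) y = polar n (scale (n x) 1) y" for y
    using polar_cj_right[of x "cj x" y] polar_mult_same_right[of 1 x y] by (simp add: cj_cj polar_scale_left mult.commute)
  then have "x * cj x - scale (n x) 1 = 0" by (intro polar_nondegenerate) (simp add: polar_linear)
  then show ?thesis by simp
qed

lemma cj_perp: "polar n x 1 = 0 \<Longrightarrow> cj x = - x"
  by (simp add: conjugation_def)

lemma square_perp: "polar n x 1 = 0 \<Longrightarrow> x * x = scale (- n x) 1"
proof -
  assume "polar n x 1 = 0"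
  then have "- (x * x) = scale (n x) 1" using norm_cj[of x] by (simp add: cj_perp)
  then have "x * x = - scale (n x) 1" by (metis minus_minus)
  then show ?thesis by simp
qed

lemma add_cj: "x + cj x = scale (polar n x 1) 1"
  by (simp add: conjugation_def)

lemma trace_pairing: "polar n (x * cj w) 1 = polar n x w"
  using polar_cj_right[of x "cj w" 1] by (simp add: cj_cj)

context
  assumes two: "(2::'k) \<noteq> 0"
begin

lemma orthogonal_independent:
  assumes "orthogonal_set E" shows "independent E"
proof -
  have "u e = 0" if "(\<Sum>e\<in>E. scale (u e) e) = 0" "e \<in> E" for u e
  proof -
    have "0 = polar n (\<Sum>e\<in>E. scale (u e) e) e" using that(1) polar_scale_left[of 0 0 e] by simp
    also have "\<dots> = (\<Sum>f\<in>E. u f * polar n f e)" by (simp add: polar_sum_left polar_scale_left)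
    also have "\<dots> = (\<Sum>f\<in>E. if f = e then u e * polar n e e else 0)"
      using assms that(2) by (intro sum.cong) (auto simp: orthogonal_set_def)
    also have "\<dots> = u e * (2 * n e)" using assms that(2) by (simp add: orthogonal_set_def sum.delta polar_self)
    finally show ?thesis using assms that(2) two by (auto simp: orthogonal_set_def)
  qed
  then show ?thesis using assms by (simp add: independent_explicit_finite_subsets orthogonal_set_def dependent_finite) blast
qed

text \<open>The projection of a vector outside the span to the orthogonal complement is nonzero. If the complement had
  norm 0, it would be totally isotropic by polarisation, and this projection would be orthogonal to
  everything.\<close>

lemma orthogonal_extend:
  assumes E: "orthogonal_set E" and "span E \<noteq> UNIV"
  obtains x where "n x \<noteq> 0" "\<And>e. e \<in> E \<Longrightarrow> polar n x e = 0"
proof -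
  define pr where "pr x = x - (\<Sum>e\<in>E. scale (coord x e) e)" for x
  have pr: "polar n (pr x) e = 0" if "e \<in> E" for x e
  proof -
    have "polar n (\<Sum>f\<in>E. scale (coord x f) f) e = (\<Sum>f\<in>E. coord x f * polar n f e)" by (simp add: polar_sum_left polar_scale_left)
    also have "\<dots> = (\<Sum>f\<in>E. if f = e then coord x e * polar n e e else 0)"
      using E that by (intro sum.cong) (auto simp: orthogonal_set_def)
    also have "\<dots> = polar n x e" using E that two by (simp add: orthogonal_set_def sum.delta polar_self coord_def)
    finally show ?thesis by (simp add: pr_def polar_linear)
  qed
  obtain x where x: "x \<notin> span E" using assms(2) by blast
  have "(\<Sum>e\<in>E. scale (coord x e) e) \<in> span E" by (intro span_sum span_scale span_base)
  then have x0: "pr x \<noteq> 0" using x by (auto simp: pr_def)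
  have "\<exists>y. n y \<noteq> 0 \<and> (\<forall>e\<in>E. polar n y e = 0)"
  proof (rule ccontr)
    assume no: "\<not> (\<exists>y. n y \<noteq> 0 \<and> (\<forall>e\<in>E. polar n y e = 0))"
    have iso: "n y = 0" if "\<And>e. e \<in> E \<Longrightarrow> polar n y e = 0" for y using no that by blast
    have "polar n (pr x) y = 0" for y
    proof -
      have "n (pr x + pr y) = 0" "n (pr x) = 0" "n (pr y) = 0"
        by (rule iso; simp add: polar_add_left pr)+
      then have "polar n (pr x) (pr y) = 0" by (simp add: norm_add)
      moreover have "polar n (pr x) (\<Sum>e\<in>E. scale (coord y e) e) = (\<Sum>e\<in>E. coord y e * polar n (pr x) e)"
        unfolding polar_commute[of "pr x"] by (simp add: polar_sum_left polar_scale_left)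
      moreover have "\<dots> = 0" by (simp add: pr)
      moreover have "y = pr y + (\<Sum>e\<in>E. scale (coord y e) e)" by (simp add: pr_def)
      ultimately show ?thesis by (metis add_0 polar_add_right)
    qed
    then have "pr x = 0" by (rule polar_nondegenerate)
    with x0 show False by simp
  qed
  then show thesis using that by blast
qed

lemma orthogonal_dim: "orthogonal_set E \<Longrightarrow> span E = UNIV \<Longrightarrow> dim (UNIV :: 'c set) = card E"
  using dim_eq_card[of E UNIV] orthogonal_independent by simp

lemma orthogonal_spans:
  assumes E: "orthogonal_set E" and d: "card E = dim (UNIV :: 'c set)" "dim (UNIV :: 'c set) \<noteq> 0"
  shows "span E = UNIV"
proof (rule ccontr)
  assume ne: "span E \<noteq> UNIV"
  obtain B where B: "independent B" "span B = UNIV" "card B = dim (UNIV :: 'c set)"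
    using basis_exists[of UNIV] by (metis top.extremum_unique)
  have "finite B" using B(3) d(2) card.infinite by fastforce
  obtain x where "x \<notin> span E" using ne by blast
  then have "independent (insert x E)" "x \<notin> E"
    using orthogonal_independent[OF E] independent_insert[of x E] span_base by auto
  then have "card (insert x E) \<le> card B"
    using independent_span_bound[OF \<open>finite B\<close>] B(2) by simp
  with \<open>x \<notin> E\<close> E B(3) d(1) show False by (simp add: orthogonal_set_def)
qed

lemma orthogonal_expand:
  assumes E: "orthogonal_set E" and sp: "span E = UNIV"
  shows "x = (\<Sum>e\<in>E. scale (coord x e) e)"
proof -
  have fin: "finite E" using E by (simp add: orthogonal_set_def)
  have "x \<in> span E" using sp by simp
  then obtain u where u: "x = (\<Sum>e\<in>E. scale (u e) e)" using span_finite[OF fin] by auto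
  have "coord x e = u e" if "e \<in> E" for e
  proof -
    have "polar n x e = (\<Sum>f\<in>E. u f * polar n f e)" unfolding u by (simp add: polar_sum_left polar_scale_left)
    also have "\<dots> = (\<Sum>f\<in>E. if f = e then u e * polar n e e else 0)"
      using E that by (intro sum.cong) (auto simp: orthogonal_set_def)
    also have "\<dots> = u e * (2 * n e)" using E that by (simp add: orthogonal_set_def sum.delta polar_self)
    finally show ?thesis using E that two by (auto simp: coord_def orthogonal_set_def)
  qed
  then show ?thesis using u by simp
qed

lemma orthogonal_one: "orthogonal_set {1}"
  by (simp add: orthogonal_set_def norm_one)

lemma dim_one_expand:
  assumes "dim (UNIV :: 'c set) = 1"
  shows "x = scale (coord x 1) 1"
  using orthogonal_expand[OF orthogonal_one orthogonal_spans[OF orthogonal_one], of x] assms by simp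

lemma exists_i:
  assumes "dim (UNIV :: 'c set) \<noteq> 1"
  obtains i where "n i \<noteq> 0" "polar n i 1 = 0" "orthogonal_set {1, i}" "i \<noteq> 1"
proof -
  have "span {1} \<noteq> UNIV" using orthogonal_dim[OF orthogonal_one] assms by auto
  then obtain i where i: "n i \<noteq> 0" "polar n i 1 = 0" by (rule orthogonal_extend[OF orthogonal_one]) auto
  then have "i \<noteq> 1" using two by (auto simp: polar_one_one)
  with i that show thesis by (auto simp: orthogonal_set_def norm_one polar_commute)
qed

lemma dim_two_basis:
  assumes "dim (UNIV :: 'c set) = 2"
  obtains i where "n i \<noteq> 0" "polar n i 1 = 0" "\<And>x. x = scale (coord x 1) 1 + scale (coord x i) i"
proof -
  obtain i where i: "n i \<noteq> 0" "polar n i 1 = 0" "orthogonal_set {1, i}" "i \<noteq> 1"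
    using exists_i assms by auto
  then have "span {1, i} = UNIV" using assms by (intro orthogonal_spans) auto
  from orthogonal_expand[OF i(3) this] i(4) that[OF i(1,2)] show thesis by simp
qed

text \<open>Two anisotropic vectors \<open>i\<close>, \<open>j\<close>, orthogonal to 1 and to each other, give the quaternion basis \<open>1, i, j, ij\<close>: the
  product is orthogonal to \<open>i\<close> and \<open>j\<close> because multiplication by a vector scales the polar form, and to 1 because
  \<open>cj i = - i\<close>. Conjugating \<open>ij\<close> gives the anticommutation rule.\<close>

lemma dim_four_basis:
  assumes "dim (UNIV :: 'c set) = 4"
  obtains i j where "n i \<noteq> 0" "polar n i 1 = 0" "n j \<noteq> 0" "polar n j 1 = 0" "polar n i j = 0"
    "\<And>x. x = scale (coord x 1) 1 + scale (coord x i) i + scale (coord x j) j + scale (coord x (i * j)) (i * j)"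
    "j * i = - (i * j)" "polar n (i * j) 1 = 0" "polar n (i * j) i = 0" "polar n (i * j) j = 0"
proof -
  obtain i where i: "n i \<noteq> 0" "polar n i 1 = 0" "orthogonal_set {1, i}" "i \<noteq> 1"
    using exists_i assms by auto
  have "span {1, i} \<noteq> UNIV" using orthogonal_dim[OF i(3)] i(4) assms by auto
  then obtain j where "n j \<noteq> 0" "\<And>e. e \<in> {1, i} \<Longrightarrow> polar n j e = 0" by (rule orthogonal_extend[OF i(3)]) auto
  then have j: "n j \<noteq> 0" "polar n j 1 = 0" "polar n i j = 0" by (auto simp: polar_commute)
  have k1: "polar n (i * j) 1 = 0"
    using polar_cj_left[of i j 1] j(3) by (simp add: cj_perp[OF i(2)] polar_linear polar_commute)
  have ki: "polar n (i * j) i = 0" using polar_mult_same_left[of i j 1] j(2) by simp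
  have kj: "polar n (i * j) j = 0" using polar_mult_same_right[of i j 1] i(2) by simp
  have "cj (i * j) = j * i" by (simp add: cj_mult cj_perp i(2) j(2))
  then have ji: "j * i = - (i * j)" using cj_perp[OF k1] by simp
  have nk: "n (i * j) \<noteq> 0" using i j by (simp add: norm_mult)
  have self: "polar n e e \<noteq> 0" if "n e \<noteq> 0" for e using that two by (simp add: polar_self)
  have ne: "i \<noteq> 1" "j \<noteq> 1" "i * j \<noteq> 1" "i \<noteq> j" "i * j \<noteq> i" "i * j \<noteq> j"
    using i(4) j k1 ki kj i(1,2) self[of 1] self[of i] self[of j] norm_one by (auto simp: polar_commute)
  have o: "orthogonal_set {1, i, j, i * j}"
    using i(1,2) j k1 ki kj nk norm_one by (auto simp: orthogonal_set_def polar_commute)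
  have c: "card {1, i, j, i * j} = 4" using ne by auto
  have "span {1, i, j, i * j} = UNIV" using assms c by (intro orthogonal_spans o) auto
  note expand = orthogonal_expand[OF o this]
  have "x = scale (coord x 1) 1 + scale (coord x i) i + scale (coord x j) j + scale (coord x (i * j)) (i * j)" for x
    by (rule trans[OF expand]) (use ne ne[symmetric] in \<open>simp add: add.assoc\<close>)
  then show thesis using that[OF i(1,2) j _ ji k1 ki kj] by blast
qed

end

lemma coord_linear: "coord (x + y) e = coord x e + coord y e" "coord (scale a x) e = a * coord x e"
  by (simp_all add: coord_def polar_linear add_divide_distrib)

lemma coord_orthogonal: "(2::'k) \<noteq> 0 \<Longrightarrow> n e \<noteq> 0 \<Longrightarrow> coord e e = 1" "polar n e f = 0 \<Longrightarrow> coord e f = 0" "polar n f e = 0 \<Longrightarrow> coord e f = 0"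
  by (simp_all add: coord_def polar_self polar_commute)

end

section \<open>Embeddings into orthosymplectic superalgebras\<close>

text \<open>Candidates for the upper right block of an \<^locale>\<open>odd_embedding\<close> in an orthosymplectic superalgebra. The
  assumption \<open>w_spans\<close> states as an induction rule that the image of \<open>M\<close> spans.\<close>

locale rect_embedding = char3_matrix_data scale n r s J G
  for scale :: "'k::field \<Rightarrow> 'c::ring_1 \<Rightarrow> 'c" and n r s J G +
  fixes a b :: nat and \<sigma> :: "'k \<Rightarrow> 'l::field" and w :: "'c mat \<Rightarrow> 'l mat"
  assumes \<sigma>: "field_hom \<sigma>"
    and w_carrier: "m \<in> carrier_mat r s \<Longrightarrow> w m \<in> carrier_mat a b"
    and w_add: "m \<in> carrier_mat r s \<Longrightarrow> m' \<in> carrier_mat r s \<Longrightarrow> w (m + m') = w m + w m'"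
    and w_scale: "m \<in> carrier_mat r s \<Longrightarrow> w (map_mat (scale c) m) = \<sigma> c \<cdot>\<^sub>m w m"
    and w_spans: "Pr (0\<^sub>m a b) \<Longrightarrow>
      (\<And>U V. U \<in> carrier_mat a b \<Longrightarrow> V \<in> carrier_mat a b \<Longrightarrow> Pr U \<Longrightarrow> Pr V \<Longrightarrow> Pr (U + V)) \<Longrightarrow>
      (\<And>c U. U \<in> carrier_mat a b \<Longrightarrow> Pr U \<Longrightarrow> Pr (c \<cdot>\<^sub>m U)) \<Longrightarrow>
      (\<And>m. m \<in> carrier_mat r s \<Longrightarrow> Pr (w m)) \<Longrightarrow> W \<in> carrier_mat a b \<Longrightarrow> Pr W"
    and w_separated: "m \<in> carrier_mat r s \<Longrightarrow>
      (\<And>\<tau>. functional_on (carrier_mat a b) \<tau> \<Longrightarrow> (\<And>m'. m' \<in> carrier_mat r s \<Longrightarrow> \<tau> (w m') \<in> range \<sigma>) \<Longrightarrow> \<tau> (w m) = 0) \<Longrightarrow>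
      m = 0\<^sub>m r s"
begin

lemma w_minus:
  assumes "m \<in> carrier_mat r s" "m' \<in> carrier_mat r s"
  shows "w (m - m') = w m - w m'"
proof -
  interpret \<sigma>: field_hom \<sigma> by (rule \<sigma>)
  have "m - m' = m + map_mat (scale (- 1)) m'" using assms by (auto intro!: eq_matI)
  then show ?thesis
    using w_add[OF assms(1), of "map_mat (scale (- 1)) m'"] w_scale[OF assms(2), of "- 1"] assms w_carrier[OF assms(1)] w_carrier[OF assms(2)]
    by (auto simp: hom_distribs intro!: eq_matI)
qed

text \<open>Used to replace the forms of an orthosymplectic superalgebra by congruent ones.\<close>

lemma rect_embedding_congruence:
  assumes P: "P \<in> carrier_mat a a" "PI \<in> carrier_mat a a" "P * PI = 1\<^sub>m a" "PI * P = 1\<^sub>m a"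
    and Q: "Q \<in> carrier_mat b b" "QI \<in> carrier_mat b b" "Q * QI = 1\<^sub>m b" "QI * Q = 1\<^sub>m b"
  shows "rect_embedding scale n r s J G a b \<sigma> (\<lambda>m. P * w m * Q)"
proof -
  have [simp]: "dim_row P = a" "dim_col P = a" "dim_row Q = b" "dim_col Q = b"
    "dim_row PI = a" "dim_col PI = a" "dim_row QI = b" "dim_col QI = b" using P Q by auto
  have lin: "A * (U + V) * B = A * U * B + A * V * B" "A * (c \<cdot>\<^sub>m U) * B = c \<cdot>\<^sub>m (A * U * B)" "A * U * B \<in> carrier_mat a b"
    if "A \<in> carrier_mat a a" "B \<in> carrier_mat b b" "U \<in> carrier_mat a b" "V \<in> carrier_mat a b" for A B U V :: "'l mat" and c
  proof -
    have [simp]: "dim_row A = a" "dim_col A = a" "dim_row B = b" "dim_col B = b" "dim_row U = a" "dim_col U = b"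
      "dim_row V = a" "dim_col V = b" using that by auto
    show "A * (U + V) * B = A * U * B + A * V * B" by (simp add: mat_ring)
    show "A * (c \<cdot>\<^sub>m U) * B = c \<cdot>\<^sub>m (A * U * B)"
      using mult_smult_distrib[OF that(1,3)] mult_smult_assoc_mat[OF mult_carrier_mat[OF that(1,3)] that(2)] by simp
    show "A * U * B \<in> carrier_mat a b" by (rule carrier_matI) simp_all
  qed
  have inv: "P * (PI * U * QI) * Q = U" "PI * (P * U * Q) * QI = U" if "U \<in> carrier_mat a b" for U
  proof -
    have [simp]: "dim_row U = a" "dim_col U = b" using that by auto
    have "P * (PI * U * QI) * Q = (P * PI) * U * (QI * Q)" "PI * (P * U * Q) * QI = (PI * P) * U * (Q * QI)"
      by (simp_all add: mult_assoc')
    then show "P * (PI * U * QI) * Q = U" "PI * (P * U * Q) * QI = U" using that unfolding P Q by simp_all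
  qed
  show ?thesis
  proof (intro rect_embedding.intro rect_embedding_axioms.intro char3_matrix_data_axioms \<sigma>)
    fix m m' :: "'c mat" and c assume m: "m \<in> carrier_mat r s" and m': "m' \<in> carrier_mat r s"
    show "P * w (m + m') * Q = P * w m * Q + P * w m' * Q"
      unfolding w_add[OF m m'] by (rule lin(1)[OF P(1) Q(1) w_carrier[OF m] w_carrier[OF m']])
  next
    fix m :: "'c mat" and c assume m: "m \<in> carrier_mat r s"
    show "P * w m * Q \<in> carrier_mat a b" by (rule lin(3)[OF P(1) Q(1) w_carrier[OF m] w_carrier[OF m]])
    show "P * w (map_mat (scale c) m) * Q = \<sigma> c \<cdot>\<^sub>m (P * w m * Q)"
      unfolding w_scale[OF m] by (rule lin(2)[OF P(1) Q(1) w_carrier[OF m] w_carrier[OF m]])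
  next
    fix Pr :: "'l mat \<Rightarrow> bool" and W :: "'l mat" assume 0: "Pr (0\<^sub>m a b)"
      and add: "\<And>U V. U \<in> carrier_mat a b \<Longrightarrow> V \<in> carrier_mat a b \<Longrightarrow> Pr U \<Longrightarrow> Pr V \<Longrightarrow> Pr (U + V)"
      and smult: "\<And>c U. U \<in> carrier_mat a b \<Longrightarrow> Pr U \<Longrightarrow> Pr (c \<cdot>\<^sub>m U)"
      and base: "\<And>m. m \<in> carrier_mat r s \<Longrightarrow> Pr (P * w m * Q)"
      and W: "W \<in> carrier_mat a b"
    have "Pr (P * U * Q)" if "U \<in> carrier_mat a b" for U
    proof (rule w_spans[of "\<lambda>U. Pr (P * U * Q)", OF _ _ _ _ that])
      have "P * 0\<^sub>m a b * Q = 0\<^sub>m a b" using P Q by simp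
      then show "Pr (P * 0\<^sub>m a b * Q)" using 0 by simp
    next
      fix U V assume "U \<in> carrier_mat a b" "V \<in> carrier_mat a b" "Pr (P * U * Q)" "Pr (P * V * Q)"
      then show "Pr (P * (U + V) * Q)"
        using add[of "P * U * Q" "P * V * Q"] lin(1)[OF P(1) Q(1), of U V] lin(3)[OF P(1) Q(1), of U U] lin(3)[OF P(1) Q(1), of V V] by simp
    next
      fix c U assume "U \<in> carrier_mat a b" "Pr (P * U * Q)"
      then show "Pr (P * (c \<cdot>\<^sub>m U) * Q)"
        using smult[of "P * U * Q" c] lin(2)[OF P(1) Q(1), of U U] lin(3)[OF P(1) Q(1), of U U] by simp
    qed (rule base)
    from this[OF lin(3)[OF P(2) Q(2) W W]] show "Pr W" unfolding inv(1)[OF W] .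
  next
    fix m :: "'c mat" assume m: "m \<in> carrier_mat r s"
      and sep: "\<And>\<tau>. functional_on (carrier_mat a b) \<tau> \<Longrightarrow> (\<And>m'. m' \<in> carrier_mat r s \<Longrightarrow> \<tau> (P * w m' * Q) \<in> range \<sigma>) \<Longrightarrow> \<tau> (P * w m * Q) = 0"
    show "m = 0\<^sub>m r s"
    proof (rule w_separated[OF m])
      fix \<tau> assume \<tau>: "functional_on (carrier_mat a b) \<tau>" and rat: "\<And>m'. m' \<in> carrier_mat r s \<Longrightarrow> \<tau> (w m') \<in> range \<sigma>"
      have "functional_on (carrier_mat a b) (\<lambda>U. \<tau> (PI * U * QI))"
        unfolding functional_on_def
      proof (intro conjI ballI allI)
        fix U V :: "'l mat" and c assume U: "U \<in> carrier_mat a b"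
        show "\<tau> (PI * (c \<cdot>\<^sub>m U) * QI) = c * \<tau> (PI * U * QI)"
          unfolding lin(2)[OF P(2) Q(2) U U] using \<tau> lin(3)[OF P(2) Q(2) U U] unfolding functional_on_def by blast
        assume V: "V \<in> carrier_mat a b"
        show "\<tau> (PI * (U + V) * QI) = \<tau> (PI * U * QI) + \<tau> (PI * V * QI)"
          unfolding lin(1)[OF P(2) Q(2) U V] using \<tau> lin(3)[OF P(2) Q(2) U U] lin(3)[OF P(2) Q(2) V V] unfolding functional_on_def by blast
      qed
      from sep[OF this] show "\<tau> (w m) = 0" using inv(2)[OF w_carrier] m rat by simp
    qed
  qed
qed

end

context char3_matrix_data
begin

lemma der_value:
  assumes c: "x \<in> carrier_mat r s" "y \<in> carrier_mat r s" "z \<in> carrier_mat r s"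
  shows "der x y z = z * R x * y + z * R y * x - x * R y * z - y * R x * z"
proof -
  have [simp]: "dim_row x = r" "dim_col x = s" "dim_row y = r" "dim_col y = s" "dim_row z = r" "dim_col z = s" using c by auto
  have "der x y z = - (x * R y + y * R x) * z + z * (R x * y + R y * x)"
    using der_represented[OF c(1,2)] c(3) by (simp add: represented_def)
  also have "\<dots> = z * R x * y + z * R y * x - x * R y * z - y * R x * z"
    by (rule eq_matI) (simp_all add: mat_ring algebra_simps del: index_mult_mat(1))
  finally show ?thesis .
qed

lemma triple_carrier:
  assumes "x \<in> carrier_mat r s" "y \<in> carrier_mat r s" "z \<in> carrier_mat r s"
  shows "x * R y * z \<in> carrier_mat r s"
  using assms by (intro carrier_matI) auto

end

context rect_embedding
begin

lemma w_der:
  assumes c: "x \<in> carrier_mat r s" "y \<in> carrier_mat r s" "z \<in> carrier_mat r s"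
  shows "w (der x y z) = w (z * R x * y) + w (z * R y * x) - w (x * R y * z) - w (y * R x * z)"
proof -
  note t = triple_carrier[OF c(3,1,2)] triple_carrier[OF c(3,2,1)] triple_carrier[OF c(1,2,3)] triple_carrier[OF c(2,1,3)]
  show ?thesis
    unfolding der_value[OF c] using w_minus[OF minus_carrier_mat[OF t(3)] t(4)] w_minus[OF add_carrier_mat[OF t(2)] t(3)] w_add[OF t(1,2)] by simp
qed

text \<open>The right-hand side is the upper right block of \<open>[[X, Y], Z]\<close> for the odd elements \<open>X, Y, Z\<close> with upper right
  blocks \<open>w x, w y, w z\<close>. Since it is unchanged when the order and the sign of all products are reversed, it
  covers maps \<open>w\<close> that preserve products and maps that reverse them.\<close>

definition osp_compatible :: "'l mat \<Rightarrow> 'l mat \<Rightarrow> bool" where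
  "osp_compatible K S \<longleftrightarrow> (\<forall>x\<in>carrier_mat r s. \<forall>y\<in>carrier_mat r s. \<forall>z\<in>carrier_mat r s.
     w (der x y z) = w z * (K * transpose_mat (w x) * S) * w y + w z * (K * transpose_mat (w y) * S) * w x
       - w x * (K * transpose_mat (w y) * S) * w z - w y * (K * transpose_mat (w x) * S) * w z)"

lemma osp_odd_embedding:
  assumes osp: "osp_data a b S SI A K" and comp: "osp_compatible K S"
  shows "odd_embedding scale n r s J G a b (osp_data.V0 a b S A) (osp_data.V1 a b S K) \<sigma> (\<lambda>m. block_off (w m) (- osp_data.rho S K (w m)))"
proof -
  interpret osp: osp_data a b S SI A K by (rule osp)
  note zs = zero_carrier_mat[of a a] zero_carrier_mat[of b b] zero_carrier_mat[of a a] zero_carrier_mat[of b b]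
  have r: "- osp.rho U \<in> carrier_mat b a" if "U \<in> carrier_mat a b" for U using that by simp
  have rho_add: "- osp.rho (U + V) = - osp.rho U + - osp.rho V" if "U \<in> carrier_mat a b" "V \<in> carrier_mat a b" for U V
  proof -
    have [simp]: "dim_row U = a" "dim_col U = b" "dim_row V = a" "dim_col V = b" using that by auto
    show ?thesis unfolding osp.rho_def by (rule eq_matI) (simp_all add: mat_ring transpose_add' del: index_mult_mat(1))
  qed
  have off_add: "block_off (U + V) (- osp.rho (U + V)) = block_off U (- osp.rho U) + block_off V (- osp.rho V)"
    if "U \<in> carrier_mat a b" "V \<in> carrier_mat a b" for U V
    unfolding rho_add[OF that] by (rule block_linear(4)[OF zs that(1) r[OF that(1)] that(2) r[OF that(2)], symmetric])
  have off_smult: "block_off (c \<cdot>\<^sub>m U) (- osp.rho (c \<cdot>\<^sub>m U)) = c \<cdot>\<^sub>m block_off U (- osp.rho U)" if U: "U \<in> carrier_mat a b" for U c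
  proof -
    have t: "transpose_mat (c \<cdot>\<^sub>m U) = c \<cdot>\<^sub>m transpose_mat U" by (rule eq_matI) auto
    have tU: "transpose_mat U \<in> carrier_mat b a" using U by simp
    have "osp.rho (c \<cdot>\<^sub>m U) = c \<cdot>\<^sub>m osp.rho U"
      unfolding osp.rho_def t mult_smult_distrib[OF osp.K(1) tU] mult_smult_assoc_mat[OF mult_carrier_mat[OF osp.K(1) tU] osp.S(1)] ..
    then have "- osp.rho (c \<cdot>\<^sub>m U) = c \<cdot>\<^sub>m - osp.rho U" by (auto intro!: eq_matI)
    then show ?thesis using block_linear(6)[OF zs U r[OF U] U r[OF U], of c] by simp
  qed
  have off_zero: "block_off (0\<^sub>m a b) (- osp.rho (0\<^sub>m a b)) = 0\<^sub>m (a + b) (a + b)"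
  proof -
    have "- osp.rho (0\<^sub>m a b) = 0\<^sub>m b a" by (rule eq_matI) (auto simp: osp.rho_def scalar_prod_def)
    then show ?thesis by (simp add: block_zero)
  qed
  show ?thesis
  proof (intro odd_embedding.intro odd_embedding_axioms.intro char3_matrix_data_axioms osp.matrix_lie_superalgebra_axioms \<sigma>)
    fix m :: "'c mat" assume m: "m \<in> carrier_mat r s"
    show "block_off (w m) (- osp.rho (w m)) \<in> osp.V1" by (rule osp.V1I[OF w_carrier[OF m]])
    show "block_off (w (map_mat (scale c) m)) (- osp.rho (w (map_mat (scale c) m))) = \<sigma> c \<cdot>\<^sub>m block_off (w m) (- osp.rho (w m))" for c
      unfolding w_scale[OF m] by (rule off_smult[OF w_carrier[OF m]])
    show "block_off (w (m + m')) (- osp.rho (w (m + m'))) = block_off (w m) (- osp.rho (w m)) + block_off (w m') (- osp.rho (w m'))"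
      if m': "m' \<in> carrier_mat r s" for m'
      unfolding w_add[OF m m'] by (rule off_add[OF w_carrier[OF m] w_carrier[OF m']])
  next
    fix x y z :: "'c mat" assume c: "x \<in> carrier_mat r s" "y \<in> carrier_mat r s" "z \<in> carrier_mat r s"
    note wc = w_carrier[OF c(1)] w_carrier[OF c(2)] w_carrier[OF c(3)]
    have [simp]: "dim_row (w x) = a" "dim_col (w x) = b" "dim_row (w y) = a" "dim_col (w y) = b" "dim_row (w z) = a" "dim_col (w z) = b"
      using wc by auto
    let ?P = "- (w x * osp.rho (w y) + w y * osp.rho (w x))" and ?D = "- (osp.rho (w x) * w y + osp.rho (w y) * w x)"
    have PD: "?P \<in> carrier_mat a a" "?D \<in> carrier_mat b b" by (auto intro!: carrier_matI)
    have "block_diag ?P ?D \<in> osp.V0"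
      using osp.closed_11[OF osp.V1I[OF wc(1)] osp.V1I[OF wc(2)]] unfolding osp.anticommutator_eq[OF wc(1,2)] .
    then obtain P D where e: "block_diag ?P ?D = block_diag P D" and c': "P \<in> carrier_mat a a" "D \<in> carrier_mat b b"
      and s: "transpose_mat P * S = - (S * P)" "transpose_mat D * A = - (A * D)" unfolding osp.V0_def by blast
    have "P = ?P" "D = ?D" using e block_diag_inject[OF PD c'] by auto
    then have s: "transpose_mat ?P * S = - (S * ?P)" "transpose_mat ?D * A = - (A * ?D)" using s by auto
    have "w (der x y z) = ?P * w z - w z * ?D"
      using comp c unfolding osp_compatible_def osp.rho_def[symmetric]
      by (auto intro!: eq_matI simp: mat_ring algebra_simps simp del: index_mult_mat(1))
    then show "block_off (w (der x y z)) (- osp.rho (w (der x y z))) =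
       commutator (anticommutator (block_off (w x) (- osp.rho (w x))) (block_off (w y) (- osp.rho (w y)))) (block_off (w z) (- osp.rho (w z)))"
      unfolding osp.anticommutator_eq[OF wc(1,2)] block_brackets(2)[OF PD PD wc(3) r[OF wc(3)] wc(3) r[OF wc(3)]]
        osp.rho_commutator[OF PD wc(3) s] by simp
  next
    show "spanned_by (a + b) osp.V1 ((\<lambda>m. block_off (w m) (- osp.rho (w m))) ` carrier_mat r s)"
      unfolding spanned_by_def
    proof (intro allI impI)
      fix U assume U: "mat_subspace (a + b) U" and sub: "(\<lambda>m. block_off (w m) (- osp.rho (w m))) ` carrier_mat r s \<subseteq> U"
      note Uc = mat_subspaceD[OF U]
      have "block_off W (- osp.rho W) \<in> U" if W: "W \<in> carrier_mat a b" for W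
      proof (rule w_spans[of "\<lambda>W. block_off W (- osp.rho W) \<in> U", OF _ _ _ _ W])
        show "block_off (0\<^sub>m a b) (- osp.rho (0\<^sub>m a b)) \<in> U" unfolding off_zero by (rule Uc(2))
        show "block_off (V + V') (- osp.rho (V + V')) \<in> U"
          if "V \<in> carrier_mat a b" "V' \<in> carrier_mat a b" "block_off V (- osp.rho V) \<in> U" "block_off V' (- osp.rho V') \<in> U" for V V'
          unfolding off_add[OF that(1,2)] by (rule Uc(3)[OF that(3,4)])
        show "block_off (c \<cdot>\<^sub>m V) (- osp.rho (c \<cdot>\<^sub>m V)) \<in> U" if "V \<in> carrier_mat a b" "block_off V (- osp.rho V) \<in> U" for c V
          unfolding off_smult[OF that(1)] by (rule Uc(4)[OF that(2)])
        show "block_off (w m) (- osp.rho (w m)) \<in> U" if "m \<in> carrier_mat r s" for m using sub that by blast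
      qed
      then show "osp.V1 \<subseteq> U" unfolding osp.V1_def by blast
    qed
  next
    fix m :: "'c mat" assume m: "m \<in> carrier_mat r s"
      and sep: "\<And>\<tau>. functional_on osp.V1 \<tau> \<Longrightarrow>
         (\<And>m'. m' \<in> carrier_mat r s \<Longrightarrow> \<tau> (block_off (w m') (- osp.rho (w m'))) \<in> range \<sigma>) \<Longrightarrow>
         \<tau> (block_off (w m) (- osp.rho (w m))) = 0"
    show "m = 0\<^sub>m r s"
    proof (rule w_separated[OF m])
      fix \<tau> assume \<tau>: "functional_on (carrier_mat a b) \<tau>" and rat: "\<And>m'. m' \<in> carrier_mat r s \<Longrightarrow> \<tau> (w m') \<in> range \<sigma>"
      let ?u = "\<lambda>Q. mat a b (\<lambda>(i, j). Q $$ (i, a + j))"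
      have u: "?u (block_off W (- osp.rho W)) = W" if "W \<in> carrier_mat a b" for W
        using that by (intro eq_matI) (auto simp: block_off_def)
      have "functional_on osp.V1 (\<lambda>Q. \<tau> (?u Q))"
        unfolding functional_on_def
      proof (intro conjI ballI allI)
        fix Q c assume "Q \<in> osp.V1"
        then obtain W where W: "W \<in> carrier_mat a b" and Q: "Q = block_off W (- osp.rho W)" unfolding osp.V1_def by blast
        have cW: "c \<cdot>\<^sub>m W \<in> carrier_mat a b" using W by simp
        show "\<tau> (?u (c \<cdot>\<^sub>m Q)) = c * \<tau> (?u Q)"
          unfolding Q off_smult[OF W, symmetric] u[OF cW] u[OF W] using \<tau> W unfolding functional_on_def by blast
        fix Q' assume "Q' \<in> osp.V1"
        then obtain W' where W': "W' \<in> carrier_mat a b" and Q': "Q' = block_off W' (- osp.rho W')" unfolding osp.V1_def by blast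
        have WW: "W + W' \<in> carrier_mat a b" using W W' by simp
        show "\<tau> (?u (Q + Q')) = \<tau> (?u Q) + \<tau> (?u Q')"
          unfolding Q Q' off_add[OF W W', symmetric] u[OF WW] u[OF W] u[OF W'] using \<tau> W W' unfolding functional_on_def by blast
      qed
      from sep[OF this] show "\<tau> (w m) = 0" using u[OF w_carrier] m rat by simp
    qed
  qed
qed

end

lemma (in matrix_lie_superalgebra) id_hom: "superalgebra_hom id \<G> \<G> id"
  unfolding superalgebra_hom_def by (auto simp: simps)

lemma (in odd_embedding) faithful_target:
  assumes "\<And>Q. Q \<in> V0 \<Longrightarrow> (\<And>x. x \<in> V1 \<Longrightarrow> commutator Q x = 0\<^sub>m (a + b) (a + b)) \<Longrightarrow> Q = 0\<^sub>m (a + b) (a + b)"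
  shows "superalgebra_hom \<sigma> semisimplified \<G> (super_map id)" "semilinear semisimplified \<G> \<sigma> (super_map id)"
    "carrier \<G> \<subseteq> LinearCombinations.module.span class_ring \<G> (super_map id ` carrier semisimplified)"
proof -
  have ker: "id Q = \<zero>\<^bsub>\<G>\<^esub> \<longleftrightarrow> Q \<in> V0 \<and> (\<forall>x\<in>V1. commutator Q x = 0\<^sub>m (a + b) (a + b))" for Q
    using assms[of Q] sub0(2) commutator_zero(1)[OF sub1(1)] by (auto simp: simps)
  show "superalgebra_hom \<sigma> semisimplified \<G> (super_map id)" "semilinear semisimplified \<G> \<sigma> (super_map id)"
    "carrier \<G> \<subseteq> LinearCombinations.module.span class_ring \<G> (super_map id ` carrier semisimplified)"
    by (rule super_map_hom super_map_semilinear super_map_generates; (rule vectorspace_matrix_superalgebra id_hom ker)?; simp)+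
qed

lemma osp_data_standard:
  assumes "a \<ge> 1" "k \<ge> 1" "(2::'l::field) \<noteq> 0"
  shows "osp_data a (2 * k) (1\<^sub>m a :: 'l mat) (1\<^sub>m a) (std_alternating k) (std_alternating k)"
  by (rule osp_data.intro) (use assms in \<open>auto simp: std_alternating_square std_alternating_transpose\<close>)

lemma osp_eq: "osp a (2 * k) = osp_form a (2 * k) (1\<^sub>m a) (std_alternating k)"
  by (simp add: osp_def std_alternating_def Let_def)

text \<open>If \<open>S = Q\<^sup>T Q\<close> and \<open>K = Q'\<^sup>T \<Omega> Q'\<close> with the standard alternating matrix \<open>\<Omega>\<close>, then \<open>Q w Q'\<^sup>T\<close> is compatible
  with the standard forms.\<close>

lemma form_of_osp:
  fixes w :: "'c::ring_1 mat \<Rightarrow> 'k::field alg_closure mat"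
  assumes w: "rect_embedding scale n r s J G a (2 * k) to_ac w"
    and comp: "rect_embedding.osp_compatible scale n r s J G w K S"
    and ak: "a \<ge> 1" "k \<ge> 1" 
    and S: "S \<in> carrier_mat a a" "transpose_mat S = S" "SI \<in> carrier_mat a a" "S * SI = 1\<^sub>m a"
    and K: "K \<in> carrier_mat (2 * k) (2 * k)" "transpose_mat K = - K" "KI \<in> carrier_mat (2 * k) (2 * k)" "K * KI = 1\<^sub>m (2 * k)"
  shows "form_of (matrix_data.semisimplified scale n r s J G) (osp a (2 * k))"
proof -
  interpret w: rect_embedding scale n r s J G a "2 * k" to_ac w by (rule w)
  have two: "(2::'k alg_closure) \<noteq> 0"
    using w.two_scalar by (metis to_ac_numeral to_ac_eq_0_iff)
  obtain P Q where PQ: "P \<in> carrier_mat a a" "Q \<in> carrier_mat a a" "P * Q = 1\<^sub>m a" "Q * P = 1\<^sub>m a" and SQ: "S = transpose_mat Q * Q"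
    by (rule symmetric_normal_form[OF S two])
  obtain P' Q' where PQ': "P' \<in> carrier_mat (2 * k) (2 * k)" "Q' \<in> carrier_mat (2 * k) (2 * k)"
    "P' * Q' = 1\<^sub>m (2 * k)" "Q' * P' = 1\<^sub>m (2 * k)" and KQ: "K = transpose_mat Q' * std_alternating k * Q'"
    by (rule alternating_normal_form[OF K two])
  let ?v = "\<lambda>m. Q * w m * transpose_mat Q'"
  have tr: "transpose_mat Q' * transpose_mat P' = 1\<^sub>m (2 * k)" "transpose_mat P' * transpose_mat Q' = 1\<^sub>m (2 * k)"
    using PQ' by (simp_all flip: transpose_mult)
  interpret v: rect_embedding scale n r s J G a "2 * k" to_ac ?v
    by (rule w.rect_embedding_congruence[OF PQ(2,1,4,3) _ _ tr]) (use PQ' in auto)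
  have [simp]: "dim_row Q = a" "dim_col Q = a" "dim_row Q' = 2 * k" "dim_col Q' = 2 * k" using PQ PQ' by auto
  have "v.osp_compatible (std_alternating k) (1\<^sub>m a)"
    unfolding v.osp_compatible_def
  proof (intro ballI)
    fix x y z :: "'c mat" assume c: "x \<in> carrier_mat r s" "y \<in> carrier_mat r s" "z \<in> carrier_mat r s"
    have [simp]: "dim_row (w x) = a" "dim_col (w x) = 2 * k" "dim_row (w y) = a" "dim_col (w y) = 2 * k" "dim_row (w z) = a" "dim_col (w z) = 2 * k"
      using w.w_carrier[OF c(1)] w.w_carrier[OF c(2)] w.w_carrier[OF c(3)] by auto
    have t: "Q * U * transpose_mat Q' * (std_alternating k * transpose_mat (Q * V * transpose_mat Q') * 1\<^sub>m a) * (Q * W * transpose_mat Q') =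
        Q * (U * (K * transpose_mat V * S) * W) * transpose_mat Q'"
      if "U \<in> carrier_mat a (2 * k)" "V \<in> carrier_mat a (2 * k)" "W \<in> carrier_mat a (2 * k)" for U V W
    proof -
      have [simp]: "dim_row U = a" "dim_col U = 2 * k" "dim_row V = a" "dim_col V = 2 * k" "dim_row W = a" "dim_col W = 2 * k" using that by auto
      have "1\<^sub>m a * F = F" if "dim_row F = a" for F :: "'k alg_closure mat" using that by simp
      then show ?thesis unfolding KQ SQ by (simp add: mat_ring transpose_mult')
    qed
    note wc = w.w_carrier[OF c(1)] w.w_carrier[OF c(2)] w.w_carrier[OF c(3)]
    show "Q * w (w.der x y z) * transpose_mat Q' =
       Q * w z * transpose_mat Q' * (std_alternating k * transpose_mat (Q * w x * transpose_mat Q') * 1\<^sub>m a) * (Q * w y * transpose_mat Q')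
       + Q * w z * transpose_mat Q' * (std_alternating k * transpose_mat (Q * w y * transpose_mat Q') * 1\<^sub>m a) * (Q * w x * transpose_mat Q')
       - Q * w x * transpose_mat Q' * (std_alternating k * transpose_mat (Q * w y * transpose_mat Q') * 1\<^sub>m a) * (Q * w z * transpose_mat Q')
       - Q * w y * transpose_mat Q' * (std_alternating k * transpose_mat (Q * w x * transpose_mat Q') * 1\<^sub>m a) * (Q * w z * transpose_mat Q')"
      unfolding t[OF wc(3,1,2)] t[OF wc(3,2,1)] t[OF wc(1,2,3)] t[OF wc(2,1,3)]
      using comp c S(1) K(1) unfolding w.osp_compatible_def by (simp add: mat_ring)
  qed
  note osp = osp_data_standard[OF ak two]
  interpret osp: osp_data a "2 * k" "1\<^sub>m a :: 'k alg_closure mat" "1\<^sub>m a" "std_alternating k" "std_alternating k" by (rule osp)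
  interpret o: odd_embedding scale n r s J G a "2 * k" osp.V0 osp.V1 to_ac "\<lambda>m. block_off (?v m) (- osp.rho (?v m))"
    by (rule v.osp_odd_embedding[OF osp]) fact
  note f = o.faithful_target[OF osp.annihilator_trivial]
  show ?thesis
    unfolding osp_eq osp.osp_form_eq by (rule form_ofI[OF f])
qed

section \<open>Composition algebras over algebraically closed fields\<close>

context assoc_composition_algebra
begin

context
  fixes \<sigma> :: "'k \<Rightarrow> 'l::alg_closed_field"
  assumes \<sigma>: "field_hom \<sigma>" and two: "(2::'k) \<noteq> 0"
begin

interpretation \<sigma>: field_hom \<sigma> by (rule \<sigma>)

text \<open>The scalar extension of \<open>C\<close> is a product of two copies of the field, and \<open>\<phi>\<close> is one of the two projections; it sends \<open>i\<close> to
  a square root of \<open>- n(i)\<close>. The choice of an element with \<open>cj i = - i\<close> records that the conjugation interchanges the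
  projections.\<close>

lemma dim_two_rep:
  assumes "dim (UNIV :: 'c set) = 2"
  obtains \<phi> :: "'c \<Rightarrow> 'l" and i where "semiring_hom \<phi>" "\<And>c x. \<phi> (scale c x) = \<sigma> c * \<phi> x" "\<phi> i \<noteq> 0" "cj i = - i"
proof -
  obtain i where i: "n i \<noteq> 0" "polar n i 1 = 0" and expand: "\<And>x. x = scale (coord x 1) 1 + scale (coord x i) i"
    using dim_two_basis[OF two assms] by metis
  obtain t where t: "t ^ 2 = \<sigma> (- n i)" using nth_root_exists[of 2 "\<sigma> (- n i)"] by auto
  define \<phi> where "\<phi> x = \<sigma> (coord x 1) + \<sigma> (coord x i) * t" for x
  have add: "\<phi> (x + y) = \<phi> x + \<phi> y" for x y by (simp add: \<phi>_def coord_linear hom_distribs algebra_simps)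
  have sc: "\<phi> (scale c x) = \<sigma> c * \<phi> x" for c x by (simp add: \<phi>_def coord_linear hom_distribs algebra_simps)
  have n1: "n 1 \<noteq> 0" by (simp add: norm_one)
  have one: "\<phi> 1 = 1" using coord_orthogonal(1)[OF two n1] coord_orthogonal(3)[OF i(2)] by (simp add: \<phi>_def)
  have \<phi>i: "\<phi> i = t" using coord_orthogonal(1)[OF two i(1)] coord_orthogonal(2)[OF i(2)] by (simp add: \<phi>_def)
  have ii: "\<phi> (i * i) = t * t" using t by (simp add: square_perp[OF i(2)] sc one power2_eq_square del: scale_minus_left)
  have mult: "\<phi> (x * y) = \<phi> x * \<phi> y" for x y
  proof -
    have "\<phi> (x * y) = \<phi> ((scale (coord x 1) 1 + scale (coord x i) i) * (scale (coord y 1) 1 + scale (coord y i) i))"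
      using expand[of x] expand[of y] by simp
    also have "\<dots> = \<phi> x * \<phi> y"
      unfolding distrib_left distrib_right scale_mult_left scale_mult_right add sc mult_1_left mult_1_right one \<phi>i ii
      unfolding \<phi>_def by (simp add: algebra_simps)
    finally show ?thesis .
  qed
  have zero: "\<phi> 0 = 0" using sc[of 0 0] by simp
  have hom: "semiring_hom \<phi>" by unfold_locales (simp_all add: add mult one zero)
  have "t \<noteq> 0" using t i(1) by auto
  then show thesis
    using that[OF hom sc _ cj_perp[OF i(2)]] \<phi>i by simp
qed

text \<open>The scalar extension of \<open>C\<close> is the algebra of \<open>2 \<times> 2\<close> matrices. In terms of a quaternion basis, let
  \<open>t\<close> be a square root of \<open>i\<^sup>2\<close>; then \<open>i\<close> goes to the diagonal matrix with entries \<open>t, - t\<close>, and \<open>j\<close> to the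
  matrix with rows \<open>(0, j\<^sup>2)\<close> and \<open>(1, 0)\<close>. The value \<open>f p q x\<close> is the entry at \<open>(p, q)\<close> of the matrix of \<open>x\<close>. The
  conjugation becomes the adjugate, which interchanges the diagonal entries and negates the others. The last property
  says that the matrices of elements of \<open>C\<close> span all matrices.\<close>

lemma dim_four_rep:
  assumes "dim (UNIV :: 'c set) = 4"
  obtains f :: "bool \<Rightarrow> bool \<Rightarrow> 'c \<Rightarrow> 'l"
  where "\<And>p q x y. f p q (x + y) = f p q x + f p q y" "\<And>p q c x. f p q (scale c x) = \<sigma> c * f p q x"
    "\<And>p q x y. f p q (x * y) = f p False x * f False q y + f p True x * f True q y"
    "\<And>p q. f p q 1 = (if p = q then 1 else 0)"
    "\<And>p x. f p p (cj x) = f (\<not> p) (\<not> p) x" "\<And>p x. f p (\<not> p) (cj x) = - f p (\<not> p) x"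
    "\<And>p q. \<exists>k x l y. \<forall>p' q'. k * f p' q' x + l * f p' q' y = (if p = p' \<and> q = q' then 1 else 0)"
proof -
  obtain i j where ij: "n i \<noteq> 0" "polar n i 1 = 0" "n j \<noteq> 0" "polar n j 1 = 0" "polar n i j = 0"
    and expand: "\<And>x. x = scale (coord x 1) 1 + scale (coord x i) i + scale (coord x j) j + scale (coord x (i * j)) (i * j)"
    and ji: "j * i = - (i * j)" and perp: "polar n (i * j) 1 = 0" "polar n (i * j) i = 0" "polar n (i * j) j = 0"
    using dim_four_basis[OF two assms] by metis
  define k where "k = i * j"
  note expand = expand[folded k_def] and perp = perp[folded k_def]
  have nk: "n k \<noteq> 0" using ij by (simp add: k_def norm_mult)
  define A B where "A = - n i" and "B = - n j"
  have ii: "i * i = scale A 1" and jj: "j * j = scale B 1"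
    using square_perp[OF ij(2)] square_perp[OF ij(4)] by (simp_all add: A_def B_def)
  have ik: "i * k = scale A j" by (simp add: k_def ii scale_mult_left flip: mult.assoc)
  have kj: "k * j = scale B i" by (simp add: k_def mult.assoc jj scale_mult_right)
  have ki: "k * i = scale (- A) j"
  proof -
    have "k * i = i * (j * i)" by (simp add: k_def mult.assoc)
    also have "\<dots> = - (i * k)" by (simp add: ji k_def)
    finally show ?thesis by (simp add: ik)
  qed
  have jk: "j * k = scale (- B) i"
  proof -
    have "j * k = (j * i) * j" by (simp add: k_def mult.assoc)
    also have "\<dots> = - (k * j)" by (simp add: ji k_def)
    finally show ?thesis by (simp add: kj)
  qed
  have kk: "k * k = scale (- (A * B)) 1"
  proof -
    have "k * k = (k * i) * j" by (simp add: k_def mult.assoc)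
    then show ?thesis by (simp add: ki scale_mult_left jj)
  qed
  obtain t where t: "t ^ 2 = \<sigma> A" using nth_root_exists[of 2 "\<sigma> A"] by auto
  have t0: "t \<noteq> 0" using t ij(1) by (auto simp: A_def)
  have tt: "t * t = \<sigma> A" "t * (t * z) = \<sigma> A * z" for z using t by (simp_all add: power2_eq_square flip: mult.assoc)
  have B0: "\<sigma> B \<noteq> 0" using ij(3) by (simp add: B_def)
  define f :: "bool \<Rightarrow> bool \<Rightarrow> 'c \<Rightarrow> 'l" where
    "f p q x = (if p then if q then \<sigma> (coord x 1) - \<sigma> (coord x i) * t else \<sigma> (coord x j) - \<sigma> (coord x k) * t
       else if q then (\<sigma> (coord x j) + \<sigma> (coord x k) * t) * \<sigma> B else \<sigma> (coord x 1) + \<sigma> (coord x i) * t)" for p q x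
  have add: "f p q (x + y) = f p q x + f p q y" for p q x y
    by (simp add: f_def coord_linear hom_distribs algebra_simps)
  have sc: "f p q (scale c x) = \<sigma> c * f p q x" for p q c x
    by (simp add: f_def coord_linear hom_distribs algebra_simps)
  have n1: "n 1 \<noteq> 0" by (simp add: norm_one)
  note co1 = coord_orthogonal(1)[OF two n1] coord_orthogonal(3)[OF ij(2)] coord_orthogonal(3)[OF ij(4)] coord_orthogonal(3)[OF perp(1)]
  note coi = coord_orthogonal(2)[OF ij(2)] coord_orthogonal(1)[OF two ij(1)] coord_orthogonal(2)[OF ij(5)] coord_orthogonal(3)[OF perp(2)]
  note coj = coord_orthogonal(2)[OF ij(4)] coord_orthogonal(3)[OF ij(5)] coord_orthogonal(1)[OF two ij(3)] coord_orthogonal(3)[OF perp(3)]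
  note cok = coord_orthogonal(2)[OF perp(1)] coord_orthogonal(2)[OF perp(2)] coord_orthogonal(2)[OF perp(3)] coord_orthogonal(1)[OF two nk]
  have one: "f p q 1 = (if p = q then 1 else 0)" for p q by (simp add: f_def co1)
  have fi: "f p q i = (if p = q then if p then - t else t else 0)" for p q by (simp add: f_def coi)
  have fj: "f p q j = (if p = q then 0 else if p then 1 else \<sigma> B)" for p q by (simp add: f_def coj)
  have fk: "f p q k = (if p = q then 0 else if p then - t else t * \<sigma> B)" for p q by (simp add: f_def cok)
  have fm: "f p q (- x) = - f p q x" for p q x using sc[of p q "- 1" x] by (simp add: hom_distribs)
  have mult: "f p q (x * y) = f p False x * f False q y + f p True x * f True q y" for p q x y
  proof -
    have ji': "j * i = - k" using ji by (simp add: k_def)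
    have "f p q (x * y) = f p q ((scale (coord x 1) 1 + scale (coord x i) i + scale (coord x j) j + scale (coord x k) k) *
        (scale (coord y 1) 1 + scale (coord y i) i + scale (coord y j) j + scale (coord y k) k))"
      using expand[of x] expand[of y] by simp
    also have "\<dots> = f p False x * f False q y + f p True x * f True q y"
      unfolding distrib_left distrib_right scale_mult_left scale_mult_right add sc mult_1_left mult_1_right
        k_def[symmetric] ii jj kk ik ki jk kj ji' fm sc one fi fj fk
      unfolding f_def by (simp add: hom_distribs algebra_simps tt)
    finally show ?thesis .
  qed
  have cjs: "cj x = scale (coord x 1) 1 + scale (- coord x i) i + scale (- coord x j) j + scale (- coord x k) k" for x
  proof -
    have "cj x = cj (scale (coord x 1) 1 + scale (coord x i) i + scale (coord x j) j + scale (coord x k) k)" using expand[of x] by simp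
    then show ?thesis by (simp add: cj_add cj_scale cj_one cj_perp ij perp)
  qed
  have conj: "f p p (cj x) = f (\<not> p) (\<not> p) x" "f p (\<not> p) (cj x) = - f p (\<not> p) x" for p x
    unfolding cjs[of x] add sc one fi fj fk by (simp_all add: f_def hom_distribs algebra_simps)
  have two': "(2::'l) \<noteq> 0"
  proof -
    have "\<sigma> 2 \<noteq> 0" using two by simp
    then show ?thesis by (simp add: hom_distribs)
  qed
  have half: "1 / 2 + 1 / 2 = (1::'l)" using two' by (simp add: field_simps)
  have span: "\<exists>k x l y. \<forall>p' q'. k * f p' q' x + l * f p' q' y = (if p = p' \<and> q = q' then 1 else 0)" for p q
  proof (cases p; cases q)
    assume "p" "q"
    then show ?thesis
      by (intro exI[of _ "1 / 2"] exI[of _ 1] exI[of _ "- (1 / (2 * t))"] exI[of _ i]) (use t0 two' half in \<open>auto simp: one fi field_simps\<close>)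
  next
    assume "p" "\<not> q"
    then show ?thesis
      by (intro exI[of _ "1 / 2"] exI[of _ j] exI[of _ "- (1 / (2 * t))"] exI[of _ k]) (use t0 two' half in \<open>auto simp: fj fk field_simps\<close>)
  next
    assume "\<not> p" "q"
    then show ?thesis
      by (intro exI[of _ "1 / (2 * \<sigma> B)"] exI[of _ j] exI[of _ "1 / (2 * t * \<sigma> B)"] exI[of _ k]) (use t0 B0 two' half in \<open>auto simp: fj fk field_simps\<close>)
  next
    assume "\<not> p" "\<not> q"
    then show ?thesis
      by (intro exI[of _ "1 / 2"] exI[of _ 1] exI[of _ "1 / (2 * t)"] exI[of _ i]) (use t0 two' half in \<open>auto simp: one fi field_simps\<close>)
  qed
  show thesis by (rule that[OF add sc mult one conj span])
qed

end

end

context semiring_hom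
begin

lemma map_mat_mult: "dim_col A = dim_row B \<Longrightarrow> map_mat hom (A * B) = map_mat hom A * map_mat hom B"
  by (rule mat_hom_mult[of _ "dim_row A" "dim_col A" _ "dim_col B"]) auto

lemma map_mat_add: "dim_row A = dim_row B \<Longrightarrow> dim_col A = dim_col B \<Longrightarrow> map_mat hom (A + B) = map_mat hom A + map_mat hom B"
  by (rule eq_matI) (auto simp: hom_add)

end

lemma hom_uminus:
  fixes \<phi> :: "'c::ring_1 \<Rightarrow> 'l::ring_1"
  assumes "semiring_hom \<phi>" shows "\<phi> (- x) = - \<phi> x"
proof -
  interpret semiring_hom \<phi> by (rule assms)
  have "\<phi> (x + - x) = \<phi> x + \<phi> (- x)" by (rule hom_add)
  then show ?thesis by (simp add: eq_neg_iff_add_eq_0 add.commute)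
qed

lemma map_mat_minus:
  fixes \<phi> :: "'c::ring_1 \<Rightarrow> 'l::ring_1"
  assumes "semiring_hom \<phi>"
  shows "dim_row A = dim_row B \<Longrightarrow> dim_col A = dim_col B \<Longrightarrow> map_mat \<phi> (A - B) = map_mat \<phi> A - map_mat \<phi> B"
    "map_mat \<phi> (- A) = - map_mat \<phi> A"
proof -
  interpret semiring_hom \<phi> by (rule assms)
  show "map_mat \<phi> (- A) = - map_mat \<phi> A" by (rule eq_matI) (auto simp: hom_uminus[OF assms])
  show "dim_row A = dim_row B \<Longrightarrow> dim_col A = dim_col B \<Longrightarrow> map_mat \<phi> (A - B) = map_mat \<phi> A - map_mat \<phi> B"
  proof (rule eq_matI)
    have "\<phi> (x - y) = \<phi> x - \<phi> y" for x y using hom_add[of x "- y"] by (simp add: hom_uminus[OF assms])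
    then show "map_mat \<phi> (A - B) $$ (i, j) = (map_mat \<phi> A - map_mat \<phi> B) $$ (i, j)"
      if "dim_row A = dim_row B" "dim_col A = dim_col B" "i < dim_row (map_mat \<phi> A - map_mat \<phi> B)" "j < dim_col (map_mat \<phi> A - map_mat \<phi> B)" for i j
      using that by simp
  qed auto
qed

section \<open>Embedding into the special linear superalgebra\<close>

context char3_matrix_data
begin

lemma R_triple:
  assumes c: "x \<in> carrier_mat r s" "y \<in> carrier_mat r s" "z \<in> carrier_mat r s"
  shows "R (x * R y * z) = - (R z * y * R x)"
proof -
  have xy: "x * R y \<in> carrier_mat r r" using c by (intro mult_carrier_mat[of _ r s] R_carrier)
  have [simp]: "dim_row x = r" "dim_col x = s" "dim_row y = r" "dim_col y = s" "dim_row z = r" "dim_col z = s" using c by auto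
  show ?thesis unfolding R_mult_left[OF xy c(3)] adj_xR[OF c(1,2)] by (simp add: mat_ring)
qed

lemma R_minus: "x \<in> carrier_mat r s \<Longrightarrow> y \<in> carrier_mat r s \<Longrightarrow> R (x - y) = R x - R y"
  by (auto simp: R_def star_minus' mat_ring)

lemma R_der:
  assumes c: "x \<in> carrier_mat r s" "y \<in> carrier_mat r s" "z \<in> carrier_mat r s"
  shows "R (der x y z) = R z * y * R x + R z * x * R y - R x * y * R z - R y * x * R z"
proof -
  have [simp]: "dim_row x = r" "dim_col x = s" "dim_row y = r" "dim_col y = s" "dim_row z = r" "dim_col z = s" using c by auto
  note t = triple_carrier[OF c(3,1,2)] triple_carrier[OF c(3,2,1)] triple_carrier[OF c(1,2,3)] triple_carrier[OF c(2,1,3)]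
  show ?thesis
    unfolding der_value[OF c] R_minus[OF minus_carrier_mat[OF t(3)] t(4)] R_minus[OF add_carrier_mat[OF t(2)] t(3)] R_add[OF t(1,2)]
      R_triple[OF c(3,1,2)] R_triple[OF c(3,2,1)] R_triple[OF c] R_triple[OF c(2,1,3)]
    by (rule eq_matI) (simp_all add: mat_ring del: index_mult_mat(1))
qed

lemma J_inverse: obtains JI where "JI \<in> carrier_mat s s" "J * JI = 1\<^sub>m s" "JI * J = 1\<^sub>m s"
  by (rule inverse_mat_obtain[OF J_carrier invertible_J]) (rule that)

lemma map_scale_hom:
  assumes "semiring_hom \<phi>" "\<And>c x. \<phi> (scale c x) = \<sigma> c * \<phi> x"
  shows "map_mat \<phi> (map_mat (scale c) m) = \<sigma> c \<cdot>\<^sub>m map_mat \<phi> m" "map_mat \<phi> GC = map_mat \<sigma> G"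
proof -
  interpret \<phi>: semiring_hom \<phi> by fact
  show "map_mat \<phi> (map_mat (scale c) m) = \<sigma> c \<cdot>\<^sub>m map_mat \<phi> m" by (rule eq_matI) (simp_all add: assms(2))
  show "map_mat \<phi> GC = map_mat \<sigma> G" unfolding GC_def by (rule eq_matI) (simp_all add: assms(2))
qed

text \<open>Evaluate at \<open>c E\<^sub>k\<^sub>l\<close> for \<open>c = 1\<close> and \<open>c = i\<close>. Since \<open>cj 1 = 1\<close> and \<open>cj i = - i\<close>, combinations of the two
  values isolate the upper right and the lower left block, so both blocks are exhausted independently. For the separation, the trace
  form \<open>\<phi>(x * cj u) + \<phi>(u * cj x)\<close> of an entry \<open>x\<close> can be read off from the two blocks and lies in the small field.\<close>

lemma sl_odd_embedding:
  fixes \<phi> :: "'c \<Rightarrow> 'l::field"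
  assumes \<sigma>: "field_hom \<sigma>" and hom: "semiring_hom \<phi>" and sc: "\<And>c x. \<phi> (scale c x) = \<sigma> c * \<phi> x"
    and i: "\<phi> i \<noteq> 0" "cj i = - i" and r: "r \<ge> 1"
  shows "odd_embedding scale n r s J G r s (sl_data.V0 r s) (sl_data.V1 r s) \<sigma> (\<lambda>m. block_off (map_mat \<phi> m) (- map_mat \<phi> (R m)))"
proof -
  interpret \<sigma>: field_hom \<sigma> by (rule \<sigma>)
  interpret \<phi>: semiring_hom \<phi> by (rule hom)
  interpret sl: sl_data r s "TYPE('l)" by unfold_locales (use r s in auto)
  let ?h = "map_mat \<phi>"
  note hm = map_mat_minus[OF hom]
  have hc: "?h m \<in> carrier_mat r s" "- ?h (R m) \<in> carrier_mat s r" if "m \<in> carrier_mat r s" for m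
    using that by auto
  note zs = zero_carrier_mat[of r r] zero_carrier_mat[of s s] zero_carrier_mat[of r r] zero_carrier_mat[of s s]
  show ?thesis
  proof (intro odd_embedding.intro odd_embedding_axioms.intro char3_matrix_data_axioms sl.matrix_lie_superalgebra_axioms \<sigma>)
    fix m :: "'c mat" assume m: "m \<in> carrier_mat r s"
    show "block_off (?h m) (- ?h (R m)) \<in> sl.V1" unfolding sl.V1_def by (rule block_off_gl_odd[OF hc[OF m]])
    show "block_off (?h (map_mat (scale c) m)) (- ?h (R (map_mat (scale c) m))) = \<sigma> c \<cdot>\<^sub>m block_off (?h m) (- ?h (R m))" for c
    proof -
      have "- (\<sigma> c \<cdot>\<^sub>m ?h (R m)) = \<sigma> c \<cdot>\<^sub>m - ?h (R m)" by (rule eq_matI) auto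
      then show ?thesis
        unfolding R_scale[OF m] map_scale_hom(1)[OF hom sc] block_linear(6)[OF zs hc[OF m] hc[OF m]] by simp
    qed
    fix m' :: "'c mat" assume m': "m' \<in> carrier_mat r s"
    have [simp]: "dim_row m = r" "dim_col m = s" "dim_row m' = r" "dim_col m' = s" using m m' by auto
    have "- ?h (R (m + m')) = - ?h (R m) + - ?h (R m')"
      unfolding R_add[OF m m'] by (rule eq_matI) (simp_all add: \<phi>.hom_add)
    then show "block_off (?h (m + m')) (- ?h (R (m + m'))) = block_off (?h m) (- ?h (R m)) + block_off (?h m') (- ?h (R m'))"
      unfolding block_linear(4)[OF zs hc[OF m] hc[OF m']] by (simp add: \<phi>.map_mat_add)
  next
    fix x y z :: "'c mat" assume c: "x \<in> carrier_mat r s" "y \<in> carrier_mat r s" "z \<in> carrier_mat r s"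
    have [simp]: "dim_row x = r" "dim_col x = s" "dim_row y = r" "dim_col y = s" "dim_row z = r" "dim_col z = s" using c by auto
    let ?P = "?h x * (- ?h (R y)) + ?h y * (- ?h (R x))" and ?D = "(- ?h (R x)) * ?h y + (- ?h (R y)) * ?h x"
    have PD: "?P \<in> carrier_mat r r" "?D \<in> carrier_mat s s" by (auto intro!: carrier_matI)
    have 1: "?h (der x y z) = ?P * ?h z - ?h z * ?D"
      unfolding der_value[OF c]
      by (rule eq_matI) (simp_all add: hm \<phi>.map_mat_add \<phi>.map_mat_mult mat_ring algebra_simps del: index_mult_mat(1) index_map_mat(1))
    have 2: "- ?h (R (der x y z)) = ?D * (- ?h (R z)) - (- ?h (R z)) * ?P"
      unfolding R_der[OF c]
      by (rule eq_matI) (simp_all add: hm \<phi>.map_mat_add \<phi>.map_mat_mult mat_ring algebra_simps del: index_mult_mat(1) index_map_mat(1))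
    show "block_off (?h (der x y z)) (- ?h (R (der x y z))) =
       commutator (anticommutator (block_off (?h x) (- ?h (R x))) (block_off (?h y) (- ?h (R y)))) (block_off (?h z) (- ?h (R z)))"
      unfolding block_brackets(3)[OF zs hc[OF c(1)] hc[OF c(2)]] block_brackets(2)[OF PD PD hc[OF c(3)] hc[OF c(3)]] 1 2 ..
  next
    obtain JI where JI: "JI \<in> carrier_mat s s" "J * JI = 1\<^sub>m s" "JI * J = 1\<^sub>m s" by (rule J_inverse)
    have [simp]: "dim_row JI = s" "dim_col JI = s" using JI by auto
    have hone: "?h (1\<^sub>m p) = 1\<^sub>m p" for p by (rule eq_matI) auto
    have hJ: "?h J * ?h JI = 1\<^sub>m s" "?h JI * ?h J = 1\<^sub>m s" and hG: "?h GI * ?h GC = 1\<^sub>m r" "?h GC * ?h GI = 1\<^sub>m r"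
      using JI GI_GC GC_GI by (simp_all add: hone flip: \<phi>.map_mat_mult)
    show "spanned_by (r + s) sl.V1 ((\<lambda>m. block_off (?h m) (- ?h (R m))) ` carrier_mat r s)"
      unfolding spanned_by_def
    proof (intro allI impI)
      fix U assume U: "mat_subspace (r + s) U" and sub: "(\<lambda>m. block_off (?h m) (- ?h (R m))) ` carrier_mat r s \<subseteq> U"
      note Uc = mat_subspaceD[OF U]
      let ?e = "\<lambda>k l. unit_mat r s k l :: 'l mat" and ?e' = "\<lambda>l k. unit_mat s r l k :: 'l mat"
      define F where "F Y = ?h J * Y * ?h GC" for Y
      have Fc: "F Y \<in> carrier_mat s r" if "Y \<in> carrier_mat s r" for Y
        using that unfolding F_def by (intro carrier_matI) simp_all
      have m: "block_off (\<phi> c \<cdot>\<^sub>m ?e k l) (- (\<phi> (cj c) \<cdot>\<^sub>m F (?e' l k))) \<in> U" for c k l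
      proof -
        let ?m = "mat r s (\<lambda>(i, j). if i = k \<and> j = l then c else 0)"
        have hm: "?h ?m = \<phi> c \<cdot>\<^sub>m ?e k l" by (rule eq_matI) (auto simp: unit_mat_def)
        have "?h (st ?m) = \<phi> (cj c) \<cdot>\<^sub>m ?e' l k" by (rule eq_matI) (auto simp: unit_mat_def cj_zero)
        moreover have "?h J * ?e' l k \<in> carrier_mat s r" by (rule carrier_matI) simp_all
        ultimately have "?h (R ?m) = \<phi> (cj c) \<cdot>\<^sub>m F (?e' l k)"
          unfolding R_def F_def using mult_smult_distrib[of "?h J" s s "?e' l k" r "\<phi> (cj c)"] mult_smult_assoc_mat[of "?h J * ?e' l k" s r "?h GC" r "\<phi> (cj c)"]
          by (simp add: \<phi>.map_mat_mult)
        then have hR: "?h (R ?m) = \<phi> (cj c) \<cdot>\<^sub>m F (?e' l k)" .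
        have "block_off (?h ?m) (- ?h (R ?m)) \<in> U" by (rule subsetD[OF sub], rule imageI) simp
        then show ?thesis unfolding hm hR .
      qed
      have comb: "block_off ((x + k * x') \<cdot>\<^sub>m W) ((y + k * y') \<cdot>\<^sub>m Y) \<in> U"
        if "block_off (x \<cdot>\<^sub>m W) (y \<cdot>\<^sub>m Y) \<in> U" "block_off (x' \<cdot>\<^sub>m W) (y' \<cdot>\<^sub>m Y) \<in> U" "W \<in> carrier_mat r s" "Y \<in> carrier_mat s r"
        for x y x' y' k and W Y :: "'l mat"
      proof -
        have "block_off (x \<cdot>\<^sub>m W) (y \<cdot>\<^sub>m Y) + k \<cdot>\<^sub>m block_off (x' \<cdot>\<^sub>m W) (y' \<cdot>\<^sub>m Y) \<in> U" using that Uc by blast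
        also have "block_off (x \<cdot>\<^sub>m W) (y \<cdot>\<^sub>m Y) + k \<cdot>\<^sub>m block_off (x' \<cdot>\<^sub>m W) (y' \<cdot>\<^sub>m Y) = block_off ((x + k * x') \<cdot>\<^sub>m W) ((y + k * y') \<cdot>\<^sub>m Y)"
          using that by (intro eq_matI) (auto simp: block_off_def algebra_simps)
        finally show ?thesis .
      qed
      have two: "(2::'l) \<noteq> 0"
      proof -
        have "\<sigma> 2 \<noteq> 0" using two_scalar by simp
        then show ?thesis by (simp add: hom_distribs)
      qed
      have units: "block_off (?e k l) (0\<^sub>m s r) \<in> U" "block_off (0\<^sub>m r s) (F (?e' l k)) \<in> U" for k l
      proof -
        have neg: "- (c \<cdot>\<^sub>m F (?e' l k)) = (- c) \<cdot>\<^sub>m F (?e' l k)" for c by (rule eq_matI) auto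
        have F': "F (?e' l k) \<in> carrier_mat s r" by (rule Fc) simp
        have 1: "block_off (1 \<cdot>\<^sub>m ?e k l) ((- 1) \<cdot>\<^sub>m F (?e' l k)) \<in> U"
          using m[of 1 k l] unfolding neg by (simp add: cj_one)
        have 2: "block_off (\<phi> i \<cdot>\<^sub>m ?e k l) (\<phi> i \<cdot>\<^sub>m F (?e' l k)) \<in> U"
          using m[of i k l] unfolding neg by (simp add: i(2) hom_uminus[OF hom])
        have "block_off ((1 + (1 / \<phi> i) * \<phi> i) \<cdot>\<^sub>m ?e k l) ((- 1 + (1 / \<phi> i) * \<phi> i) \<cdot>\<^sub>m F (?e' l k)) \<in> U"
          by (rule comb[OF 1 2 unit_mat_carrier(1) F'])
        then have "block_off (2 \<cdot>\<^sub>m ?e k l) (0 \<cdot>\<^sub>m F (?e' l k)) \<in> U" using i(1) by simp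
        from Uc(4)[OF this, of "1/2"] show "block_off (?e k l) (0\<^sub>m s r) \<in> U"
        proof (rule back_subst[of "\<lambda>x. x \<in> U"])
          show "1 / 2 \<cdot>\<^sub>m block_off (2 \<cdot>\<^sub>m ?e k l) (0 \<cdot>\<^sub>m F (?e' l k)) = block_off (?e k l) (0\<^sub>m s r)"
            using two F' by (intro eq_matI) (auto simp: block_off_def)
        qed
        have "block_off ((1 + (- (1 / \<phi> i)) * \<phi> i) \<cdot>\<^sub>m ?e k l) ((- 1 + (- (1 / \<phi> i)) * \<phi> i) \<cdot>\<^sub>m F (?e' l k)) \<in> U"
          by (rule comb[OF 1 2 unit_mat_carrier(1) F'])
        then have "block_off (0 \<cdot>\<^sub>m ?e k l) ((- 2) \<cdot>\<^sub>m F (?e' l k)) \<in> U" using i(1) by simp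
        from Uc(4)[OF this, of "- (1/2)"] show "block_off (0\<^sub>m r s) (F (?e' l k)) \<in> U"
        proof (rule back_subst[of "\<lambda>x. x \<in> U"])
          show "- (1 / 2) \<cdot>\<^sub>m block_off (0 \<cdot>\<^sub>m ?e k l) ((- 2) \<cdot>\<^sub>m F (?e' l k)) = block_off (0\<^sub>m r s) (F (?e' l k))"
            using two F' by (intro eq_matI) (auto simp: block_off_def)
        qed
      qed
      have up: "block_off W (0\<^sub>m s r) \<in> U" if "W \<in> carrier_mat r s" for W
        using that
      proof (induction rule: mat_induct_units)
        case zero
        then show ?case using Uc(2) by (simp add: block_zero)
      next
        case (add A B)
        then show ?case using Uc(3)[OF add(3,4)] block_linear(4)[OF zs add(1) zero_carrier_mat add(2) zero_carrier_mat] by simp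
      next
        case (smult c A)
        have "c \<cdot>\<^sub>m 0\<^sub>m s r = (0\<^sub>m s r :: 'l mat)" by (rule eq_matI) auto
        then show ?case using Uc(4)[OF smult(2), of c] block_linear(6)[OF zs smult(1) zero_carrier_mat smult(1) zero_carrier_mat, of c] by simp
      next
        case (unit k l)
        then show ?case using units(1) by simp
      qed
      have low: "block_off (0\<^sub>m r s) (F Y) \<in> U" if "Y \<in> carrier_mat s r" for Y
        using that
      proof (induction rule: mat_induct_units)
        case zero
        have "F (0\<^sub>m s r) = 0\<^sub>m s r" by (rule eq_matI) (auto simp: F_def scalar_prod_def)
        then show ?case using Uc(2) by (simp add: block_zero)
      next
        case (add A B)
        have [simp]: "dim_row A = s" "dim_col A = r" "dim_row B = s" "dim_col B = r" using add by auto
        have "F (A + B) = F A + F B" unfolding F_def by (simp add: mat_ring)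
        then show ?case using Uc(3)[OF add(3,4)] block_linear(4)[OF zs zero_carrier_mat Fc[OF add(1)] zero_carrier_mat Fc[OF add(2)]] by simp
      next
        case (smult c A)
        have [simp]: "dim_row A = s" "dim_col A = r" using smult by auto
        have "F (c \<cdot>\<^sub>m A) = c \<cdot>\<^sub>m F A" unfolding F_def
          using mult_smult_distrib[of "?h J" s s A r c] mult_smult_assoc_mat[of "?h J * A" s r "?h GC" r c]
          smult(1) carrier_matI[of "?h J * A" s r] by simp
        moreover have "c \<cdot>\<^sub>m 0\<^sub>m r s = (0\<^sub>m r s :: 'l mat)" by (rule eq_matI) auto
        ultimately show ?case using Uc(4)[OF smult(2), of c] block_linear(6)[OF zs zero_carrier_mat Fc[OF smult(1)] zero_carrier_mat Fc[OF smult(1)], of c] by simp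
      next
        case (unit k l)
        then show ?case using units(2) by simp
      qed
      show "sl.V1 \<subseteq> U"
      proof
        fix Q assume "Q \<in> sl.V1"
        then obtain W Y where c: "W \<in> carrier_mat r s" "Y \<in> carrier_mat s r" and Q: "Q = block_off W Y"
          unfolding sl.V1_def by (rule gl_oddE)
        have [simp]: "dim_row Y = s" "dim_col Y = r" using c by auto
        have "F (?h JI * Y * ?h GI) = (?h J * ?h JI) * Y * (?h GI * ?h GC)" unfolding F_def by (simp add: mult_assoc')
        also have "\<dots> = Y" unfolding hJ hG using c(2) by simp
        finally have FY: "F (?h JI * Y * ?h GI) = Y" .
        have "block_off (0\<^sub>m r s) Y \<in> U" using low[of "?h JI * Y * ?h GI"] unfolding FY by (simp add: carrier_matI)
        from Uc(3)[OF up[OF c(1)] this] show "Q \<in> U"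
          using block_linear(4)[OF zs c(1) zero_carrier_mat zero_carrier_mat c(2)] c by (simp add: Q)
      qed
    qed
    fix m :: "'c mat" assume m: "m \<in> carrier_mat r s"
      and sep: "\<And>\<tau>. functional_on sl.V1 \<tau> \<Longrightarrow>
         (\<And>m'. m' \<in> carrier_mat r s \<Longrightarrow> \<tau> (block_off (?h m') (- ?h (R m'))) \<in> range \<sigma>) \<Longrightarrow>
         \<tau> (block_off (?h m) (- ?h (R m))) = 0"
    show "m = 0\<^sub>m r s"
    proof (rule eq_matI)
      fix k l assume "k < dim_row (0\<^sub>m r s :: 'c mat)" "l < dim_col (0\<^sub>m r s :: 'c mat)"
      then have kl: "k < r" "l < s" by auto
      have "m $$ (k, l) = 0"
      proof (rule polar_nondegenerate)
        fix u
        let ?low = "\<lambda>Q. mat s r (\<lambda>(i, j). Q $$ (r + i, j))"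
        \<comment> \<open>On the image of \<open>x\<close>, the lower block multiplied by the inverses of \<open>J\<close> and \<open>G\<close> is \<open>- \<phi>(x\<^sup>*)\<close>.\<close>
        let ?t = "\<lambda>Q. \<phi> (cj u) * Q $$ (k, r + l) - \<phi> u * (?h JI * ?low Q * ?h GI) $$ (l, k)"
        have t: "?t (block_off (?h m') (- ?h (R m'))) = \<sigma> (polar n (m' $$ (k, l)) u)" if m': "m' \<in> carrier_mat r s" for m'
        proof -
          have [simp]: "dim_row m' = r" "dim_col m' = s" using m' by auto
          have "block_off (?h m') (- ?h (R m')) $$ (k, r + l) = \<phi> (m' $$ (k, l))" using kl by (simp add: block_off_def)
          moreover have "?low (block_off (?h m') (- ?h (R m'))) = - ?h (R m')"
            by (rule eq_matI) (auto simp: block_off_def)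
          moreover have "?h JI * (- ?h (R m')) * ?h GI = - ((?h JI * ?h J) * ?h (st m') * (?h GC * ?h GI))"
            unfolding R_def by (simp add: \<phi>.map_mat_mult mat_ring)
          moreover have "\<dots> = - ?h (st m')" unfolding hJ hG using m' by simp
          ultimately have "?t (block_off (?h m') (- ?h (R m'))) = \<phi> (cj u) * \<phi> (m' $$ (k, l)) + \<phi> u * \<phi> (cj (m' $$ (k, l)))"
            using kl by simp
          also have "\<dots> = \<phi> (m' $$ (k, l) * cj u + cj (m' $$ (k, l) * cj u))"
            by (simp add: \<phi>.hom_mult \<phi>.hom_add cj_mult cj_cj mult.commute)
          also have "\<dots> = \<sigma> (polar n (m' $$ (k, l)) u)"
            unfolding add_cj trace_pairing sc by simp
          finally show ?thesis .
        qed
        have "functional_on sl.V1 ?t"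
          unfolding functional_on_def
        proof (intro conjI ballI allI)
          fix Q Q' :: "'l mat" and c assume Q: "Q \<in> sl.V1"
          have Qc: "Q \<in> carrier_mat (r + s) (r + s)" by (rule sl.sub1(1)[OF Q])
          have "?low (c \<cdot>\<^sub>m Q) = c \<cdot>\<^sub>m ?low Q" using Qc by (intro eq_matI) auto
          moreover have "?h JI * (c \<cdot>\<^sub>m ?low Q) * ?h GI = c \<cdot>\<^sub>m (?h JI * ?low Q * ?h GI)"
            using mult_smult_distrib[of "?h JI" s s "?low Q" r c] mult_smult_assoc_mat[of "?h JI * ?low Q" s r "?h GI" r c]
              JI(1) carrier_matI[of "?h JI * ?low Q" s r] by simp
          ultimately show "?t (c \<cdot>\<^sub>m Q) = c * ?t Q" using Qc kl by (simp add: algebra_simps del: index_mult_mat(1))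
          assume Q': "Q' \<in> sl.V1"
          have Qc': "Q' \<in> carrier_mat (r + s) (r + s)" by (rule sl.sub1(1)[OF Q'])
          have "?low (Q + Q') = ?low Q + ?low Q'" using Qc Qc' by (intro eq_matI) auto
          moreover have "?h JI * (?low Q + ?low Q') * ?h GI = ?h JI * ?low Q * ?h GI + ?h JI * ?low Q' * ?h GI"
            by (simp add: mat_ring)
          ultimately show "?t (Q + Q') = ?t Q + ?t Q'" using Qc Qc' kl by (simp add: algebra_simps del: index_mult_mat(1))
        qed
        from sep[OF this] have "?t (block_off (?h m) (- ?h (R m))) = 0" using t by (metis rangeI)
        then have "\<sigma> (polar n (m $$ (k, l)) u) = 0" unfolding t[OF m] .
        then show "polar n (m $$ (k, l)) u = 0" by simp
      qed
      with kl show "m $$ (k, l) = 0\<^sub>m r s $$ (k, l)" by simp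
    qed (use m in auto)
  qed
qed

end

section \<open>Composition algebras of dimension one and two\<close>

context char3_matrix_data
begin

context
  fixes \<sigma> :: "'k \<Rightarrow> 'l::field"
  assumes \<sigma>: "field_hom \<sigma>" and dim: "dim (UNIV :: 'c set) = 1"
begin

interpretation \<sigma>: field_hom \<sigma> by (rule \<sigma>)

definition scalar_part :: "'c \<Rightarrow> 'l" where "scalar_part c = \<sigma> (coord c 1)"

lemma dim_one_scalar: "c = scale (coord c 1) 1"
  by (rule dim_one_expand[OF two_scalar dim])

lemma scalar_part_scale_one: "scalar_part (scale a 1) = \<sigma> a"
  using coord_orthogonal(1)[OF two_scalar, of 1] by (simp add: scalar_part_def coord_linear norm_one)

lemma scalar_part_hom: "semiring_hom scalar_part"
proof unfold_locales
  show "scalar_part (x + y) = scalar_part x + scalar_part y" for x y by (simp add: scalar_part_def coord_linear hom_distribs)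
  show "scalar_part 0 = 0" using coord_linear(2)[of 0 0 1] by (simp add: scalar_part_def)
  show "scalar_part 1 = 1" using scalar_part_scale_one[of 1] by simp
  show "scalar_part (x * y) = scalar_part x * scalar_part y" for x y
  proof -
    have "x * y = scale (coord x 1) 1 * scale (coord y 1) 1" using dim_one_scalar[of x] dim_one_scalar[of y] by simp
    also have "\<dots> = scale (coord x 1 * coord y 1) 1" by (simp add: scale_mult_left)
    finally show ?thesis by (simp add: scalar_part_scale_one) (simp add: scalar_part_def hom_distribs)
  qed
qed

lemma scalar_part_scale: "scalar_part (scale c x) = \<sigma> c * scalar_part x"
  by (simp add: scalar_part_def coord_linear hom_distribs)

lemma dim_one_cj: "cj c = c"
  using cj_scale[of "coord c 1" 1] dim_one_scalar[of c] by (simp add: cj_one)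

lemma scalar_part_star: "map_mat scalar_part (st m) = transpose_mat (map_mat scalar_part m)"
  by (rule eq_matI) (simp_all add: dim_one_cj)

lemma dim_one_rect_embedding: "rect_embedding scale n r s J G r s \<sigma> (map_mat scalar_part)"
proof (intro rect_embedding.intro rect_embedding_axioms.intro char3_matrix_data_axioms \<sigma>)
  interpret \<phi>: semiring_hom scalar_part by (rule scalar_part_hom)
  fix m m' :: "'c mat" assume m: "m \<in> carrier_mat r s" and m': "m' \<in> carrier_mat r s"
  show "map_mat scalar_part (m + m') = map_mat scalar_part m + map_mat scalar_part m'"
    using m m' by (intro \<phi>.map_mat_add) auto
next
  fix m :: "'c mat" and c assume m: "m \<in> carrier_mat r s"
  show "map_mat scalar_part m \<in> carrier_mat r s" using m by simp
  show "map_mat scalar_part (map_mat (scale c) m) = \<sigma> c \<cdot>\<^sub>m map_mat scalar_part m"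
    by (rule map_scale_hom(1)[OF scalar_part_hom scalar_part_scale])
next
  interpret \<phi>: semiring_hom scalar_part by (rule scalar_part_hom)
  fix Pr :: "'l mat \<Rightarrow> bool" and W :: "'l mat"
  assume Pr: "Pr (0\<^sub>m r s)" "\<And>U V. U \<in> carrier_mat r s \<Longrightarrow> V \<in> carrier_mat r s \<Longrightarrow> Pr U \<Longrightarrow> Pr V \<Longrightarrow> Pr (U + V)"
    "\<And>c U. U \<in> carrier_mat r s \<Longrightarrow> Pr U \<Longrightarrow> Pr (c \<cdot>\<^sub>m U)"
    and base: "\<And>m. m \<in> carrier_mat r s \<Longrightarrow> Pr (map_mat scalar_part m)" and W: "W \<in> carrier_mat r s"
  show "Pr W"
    using W
  proof (induction rule: mat_induct_units)
    case (unit i j)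
    have "map_mat scalar_part (unit_mat r s i j) = unit_mat r s i j" by (rule eq_matI) (auto simp: unit_mat_def)
    then show ?case using base[of "unit_mat r s i j"] by simp
  qed (use Pr in auto)
next
  fix m :: "'c mat" assume m: "m \<in> carrier_mat r s"
    and sep: "\<And>\<tau>. functional_on (carrier_mat r s) \<tau> \<Longrightarrow>
      (\<And>m'. m' \<in> carrier_mat r s \<Longrightarrow> \<tau> (map_mat scalar_part m') \<in> range \<sigma>) \<Longrightarrow> \<tau> (map_mat scalar_part m) = 0"
  show "m = 0\<^sub>m r s"
  proof (rule eq_matI)
    fix k l assume "k < dim_row (0\<^sub>m r s :: 'c mat)" "l < dim_col (0\<^sub>m r s :: 'c mat)"
    then have kl: "k < r" "l < s" by auto
    have "functional_on (carrier_mat r s) (\<lambda>U :: 'l mat. U $$ (k, l))" using kl by (auto simp: functional_on_def)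
    from sep[OF this] have "scalar_part (m $$ (k, l)) = 0" using kl m by (auto simp: scalar_part_def)
    then have "coord (m $$ (k, l)) 1 = 0" by (simp add: scalar_part_def)
    then show "m $$ (k, l) = 0\<^sub>m r s $$ (k, l)" using dim_one_scalar[of "m $$ (k, l)"] kl by simp
  qed (use m in auto)
qed

lemma dim_one_compatible:
  "rect_embedding.osp_compatible scale n r s J G (map_mat scalar_part) (map_mat scalar_part J) (map_mat scalar_part GC)"
proof -
  interpret w: rect_embedding scale n r s J G r s \<sigma> "map_mat scalar_part" by (rule dim_one_rect_embedding)
  interpret \<phi>: semiring_hom scalar_part by (rule scalar_part_hom)
  show ?thesis
    unfolding w.osp_compatible_def
  proof (intro ballI)
    fix x y z :: "'c mat" assume c: "x \<in> carrier_mat r s" "y \<in> carrier_mat r s" "z \<in> carrier_mat r s"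
    have [simp]: "dim_row x = r" "dim_col x = s" "dim_row y = r" "dim_col y = s" "dim_row z = r" "dim_col z = s" using c by auto
    show "map_mat scalar_part (der x y z) =
      map_mat scalar_part z * (map_mat scalar_part J * transpose_mat (map_mat scalar_part x) * map_mat scalar_part GC) * map_mat scalar_part y
      + map_mat scalar_part z * (map_mat scalar_part J * transpose_mat (map_mat scalar_part y) * map_mat scalar_part GC) * map_mat scalar_part x
      - map_mat scalar_part x * (map_mat scalar_part J * transpose_mat (map_mat scalar_part y) * map_mat scalar_part GC) * map_mat scalar_part z
      - map_mat scalar_part y * (map_mat scalar_part J * transpose_mat (map_mat scalar_part x) * map_mat scalar_part GC) * map_mat scalar_part z"
      unfolding w.w_der[OF c] by (simp add: \<phi>.map_mat_mult R_def scalar_part_star)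
  qed
qed

lemma scalar_part_forms:
  shows "transpose_mat (map_mat scalar_part GC) = map_mat scalar_part GC"
    "map_mat scalar_part GC * map_mat scalar_part GI = 1\<^sub>m r" "map_mat scalar_part GI * map_mat scalar_part GC = 1\<^sub>m r"
    "transpose_mat (map_mat scalar_part J) = - map_mat scalar_part J"
proof -
  interpret \<phi>: semiring_hom scalar_part by (rule scalar_part_hom)
  have one: "map_mat scalar_part (1\<^sub>m p) = 1\<^sub>m p" for p by (rule eq_matI) auto
  show "transpose_mat (map_mat scalar_part GC) = map_mat scalar_part GC" using scalar_part_star[of GC] by simp
  show "map_mat scalar_part GC * map_mat scalar_part GI = 1\<^sub>m r" "map_mat scalar_part GI * map_mat scalar_part GC = 1\<^sub>m r"
    using GC_GI GI_GC by (simp_all add: one flip: \<phi>.map_mat_mult)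
  show "transpose_mat (map_mat scalar_part J) = - map_mat scalar_part J"
    using scalar_part_star[of J] J(2) map_mat_minus(2)[OF scalar_part_hom, of J] by simp
qed

lemma scalar_part_J_inverse:
  obtains KI where "KI \<in> carrier_mat s s" "map_mat scalar_part J * KI = 1\<^sub>m s" "KI * map_mat scalar_part J = 1\<^sub>m s"
proof -
  interpret \<phi>: semiring_hom scalar_part by (rule scalar_part_hom)
  have one: "map_mat scalar_part (1\<^sub>m p) = 1\<^sub>m p" for p by (rule eq_matI) auto
  obtain JI where JI: "JI \<in> carrier_mat s s" "J * JI = 1\<^sub>m s" "JI * J = 1\<^sub>m s" by (rule J_inverse)
  then have "map_mat scalar_part J * map_mat scalar_part JI = 1\<^sub>m s" "map_mat scalar_part JI * map_mat scalar_part J = 1\<^sub>m s"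
    by (simp_all add: one flip: \<phi>.map_mat_mult)
  with that[of "map_mat scalar_part JI"] JI show thesis by simp
qed

end

lemma dim_one_form_of_osp:
  assumes dim: "dim (UNIV :: 'c set) = 1" and r: "r \<ge> 1" and k: "s = 2 * k"
  shows "form_of semisimplified (osp r s :: ('k alg_closure, 'k alg_closure mat) superalgebra)"
proof -
  have \<sigma>: "field_hom (to_ac :: 'k \<Rightarrow> 'k alg_closure)" by unfold_locales auto
  let ?h = "map_mat (scalar_part to_ac)"
  obtain KI where KI: "KI \<in> carrier_mat s s" "?h J * KI = 1\<^sub>m s" "KI * ?h J = 1\<^sub>m s"
    by (rule scalar_part_J_inverse[OF \<sigma> dim])
  note f = scalar_part_forms[OF \<sigma> dim]
  show ?thesis
    unfolding k
    by (rule form_of_osp[OF dim_one_rect_embedding[OF \<sigma> dim, unfolded k] dim_one_compatible[OF \<sigma> dim, unfolded k] r _ _ f(1) _ f(2) _ f(4) _ KI(2)[unfolded k]])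
      (use k s KI in auto)
qed

text \<open>Here \<open>C\<close> is the field itself, so the embedding is defined without an extension of scalars. The forms
  are \<open>G\<close> and \<open>- J\<^sup>-\<^sup>1\<close>.\<close>

lemma dim_one_iso_osp_form:
  assumes dim: "dim (UNIV :: 'c set) = 1" and r: "r \<ge> 1"
  shows "\<exists>S A. symmetric_form r S \<and> symplectic_form s A \<and> superalgebra_iso semisimplified (osp_form r s S A)"
proof -
  have \<sigma>: "field_hom (id :: 'k \<Rightarrow> 'k)" by unfold_locales auto
  let ?h = "map_mat (scalar_part id)"
  obtain KI where KI: "KI \<in> carrier_mat s s" "?h J * KI = 1\<^sub>m s" "KI * ?h J = 1\<^sub>m s"
    by (rule scalar_part_J_inverse[OF \<sigma> dim])
  note f = scalar_part_forms[OF \<sigma> dim]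
  let ?S = "?h GC" and ?A = "- KI"
  have [simp]: "dim_row KI = s" "dim_col KI = s" using KI by auto
  have KI_t: "transpose_mat KI = - KI"
  proof -
    have "transpose_mat KI * transpose_mat (?h J) = 1\<^sub>m s" using arg_cong[OF KI(2), of transpose_mat] by (simp add: transpose_mult')
    then have 1: "- (transpose_mat KI * ?h J) = 1\<^sub>m s" unfolding f(4) by simp
    have "transpose_mat KI = transpose_mat KI * (?h J * KI)" unfolding KI(2) by (simp add: right_mult_one_mat[of _ s s])
    also have "\<dots> = - ((- (transpose_mat KI * ?h J)) * KI)" by (simp add: mat_ring)
    finally show ?thesis unfolding 1 using KI(1) by simp
  qed
  have osp: "osp_data r s ?S (?h GI) ?A (?h J)"
  proof (rule osp_data.intro)
    show "transpose_mat ?A = - ?A" by (simp add: transpose_uminus KI_t)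
  qed (use two_scalar r s f KI in auto)
  have "symmetric_form r ?S"
    unfolding symmetric_form_def invertible_mat_def inverts_mat_def using f by (auto intro!: exI[of _ "?h GI"])
  moreover have "symplectic_form s ?A"
  proof -
    have "invertible_mat ?A"
      unfolding invertible_mat_def inverts_mat_def using KI by (auto intro!: exI[of _ "- ?h J"])
    moreover have "?A $$ (i, i) = 0" if "i < s" for i
    proof -
      have "transpose_mat KI $$ (i, i) = (- KI) $$ (i, i)" using KI_t by simp
      then have "2 * KI $$ (i, i) = 0" using that by (simp add: eq_neg_iff_add_eq_0)
      then show ?thesis using two_scalar that by simp
    qed
    ultimately show ?thesis unfolding symplectic_form_def using KI by (auto simp: transpose_uminus KI_t)
  qed
  moreover have "superalgebra_iso semisimplified (osp_form r s ?S ?A)"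
  proof -
    interpret osp: osp_data r s ?S "?h GI" ?A "?h J" by (rule osp)
    interpret w: rect_embedding scale n r s J G r s id ?h by (rule dim_one_rect_embedding[OF \<sigma> dim])
    interpret o: odd_embedding scale n r s J G r s osp.V0 osp.V1 id "\<lambda>m. block_off (?h m) (- osp.rho (?h m))"
      by (rule w.osp_odd_embedding[OF osp dim_one_compatible[OF \<sigma> dim]])
    show ?thesis
      unfolding osp.osp_form_eq by (rule superalgebra_isoI[OF o.faithful_target[OF osp.annihilator_trivial]])
  qed
  ultimately show ?thesis by blast
qed

text \<open>The annihilator of the odd part of \<open>sl(r, s)\<close> consists of the scalar matrices of supertrace 0. They are nonzero
  precisely if the characteristic divides \<open>r - s\<close>, which is the case where the type is defined by \<^const>\<open>psl\<close>.\<close>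

lemma dim_two_type_A:
  assumes dim: "dim (UNIV :: 'c set) = 2" and r: "r \<ge> 1"
  shows "type_A semisimplified (r - 1) (s - 1)"
proof -
  have \<sigma>: "field_hom (to_ac :: 'k \<Rightarrow> 'k alg_closure)" by unfold_locales auto
  obtain \<phi> :: "'c \<Rightarrow> 'k alg_closure" and i where \<phi>: "semiring_hom \<phi>" "\<And>c x. \<phi> (scale c x) = to_ac c * \<phi> x" "\<phi> i \<noteq> 0" "cj i = - i"
    using dim_two_rep[OF \<sigma> two_scalar dim] by metis
  interpret sl: sl_data r s "TYPE('k alg_closure)" by unfold_locales (use r s in auto)
  interpret o: odd_embedding scale n r s J G r s sl.V0 sl.V1 to_ac "\<lambda>m. block_off (map_mat \<phi> m) (- map_mat \<phi> (R m))"
    by (rule sl_odd_embedding[OF \<sigma> \<phi> r])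
  have e: "r - 1 + 1 = r" "s - 1 + 1 = s" using r s by auto
  have "int CHAR('k) dvd int (r - 1) - int (s - 1) \<longleftrightarrow> (of_nat r :: 'k alg_closure) = of_nat s"
  proof -
    have "int (r - 1) - int (s - 1) = int r - int s" using r s by auto
    then have "int CHAR('k) dvd int (r - 1) - int (s - 1) \<longleftrightarrow> (of_int (int r - int s) :: 'k) = 0"
      by (simp only: of_int_eq_0_iff_char_dvd)
    also have "\<dots> \<longleftrightarrow> (of_nat r :: 'k) = of_nat s" by simp
    also have "\<dots> \<longleftrightarrow> (of_nat r :: 'k alg_closure) = of_nat s" by (metis to_ac_of_nat to_ac_eq_iff)
    finally show ?thesis .
  qed
  then show ?thesis
    unfolding type_A_def e
  proof (split if_split, intro conjI impI)
    assume eq: "int CHAR('k) dvd int (r - 1) - int (s - 1) \<longleftrightarrow> (of_nat r :: 'k alg_closure) = of_nat s"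
    {
      assume "int CHAR('k) dvd int (r - 1) - int (s - 1)"
      then have d: "(of_nat r :: 'k alg_closure) = of_nat s" using eq by simp
      note \<pi> = sl.vectorspace_psl[OF d] sl.coset_hom[OF d] sl.psl_simps(1)[OF d, symmetric] sl.coset_kernel[OF d]
      show "form_of semisimplified (psl r s :: ('k alg_closure, _) superalgebra)"
        by (rule form_ofI[OF o.super_map_hom[OF \<pi>] o.super_map_semilinear[OF \<pi>] o.super_map_generates[OF \<pi>]])
    next
      assume "\<not> int CHAR('k) dvd int (r - 1) - int (s - 1)"
      then have d: "(of_nat r :: 'k alg_closure) \<noteq> of_nat s" using eq by simp
      have "Q = 0\<^sub>m (r + s) (r + s)" if Q: "Q \<in> sl.V0" "\<And>x. x \<in> sl.V1 \<Longrightarrow> commutator Q x = 0\<^sub>m (r + s) (r + s)" for Q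
      proof -
        obtain c where c: "Q = c \<cdot>\<^sub>m 1\<^sub>m (r + s)" "c * (of_nat r - of_nat s) = 0"
          using sl.annihilator_scalar[OF Q] by blast
        then have "c = 0" using d by simp
        then show ?thesis unfolding c(1) by (auto intro!: eq_matI)
      qed
      note f = o.faithful_target[OF this]
      show "form_of semisimplified (sl r s :: ('k alg_closure, _) superalgebra)"
        unfolding sl.sl_eq by (rule form_ofI[OF f])
    }
  qed
qed

end

section \<open>Composition algebras of dimension four\<close>

text \<open>Indexing the blocks by booleans allows for a uniform treatment of the four entries of a quaternion.\<close>

definition blocks :: "(bool \<Rightarrow> bool \<Rightarrow> 'a::zero mat) \<Rightarrow> 'a mat" where
  "blocks M = four_block_mat (M False False) (M False True) (M True False) (M True True)"

lemma blocks_carrier: "(\<And>p q. M p q \<in> carrier_mat k l) \<Longrightarrow> blocks M \<in> carrier_mat (2 * k) (2 * l)"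
  unfolding blocks_def mult_2 by (intro four_block_carrier_mat)

lemma blocks_index:
  assumes "\<And>p q. M p q \<in> carrier_mat k l" "i < k" "j < l"
  shows "blocks M $$ ((if p then k else 0) + i, (if q then l else 0) + j) = M p q $$ (i, j)"
proof -
  have [simp]: "dim_row (M p q) = k" "dim_col (M p q) = l" for p q using assms(1)[of p q] by auto
  show ?thesis using assms(2,3) by (auto simp: blocks_def)
qed

lemma blocks_eqI:
  assumes "A \<in> carrier_mat (2 * k) (2 * l)" "B \<in> carrier_mat (2 * k) (2 * l)"
    and eq: "\<And>p q i j. i < k \<Longrightarrow> j < l \<Longrightarrow>
      A $$ ((if p then k else 0) + i, (if q then l else 0) + j) = B $$ ((if p then k else 0) + i, (if q then l else 0) + j)"
  shows "A = B"
proof (rule eq_matI)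
  fix i j assume "i < dim_row B" "j < dim_col B"
  then have ij: "i < 2 * k" "j < 2 * l" using assms by auto
  have "i = (if k \<le> i then k else 0) + (if k \<le> i then i - k else i)"
    "j = (if l \<le> j then l else 0) + (if l \<le> j then j - l else j)" by auto
  moreover have "(if k \<le> i then i - k else i) < k" "(if l \<le> j then j - l else j) < l" using ij by auto
  ultimately show "A $$ (i, j) = B $$ (i, j)" using eq by metis
qed (use assms in auto)

context char3_matrix_data
begin

text \<open>Let \<open>F x\<close> be the matrix of size \<open>2r \<times> 2s\<close> with the four matrices of entries of \<open>x\<close> as its blocks.
  As the conjugation is the adjugate, \<open>F (x\<^sup>*) = - \<Omega> (F x)\<^sup>T \<Omega>\<close> for the standard alternating matrices \<open>\<Omega>\<close>. This turns the
  symmetry of \<open>G\<close> and the skew symmetry of \<open>J\<close> into their opposites for the matrices \<open>(F G)\<^sup>T \<Omega>\<close> and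
  \<open>\<Omega> (F J)\<^sup>T\<close>. The symmetric matrix has size \<open>2s\<close> and must come first in the orthosymplectic superalgebra, so
  the embedding of \<open>M\<close> is the transpose of \<open>F\<close>.\<close>

lemma dim_four_form_of_osp:
  assumes dim: "dim (UNIV :: 'c set) = 4" and r: "r \<ge> 1"
  shows "form_of semisimplified (osp (2 * s) (2 * r) :: ('k alg_closure, 'k alg_closure mat) superalgebra)"
proof -
  have \<sigma>: "field_hom (to_ac :: 'k \<Rightarrow> 'k alg_closure)" by unfold_locales auto
  obtain f :: "bool \<Rightarrow> bool \<Rightarrow> 'c \<Rightarrow> 'k alg_closure"
    where f_add: "\<And>p q x y. f p q (x + y) = f p q x + f p q y" and f_scale: "\<And>p q c x. f p q (scale c x) = to_ac c * f p q x"
    and f_mult: "\<And>p q x y. f p q (x * y) = f p False x * f False q y + f p True x * f True q y"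
    and f_one: "\<And>p q. f p q 1 = (if p = q then 1 else 0)"
    and f_cj: "\<And>p x. f p p (cj x) = f (\<not> p) (\<not> p) x" "\<And>p x. f p (\<not> p) (cj x) = - f p (\<not> p) x"
    and f_span: "\<And>p q. \<exists>k x l y. \<forall>p' q'. k * f p' q' x + l * f p' q' y = (if p = p' \<and> q = q' then 1 else 0)"
    by (rule dim_four_rep[OF \<sigma> two_scalar dim]) (rule that)
  have f_zero: "f p q 0 = 0" for p q using f_scale[of p q 0 0] by simp
  have f_minus: "f p q (- x) = - f p q x" for p q x using f_scale[of p q "- 1" x] by simp
  have f_sum: "f p q (sum g I) = (\<Sum>i\<in>I. f p q (g i))" for p q g and I :: "nat set"
    by (induction I rule: infinite_finite_induct) (simp_all add: f_zero f_add)
  define F where "F A = blocks (\<lambda>p q. map_mat (f p q) A)" for A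
  have F_carrier: "F A \<in> carrier_mat (2 * k) (2 * l)" if "A \<in> carrier_mat k l" for A k l
    unfolding F_def using that by (intro blocks_carrier) auto
  have F_dims [simp]: "dim_row (F A) = 2 * dim_row A" "dim_col (F A) = 2 * dim_col A" for A
    using F_carrier[of A "dim_row A" "dim_col A"] by auto
  have F_index: "F A $$ ((if p then k else 0) + i, (if q then l else 0) + j) = f p q (A $$ (i, j))"
    if "A \<in> carrier_mat k l" "i < k" "j < l" for A k l i j p q
    unfolding F_def using that by (subst blocks_index) auto
  have bound: "(if p then k else 0) + i < 2 * k" if "i < k" for p and i k :: nat using that by simp
  have F_mult: "F (A * B) = F A * F B" if "dim_col A = dim_row B" for A B
  proof -
    have c: "map_mat (f p q) A \<in> carrier_mat (dim_row A) (dim_row B)" "map_mat (f p q) B \<in> carrier_mat (dim_row B) (dim_col B)" for p q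
      using that by auto
    have e: "map_mat (f p q) (A * B) = map_mat (f p False) A * map_mat (f False q) B + map_mat (f p True) A * map_mat (f True q) B" for p q
      using that by (intro eq_matI) (auto simp: scalar_prod_def f_sum f_mult sum.distrib)
    show ?thesis
      unfolding F_def blocks_def mult_four_block_mat[OF c(1) c(1) c(1) c(1) c(2) c(2) c(2) c(2)] e ..
  qed
  have F_add: "F (A + B) = F A + F B" if "A \<in> carrier_mat k l" "B \<in> carrier_mat k l" for A B k l
    by (rule blocks_eqI[of _ k l]) (use that bound in \<open>auto simp: F_carrier carrier_matD[OF F_carrier[OF that(1)]] carrier_matD[OF F_carrier[OF that(2)]] F_index[of _ k l] f_add simp del: F_dims\<close>)
  have F_scale: "F (map_mat (scale c) A) = to_ac c \<cdot>\<^sub>m F A" if "A \<in> carrier_mat k l" for A k l c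
    by (rule blocks_eqI[of _ k l]) (use that bound in \<open>auto simp: F_carrier carrier_matD[OF F_carrier[OF that]] F_index[of _ k l] f_scale simp del: F_dims\<close>)
  have F_uminus: "F (- A) = - F A" if "A \<in> carrier_mat k l" for A k l
    by (rule blocks_eqI[of _ k l]) (use that bound in \<open>auto simp: F_carrier carrier_matD[OF F_carrier[OF that]] F_index[of _ k l] f_minus simp del: F_dims\<close>)
  have F_one: "F (1\<^sub>m k) = 1\<^sub>m (2 * k)" for k
    by (rule blocks_eqI[of _ k k]) (use bound in \<open>auto simp: F_carrier F_index[of _ k k] f_one f_zero simp del: F_dims\<close>)
  have F_star: "F (st A) = - (std_alternating l * transpose_mat (F A) * std_alternating k)" if A: "A \<in> carrier_mat k l" for A k l
  proof -
    let ?t = "\<lambda>p q. transpose_mat (map_mat (f p q) A)"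
    have c: "?t p q \<in> carrier_mat l k" for p q using A by simp
    have T: "transpose_mat (F A) = four_block_mat (?t False False) (?t True False) (?t False True) (?t True True)"
      unfolding F_def blocks_def by (rule transpose_four_block_mat[of _ k l _ l _ k]) (use A in auto)
    have "std_alternating l * transpose_mat (F A) = four_block_mat (?t False True) (?t True True) (- ?t False False) (- ?t True False)"
      unfolding T std_alternating_def
      by (subst mult_four_block_mat[of _ l l _ l _ l _ _ k _ k]) (use c in \<open>auto simp: uminus_mult_left_mat left_mult_one_mat[of _ l k]\<close>)
    then have "std_alternating l * transpose_mat (F A) * std_alternating k =
        four_block_mat (- ?t True True) (?t False True) (?t True False) (- ?t False False)"
      unfolding std_alternating_def
      by (simp, subst mult_four_block_mat[of _ l k _ k _ l _ _ k _ k]) (use c A in \<open>auto simp: right_mult_one_mat[of _ l k]\<close>)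
    moreover have "F (st A) = four_block_mat (?t True True) (- ?t False True) (- ?t True False) (?t False False)"
      unfolding F_def blocks_def using f_cj[of False] f_cj[of True] A by (intro cong_four_block_mat eq_matI) auto
    ultimately show ?thesis using c A by (auto intro!: eq_matI)
  qed
  have om: "std_alternating k * (std_alternating k * B) = - B" if "dim_row B = 2 * k" for k and B :: "'k alg_closure mat"
  proof -
    have "std_alternating k * (std_alternating k * B) = std_alternating k * std_alternating k * B" using that by (simp add: mult_assoc')
    then show ?thesis unfolding std_alternating_square using that by simp
  qed
  have om': "B * std_alternating k * std_alternating k = - B" if "dim_col B = 2 * k" for k and B :: "'k alg_closure mat"
  proof -
    have "B * std_alternating k * std_alternating k = B * (std_alternating k * std_alternating k)" using that by (simp add: mult_assoc')
    then show ?thesis unfolding std_alternating_square using that by simp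
  qed
  define w where "w m = transpose_mat (F m)" for m
  have w_dims: "w m \<in> carrier_mat (2 * s) (2 * r)" if "m \<in> carrier_mat r s" for m
    using F_carrier[OF that] by (simp add: w_def)
  have rect: "rect_embedding scale n r s J G (2 * s) (2 * r) to_ac w"
  proof (intro rect_embedding.intro rect_embedding_axioms.intro char3_matrix_data_axioms \<sigma>)
    fix m m' :: "'c mat" assume m: "m \<in> carrier_mat r s" and m': "m' \<in> carrier_mat r s"
    show "w (m + m') = w m + w m'" unfolding w_def F_add[OF m m'] by (rule transpose_add') (use m m' in auto)
  next
    fix m :: "'c mat" and c assume m: "m \<in> carrier_mat r s"
    show "w m \<in> carrier_mat (2 * s) (2 * r)" by (rule w_dims[OF m])
    show "w (map_mat (scale c) m) = to_ac c \<cdot>\<^sub>m w m" unfolding w_def F_scale[OF m] by (rule eq_matI) auto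
  next
    fix Pr :: "'k alg_closure mat \<Rightarrow> bool" and W :: "'k alg_closure mat"
    assume Pr0: "Pr (0\<^sub>m (2 * s) (2 * r))"
      and Pr_add: "\<And>U V. U \<in> carrier_mat (2 * s) (2 * r) \<Longrightarrow> V \<in> carrier_mat (2 * s) (2 * r) \<Longrightarrow> Pr U \<Longrightarrow> Pr V \<Longrightarrow> Pr (U + V)"
      and Pr_smult: "\<And>c U. U \<in> carrier_mat (2 * s) (2 * r) \<Longrightarrow> Pr U \<Longrightarrow> Pr (c \<cdot>\<^sub>m U)"
      and base: "\<And>m. m \<in> carrier_mat r s \<Longrightarrow> Pr (w m)" and W: "W \<in> carrier_mat (2 * s) (2 * r)"
    show "Pr W"
      using W
    proof (induction rule: mat_induct_units)
      case (unit j i)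
      define p q where "p = (r \<le> i)" and "q = (s \<le> j)"
      define i' j' where "i' = (if p then i - r else i)" and "j' = (if q then j - s else j)"
      have ij: "i' < r" "j' < s" "i = (if p then r else 0) + i'" "j = (if q then s else 0) + j'"
        using unit by (auto simp: i'_def j'_def p_def q_def)
      obtain k x l y where span: "\<And>p' q'. k * f p' q' x + l * f p' q' y = (if p = p' \<and> q = q' then 1 else 0)"
        using f_span[of p q] by metis
      let ?m = "\<lambda>x. mat r s (\<lambda>(a, b). if a = i' \<and> b = j' then x else 0)"
      have "k \<cdot>\<^sub>m F (?m x) + l \<cdot>\<^sub>m F (?m y) = unit_mat (2 * r) (2 * s) i j"
      proof (rule blocks_eqI[of _ r s])
        fix p' q' a b assume ab: "a < r" "b < s"
        have "((if p' then r else 0) + a = i \<and> (if q' then s else 0) + b = j) \<longleftrightarrow> (a = i' \<and> b = j') \<and> p = p' \<and> q = q'"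
          using ij ab by auto
        then show "(k \<cdot>\<^sub>m F (?m x) + l \<cdot>\<^sub>m F (?m y)) $$ ((if p' then r else 0) + a, (if q' then s else 0) + b) =
          unit_mat (2 * r) (2 * s) i j $$ ((if p' then r else 0) + a, (if q' then s else 0) + b)"
          using ab bound[OF ab(1), of p'] bound[OF ab(2), of q'] span[of p' q'] F_index[of "?m x" r s a b p' q'] F_index[of "?m y" r s a b p' q']
          by (simp add: unit_mat_def f_zero)
      qed (use F_carrier[of "?m x" r s] F_carrier[of "?m y" r s] in auto)
      then have "transpose_mat (k \<cdot>\<^sub>m F (?m x) + l \<cdot>\<^sub>m F (?m y)) = unit_mat (2 * s) (2 * r) j i"
        by (simp add: unit_mat_transpose)
      moreover have "transpose_mat (k \<cdot>\<^sub>m F (?m x) + l \<cdot>\<^sub>m F (?m y)) = k \<cdot>\<^sub>m w (?m x) + l \<cdot>\<^sub>m w (?m y)"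
        unfolding w_def by (rule eq_matI) auto
      moreover have "Pr (k \<cdot>\<^sub>m w (?m x) + l \<cdot>\<^sub>m w (?m y))"
        using w_dims[of "?m x"] w_dims[of "?m y"] by (intro Pr_add Pr_smult base) auto
      ultimately show ?case by simp
    qed (use Pr0 Pr_add Pr_smult in auto)
  next
    fix m :: "'c mat" assume m: "m \<in> carrier_mat r s"
      and sep: "\<And>\<tau>. functional_on (carrier_mat (2 * s) (2 * r)) \<tau> \<Longrightarrow>
        (\<And>m'. m' \<in> carrier_mat r s \<Longrightarrow> \<tau> (w m') \<in> range to_ac) \<Longrightarrow> \<tau> (w m) = 0"
    show "m = 0\<^sub>m r s"
    proof (rule eq_matI)
      fix k l assume "k < dim_row (0\<^sub>m r s :: 'c mat)" "l < dim_col (0\<^sub>m r s :: 'c mat)"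
      then have kl: "k < r" "l < s" by auto
      have "m $$ (k, l) = 0"
      proof (rule polar_nondegenerate)
        fix u
        define e where "e p q W = W $$ ((if q then s else 0) + l, (if p then r else 0) + k)" for p q and W :: "'k alg_closure mat"
        have e_w: "e p q (w m') = f p q (m' $$ (k, l))" if m': "m' \<in> carrier_mat r s" for m' p q
          using F_index[OF m' kl, of p q] bound[OF kl(1), of p] bound[OF kl(2), of q] m' by (simp add: e_def w_def)
        \<comment> \<open>The trace of \<open>x * cj u\<close> for the entry \<open>x\<close> at \<open>(k, l)\<close>, which is \<open>polar n x u\<close>.\<close>
        let ?t = "\<lambda>W. (e False False W * f False False (cj u) + e False True W * f True False (cj u))
            + (e True False W * f False True (cj u) + e True True W * f True True (cj u))"
        have t: "?t (w m') = to_ac (polar n (m' $$ (k, l)) u)" if m': "m' \<in> carrier_mat r s" for m'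
        proof -
          let ?x = "m' $$ (k, l) * cj u"
          have "?t (w m') = f False False ?x + f True True ?x" unfolding e_w[OF m'] f_mult ..
          also have "\<dots> = f False False (?x + cj ?x)" using f_cj(1)[of False] by (simp add: f_add)
          also have "\<dots> = to_ac (polar n (m' $$ (k, l)) u)" unfolding add_cj trace_pairing f_scale f_one by simp
          finally show ?thesis .
        qed
        have e_add: "e p q (V + W) = e p q V + e p q W" if "V \<in> carrier_mat (2 * s) (2 * r)" "W \<in> carrier_mat (2 * s) (2 * r)" for p q V W
          using that bound[OF kl(1), of p] bound[OF kl(2), of q] unfolding e_def by (intro index_add_mat(1)) auto
        have e_smult: "e p q (c \<cdot>\<^sub>m W) = c * e p q W" if "W \<in> carrier_mat (2 * s) (2 * r)" for p q c W
          using that bound[OF kl(1), of p] bound[OF kl(2), of q] unfolding e_def by (intro index_smult_mat(1)) auto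
        have "functional_on (carrier_mat (2 * s) (2 * r)) ?t"
          unfolding functional_on_def by (simp add: e_add e_smult algebra_simps)
        from sep[OF this] have "?t (w m) = 0" using t by (metis rangeI)
        then show "polar n (m $$ (k, l)) u = 0" unfolding t[OF m] by simp
      qed
      with kl show "m $$ (k, l) = 0\<^sub>m r s $$ (k, l)" by simp
    qed (use m in auto)
  qed
  interpret w: rect_embedding scale n r s J G "2 * s" "2 * r" to_ac w by (rule rect)
  let ?K = "transpose_mat (F GC) * std_alternating r" and ?S = "std_alternating s * transpose_mat (F J)"
  have F_R: "transpose_mat (F (R y)) = - (?K * transpose_mat (w y) * ?S)" if y: "y \<in> carrier_mat r s" for y
  proof -
    have [simp]: "dim_row y = r" "dim_col y = s" using y by auto
    have "F (R y) = F J * F (st y) * F GC" unfolding R_def by (simp add: F_mult)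
    also have "F (st y) = - (std_alternating s * transpose_mat (F y) * std_alternating r)" by (rule F_star[OF y])
    finally show ?thesis
      by (simp add: transpose_uminus transpose_mult' std_alternating_transpose mat_ring w_def)
  qed
  have comp: "w.osp_compatible ?K ?S"
    unfolding w.osp_compatible_def
  proof (intro ballI)
    fix x y z :: "'c mat" assume c: "x \<in> carrier_mat r s" "y \<in> carrier_mat r s" "z \<in> carrier_mat r s"
    have t: "w (x * R y * z) = - (w z * (?K * transpose_mat (w y) * ?S) * w x)"
      if c: "x \<in> carrier_mat r s" "y \<in> carrier_mat r s" "z \<in> carrier_mat r s" for x y z
    proof -
      have [simp]: "dim_row x = r" "dim_col x = s" "dim_row y = r" "dim_col y = s" "dim_row z = r" "dim_col z = s" using c by auto
      have "w (x * R y * z) = w z * (transpose_mat (F (R y)) * w x)"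
        unfolding w_def by (simp add: F_mult transpose_mult')
      then show ?thesis unfolding F_R[OF c(2)] by (simp add: w_def mat_ring)
    qed
    have [simp]: "dim_row (w x) = 2 * s" "dim_col (w x) = 2 * r" "dim_row (w y) = 2 * s" "dim_col (w y) = 2 * r"
      "dim_row (w z) = 2 * s" "dim_col (w z) = 2 * r" using w_dims[OF c(1)] w_dims[OF c(2)] w_dims[OF c(3)] by auto
    show "w (der x y z) = w z * (?K * transpose_mat (w x) * ?S) * w y + w z * (?K * transpose_mat (w y) * ?S) * w x
       - w x * (?K * transpose_mat (w y) * ?S) * w z - w y * (?K * transpose_mat (w x) * ?S) * w z"
      unfolding w.w_der[OF c] t[OF c(3,1,2)] t[OF c(3,2,1)] t[OF c] t[OF c(2,1,3)]
      by (rule eq_matI) (simp_all del: index_mult_mat(1))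
  qed
  have GC': "transpose_mat (F GC) * std_alternating r = std_alternating r * F GC"
  proof -
    have F_GC: "F GC = - (std_alternating r * transpose_mat (F GC) * std_alternating r)" using F_star[OF GC_carrier] by simp
    have "std_alternating r * F GC = std_alternating r * - (std_alternating r * transpose_mat (F GC) * std_alternating r)"
      by (rule arg_cong[OF F_GC])
    also have "\<dots> = - (std_alternating r * (std_alternating r * (transpose_mat (F GC) * std_alternating r)))"
      by (simp add: mult_assoc')
    also have "\<dots> = transpose_mat (F GC) * std_alternating r" by (subst om) simp_all
    finally show ?thesis ..
  qed
  have J': "F J * std_alternating s = - (std_alternating s * transpose_mat (F J))"
  proof -
    have "- F J = - (std_alternating s * transpose_mat (F J) * std_alternating s)"
      using F_star[OF J_carrier] J(2) F_uminus[OF J_carrier] by simp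
    then have "F J = std_alternating s * transpose_mat (F J) * std_alternating s" by (metis uminus_uminus_mat)
    then have "F J * std_alternating s = std_alternating s * transpose_mat (F J) * std_alternating s * std_alternating s" by simp
    then show ?thesis by (subst (asm) om') simp_all
  qed
  obtain JI where JI: "JI \<in> carrier_mat s s" "J * JI = 1\<^sub>m s" "JI * J = 1\<^sub>m s" by (rule J_inverse)
  have [simp]: "dim_row JI = s" "dim_col JI = s" using JI by auto
  have inv: "transpose_mat (F J) * transpose_mat (F JI) = 1\<^sub>m (2 * s)" "transpose_mat (F GC) * transpose_mat (F GI) = 1\<^sub>m (2 * r)"
    using JI(3) GI_GC by (simp_all flip: transpose_mult' F_mult add: F_one)
  have inv': "transpose_mat (F J) * (transpose_mat (F JI) * B) = B" if "dim_row B = 2 * s" for B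
    using mult_assoc'[of "transpose_mat (F J)" "transpose_mat (F JI)" B] inv that by simp
  show ?thesis
  proof (rule form_of_osp[OF rect comp])
    show "1 \<le> 2 * s" "1 \<le> r" using s r by auto
    show "?S \<in> carrier_mat (2 * s) (2 * s)" "?K \<in> carrier_mat (2 * r) (2 * r)" by (auto intro!: carrier_matI)
    show "transpose_mat ?S = ?S" using J' by (simp add: transpose_mult' std_alternating_transpose)
    show "transpose_mat ?K = - ?K" unfolding GC' by (subst GC'[symmetric]) (simp add: transpose_mult' std_alternating_transpose)
    show "transpose_mat (F JI) * - std_alternating s \<in> carrier_mat (2 * s) (2 * s)"
      "- std_alternating r * transpose_mat (F GI) \<in> carrier_mat (2 * r) (2 * r)" by (auto intro!: carrier_matI)
    show "?S * (transpose_mat (F JI) * - std_alternating s) = 1\<^sub>m (2 * s)"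
      by (simp add: mat_ring inv' std_alternating_square)
    show "?K * (- std_alternating r * transpose_mat (F GI)) = 1\<^sub>m (2 * r)"
      by (simp add: mat_ring om inv)
  qed
qed

end

theorem proposition1p11:
  fixes scale :: "'k::field \<Rightarrow> 'c::ring_1 \<Rightarrow> 'c" and n :: "'c \<Rightarrow> 'k"
    and r s :: nat and J :: "'c mat" and G :: "'k mat"
  assumes "CHAR('k) = 3"
    and "assoc_composition_algebra scale n"
    and "r \<ge> 3" and "s \<ge> 1"
    and "vector_space.dim scale (UNIV :: 'c set) = 1 \<Longrightarrow> even s"
    and "J \<in> carrier_mat s s" and "invertible_mat J" and "star scale n J = - J"
    and "G \<in> carrier_mat r r" and "invertible_mat G" and "diagonal_mat G"
  shows "let d = vector_space.dim scale (UNIV :: 'c set);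
             g = matrix_data.semisimplified scale n r s J G
         in (d = 2 \<longrightarrow> type_A g (r - 1) (s - 1)) \<and>
            (d = 1 \<longrightarrow>
              (\<exists>S A. symmetric_form r S \<and> symplectic_form s A \<and> superalgebra_iso g (osp_form r s S A)) \<and>
              (if odd r then type_B g ((r - 1) div 2) (s div 2) else type_D g (r div 2) (s div 2))) \<and>
            (d = 4 \<longrightarrow> type_D g s r)"
proof -
  interpret assoc_composition_algebra scale n by fact
  interpret char3_matrix_data scale n r s J G
    by unfold_locales fact+
  have r: "r \<ge> 1" using assms(3) by simp
  have "if odd r then type_B semisimplified ((r - 1) div 2) (s div 2) else type_D semisimplified (r div 2) (s div 2)"
    if d: "dim (UNIV :: 'c set) = 1"
  proof -
    have s: "s = 2 * (s div 2)" using assms(5) d by simp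
    have "form_of semisimplified (osp r s :: ('k alg_closure, 'k alg_closure mat) superalgebra)"
      by (rule dim_one_form_of_osp[OF d r s])
    then have "form_of semisimplified (osp r (2 * (s div 2)) :: ('k alg_closure, 'k alg_closure mat) superalgebra)"
      using s by simp
    moreover have "r = 2 * ((r - 1) div 2) + 1" if "odd r" using that by (elim oddE) simp
    moreover have "r = 2 * (r div 2)" if "even r" using that by simp
    ultimately show ?thesis unfolding type_B_def type_D_def by (metis (full_types))
  qed
  moreover have "\<exists>S A. symmetric_form r S \<and> symplectic_form s A \<and> superalgebra_iso semisimplified (osp_form r s S A)"
    if "dim (UNIV :: 'c set) = 1"
    using that assms(4) assms(5) by (intro dim_one_iso_osp_form[OF _ r]) auto
  moreover have "type_A semisimplified (r - 1) (s - 1)" if "dim (UNIV :: 'c set) = 2"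
    using that assms(4) by (intro dim_two_type_A[OF _ r]) auto
  moreover have "type_D semisimplified s r" if "dim (UNIV :: 'c set) = 4"
    unfolding type_D_def using that assms(4) by (intro dim_four_form_of_osp[OF _ r]) auto
  ultimately show ?thesis
    unfolding Let_def by blast
qed

end
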